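(* Let $\mathcal H$ be a partial building set for a geometric lattice $L$, let $\mathcal L=\mathcal L(L,\mathcal H)$, and let $r$ denote the largest rank of an element of $\mathcal L$. Then the cochain complex of sheaves on the poset of intervals $\mathrm I(\mathcal L)$ $$0\to\iota_!\mathscr{DP}(L,\mathcal H)\to\mathscr C^{\cdot,0}\xrightarrow{\ \delta\ }\cdots\xrightarrow{\ \delta\ }\mathscr C^{\cdot,i}\xrightarrow{\ \delta\ }\cdots\xrightarrow{\ \delta\ }\mathscr C^{\cdot,r}\to 0$$ is a $\Gamma$-acyclic resolution of $\iota_!\mathscr{DP}(L,\mathcal H)$; that is, it is exact and $H^q(\mathrm I(\mathcal L),\mathscr C^{i,j})=0$ for all $q>0$ and all $i,j$.
   Context: All posets are finite. For a meet-semilattice $P$ with least element $\hat 0$, write $P_+=P\setminus\{\hat 0\}$, $\mathrm{a}(P)$ for its set of atoms. $P$ is locally geometric if every interval $[\hat 0,x]$ is a geometric lattice; $P_j$ is the set of elements of rank $j$. Blowups. For $p\in P_+$, let $P_{(p)}=\{x\in P: x\not\ge p,\ p\vee x \text{ exists}\}$ and $\mathrm{Bl}_p(P)=\{x\in P:x\not\ge p\}\cup\{(p,x):x\in P_{(p)}\}$, ordered by: $y>x$ if $y>x$ in $P$; $(p,y)>(p,x)$ if $y>x$ in $P$; $(p,y)>x$ if $y\ge x$ in $P$. Building sets. $\mathcal G\subseteq L_+$ is a building set if for every $x\in L_+$ with $\max \mathcal G_{\le x}=\{x_1,\dots,x_k\}$ there is a poset isomorphism $\prod_j[\hat 0,x_j]\to[\hat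 0,x]$ sending $(\hat 0,\dots,x_j,\dots,\hat 0)$ to $x_j$; always $\hat 1\in\mathcal G$. A partial building set is $\mathcal H\subseteq\mathcal G$ (for some building set $\mathcal G$) with $\mathrm{a}(L)\subseteq\mathcal H$ and $\mathcal H^\circ:=\mathcal H\setminus \mathrm{a}(L)$ upward closed in $\mathcal G$. Writing $\mathcal H^\circ=\{p_1,\dots,p_m\}$ with $p_i\ge p_j\Rightarrow i\le j$, set $\mathcal L(L,\mathcal H)=\mathrm{Bl}_{p_m}\circ\cdots\circ\mathrm{Bl}_{p_1}(L)$, a locally geometric semilattice whose atoms are identified with $\mathcal H$. $S\subseteq\mathcal H$ is $\mathcal H$-nested if the join in $L$ of any two or more pairwise incomparable elements of $S$ is not in $\mathcal H$; $N(L,\mathcal H)$ is the complex of nested sets (equivalently, sets of atoms of $\mathcal L(L,\mathcal H)$ with an upper bound). Sheaves on posets. A poset $P$ has the topology whose open sets are the order ideals; a sheaf is equivalent to stalks $\mathscr F(x)$ with restriction maps $\mathscr F(y)\to\mathscr F(x)$ for $x\le y$; $\Gamma$ denotes global sections. De Concini–Procesi sheaf. For $y\in\mathcal L$ with $y=\bigvee S$, $S\in N(L,\mathcal H)$, let $\mathrm{DP}_y(L,\mathcal H)=\mathbb Q[x_g:g\in\mathcal H]/J_y$, where $J_y$ is generated by $x_T=\prod_{g\in T}x_g$ for $S\cup T\notin N(L,\mathcal H)$ and $c_g=\sum_{h\in\mathcal H,h\ge g}x_h$ for $g\in \mathrm{a}(L)$ (independent of $S$; $x_g$ has degree 2). $\mathscr{DP}=\mathscr{DP}(L,\mathcal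 H)$ is the sheaf of graded rings on $\mathcal L^{\mathrm{op}}$ with $\mathscr{DP}(y)=\mathrm{DP}_y(L,\mathcal H)$ and restrictions the natural surjections $\mathrm{DP}_y\to\mathrm{DP}_z$ for $y\le z$ in $\mathcal L$. Flag complex. For a locally geometric semilattice $P$, $\mathrm{Fl}^i(P)$ is the $\mathbb Q$-span of chains $(y_0<y_1<\dots<y_i)$ with $y_j\in P_j$, modulo the relations $\sum_y (y_0<\dots<y_{j-1}<y<y_{j+1}<\dots<y_i)=0$ for $0<j<i$, sum over all $y$ with $y_{j-1}<y<y_{j+1}$. Differential: $\delta(y_0<\dots<y_i)=(-1)^i\sum_{y_{i+1}\in P_{i+1},\,y_{i+1}>y_i}(y_0<\dots<y_i<y_{i+1})$. One has $\mathrm{Fl}^i(P)=\bigoplus_{x\in P_i}\mathrm{Fl}^i(P_{\le x})$. $\mathscr F\ell^{\,i}$ is the sheaf on $\mathcal L$ with stalks $\mathrm{Fl}^i(\mathcal L_{\le x})$ and restriction maps the coordinate projections with respect to this decomposition. Poset of intervals. $\mathrm I(\mathcal L)=\{(x,y):x\le y\}$ with $(x_0,y_0)\le(x_1,y_1)$ iff $x_0\le x_1\le y_1\le y_0$; $\mathrm{pr}_1\colon \mathrm I(\mathcal L)\to\mathcal L$, $\mathrm{pr}_2\colon \mathrm I(\mathcal L)\to\mathcal L^{\mathrm{op}}$ are the projections, and $\iota\colon\mathcal L^{\mathrm{op}}\to \mathrm I(\mathcal L)$, $\iota(y)=(\hat 0,y)$, is an open embedding with $\iota_!$ extension by zero: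 $\iota_!\mathscr{DP}(x,y)=\mathrm{DP}_y$ if $x=\hat 0$, and $0$ otherwise. $\mathscr C=\mathrm{pr}_1^*\mathscr F\ell\otimes_{\mathbb Q}\mathrm{pr}_2^*\mathscr{DP}$, i.e. $\mathscr C^{i,j}(x,y)=\mathrm{Fl}^j(\mathcal L_{\le x})\otimes_{\mathbb Q}\mathrm{DP}_y^i$, with differential $\delta\otimes\mathrm{id}$ raising $j$ by one. The augmentation $\iota_!\mathscr{DP}\to\mathscr C^{\cdot,0}$ is the inclusion of the kernel of $\delta$ on $\mathscr C^{\cdot,0}$ (note $\mathscr C^{\cdot,0}(x,y)=\mathrm{DP}_y$). *)

theory Defs
  imports
    "HOL-Library.Poly_Mapping"
    "HOL-Library.Extended_Nat"
    "HOL-Algebra.Module"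
    "HOL-Algebra.QuotRing"
    "HOL-Algebra.Algebraic_Closure_Type"
begin

section \<open>Posets and geometric lattices\<close>

abbreviation poset_of :: "'p set \<Rightarrow> ('p \<Rightarrow> 'p \<Rightarrow> bool) \<Rightarrow> 'p gorder" where
  "poset_of A leq \<equiv> \<lparr>carrier = A, eq = (=), le = leq\<rparr>"

definition poset_below :: "'p gorder \<Rightarrow> 'p \<Rightarrow> 'p gorder" where
  "poset_below P x = P\<lparr>carrier := {z \<in> carrier P. z \<sqsubseteq>\<^bsub>P\<^esub> x}\<rparr>"

definition covers :: "'p gorder \<Rightarrow> 'p \<Rightarrow> 'p \<Rightarrow> bool" where
  "covers P x y \<longleftrightarrow> x \<in> carrier P \<and> y \<in> carrier P \<and> x \<sqsubset>\<^bsub>P\<^esub> y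
     \<and> \<not> (\<exists>z\<in>carrier P. x \<sqsubset>\<^bsub>P\<^esub> z \<and> z \<sqsubset>\<^bsub>P\<^esub> y)"

definition atoms :: "'p gorder \<Rightarrow> 'p set" where
  "atoms P = {a. covers P \<bottom>\<^bsub>P\<^esub> a}"

definition geometric_lattice :: "'p gorder \<Rightarrow> bool" where
  "geometric_lattice L \<longleftrightarrow>
     Lattice.lattice L \<and> finite (carrier L) \<and> carrier L \<noteq> {}
     \<and> (\<forall>x\<in>carrier L. \<exists>A\<subseteq>atoms L. is_lub L x A)
     \<and> (\<forall>x\<in>carrier L. \<forall>y\<in>carrier L.
          covers L (x \<sqinter>\<^bsub>L\<^esub> y) x \<longrightarrow> covers L y (x \<squnion>\<^bsub>L\<^esub> y))"

text \<open>The rank of \<open>x\<close> is the length of a longest chain ending at or below \<open>x\<close>; in a locally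
  geometric semilattice all maximal chains of \<open>[0, x]\<close> have this length.\<close>

definition rank :: "'p gorder \<Rightarrow> 'p \<Rightarrow> nat" where
  "rank P x = Max {card C - 1 | C. C \<subseteq> carrier (poset_below P x)
     \<and> (\<forall>u\<in>C. \<forall>v\<in>C. u \<sqsubseteq>\<^bsub>P\<^esub> v \<or> v \<sqsubseteq>\<^bsub>P\<^esub> u)}"

definition max_rank :: "'p gorder \<Rightarrow> nat" where
  "max_rank P = Max (rank P ` carrier P)"

section \<open>Building sets and nested sets\<close>

definition max_below :: "'a gorder \<Rightarrow> 'a set \<Rightarrow> 'a \<Rightarrow> 'a set" where
  "max_below L G x = {g \<in> G. g \<sqsubseteq>\<^bsub>L\<^esub> x \<and> \<not> (\<exists>h\<in>G. h \<sqsubseteq>\<^bsub>L\<^esub> x \<and> g \<sqsubset>\<^bsub>L\<^esub> h)}"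

text \<open>The product of the intervals \<open>[0, g]\<close> over the maximal elements \<open>g\<close> of \<open>G\<close> below \<open>x\<close> is the
  set of extensional functions with the pointwise order.\<close>

definition building_set :: "'a gorder \<Rightarrow> 'a set \<Rightarrow> bool" where
  "building_set L G \<longleftrightarrow>
     G \<subseteq> carrier L - {\<bottom>\<^bsub>L\<^esub>} \<and> \<top>\<^bsub>L\<^esub> \<in> G
     \<and> (\<forall>x \<in> carrier L - {\<bottom>\<^bsub>L\<^esub>}.
          let M = max_below L G x; Pr = (\<Pi>\<^sub>E g\<in>M. \<lbrace>\<bottom>\<^bsub>L\<^esub>..g\<rbrace>\<^bsub>L\<^esub>)
          in \<exists>\<phi>. bij_betw \<phi> Pr \<lbrace>\<bottom>\<^bsub>L\<^esub>..x\<rbrace>\<^bsub>L\<^esub>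
             \<and> (\<forall>u\<in>Pr. \<forall>v\<in>Pr. \<phi> u \<sqsubseteq>\<^bsub>L\<^esub> \<phi> v \<longleftrightarrow> (\<forall>g\<in>M. u g \<sqsubseteq>\<^bsub>L\<^esub> v g))
             \<and> (\<forall>g\<in>M. \<phi> (\<lambda>h\<in>M. if h = g then g else \<bottom>\<^bsub>L\<^esub>) = g))"

definition partial_building_set :: "'a gorder \<Rightarrow> 'a set \<Rightarrow> bool" where
  "partial_building_set L H \<longleftrightarrow>
     (\<exists>G. building_set L G \<and> H \<subseteq> G \<and> atoms L \<subseteq> H
        \<and> (\<forall>p \<in> H - atoms L. \<forall>g\<in>G. p \<sqsubseteq>\<^bsub>L\<^esub> g \<longrightarrow> g \<in> H - atoms L))"

definition nested_sets :: "'a gorder \<Rightarrow> 'a set \<Rightarrow> 'a set set" where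
  "nested_sets L H = {S. S \<subseteq> H \<and>
     (\<forall>A\<subseteq>S. 2 \<le> card A \<and> (\<forall>a\<in>A. \<forall>b\<in>A. a \<noteq> b \<longrightarrow> \<not> a \<sqsubseteq>\<^bsub>L\<^esub> b) \<longrightarrow> \<Squnion>\<^bsub>L\<^esub> A \<notin> H)}"

section \<open>Blowups\<close>

text \<open>A single type closed under blowups: \<open>Exc p x\<close> is the element \<open>(p, x)\<close> created by blowing
  up \<open>p\<close>.\<close>

datatype 'a blow = Elt 'a | Exc "'a blow" "'a blow"

definition base_poset :: "'a gorder \<Rightarrow> 'a blow gorder" where
  "base_poset L = poset_of (Elt ` carrier L)
     (\<lambda>u v. \<exists>x\<in>carrier L. \<exists>y\<in>carrier L. u = Elt x \<and> v = Elt y \<and> x \<sqsubseteq>\<^bsub>L\<^esub> y)"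

definition not_above :: "'p gorder \<Rightarrow> 'p \<Rightarrow> 'p set" where
  "not_above P p = {x \<in> carrier P. \<not> p \<sqsubseteq>\<^bsub>P\<^esub> x}"

definition joinable :: "'p gorder \<Rightarrow> 'p \<Rightarrow> 'p set" where
  "joinable P p = {x \<in> not_above P p. \<exists>s. is_lub P s {p, x}}"

definition blowup :: "'a blow \<Rightarrow> 'a blow gorder \<Rightarrow> 'a blow gorder" where
  "blowup p P = poset_of (not_above P p \<union> Exc p ` joinable P p)
     (\<lambda>u v. (u \<in> not_above P p \<and> v \<in> not_above P p \<and> u \<sqsubseteq>\<^bsub>P\<^esub> v)
       \<or> (\<exists>x\<in>joinable P p. \<exists>y\<in>joinable P p. u = Exc p x \<and> v = Exc p y \<and> x \<sqsubseteq>\<^bsub>P\<^esub> y)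
       \<or> (\<exists>y\<in>joinable P p. u \<in> not_above P p \<and> v = Exc p y \<and> u \<sqsubseteq>\<^bsub>P\<^esub> y))"

definition blowup_order :: "'a gorder \<Rightarrow> 'a set \<Rightarrow> 'a list \<Rightarrow> bool" where
  "blowup_order L H ps \<longleftrightarrow> distinct ps \<and> set ps = H - atoms L
     \<and> (\<forall>i<length ps. \<forall>j<length ps. ps ! j \<sqsubseteq>\<^bsub>L\<^esub> ps ! i \<longrightarrow> i \<le> j)"

definition iterated_blowup :: "'a gorder \<Rightarrow> 'a list \<Rightarrow> 'a blow gorder" where
  "iterated_blowup L ps = fold (\<lambda>p P. blowup (Elt p) P) ps (base_poset L)"

text \<open>The identification of \<open>H\<close> with the atoms of the iterated blowup: atoms of \<open>L\<close> survive, and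
  a blown up \<open>p\<close> is represented by \<open>(p, 0)\<close>.\<close>

definition blow_atom :: "'a gorder \<Rightarrow> 'a \<Rightarrow> 'a blow" where
  "blow_atom L g = (if g \<in> atoms L then Elt g else Exc (Elt g) (Elt \<bottom>\<^bsub>L\<^esub>))"

section \<open>Rational vector spaces\<close>

text \<open>Vector spaces are \<open>module\<close> records over \<open>\<rat>\<close>. The library record also has fields for a ring
  multiplication, which the locale \<open>module\<close> does not look at; they are filled arbitrarily.\<close>

abbreviation Rat :: "rat ring" where
  "Rat \<equiv> ring_of_type_algebra"

definition lin_maps :: "(rat, 'v) module \<Rightarrow> (rat, 'w) module \<Rightarrow> ('v \<Rightarrow> 'w) set" where
  "lin_maps M N = {f \<in> hom (add_monoid M) (add_monoid N).
     \<forall>c. \<forall>v\<in>carrier M. f (c \<odot>\<^bsub>M\<^esub> v) = c \<odot>\<^bsub>N\<^esub> f v}"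

definition zero_module :: "(rat, 'v) module \<Rightarrow> (rat, 'v) module" where
  "zero_module M = M\<lparr>carrier := {\<zero>\<^bsub>M\<^esub>}\<rparr>"

definition free_module :: "'x set \<Rightarrow> (rat, 'x \<Rightarrow>\<^sub>0 rat) module" where
  "free_module B = \<lparr>carrier = {f. Poly_Mapping.keys f \<subseteq> B}, monoid.mult = (\<lambda>_ _. 0), one = 0,
     zero = 0, add = (+), module.smult = (\<lambda>c. Poly_Mapping.map ((*) c))\<rparr>"

definition lin_ext :: "('x \<Rightarrow> ('y \<Rightarrow>\<^sub>0 rat)) \<Rightarrow> ('x \<Rightarrow>\<^sub>0 rat) \<Rightarrow> ('y \<Rightarrow>\<^sub>0 rat)" where
  "lin_ext \<phi> f = (\<Sum>x\<in>Poly_Mapping.keys f.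
     Poly_Mapping.map ((*) (Poly_Mapping.lookup f x)) (\<phi> x))"

definition gen_submodule :: "(rat, 'v) module \<Rightarrow> 'v set \<Rightarrow> 'v set" where
  "gen_submodule M S = (\<lambda>N. submodule N Rat M) hull S"

definition quot_module :: "(rat, 'v) module \<Rightarrow> 'v set \<Rightarrow> (rat, 'v set) module" where
  "quot_module M N = \<lparr>carrier = a_rcosets\<^bsub>M\<^esub> N, monoid.mult = (\<lambda>_ _. N), one = N,
     zero = N, add = (<+>\<^bsub>M\<^esub>), module.smult = (\<lambda>c A. \<Union>a\<in>A. N +>\<^bsub>M\<^esub> (c \<odot>\<^bsub>M\<^esub> a))\<rparr>"

text \<open>The map to \<open>M / N\<close> induced on cosets by a map \<open>f\<close> to \<open>M\<close>.\<close>

definition induced :: "('w, 'z) ring_scheme \<Rightarrow> 'w set \<Rightarrow> ('v \<Rightarrow> 'w) \<Rightarrow> 'v set \<Rightarrow> 'w set" where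
  "induced M N f A = (\<Union>a\<in>A. N +>\<^bsub>M\<^esub> f a)"

abbreviation basis_elt :: "'x \<Rightarrow> ('x \<Rightarrow>\<^sub>0 rat)" where
  "basis_elt x \<equiv> Poly_Mapping.single x 1"

definition tensor_rel ::
    "(rat, 'v) module \<Rightarrow> (rat, 'w) module \<Rightarrow> ('v \<times> 'w \<Rightarrow>\<^sub>0 rat) set" where
  "tensor_rel M N = gen_submodule (free_module (carrier M \<times> carrier N))
     ({basis_elt (m \<oplus>\<^bsub>M\<^esub> m', n) - basis_elt (m, n) - basis_elt (m', n) | m m' n.
         m \<in> carrier M \<and> m' \<in> carrier M \<and> n \<in> carrier N}
      \<union> {basis_elt (m, n \<oplus>\<^bsub>N\<^esub> n') - basis_elt (m, n) - basis_elt (m, n') | m n n'.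
         m \<in> carrier M \<and> n \<in> carrier N \<and> n' \<in> carrier N}
      \<union> {basis_elt (c \<odot>\<^bsub>M\<^esub> m, n) - Poly_Mapping.single (m, n) c | c m n.
         m \<in> carrier M \<and> n \<in> carrier N}
      \<union> {basis_elt (m, c \<odot>\<^bsub>N\<^esub> n) - Poly_Mapping.single (m, n) c | c m n.
         m \<in> carrier M \<and> n \<in> carrier N})"

definition tensor ::
    "(rat, 'v) module \<Rightarrow> (rat, 'w) module \<Rightarrow> (rat, ('v \<times> 'w \<Rightarrow>\<^sub>0 rat) set) module" where
  "tensor M N = quot_module (free_module (carrier M \<times> carrier N)) (tensor_rel M N)"

definition pure_tensor ::
    "(rat, 'v) module \<Rightarrow> (rat, 'w) module \<Rightarrow> 'v \<Rightarrow> 'w \<Rightarrow> ('v \<times> 'w \<Rightarrow>\<^sub>0 rat) set" where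
  "pure_tensor M N m n =
     tensor_rel M N +>\<^bsub>free_module (carrier M \<times> carrier N)\<^esub> basis_elt (m, n)"

text \<open>The linear map \<open>f \<otimes> g\<close> into \<open>M \<otimes> N\<close>.\<close>

definition tensor_map ::
    "(rat, 'v) module \<Rightarrow> (rat, 'w) module \<Rightarrow> ('v1 \<Rightarrow> 'v) \<Rightarrow> ('w1 \<Rightarrow> 'w)
      \<Rightarrow> ('v1 \<times> 'w1 \<Rightarrow>\<^sub>0 rat) set \<Rightarrow> ('v \<times> 'w \<Rightarrow>\<^sub>0 rat) set" where
  "tensor_map M N f g = induced (free_module (carrier M \<times> carrier N)) (tensor_rel M N)
     (lin_ext (\<lambda>(m, n). basis_elt (f m, g n)))"

section \<open>Sheaves on posets and their cohomology\<close>

text \<open>A sheaf of rational vector spaces for the topology of order ideals, given by its stalks;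
  \<open>res F y x\<close> is the restriction map from the stalk at \<open>y\<close> to the stalk at \<open>x\<close> for \<open>x \<le> y\<close>.\<close>

record ('p, 'v) sheaf =
  stalk :: "'p \<Rightarrow> (rat, 'v) module"
  res :: "'p \<Rightarrow> 'p \<Rightarrow> 'v \<Rightarrow> 'v"

definition is_sheaf :: "'p gorder \<Rightarrow> ('p, 'v) sheaf \<Rightarrow> bool" where
  "is_sheaf P F \<longleftrightarrow>
     (\<forall>x\<in>carrier P. module Rat (stalk F x))
     \<and> (\<forall>x\<in>carrier P. \<forall>y\<in>carrier P. x \<sqsubseteq>\<^bsub>P\<^esub> y \<longrightarrow>
          res F y x \<in> lin_maps (stalk F y) (stalk F x))
     \<and> (\<forall>x\<in>carrier P. \<forall>v\<in>carrier (stalk F x). res F x x v = v)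
     \<and> (\<forall>x\<in>carrier P. \<forall>y\<in>carrier P. \<forall>z\<in>carrier P. x \<sqsubseteq>\<^bsub>P\<^esub> y \<and> y \<sqsubseteq>\<^bsub>P\<^esub> z \<longrightarrow>
          (\<forall>v\<in>carrier (stalk F z). res F y x (res F z y v) = res F z x v))"

definition sheaf_hom ::
    "'p gorder \<Rightarrow> ('p, 'v) sheaf \<Rightarrow> ('p, 'w) sheaf \<Rightarrow> ('p \<Rightarrow> 'v \<Rightarrow> 'w) \<Rightarrow> bool" where
  "sheaf_hom P F G \<phi> \<longleftrightarrow>
     (\<forall>x\<in>carrier P. \<phi> x \<in> lin_maps (stalk F x) (stalk G x))
     \<and> (\<forall>x\<in>carrier P. \<forall>y\<in>carrier P. x \<sqsubseteq>\<^bsub>P\<^esub> y \<longrightarrow>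
          (\<forall>v\<in>carrier (stalk F y). \<phi> x (res F y x v) = res G y x (\<phi> y v)))"

definition pullback :: "('p \<Rightarrow> 'q) \<Rightarrow> ('q, 'v) sheaf \<Rightarrow> ('p, 'v) sheaf" where
  "pullback f F = \<lparr>stalk = (\<lambda>x. stalk F (f x)), res = (\<lambda>y x. res F (f y) (f x))\<rparr>"

definition tensor_sheaf ::
    "('p, 'v) sheaf \<Rightarrow> ('p, 'w) sheaf \<Rightarrow> ('p, ('v \<times> 'w \<Rightarrow>\<^sub>0 rat) set) sheaf" where
  "tensor_sheaf F G = \<lparr>stalk = (\<lambda>x. tensor (stalk F x) (stalk G x)),
     res = (\<lambda>y x. tensor_map (stalk F x) (stalk G x) (res F y x) (res G y x))\<rparr>"

text \<open>\<open>resolution P F \<eta> C d r\<close>: the sequence \<open>0 \<rightarrow> F \<rightarrow> C 0 \<rightarrow> C 1 \<rightarrow> \<dots>\<close> is an exact sequence of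
  sheaves on \<open>P\<close>, where for finite \<open>r\<close> it ends with \<open>C r \<rightarrow> 0\<close>. Exactness of sheaves is exactness
  of all stalks.\<close>

definition resolution ::
    "'p gorder \<Rightarrow> ('p, 'v) sheaf \<Rightarrow> ('p \<Rightarrow> 'v \<Rightarrow> 'w) \<Rightarrow> (nat \<Rightarrow> ('p, 'w) sheaf)
      \<Rightarrow> (nat \<Rightarrow> 'p \<Rightarrow> 'w \<Rightarrow> 'w) \<Rightarrow> enat \<Rightarrow> bool" where
  "resolution P F \<eta> C d r \<longleftrightarrow>
     is_sheaf P F \<and> (\<forall>j. enat j \<le> r \<longrightarrow> is_sheaf P (C j))
     \<and> sheaf_hom P F (C 0) \<eta> \<and> (\<forall>j. enat j < r \<longrightarrow> sheaf_hom P (C j) (C (Suc j)) (d j))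
     \<and> (\<forall>x\<in>carrier P.
          let ker = (\<lambda>j. if enat j < r
                then {v \<in> carrier (stalk (C j) x). d j x v = \<zero>\<^bsub>stalk (C (Suc j)) x\<^esub>}
                else carrier (stalk (C j) x))
          in inj_on (\<eta> x) (carrier (stalk F x))
             \<and> \<eta> x ` carrier (stalk F x) = ker 0
             \<and> (\<forall>j. enat j < r \<longrightarrow> d j x ` carrier (stalk (C j) x) = ker (Suc j)))"

definition sections :: "'p gorder \<Rightarrow> ('p, 'v) sheaf \<Rightarrow> (rat, 'p \<Rightarrow> 'v) module" where
  "sections P F =
     \<lparr>carrier = {s \<in> \<Pi>\<^sub>E x\<in>carrier P. carrier (stalk F x).
        \<forall>x\<in>carrier P. \<forall>y\<in>carrier P. x \<sqsubseteq>\<^bsub>P\<^esub> y \<longrightarrow> res F y x (s y) = s x},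
      monoid.mult = (\<lambda>_ _. (\<lambda>x\<in>carrier P. \<zero>\<^bsub>stalk F x\<^esub>)), one = (\<lambda>x\<in>carrier P. \<zero>\<^bsub>stalk F x\<^esub>),
      zero = (\<lambda>x\<in>carrier P. \<zero>\<^bsub>stalk F x\<^esub>),
      add = (\<lambda>s t. \<lambda>x\<in>carrier P. s x \<oplus>\<^bsub>stalk F x\<^esub> t x),
      module.smult = (\<lambda>c s. \<lambda>x\<in>carrier P. c \<odot>\<^bsub>stalk F x\<^esub> s x)\<rparr>"

definition sections_map :: "'p gorder \<Rightarrow> ('p \<Rightarrow> 'v \<Rightarrow> 'w) \<Rightarrow> ('p \<Rightarrow> 'v) \<Rightarrow> ('p \<Rightarrow> 'w)" where
  "sections_map P \<phi> s = (\<lambda>x\<in>carrier P. \<phi> x (s x))"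

definition complex_cohomology ::
    "(nat \<Rightarrow> (rat, 'v) module) \<Rightarrow> (nat \<Rightarrow> 'v \<Rightarrow> 'v) \<Rightarrow> nat \<Rightarrow> (rat, 'v set) module" where
  "complex_cohomology M d q = quot_module
     ((M q)\<lparr>carrier := {v \<in> carrier (M q). d q v = \<zero>\<^bsub>M (Suc q)\<^esub>}\<rparr>)
     (case q of 0 \<Rightarrow> {\<zero>\<^bsub>M 0\<^esub>} | Suc k \<Rightarrow> d k ` carrier (M k))"

definition injective_sheaf :: "'p gorder \<Rightarrow> ('p, 'u) sheaf \<Rightarrow> bool" where
  "injective_sheaf P I \<longleftrightarrow> is_sheaf P I \<and>
     (\<forall>(A :: ('p, 'u) sheaf) (B :: ('p, 'u) sheaf) m f.
        is_sheaf P A \<and> is_sheaf P B \<and> sheaf_hom P A B m \<and> sheaf_hom P A I f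
        \<and> (\<forall>x\<in>carrier P. inj_on (m x) (carrier (stalk A x)))
        \<longrightarrow> (\<exists>g. sheaf_hom P B I g
              \<and> (\<forall>x\<in>carrier P. \<forall>a\<in>carrier (stalk A x). g x (m x a) = f x a)))"

text \<open>The right derived functors of global sections, computed from a chosen injective resolution.
  HOL cannot quantify over all types of values, so the resolving sheaves take values in the type
  \<open>'p list \<Rightarrow> 'v\<close>. On a finite poset it contains the Godement resolution of every sheaf with values
  in \<open>'v\<close>, namely products of stalks indexed by chains, so injective resolutions exist there. Unless
  \<open>'v\<close> is a singleton the type is infinite, hence also carries the representable sheaves, with stalks
  \<open>\<rat>\<close> or \<open>0\<close>, and their subsheaves; by Baer's criterion extension along those monomorphisms is enough
  for injectivity among sheaves with values in arbitrary types.\<close>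

definition sheaf_cohomology ::
    "'p gorder \<Rightarrow> ('p, 'v) sheaf \<Rightarrow> nat \<Rightarrow> (rat, ('p \<Rightarrow> 'p list \<Rightarrow> 'v) set) module" where
  "sheaf_cohomology P F q =
     (let (\<eta>, I, d) = (SOME (\<eta>, I :: nat \<Rightarrow> ('p, 'p list \<Rightarrow> 'v) sheaf, d).
            resolution P F \<eta> I d \<infinity> \<and> (\<forall>n. injective_sheaf P (I n)))
      in complex_cohomology (\<lambda>n. sections P (I n)) (\<lambda>n. sections_map P (d n)) q)"

definition gamma_acyclic :: "'p gorder \<Rightarrow> ('p, 'v) sheaf \<Rightarrow> bool" where
  "gamma_acyclic P F \<longleftrightarrow>
     (\<forall>q>0. carrier (sheaf_cohomology P F q) = {\<zero>\<^bsub>sheaf_cohomology P F q\<^esub>})"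

section \<open>The De Concini--Procesi sheaf\<close>

text \<open>Polynomials over \<open>\<rat>\<close> are finitely supported functions on monomials, the latter being
  finitely supported exponent functions.\<close>

type_synonym 'a mpoly = "('a \<Rightarrow>\<^sub>0 nat) \<Rightarrow>\<^sub>0 rat"

definition poly_ring :: "'a set \<Rightarrow> 'a mpoly ring" where
  "poly_ring H = ring_of_type_algebra
     \<lparr>carrier := {p. \<forall>m\<in>Poly_Mapping.keys p. Poly_Mapping.keys m \<subseteq> H}\<rparr>"

definition dp_var :: "'a \<Rightarrow> 'a mpoly" where
  "dp_var g = Poly_Mapping.single (Poly_Mapping.single g 1) 1"

definition DP_ideal :: "'a gorder \<Rightarrow> 'a set \<Rightarrow> 'a blow gorder \<Rightarrow> 'a blow \<Rightarrow> 'a mpoly set" where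
  "DP_ideal L H K y = Idl\<^bsub>poly_ring H\<^esub>
     ({\<Prod>g\<in>T. dp_var g | S T. S \<in> nested_sets L H \<and> is_lub K y (blow_atom L ` S)
         \<and> T \<subseteq> H \<and> S \<union> T \<notin> nested_sets L H}
      \<union> {\<Sum>h\<in>{h \<in> H. g \<sqsubseteq>\<^bsub>L\<^esub> h}. dp_var h | g. g \<in> atoms L})"

definition DP_ring :: "'a gorder \<Rightarrow> 'a set \<Rightarrow> 'a blow gorder \<Rightarrow> 'a blow \<Rightarrow> 'a mpoly set ring" where
  "DP_ring L H K y = poly_ring H Quot DP_ideal L H K y"

text \<open>Variables have degree 2.\<close>

definition homogeneous :: "nat \<Rightarrow> 'a mpoly \<Rightarrow> bool" where
  "homogeneous i p \<longleftrightarrow> (\<forall>m\<in>Poly_Mapping.keys p.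
     (\<Sum>g\<in>Poly_Mapping.keys m. 2 * Poly_Mapping.lookup m g) = i)"

definition DP_degree ::
    "'a gorder \<Rightarrow> 'a set \<Rightarrow> 'a blow gorder \<Rightarrow> nat \<Rightarrow> 'a blow \<Rightarrow> (rat, 'a mpoly set) module" where
  "DP_degree L H K i y =
     (let R = poly_ring H; J = DP_ideal L H K y; D = DP_ring L H K y
      in \<lparr>carrier = {J +>\<^bsub>R\<^esub> p | p. p \<in> carrier R \<and> homogeneous i p},
          monoid.mult = monoid.mult D, one = one D, zero = \<zero>\<^bsub>D\<^esub>, add = add D,
          module.smult = (\<lambda>c A. (J +>\<^bsub>R\<^esub> Poly_Mapping.single 0 c) \<otimes>\<^bsub>D\<^esub> A)\<rparr>)"

text \<open>The degree \<open>i\<close> part of the sheaf, on the opposite of \<open>K\<close>: for \<open>y \<le> z\<close> in \<open>K\<close> the restriction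
  map goes from the stalk at \<open>y\<close> to the stalk at \<open>z\<close>.\<close>

definition DP_sheaf ::
    "'a gorder \<Rightarrow> 'a set \<Rightarrow> 'a blow gorder \<Rightarrow> nat \<Rightarrow> ('a blow, 'a mpoly set) sheaf" where
  "DP_sheaf L H K i = \<lparr>stalk = DP_degree L H K i,
     res = (\<lambda>y z. induced (poly_ring H) (DP_ideal L H K z) (\<lambda>p. p))\<rparr>"

section \<open>The flag complex\<close>

definition flag_chains :: "'p gorder \<Rightarrow> nat \<Rightarrow> 'p list set" where
  "flag_chains P i = {ys. length ys = Suc i
     \<and> (\<forall>j\<le>i. ys ! j \<in> carrier P \<and> rank P (ys ! j) = j)
     \<and> (\<forall>j<i. ys ! j \<sqsubset>\<^bsub>P\<^esub> ys ! Suc j)}"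

definition flag_rel :: "'p gorder \<Rightarrow> nat \<Rightarrow> ('p list \<Rightarrow>\<^sub>0 rat) set" where
  "flag_rel P i = gen_submodule (free_module (flag_chains P i))
     {\<Sum>y\<in>{y \<in> carrier P. ys ! (j - 1) \<sqsubset>\<^bsub>P\<^esub> y \<and> y \<sqsubset>\<^bsub>P\<^esub> ys ! (j + 1)}. basis_elt (ys[j := y])
       | ys j. ys \<in> flag_chains P i \<and> 0 < j \<and> j < i}"

definition flag :: "'p gorder \<Rightarrow> nat \<Rightarrow> (rat, ('p list \<Rightarrow>\<^sub>0 rat) set) module" where
  "flag P i = quot_module (free_module (flag_chains P i)) (flag_rel P i)"

definition flag_diff ::
    "'p gorder \<Rightarrow> nat \<Rightarrow> ('p list \<Rightarrow>\<^sub>0 rat) set \<Rightarrow> ('p list \<Rightarrow>\<^sub>0 rat) set" where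
  "flag_diff P i = induced (free_module (flag_chains P (Suc i))) (flag_rel P (Suc i))
     (lin_ext (\<lambda>ys. \<Sum>y\<in>{y \<in> carrier P. rank P y = Suc i \<and> last ys \<sqsubset>\<^bsub>P\<^esub> y}.
        Poly_Mapping.single (ys @ [y]) ((-1) ^ i)))"

text \<open>The restriction from \<open>y\<close> to \<open>x\<close> is the projection onto the summands indexed by the elements
  below \<open>x\<close>: it keeps the chains whose top lies below \<open>x\<close> and kills all others.\<close>

definition flag_sheaf :: "'p gorder \<Rightarrow> nat \<Rightarrow> ('p, ('p list \<Rightarrow>\<^sub>0 rat) set) sheaf" where
  "flag_sheaf P i = \<lparr>stalk = (\<lambda>x. flag (poset_below P x) i),
     res = (\<lambda>y x. induced (free_module (flag_chains (poset_below P x) i))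
        (flag_rel (poset_below P x) i)
        (lin_ext (\<lambda>ys. if last ys \<sqsubseteq>\<^bsub>P\<^esub> x then basis_elt ys else 0)))\<rparr>"

section \<open>The complex on the poset of intervals\<close>

definition intervals :: "'p gorder \<Rightarrow> ('p \<times> 'p) gorder" where
  "intervals P = poset_of {(x, y). x \<in> carrier P \<and> y \<in> carrier P \<and> x \<sqsubseteq>\<^bsub>P\<^esub> y}
     (\<lambda>(x0, y0) (x1, y1). x0 \<sqsubseteq>\<^bsub>P\<^esub> x1 \<and> x1 \<sqsubseteq>\<^bsub>P\<^esub> y1 \<and> y1 \<sqsubseteq>\<^bsub>P\<^esub> y0)"

definition iota_shriek :: "'p gorder \<Rightarrow> ('p, 'v) sheaf \<Rightarrow> ('p \<times> 'p, 'v) sheaf" where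
  "iota_shriek P F =
     \<lparr>stalk = (\<lambda>(x, y). if x = \<bottom>\<^bsub>P\<^esub> then stalk F y else zero_module (stalk F y)),
      res = (\<lambda>(x1, y1) (x0, y0) v. if x1 = \<bottom>\<^bsub>P\<^esub> then res F y1 y0 v else \<zero>\<^bsub>stalk F y0\<^esub>)\<rparr>"

type_synonym 'a cvalue = "(('a blow list \<Rightarrow>\<^sub>0 rat) set \<times> 'a mpoly set \<Rightarrow>\<^sub>0 rat) set"

definition C_sheaf ::
    "'a gorder \<Rightarrow> 'a set \<Rightarrow> 'a blow gorder \<Rightarrow> nat \<Rightarrow> nat
      \<Rightarrow> ('a blow \<times> 'a blow, 'a cvalue) sheaf" where
  "C_sheaf L H K i j =
     tensor_sheaf (pullback fst (flag_sheaf K j)) (pullback snd (DP_sheaf L H K i))"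

definition C_diff ::
    "'a gorder \<Rightarrow> 'a set \<Rightarrow> 'a blow gorder \<Rightarrow> nat \<Rightarrow> nat
      \<Rightarrow> 'a blow \<times> 'a blow \<Rightarrow> 'a cvalue \<Rightarrow> 'a cvalue" where
  "C_diff L H K i j = (\<lambda>(x, y).
     tensor_map (flag (poset_below K x) (Suc j)) (DP_degree L H K i y)
       (flag_diff (poset_below K x) j) (\<lambda>a. a))"

text \<open>Under \<open>Fl\<^sup>0 \<otimes> DP\<^sub>y = DP\<^sub>y\<close> an element \<open>a\<close> of \<open>DP\<^sub>y\<close> corresponds to the class of the
  one-element chain \<open>(0)\<close> tensored with \<open>a\<close>; for \<open>x \<noteq> 0\<close> the source of the augmentation is zero.\<close>

definition C_aug ::
    "'a gorder \<Rightarrow> 'a set \<Rightarrow> 'a blow gorder \<Rightarrow> nat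
      \<Rightarrow> 'a blow \<times> 'a blow \<Rightarrow> 'a mpoly set \<Rightarrow> 'a cvalue" where
  "C_aug L H K i = (\<lambda>(x, y) a.
     let Q = poset_below K x; M = flag Q 0; N = DP_degree L H K i y
     in if x = \<bottom>\<^bsub>K\<^esub>
        then pure_tensor M N
          (flag_rel Q 0 +>\<^bsub>free_module (flag_chains Q 0)\<^esub> basis_elt [\<bottom>\<^bsub>K\<^esub>]) a
        else \<zero>\<^bsub>tensor M N\<^esub>)"

end

theory Submission
  imports Defs
begin

text \<open>Over \<open>(x, y)\<close> the complex is the flag complex of the interval below \<open>x\<close> tensored with the stalk
  of the De Concini--Procesi sheaf at \<open>y\<close>. For \<open>x\<close> above the least element, an element \<open>a\<close> below \<open>x\<close>
  with which every element below \<open>x\<close> has a join, of rank at most one more, yields a linear contraction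
  of the flag complex; over the least element only degree 0 survives. Such an \<open>a\<close> is found in an
  explicit model: the elements of the iterated blowup are the pairs of a set \<open>T\<close> of blown up elements
  and an element of the lattice, subject to a validity condition that is inherited downwards.

  The stalk of the degree \<open>j\<close> sheaf at \<open>(x, y)\<close> is the product of its stalks at the pairs \<open>(z, y)\<close>
  with \<open>z\<close> of rank \<open>j\<close> below \<open>x\<close>. So the sheaf is the right Kan extension of its restriction to the
  set \<open>T\<close> of all \<open>(z, y)\<close> with \<open>z\<close> of rank \<open>j\<close>. Products of stalks over the chains of \<open>T\<close> give an
  injective resolution, exact because the component of \<open>z\<close> in \<open>T\<close> below \<open>(x, y)\<close> has the greatest
  element \<open>(z, y)\<close>, and exact on global sections because the whole component has the greatest element
  \<open>(z, z)\<close>. Comparison with the injective resolution chosen in the definition of sheaf cohomology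
  finishes the proof.\<close>

section \<open>Rational vector spaces\<close>

text \<open>The rings in the second tensor factor enter only as vector spaces with restriction maps:
  exactness comes from contracting the first factor, and acyclicity from splitting the first factor.
  What their ideals must supply is that they grow along the poset, for otherwise the restriction
  maps would not exist; this rests on identifying nested sets with the sets of atoms that have an
  upper bound. The obstacle in the contraction is the passage to the quotient by the flag relations.
  An operator given on single chains has to send relations to combinations of relations, and the
  critical relation is one whose whole interval already lies above the apex; there the images must
  be regrouped along joins with the apex before they are relations again. On the side of cohomology,
  the definition picks some injective resolution with values in a fixed type, and nothing else is
  known about it. Hence the explicit resolution is built with values in that same type, as functions
  on lists, and is compared with the chosen one by lifts and a homotopy.\<close>

lemma Rat_simps [simp]:
  "carrier Rat = UNIV" "x \<oplus>\<^bsub>Rat\<^esub> y = x + y" "x \<otimes>\<^bsub>Rat\<^esub> y = x * y" "\<one>\<^bsub>Rat\<^esub> = 1" "\<zero>\<^bsub>Rat\<^esub> = 0"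
  by (simp_all add: ring_of_type_algebra_def)

text \<open>Negatives come for free over the rationals: \<open>- 1\<close> times \<open>x\<close> is
  an additive inverse of \<open>x\<close>, because \<open>0\<close> times \<open>x\<close> is
  assumed to be zero.\<close>

lemma rat_moduleI:
  assumes "\<zero>\<^bsub>M\<^esub> \<in> carrier M"
    and "\<And>x y. x \<in> carrier M \<Longrightarrow> y \<in> carrier M \<Longrightarrow> x \<oplus>\<^bsub>M\<^esub> y \<in> carrier M"
    and "\<And>c x. x \<in> carrier M \<Longrightarrow> c \<odot>\<^bsub>M\<^esub> x \<in> carrier M"
    and "\<And>x y z. x \<in> carrier M \<Longrightarrow> y \<in> carrier M \<Longrightarrow> z \<in> carrier M \<Longrightarrow>
           (x \<oplus>\<^bsub>M\<^esub> y) \<oplus>\<^bsub>M\<^esub> z = x \<oplus>\<^bsub>M\<^esub> (y \<oplus>\<^bsub>M\<^esub> z)"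
    and "\<And>x y. x \<in> carrier M \<Longrightarrow> y \<in> carrier M \<Longrightarrow> x \<oplus>\<^bsub>M\<^esub> y = y \<oplus>\<^bsub>M\<^esub> x"
    and "\<And>x. x \<in> carrier M \<Longrightarrow> \<zero>\<^bsub>M\<^esub> \<oplus>\<^bsub>M\<^esub> x = x"
    and "\<And>a b x. x \<in> carrier M \<Longrightarrow> (a + b) \<odot>\<^bsub>M\<^esub> x = a \<odot>\<^bsub>M\<^esub> x \<oplus>\<^bsub>M\<^esub> b \<odot>\<^bsub>M\<^esub> x"
    and "\<And>a x y. x \<in> carrier M \<Longrightarrow> y \<in> carrier M \<Longrightarrow>
           a \<odot>\<^bsub>M\<^esub> (x \<oplus>\<^bsub>M\<^esub> y) = a \<odot>\<^bsub>M\<^esub> x \<oplus>\<^bsub>M\<^esub> a \<odot>\<^bsub>M\<^esub> y"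
    and "\<And>a b x. x \<in> carrier M \<Longrightarrow> (a * b) \<odot>\<^bsub>M\<^esub> x = a \<odot>\<^bsub>M\<^esub> (b \<odot>\<^bsub>M\<^esub> x)"
    and "\<And>x. x \<in> carrier M \<Longrightarrow> 1 \<odot>\<^bsub>M\<^esub> x = x"
    and "\<And>x. x \<in> carrier M \<Longrightarrow> 0 \<odot>\<^bsub>M\<^esub> x = \<zero>\<^bsub>M\<^esub>"
  shows "module Rat M"
proof (rule moduleI)
  show "cring Rat" by (rule cring_from_type_algebra)
  show "abelian_group M"
  proof (rule abelian_groupI)
    fix x assume x: "x \<in> carrier M"
    have "((- 1) \<odot>\<^bsub>M\<^esub> x) \<oplus>\<^bsub>M\<^esub> x = \<zero>\<^bsub>M\<^esub>"
      using assms(7)[OF x, of "- 1" 1] assms(10,11)[OF x] by simp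
    then show "\<exists>y\<in>carrier M. y \<oplus>\<^bsub>M\<^esub> x = \<zero>\<^bsub>M\<^esub>"
      using assms(3)[OF x] by blast
  qed (use assms in auto)
qed (use assms in auto)

lemma rat_smult_minus:
  assumes "module Rat M" "x \<in> carrier M"
  shows "(- 1) \<odot>\<^bsub>M\<^esub> x = \<ominus>\<^bsub>M\<^esub> x"
proof -
  interpret module Rat M by fact
  have "(- 1) \<odot>\<^bsub>M\<^esub> x \<oplus>\<^bsub>M\<^esub> x = \<zero>\<^bsub>M\<^esub>"
    using smult_l_distr[of "- 1" 1 x] smult_one[of x] smult_l_null[of x] assms by simp
  then show ?thesis using M.minus_equality smult_closed assms by force
qed

lemma minus_zero_eq:
  assumes "module Rat M" "x \<in> carrier M" "y \<in> carrier M" "x \<ominus>\<^bsub>M\<^esub> y = \<zero>\<^bsub>M\<^esub>"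
  shows "x = y"
proof -
  interpret M: module Rat M by fact
  show ?thesis
    using assms(2-4) by (metis M.add.inv_comm M.minus_equality M.minus_minus M.a_inv_closed a_minus_def)
qed

lemma minus_self:
  assumes "module Rat M" "x \<in> carrier M"
  shows "x \<ominus>\<^bsub>M\<^esub> x = \<zero>\<^bsub>M\<^esub>"
  unfolding a_minus_def by (rule abelian_group.r_neg[OF module.axioms(2)[OF assms(1)] assms(2)])

section \<open>Subspaces and linear maps\<close>

lemma rat_submoduleI:
  assumes "module Rat M" "N \<subseteq> carrier M" "\<zero>\<^bsub>M\<^esub> \<in> N"
    and "\<And>x y. x \<in> N \<Longrightarrow> y \<in> N \<Longrightarrow> x \<oplus>\<^bsub>M\<^esub> y \<in> N"
    and "\<And>c x. x \<in> N \<Longrightarrow> c \<odot>\<^bsub>M\<^esub> x \<in> N"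
  shows "submodule N Rat M"
proof -
  interpret module Rat M by fact
  show ?thesis
    by (rule submoduleI) (use assms rat_smult_minus[OF assms(1)] in \<open>auto simp: subset_iff, metis\<close>)
qed

lemma submoduleD:
  assumes "module Rat M" "submodule N Rat M"
  shows "N \<subseteq> carrier M" "\<zero>\<^bsub>M\<^esub> \<in> N"
    and "\<And>x y. x \<in> N \<Longrightarrow> y \<in> N \<Longrightarrow> x \<oplus>\<^bsub>M\<^esub> y \<in> N"
    and "\<And>x y. x \<in> N \<Longrightarrow> y \<in> N \<Longrightarrow> x \<ominus>\<^bsub>M\<^esub> y \<in> N"
    and "\<And>c x. x \<in> N \<Longrightarrow> c \<odot>\<^bsub>M\<^esub> x \<in> N"
    and "\<And>x. x \<in> N \<Longrightarrow> \<ominus>\<^bsub>M\<^esub> x \<in> N"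
proof -
  interpret module Rat M by fact
  note E = submoduleE[OF assms(2)]
  show "N \<subseteq> carrier M" by (rule E)
  show "\<And>x y. x \<in> N \<Longrightarrow> y \<in> N \<Longrightarrow> x \<oplus>\<^bsub>M\<^esub> y \<in> N" by (rule E)
  show "\<And>c x. x \<in> N \<Longrightarrow> c \<odot>\<^bsub>M\<^esub> x \<in> N" using E(4) by simp
  show 3: "\<And>x. x \<in> N \<Longrightarrow> \<ominus>\<^bsub>M\<^esub> x \<in> N" by (rule E)
  show "\<And>x y. x \<in> N \<Longrightarrow> y \<in> N \<Longrightarrow> x \<ominus>\<^bsub>M\<^esub> y \<in> N"
    unfolding a_minus_def using E(5) 3 by blast
  obtain x where "x \<in> N" using E(2) by blast
  then show "\<zero>\<^bsub>M\<^esub> \<in> N" using E(5)[of x "\<ominus>\<^bsub>M\<^esub> x"] 3 E(1) M.r_neg by (metis subsetD)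
qed

lemma submodule_module:
  assumes "module Rat M" "submodule N Rat M"
  shows "module Rat (M\<lparr>carrier := N\<rparr>)"
proof -
  interpret module Rat M by fact
  note D = submoduleD[OF assms]
  show ?thesis
    by (rule rat_moduleI)
      (use D smult_l_distr smult_r_distr smult_assoc1 smult_one smult_l_null M.a_assoc M.a_comm in
        \<open>auto simp: subset_iff\<close>)
qed

lemma zero_submodule:
  assumes "module Rat M" shows "submodule {\<zero>\<^bsub>M\<^esub>} Rat M"
proof -
  interpret module Rat M by fact
  show ?thesis by (rule rat_submoduleI[OF assms]) (auto simp: smult_r_null)
qed

lemma lin_maps_iff:
  "f \<in> lin_maps M N \<longleftrightarrow> (\<forall>x\<in>carrier M. f x \<in> carrier N)
     \<and> (\<forall>x\<in>carrier M. \<forall>y\<in>carrier M. f (x \<oplus>\<^bsub>M\<^esub> y) = f x \<oplus>\<^bsub>N\<^esub> f y)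
     \<and> (\<forall>c. \<forall>x\<in>carrier M. f (c \<odot>\<^bsub>M\<^esub> x) = c \<odot>\<^bsub>N\<^esub> f x)"
  by (auto simp: lin_maps_def hom_def)

lemma lin_mapsI:
  assumes "\<And>x. x \<in> carrier M \<Longrightarrow> f x \<in> carrier N"
    and "\<And>x y. x \<in> carrier M \<Longrightarrow> y \<in> carrier M \<Longrightarrow> f (x \<oplus>\<^bsub>M\<^esub> y) = f x \<oplus>\<^bsub>N\<^esub> f y"
    and "\<And>c x. x \<in> carrier M \<Longrightarrow> f (c \<odot>\<^bsub>M\<^esub> x) = c \<odot>\<^bsub>N\<^esub> f x"
  shows "f \<in> lin_maps M N"
  using assms by (auto simp: lin_maps_iff)

lemma lin_mapsD:
  assumes "f \<in> lin_maps M N"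
  shows "\<And>x. x \<in> carrier M \<Longrightarrow> f x \<in> carrier N"
    and "\<And>x y. x \<in> carrier M \<Longrightarrow> y \<in> carrier M \<Longrightarrow> f (x \<oplus>\<^bsub>M\<^esub> y) = f x \<oplus>\<^bsub>N\<^esub> f y"
    and "\<And>c x. x \<in> carrier M \<Longrightarrow> f (c \<odot>\<^bsub>M\<^esub> x) = c \<odot>\<^bsub>N\<^esub> f x"
  using assms by (auto simp: lin_maps_iff)

lemma lin_maps_zero:
  assumes "f \<in> lin_maps M N" "module Rat M" "module Rat N"
  shows "f \<zero>\<^bsub>M\<^esub> = \<zero>\<^bsub>N\<^esub>"
proof -
  interpret M: module Rat M by fact
  interpret N: module Rat N by fact
  have "f (0 \<odot>\<^bsub>M\<^esub> \<zero>\<^bsub>M\<^esub>) = 0 \<odot>\<^bsub>N\<^esub> f \<zero>\<^bsub>M\<^esub>"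
    using lin_mapsD(3)[OF assms(1)] by blast
  then show ?thesis
    using M.smult_l_null[of "\<zero>\<^bsub>M\<^esub>"] N.smult_l_null[of "f \<zero>\<^bsub>M\<^esub>"] lin_mapsD(1)[OF assms(1)] by simp
qed

lemma lin_maps_minus:
  assumes "f \<in> lin_maps M N" "module Rat M" "module Rat N" "x \<in> carrier M" "y \<in> carrier M"
  shows "f (x \<ominus>\<^bsub>M\<^esub> y) = f x \<ominus>\<^bsub>N\<^esub> f y"
proof -
  interpret M: module Rat M by fact
  interpret N: module Rat N by fact
  have "f (\<ominus>\<^bsub>M\<^esub> y) = \<ominus>\<^bsub>N\<^esub> f y"
    using rat_smult_minus[OF assms(2,5)] rat_smult_minus[OF assms(3) lin_mapsD(1)[OF assms(1,5)]]
      lin_mapsD(3)[OF assms(1,5), of "-1"] by simp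
  then show ?thesis
    unfolding a_minus_def using lin_mapsD(2)[OF assms(1,4)] assms(5) by simp
qed

text \<open>One identity replaces two: \<open>k = 1\<close> gives additivity, additivity at zero
  gives that zero goes to zero by cancellation, and then the case of a zero second argument gives
  homogeneity.\<close>

lemma lin_mapsI_comb:
  assumes M: "module Rat M" "module Rat N" and c: "\<And>x. x \<in> carrier M \<Longrightarrow> f x \<in> carrier N"
    and l: "\<And>x y k. x \<in> carrier M \<Longrightarrow> y \<in> carrier M \<Longrightarrow>
      f (k \<odot>\<^bsub>M\<^esub> x \<oplus>\<^bsub>M\<^esub> y) = k \<odot>\<^bsub>N\<^esub> f x \<oplus>\<^bsub>N\<^esub> f y"
  shows "f \<in> lin_maps M N"
proof -
  interpret M: module Rat M by fact
  interpret N: module Rat N by fact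
  have a: "f (x \<oplus>\<^bsub>M\<^esub> y) = f x \<oplus>\<^bsub>N\<^esub> f y" if "x \<in> carrier M" "y \<in> carrier M" for x y
    using l[OF that, of 1] M.smult_one[OF that(1)] N.smult_one[OF c[OF that(1)]] by simp
  have z: "f \<zero>\<^bsub>M\<^esub> = \<zero>\<^bsub>N\<^esub>"
    using a[of "\<zero>\<^bsub>M\<^esub>" "\<zero>\<^bsub>M\<^esub>"] N.add.l_cancel_one[of "f \<zero>\<^bsub>M\<^esub>" "f \<zero>\<^bsub>M\<^esub>"] c by simp
  show ?thesis
  proof (rule lin_mapsI[OF c a])
    fix k x assume x: "x \<in> carrier M"
    show "f (k \<odot>\<^bsub>M\<^esub> x) = k \<odot>\<^bsub>N\<^esub> f x"
      using l[OF x M.zero_closed, of k] z M.smult_closed[of k x] N.smult_closed[of k "f x"] c[OF x] x by simp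
  qed
qed

lemma lin_maps_comp:
  "f \<in> lin_maps M N \<Longrightarrow> g \<in> lin_maps N W \<Longrightarrow> (\<lambda>x. g (f x)) \<in> lin_maps M W"
  by (auto simp: lin_maps_iff)

lemma lin_maps_id: "(\<lambda>x. x) \<in> lin_maps M M"
  by (auto simp: lin_maps_iff)

lemma lin_maps_const_zero:
  assumes "module Rat N"
  shows "(\<lambda>x. \<zero>\<^bsub>N\<^esub>) \<in> lin_maps M N"
proof -
  interpret N: module Rat N by fact
  show ?thesis by (auto simp: lin_maps_iff N.smult_r_null)
qed

lemma lin_maps_add:
  assumes "f \<in> lin_maps M N" "g \<in> lin_maps M N" "module Rat N"
  shows "(\<lambda>x. f x \<oplus>\<^bsub>N\<^esub> g x) \<in> lin_maps M N"
proof -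
  interpret N: module Rat N by fact
  note [simp] = lin_mapsD[OF assms(1)] lin_mapsD[OF assms(2)]
  show ?thesis by (rule lin_mapsI) (simp_all add: N.a_ac N.smult_r_distr)
qed

lemma lin_maps_smult:
  assumes "f \<in> lin_maps M N" "module Rat N"
  shows "(\<lambda>x. c \<odot>\<^bsub>N\<^esub> f x) \<in> lin_maps M N"
proof -
  interpret N: module Rat N by fact
  note [simp] = lin_mapsD[OF assms(1)]
  show ?thesis
  proof (rule lin_mapsI)
    fix d x assume "x \<in> carrier M"
    then show "c \<odot>\<^bsub>N\<^esub> f (d \<odot>\<^bsub>M\<^esub> x) = d \<odot>\<^bsub>N\<^esub> (c \<odot>\<^bsub>N\<^esub> f x)"
      using N.smult_assoc1[of c d "f x"] N.smult_assoc1[of d c "f x"] by (simp add: mult.commute)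
  qed (simp_all add: N.smult_r_distr)
qed

lemma lin_maps_cong:
  assumes "f \<in> lin_maps M N" "module Rat M" "\<And>x. x \<in> carrier M \<Longrightarrow> g x = f x"
  shows "g \<in> lin_maps M N"
proof -
  interpret M: module Rat M by fact
  show ?thesis using assms(1,3) by (auto simp: lin_maps_iff)
qed

lemma lin_maps_diff:
  assumes "f \<in> lin_maps M N" "g \<in> lin_maps M N" "module Rat M" "module Rat N"
  shows "(\<lambda>x. f x \<ominus>\<^bsub>N\<^esub> g x) \<in> lin_maps M N"
proof (rule lin_maps_cong)
  show "(\<lambda>x. f x \<oplus>\<^bsub>N\<^esub> (- 1) \<odot>\<^bsub>N\<^esub> g x) \<in> lin_maps M N"
    by (intro lin_maps_add lin_maps_smult assms)
  show "f x \<ominus>\<^bsub>N\<^esub> g x = f x \<oplus>\<^bsub>N\<^esub> (- 1) \<odot>\<^bsub>N\<^esub> g x" if "x \<in> carrier M" for x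
    using rat_smult_minus[OF assms(4) lin_mapsD(1)[OF assms(2) that]] by (simp add: a_minus_def)
qed fact

lemma kernel_submodule:
  assumes "module Rat M" "module Rat N" "f \<in> lin_maps M N"
  shows "submodule {x \<in> carrier M. f x = \<zero>\<^bsub>N\<^esub>} Rat M"
proof -
  interpret M: module Rat M by fact
  interpret N: module Rat N by fact
  show ?thesis
    by (rule rat_submoduleI)
      (auto simp: assms lin_mapsD[OF assms(3)] lin_maps_zero[OF assms(3)] N.smult_r_null)
qed

lemma preimage_submodule:
  assumes "module Rat M" "module Rat N" "f \<in> lin_maps M N" "submodule A Rat N"
  shows "submodule {x \<in> carrier M. f x \<in> A} Rat M"
proof -
  interpret M: module Rat M by fact
  note D = submoduleD[OF assms(2,4)]
  show ?thesis
    by (rule rat_submoduleI)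
      (auto simp: assms lin_mapsD[OF assms(3)] lin_maps_zero[OF assms(3)] D)
qed

lemma image_submodule:
  assumes "module Rat M" "module Rat N" "f \<in> lin_maps M N" "submodule A Rat M"
  shows "submodule (f ` A) Rat N"
proof -
  note D = submoduleD[OF assms(1,4)]
  note [simp] = lin_mapsD[OF assms(3)]
  show ?thesis
  proof (rule rat_submoduleI)
    show "f ` A \<subseteq> carrier N" using D(1) by auto
    show "\<zero>\<^bsub>N\<^esub> \<in> f ` A" using D(2) lin_maps_zero[OF assms(3,1,2)] by (metis imageI)
    show "x \<oplus>\<^bsub>N\<^esub> y \<in> f ` A" if "x \<in> f ` A" "y \<in> f ` A" for x y
      using that D(1,3) lin_mapsD(2)[OF assms(3)]
      by (smt (verit, ccfv_threshold) image_iff subsetD)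
    show "c \<odot>\<^bsub>N\<^esub> x \<in> f ` A" if "x \<in> f ` A" for c x
      using that D(1,5) lin_mapsD(3)[OF assms(3)]
      by (smt (verit, ccfv_threshold) image_iff subsetD)
  qed fact
qed

lemma carrier_submodule:
  assumes "module Rat M" shows "submodule (carrier M) Rat M"
proof -
  interpret module Rat M by fact
  show ?thesis by (rule rat_submoduleI[OF assms]) auto
qed

text \<open>A subspace that is maximal among those meeting \<open>A\<close> in \<open>0\<close> is a complement.\<close>

lemma complement_exists:
  assumes "module Rat M" "submodule A Rat M"
  obtains N where "submodule N Rat M" "A \<inter> N = {\<zero>\<^bsub>M\<^esub>}"
    "\<And>x. x \<in> carrier M \<Longrightarrow> \<exists>a\<in>A. \<exists>n\<in>N. x = a \<oplus>\<^bsub>M\<^esub> n"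
proof -
  interpret M: module Rat M by fact
  note A = submoduleD[OF assms]
  define Z where "Z = {N. submodule N Rat M \<and> A \<inter> N = {\<zero>\<^bsub>M\<^esub>}}"
  have "\<exists>N\<in>Z. \<forall>N'\<in>Z. N \<subseteq> N' \<longrightarrow> N' = N"
  proof (rule subset_Zorn_nonempty)
    show "Z \<noteq> {}" unfolding Z_def using zero_submodule[OF assms(1)] A(2) by blast
    fix C assume C: "C \<noteq> {}" "subset.chain Z C"
    then have CX: "\<And>N. N \<in> C \<Longrightarrow> submodule N Rat M \<and> A \<inter> N = {\<zero>\<^bsub>M\<^esub>}"
      by (auto simp: subset.chain_def Z_def)
    have cmp: "N \<subseteq> N' \<or> N' \<subseteq> N" if "N \<in> C" "N' \<in> C" for N N'
      using C(2) that by (auto simp: subset.chain_def)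
    have "submodule (\<Union>C) Rat M"
    proof (rule rat_submoduleI[OF assms(1)])
      show "\<Union>C \<subseteq> carrier M" using CX submoduleD(1)[OF assms(1)] by blast
      show "\<zero>\<^bsub>M\<^esub> \<in> \<Union>C" using CX C(1) submoduleD(2)[OF assms(1)] by blast
      show "x \<oplus>\<^bsub>M\<^esub> y \<in> \<Union>C" if "x \<in> \<Union>C" "y \<in> \<Union>C" for x y
        proof -
        obtain N N' where N: "N \<in> C" "N' \<in> C" "x \<in> N" "y \<in> N'" using \<open>x \<in> \<Union>C\<close> \<open>y \<in> \<Union>C\<close> by blast
        then obtain N'' where "N'' \<in> C" "x \<in> N''" "y \<in> N''" using cmp[OF N(1,2)] by blast
        then show ?thesis using submoduleD(3)[OF assms(1)] CX by blast
      qed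
      show "c \<odot>\<^bsub>M\<^esub> x \<in> \<Union>C" if "x \<in> \<Union>C" for c x
        using that CX submoduleD(5)[OF assms(1)] by blast
    qed
    moreover have "A \<inter> \<Union>C = {\<zero>\<^bsub>M\<^esub>}" using CX C(1) by blast
    ultimately show "\<Union>C \<in> Z" by (simp add: Z_def)
  qed
  then obtain N where NZ: "N \<in> Z" and mz: "\<forall>N'\<in>Z. N \<subseteq> N' \<longrightarrow> N' = N" by (elim bexE)
  from NZ have N: "submodule N Rat M" "A \<inter> N = {\<zero>\<^bsub>M\<^esub>}" by (simp_all add: Z_def)
  have max: "\<And>N'. submodule N' Rat M \<Longrightarrow> A \<inter> N' = {\<zero>\<^bsub>M\<^esub>} \<Longrightarrow> N \<subseteq> N' \<Longrightarrow> N' = N"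
    using mz by (simp add: Z_def)
  note D = submoduleD[OF assms(1) N(1)]
  have "\<exists>a\<in>A. \<exists>n\<in>N. x = a \<oplus>\<^bsub>M\<^esub> n" if x: "x \<in> carrier M" for x
  proof (rule ccontr)
    assume no: "\<not> ?thesis"
    \<comment> \<open>The span of \<open>N\<close> and \<open>x\<close>. By maximality of
      \<open>N\<close> it meets \<open>A\<close> nontrivially, and dividing the resulting equation
      by the coefficient of \<open>x\<close>, which cannot be zero, exhibits \<open>x\<close> in the
      sum of \<open>A\<close> and \<open>N\<close> after all.\<close>
    define N' where "N' = {n \<oplus>\<^bsub>M\<^esub> c \<odot>\<^bsub>M\<^esub> x | n c. n \<in> N}"
    have sub: "submodule N' Rat M"
    proof (rule rat_submoduleI[OF assms(1)])
      show "N' \<subseteq> carrier M" unfolding N'_def using D(1) x by auto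
      have "\<zero>\<^bsub>M\<^esub> = \<zero>\<^bsub>M\<^esub> \<oplus>\<^bsub>M\<^esub> 0 \<odot>\<^bsub>M\<^esub> x" using M.smult_l_null[OF x] by simp
      then show "\<zero>\<^bsub>M\<^esub> \<in> N'" unfolding N'_def using D(2) by blast
    next
      fix u v assume "u \<in> N'" "v \<in> N'"
      then obtain n c n' c' where "n \<in> N" "n' \<in> N" "u = n \<oplus>\<^bsub>M\<^esub> c \<odot>\<^bsub>M\<^esub> x" "v = n' \<oplus>\<^bsub>M\<^esub> c' \<odot>\<^bsub>M\<^esub> x"
        unfolding N'_def by blast
      moreover from this have "u \<oplus>\<^bsub>M\<^esub> v = (n \<oplus>\<^bsub>M\<^esub> n') \<oplus>\<^bsub>M\<^esub> (c + c') \<odot>\<^bsub>M\<^esub> x"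
        using M.smult_l_distr[of c c' x] D(1) x by (auto simp: M.a_ac subset_iff)
      ultimately show "u \<oplus>\<^bsub>M\<^esub> v \<in> N'" unfolding N'_def using D(3) by blast
    next
      fix d u assume "u \<in> N'"
      then obtain n c where "n \<in> N" "u = n \<oplus>\<^bsub>M\<^esub> c \<odot>\<^bsub>M\<^esub> x"
        unfolding N'_def by blast
      moreover from this have "d \<odot>\<^bsub>M\<^esub> u = d \<odot>\<^bsub>M\<^esub> n \<oplus>\<^bsub>M\<^esub> (d * c) \<odot>\<^bsub>M\<^esub> x"
        using M.smult_r_distr[of d n "c \<odot>\<^bsub>M\<^esub> x"] M.smult_assoc1[of d c x] D(1) x by auto
      ultimately show "d \<odot>\<^bsub>M\<^esub> u \<in> N'" unfolding N'_def using D(5) by blast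
    qed
    have "N \<subseteq> N'"
    proof
      fix n assume "n \<in> N"
      then have "n = n \<oplus>\<^bsub>M\<^esub> 0 \<odot>\<^bsub>M\<^esub> x" using M.smult_l_null[OF x] D(1) by (auto simp: subset_iff)
      then show "n \<in> N'" unfolding N'_def using \<open>n \<in> N\<close> by blast
    qed
    moreover have "x \<in> N'"
    proof -
      have "x = \<zero>\<^bsub>M\<^esub> \<oplus>\<^bsub>M\<^esub> 1 \<odot>\<^bsub>M\<^esub> x" using M.smult_one[OF x] x by simp
      then show ?thesis unfolding N'_def using D(2) by blast
    qed
    moreover have "x \<notin> N"
    proof
      assume "x \<in> N"
      moreover have "x = \<zero>\<^bsub>M\<^esub> \<oplus>\<^bsub>M\<^esub> x" using x by simp
      ultimately show False using no A(2) by blast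
    qed
    ultimately have "A \<inter> N' \<noteq> {\<zero>\<^bsub>M\<^esub>}" using max[OF sub] by blast
    then obtain b where b: "b \<in> A" "b \<in> N'" "b \<noteq> \<zero>\<^bsub>M\<^esub>"
      using A(2) submoduleD(2)[OF assms(1) sub] by blast
    then obtain n c where n: "n \<in> N" "b = n \<oplus>\<^bsub>M\<^esub> c \<odot>\<^bsub>M\<^esub> x" unfolding N'_def by blast
    have nc: "n \<in> carrier M" "b \<in> carrier M" using n D(1) b A(1) by auto
    have "c \<noteq> 0"
    proof
      assume "c = 0"
      then have "b = n" using n M.smult_l_null[OF x] nc by simp
      then show False using b n N(2) by blast
    qed
    have "c \<odot>\<^bsub>M\<^esub> x = b \<oplus>\<^bsub>M\<^esub> (\<ominus>\<^bsub>M\<^esub> n)"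
      using n(2) nc x by (simp add: M.a_ac M.r_neg1 M.r_neg2)
    then have "inverse c \<odot>\<^bsub>M\<^esub> (c \<odot>\<^bsub>M\<^esub> x) = inverse c \<odot>\<^bsub>M\<^esub> b \<oplus>\<^bsub>M\<^esub> inverse c \<odot>\<^bsub>M\<^esub> (\<ominus>\<^bsub>M\<^esub> n)"
      using M.smult_r_distr nc by simp
    then have "x = inverse c \<odot>\<^bsub>M\<^esub> b \<oplus>\<^bsub>M\<^esub> inverse c \<odot>\<^bsub>M\<^esub> (\<ominus>\<^bsub>M\<^esub> n)"
      using M.smult_assoc1[of "inverse c" c x] M.smult_one[OF x] \<open>c \<noteq> 0\<close> x by simp
    then show False using no A(5)[OF b(1)] D(5)[OF D(6)[OF n(1)]] by blast
  qed
  then show thesis using that N by blast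
qed

text \<open>A complement of the image of \<open>d\<close> exists, and \<open>h\<close> is
  \<open>g\<close> transported to the image and zero on the complement. This is the fact of linear
  algebra behind the injectivity of the sheaves below; quotients also get their universal property
  from it.\<close>

lemma linear_factor:
  assumes M: "module Rat A" "module Rat B" "module Rat W"
    and d: "d \<in> lin_maps A B" and g: "g \<in> lin_maps A W"
    and ker: "\<And>a. a \<in> carrier A \<Longrightarrow> d a = \<zero>\<^bsub>B\<^esub> \<Longrightarrow> g a = \<zero>\<^bsub>W\<^esub>"
  shows "\<exists>h\<in>lin_maps B W. \<forall>a\<in>carrier A. h (d a) = g a"
proof -
  interpret A: module Rat A by fact
  interpret B: module Rat B by fact
  interpret W: module Rat W by fact
  note d' = lin_mapsD[OF d] and g' = lin_mapsD[OF g]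
  have im: "submodule (d ` carrier A) Rat B"
    by (rule image_submodule[OF M(1,2) d carrier_submodule[OF M(1)]])
  from complement_exists[OF M(2) im] obtain N where N: "submodule N Rat B"
    and dis: "d ` carrier A \<inter> N = {\<zero>\<^bsub>B\<^esub>}"
    and ex: "\<And>x. x \<in> carrier B \<Longrightarrow> \<exists>a\<in>d ` carrier A. \<exists>n\<in>N. x = a \<oplus>\<^bsub>B\<^esub> n" by blast
  note D = submoduleD[OF M(2) N]
  \<comment> \<open>The choice of \<open>a\<close> is harmless: by \<open>uniq\<close>, shown next,
    two decompositions of \<open>x\<close> give the same value of \<open>g\<close>.\<close>
  define h where "h x = g (SOME a. a \<in> carrier A \<and> (\<exists>n\<in>N. x = d a \<oplus>\<^bsub>B\<^esub> n))" for x
  have uniq: "g a = g a'"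
    if a: "a \<in> carrier A" "a' \<in> carrier A" "n \<in> N" "n' \<in> N" "d a \<oplus>\<^bsub>B\<^esub> n = d a' \<oplus>\<^bsub>B\<^esub> n'" for a a' n n'
  proof -
    have c: "n \<in> carrier B" "n' \<in> carrier B" "d a \<in> carrier B" "d a' \<in> carrier B"
      using a D(1) d' by auto
    have "d a \<ominus>\<^bsub>B\<^esub> d a' = n' \<ominus>\<^bsub>B\<^esub> n"
    proof -
      have "d a \<ominus>\<^bsub>B\<^esub> d a' = (d a \<oplus>\<^bsub>B\<^esub> n) \<ominus>\<^bsub>B\<^esub> n \<ominus>\<^bsub>B\<^esub> d a'"
        using c by (simp add: a_minus_def B.a_assoc B.r_neg)
      also have "\<dots> = (d a' \<oplus>\<^bsub>B\<^esub> n') \<ominus>\<^bsub>B\<^esub> n \<ominus>\<^bsub>B\<^esub> d a'" using a(5) by simp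
      also have "\<dots> = n' \<ominus>\<^bsub>B\<^esub> n \<oplus>\<^bsub>B\<^esub> (d a' \<ominus>\<^bsub>B\<^esub> d a')"
        using c by (simp add: a_minus_def B.a_ac)
      finally show ?thesis using c by (simp add: a_minus_def B.r_neg)
    qed
    moreover have "d a \<ominus>\<^bsub>B\<^esub> d a' = d (a \<ominus>\<^bsub>A\<^esub> a')" using lin_maps_minus[OF d M(1,2)] a by simp
    moreover have "d (a \<ominus>\<^bsub>A\<^esub> a') \<in> d ` carrier A" using a by simp
    ultimately have "d (a \<ominus>\<^bsub>A\<^esub> a') = \<zero>\<^bsub>B\<^esub>" using dis D(4)[OF a(4,3)] by auto
    then have "g a \<ominus>\<^bsub>W\<^esub> g a' = \<zero>\<^bsub>W\<^esub>" using ker[of "a \<ominus>\<^bsub>A\<^esub> a'"] lin_maps_minus[OF g M(1,3)] a by simp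
    then show ?thesis using minus_zero_eq[OF M(3)] g'(1) a by blast
  qed
  have h: "h (d a \<oplus>\<^bsub>B\<^esub> n) = g a" if "a \<in> carrier A" "n \<in> N" for a n
  proof -
    let ?P = "\<lambda>x a. a \<in> carrier A \<and> (\<exists>n\<in>N. x = d a \<oplus>\<^bsub>B\<^esub> n)"
    have "?P (d a \<oplus>\<^bsub>B\<^esub> n) a" using that by blast
    then have "?P (d a \<oplus>\<^bsub>B\<^esub> n) (SOME a'. ?P (d a \<oplus>\<^bsub>B\<^esub> n) a')" by (rule someI)
    then obtain n' where "(SOME a'. ?P (d a \<oplus>\<^bsub>B\<^esub> n) a') \<in> carrier A" "n' \<in> N"
      "d a \<oplus>\<^bsub>B\<^esub> n = d (SOME a'. ?P (d a \<oplus>\<^bsub>B\<^esub> n) a') \<oplus>\<^bsub>B\<^esub> n'" by (elim conjE bexE)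
    from uniq[OF that(1) this(1) that(2) this(2,3)] show ?thesis unfolding h_def by (rule sym)
  qed
  have "h \<in> lin_maps B W"
  proof (rule lin_mapsI_comb[OF M(2,3)])
    fix x assume "x \<in> carrier B"
    then obtain a n where x: "a \<in> carrier A" "n \<in> N" "x = d a \<oplus>\<^bsub>B\<^esub> n" using ex by blast
    then show "h x \<in> carrier W" using h g' by simp
    fix y k assume "y \<in> carrier B"
    then obtain a' n' where y: "a' \<in> carrier A" "n' \<in> N" "y = d a' \<oplus>\<^bsub>B\<^esub> n'" using ex by blast
    have c: "n \<in> carrier B" "n' \<in> carrier B" using x y D(1) by auto
    have "k \<odot>\<^bsub>B\<^esub> x \<oplus>\<^bsub>B\<^esub> y = d (k \<odot>\<^bsub>A\<^esub> a \<oplus>\<^bsub>A\<^esub> a') \<oplus>\<^bsub>B\<^esub> (k \<odot>\<^bsub>B\<^esub> n \<oplus>\<^bsub>B\<^esub> n')"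
      using x y d' c by (simp add: B.smult_r_distr B.a_ac)
    then show "h (k \<odot>\<^bsub>B\<^esub> x \<oplus>\<^bsub>B\<^esub> y) = k \<odot>\<^bsub>W\<^esub> h x \<oplus>\<^bsub>W\<^esub> h y" using x y h D(3,5) g' by simp
  qed
  moreover have "h (d a) = g a" if "a \<in> carrier A" for a
    using h[OF that D(2)] d' that by simp
  ultimately show ?thesis by blast
qed

text \<open>Records such as \<open>sections\<close> or \<open>DP_degree\<close> agree with a
  submodule only on its carrier; as records they differ, so the module structure has to be carried
  over.\<close>

lemma module_cong:
  assumes M: "module Rat M" and c: "carrier M' = carrier M" "\<zero>\<^bsub>M'\<^esub> = \<zero>\<^bsub>M\<^esub>"
    and a: "\<And>x y. x \<in> carrier M \<Longrightarrow> y \<in> carrier M \<Longrightarrow> x \<oplus>\<^bsub>M'\<^esub> y = x \<oplus>\<^bsub>M\<^esub> y"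
    and s: "\<And>k x. x \<in> carrier M \<Longrightarrow> k \<odot>\<^bsub>M'\<^esub> x = k \<odot>\<^bsub>M\<^esub> x"
  shows "module Rat M'"
proof -
  interpret module Rat M by fact
  have cl: "k \<odot>\<^bsub>M\<^esub> x \<in> carrier M" if "x \<in> carrier M" for k x using smult_closed[OF _ that] by simp
  show ?thesis
    by (rule rat_moduleI) (simp_all add: c a s cl M.a_ac smult_l_distr[simplified] smult_r_distr
        smult_assoc1[simplified] smult_one[simplified] smult_l_null[simplified])
qed

section \<open>Products of vector spaces\<close>

definition pi_module :: "'i set \<Rightarrow> ('i \<Rightarrow> (rat, 'v) module) \<Rightarrow> (rat, 'i \<Rightarrow> 'v) module" where
  "pi_module A V = \<lparr>carrier = (\<Pi>\<^sub>E i\<in>A. carrier (V i)),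
     monoid.mult = (\<lambda>_ _. undefined), one = undefined, zero = (\<lambda>i\<in>A. \<zero>\<^bsub>V i\<^esub>),
     add = (\<lambda>c c'. \<lambda>i\<in>A. c i \<oplus>\<^bsub>V i\<^esub> c' i), module.smult = (\<lambda>k c. \<lambda>i\<in>A. k \<odot>\<^bsub>V i\<^esub> c i)\<rparr>"

lemma pi_module_simps:
  "carrier (pi_module A V) = (\<Pi>\<^sub>E i\<in>A. carrier (V i))"
  "\<zero>\<^bsub>pi_module A V\<^esub> = (\<lambda>i\<in>A. \<zero>\<^bsub>V i\<^esub>)"
  "c \<oplus>\<^bsub>pi_module A V\<^esub> c' = (\<lambda>i\<in>A. c i \<oplus>\<^bsub>V i\<^esub> c' i)"
  "k \<odot>\<^bsub>pi_module A V\<^esub> c = (\<lambda>i\<in>A. k \<odot>\<^bsub>V i\<^esub> c i)"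
  by (simp_all add: pi_module_def)

lemma pi_module_module:
  assumes m: "\<And>i. i \<in> A \<Longrightarrow> module Rat (V i)"
  shows "module Rat (pi_module A V)"
proof -
  have ag: "abelian_monoid (V i)" if "i \<in> A" for i
    using abelian_group.axioms(1)[OF module.axioms(2)[OF m[OF that]]] .
  have E: "c i \<in> carrier (V i)" if "c \<in> carrier (pi_module A V)" "i \<in> A" for c i
    using that by (auto simp: pi_module_simps)
  have U: "c i = undefined" if "c \<in> carrier (pi_module A V)" "i \<notin> A" for c i
    using that by (auto simp: pi_module_simps PiE_def extensional_def)
  have rI: "restrict c A \<in> carrier (pi_module A V)" if "\<And>i. i \<in> A \<Longrightarrow> c i \<in> carrier (V i)" for c
    using that by (simp add: pi_module_simps)
  note ops = pi_module_simps(2-4)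
  show ?thesis
  proof (rule rat_moduleI)
    show "\<zero>\<^bsub>pi_module A V\<^esub> \<in> carrier (pi_module A V)"
      unfolding ops by (rule rI) (rule abelian_monoid.zero_closed[OF ag])
    fix a assume a: "a \<in> carrier (pi_module A V)"
    show "k \<odot>\<^bsub>pi_module A V\<^esub> a \<in> carrier (pi_module A V)" for k
      unfolding ops by (rule rI) (simp add: module.smult_closed[OF m] E[OF a])
    show "\<zero>\<^bsub>pi_module A V\<^esub> \<oplus>\<^bsub>pi_module A V\<^esub> a = a"
      by (rule ext) (simp add: ops U[OF a] abelian_monoid.l_zero[OF ag] E[OF a])
    show "(k + l) \<odot>\<^bsub>pi_module A V\<^esub> a = k \<odot>\<^bsub>pi_module A V\<^esub> a \<oplus>\<^bsub>pi_module A V\<^esub> l \<odot>\<^bsub>pi_module A V\<^esub> a" for k l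
      by (rule ext) (simp add: ops module.smult_l_distr[OF m, simplified] E[OF a])
    show "(k * l) \<odot>\<^bsub>pi_module A V\<^esub> a = k \<odot>\<^bsub>pi_module A V\<^esub> (l \<odot>\<^bsub>pi_module A V\<^esub> a)" for k l
      by (rule ext) (simp add: ops module.smult_assoc1[OF m, simplified] E[OF a])
    show "1 \<odot>\<^bsub>pi_module A V\<^esub> a = a"
      by (rule ext) (simp add: ops U[OF a] module.smult_one[OF m, simplified] E[OF a])
    show "0 \<odot>\<^bsub>pi_module A V\<^esub> a = \<zero>\<^bsub>pi_module A V\<^esub>"
      by (rule ext) (simp add: ops module.smult_l_null[OF m, simplified] E[OF a])
    fix b assume b: "b \<in> carrier (pi_module A V)"
    show "a \<oplus>\<^bsub>pi_module A V\<^esub> b \<in> carrier (pi_module A V)"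
      unfolding ops by (rule rI) (simp add: abelian_monoid.a_closed[OF ag] E[OF a] E[OF b])
    show "a \<oplus>\<^bsub>pi_module A V\<^esub> b = b \<oplus>\<^bsub>pi_module A V\<^esub> a"
      by (rule ext) (simp add: ops abelian_monoid.a_comm[OF ag] E[OF a] E[OF b])
    show "k \<odot>\<^bsub>pi_module A V\<^esub> (a \<oplus>\<^bsub>pi_module A V\<^esub> b) = k \<odot>\<^bsub>pi_module A V\<^esub> a \<oplus>\<^bsub>pi_module A V\<^esub> k \<odot>\<^bsub>pi_module A V\<^esub> b" for k
      by (rule ext) (simp add: ops module.smult_r_distr[OF m, simplified] E[OF a] E[OF b])
    fix c assume c: "c \<in> carrier (pi_module A V)"
    show "a \<oplus>\<^bsub>pi_module A V\<^esub> b \<oplus>\<^bsub>pi_module A V\<^esub> c = a \<oplus>\<^bsub>pi_module A V\<^esub> (b \<oplus>\<^bsub>pi_module A V\<^esub> c)"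
      by (rule ext) (simp add: ops abelian_monoid.a_assoc[OF ag] E[OF a] E[OF b] E[OF c])
  qed
qed

subsection \<open>Quotients\<close>

lemma coset_iff:
  assumes "module Rat M" "submodule N Rat M" "a \<in> carrier M"
  shows "b \<in> N +>\<^bsub>M\<^esub> a \<longleftrightarrow> b \<in> carrier M \<and> b \<ominus>\<^bsub>M\<^esub> a \<in> N"
proof -
  interpret M: module Rat M by fact
  note D = submoduleD[OF assms(1,2)]
  show ?thesis
  proof
    assume "b \<in> N +>\<^bsub>M\<^esub> a"
    then obtain h where h: "h \<in> N" "b = h \<oplus>\<^bsub>M\<^esub> a" by (auto simp: a_r_coset_def')
    then have "b \<ominus>\<^bsub>M\<^esub> a = h" using D(1) assms(3)
      by (auto simp: a_minus_def M.a_assoc M.r_neg subset_iff)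
    then show "b \<in> carrier M \<and> b \<ominus>\<^bsub>M\<^esub> a \<in> N" using h D(1) assms(3) by auto
  next
    assume b: "b \<in> carrier M \<and> b \<ominus>\<^bsub>M\<^esub> a \<in> N"
    then have "b = (b \<ominus>\<^bsub>M\<^esub> a) \<oplus>\<^bsub>M\<^esub> a"
      using assms(3) by (simp add: a_minus_def M.a_assoc M.l_neg)
    then show "b \<in> N +>\<^bsub>M\<^esub> a" using b by (auto simp: a_r_coset_def')
  qed
qed

lemma coset_self:
  assumes "module Rat M" "submodule N Rat M" "a \<in> carrier M"
  shows "a \<in> N +>\<^bsub>M\<^esub> a"
proof -
  interpret M: module Rat M by fact
  show ?thesis using coset_iff[OF assms] submoduleD(2)[OF assms(1,2)] assms(3)
    by (simp add: a_minus_def M.r_neg)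
qed

lemma coset_eq:
  assumes "module Rat M" "submodule N Rat M" "a \<in> carrier M" "b \<in> carrier M"
  shows "N +>\<^bsub>M\<^esub> a = N +>\<^bsub>M\<^esub> b \<longleftrightarrow> a \<ominus>\<^bsub>M\<^esub> b \<in> N"
proof
  interpret M: module Rat M by fact
  assume "N +>\<^bsub>M\<^esub> a = N +>\<^bsub>M\<^esub> b"
  then show "a \<ominus>\<^bsub>M\<^esub> b \<in> N"
    using coset_self[OF assms(1-3)] coset_iff[OF assms(1,2,4)] by blast
next
  interpret M: module Rat M by fact
  assume "a \<ominus>\<^bsub>M\<^esub> b \<in> N"
  then have "a \<in> N +>\<^bsub>M\<^esub> b" using coset_iff[OF assms(1,2,4)] assms by blast
  then show "N +>\<^bsub>M\<^esub> a = N +>\<^bsub>M\<^esub> b"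
    using M.a_repr_independence[of a N b] assms(2,4) submodule.axioms(1) by metis
qed

lemma coset_zero:
  assumes "module Rat M" "submodule N Rat M"
  shows "N +>\<^bsub>M\<^esub> \<zero>\<^bsub>M\<^esub> = N"
proof -
  interpret M: module Rat M by fact
  show ?thesis using submoduleD(1)[OF assms] by simp
qed

lemma quot_module_simps:
  "zero (quot_module M N) = N" "add (quot_module M N) = (<+>\<^bsub>M\<^esub>)"
  "carrier (quot_module M N) = (\<lambda>a. N +>\<^bsub>M\<^esub> a) ` carrier M"
  by (auto simp: quot_module_def A_RCOSETS_def')

lemma coset_add:
  assumes "module Rat M" "submodule N Rat M" "a \<in> carrier M" "b \<in> carrier M"
  shows "(N +>\<^bsub>M\<^esub> a) <+>\<^bsub>M\<^esub> (N +>\<^bsub>M\<^esub> b) = N +>\<^bsub>M\<^esub> (a \<oplus>\<^bsub>M\<^esub> b)"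
proof -
  interpret M: module Rat M by fact
  interpret abelian_subgroup N M
    using M.abelian_group_axioms assms(2) by (auto intro!: abelian_subgroupI3 additive_subgroupI simp: submodule.axioms(1))
  show ?thesis using a_rcos_sum assms by blast
qed

text \<open>Scalar multiplication and induced maps on quotients are encoded as unions over all
  representatives. Such a union collapses to a single term once the term is independent of the
  representative.\<close>

lemma coset_UN:
  assumes "module Rat M" "submodule N Rat M" "a \<in> carrier M"
    and "\<And>b. b \<in> carrier M \<Longrightarrow> b \<ominus>\<^bsub>M\<^esub> a \<in> N \<Longrightarrow> g b = g a"
  shows "(\<Union>b\<in>N +>\<^bsub>M\<^esub> a. g b) = g a"
proof -
  have "g b = g a" if "b \<in> N +>\<^bsub>M\<^esub> a" for b
    using that coset_iff[OF assms(1-3)] assms(4) by blast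
  then show ?thesis using coset_self[OF assms(1-3)] by blast
qed

lemma coset_smult:
  assumes "module Rat M" "submodule N Rat M" "a \<in> carrier M"
  shows "c \<odot>\<^bsub>quot_module M N\<^esub> (N +>\<^bsub>M\<^esub> a) = N +>\<^bsub>M\<^esub> (c \<odot>\<^bsub>M\<^esub> a)"
proof -
  interpret M: module Rat M by fact
  have "(\<Union>b\<in>N +>\<^bsub>M\<^esub> a. N +>\<^bsub>M\<^esub> (c \<odot>\<^bsub>M\<^esub> b)) = N +>\<^bsub>M\<^esub> (c \<odot>\<^bsub>M\<^esub> a)"
  proof (rule coset_UN[OF assms])
    fix b assume b: "b \<in> carrier M" "b \<ominus>\<^bsub>M\<^esub> a \<in> N"
    have "c \<odot>\<^bsub>M\<^esub> b \<ominus>\<^bsub>M\<^esub> c \<odot>\<^bsub>M\<^esub> a = c \<odot>\<^bsub>M\<^esub> (b \<ominus>\<^bsub>M\<^esub> a)"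
      using b assms(3) by (simp add: a_minus_def M.smult_r_distr M.smult_r_minus)
    then show "N +>\<^bsub>M\<^esub> (c \<odot>\<^bsub>M\<^esub> b) = N +>\<^bsub>M\<^esub> (c \<odot>\<^bsub>M\<^esub> a)"
      using coset_eq[OF assms(1,2)] submoduleD(5)[OF assms(1,2) b(2)] b(1) assms(3) by simp
  qed
  then show ?thesis by (simp add: quot_module_def)
qed

lemma quot_module_module:
  assumes "module Rat M" "submodule N Rat M"
  shows "module Rat (quot_module M N)"
proof -
  interpret M: module Rat M by fact
  note [simp] = quot_module_simps coset_add[OF assms] coset_smult[OF assms]
  have z: "N = N +>\<^bsub>M\<^esub> \<zero>\<^bsub>M\<^esub>" using coset_zero[OF assms] by simp
  show ?thesis
  proof (rule rat_moduleI)
    show "\<zero>\<^bsub>quot_module M N\<^esub> \<in> carrier (quot_module M N)" using z by auto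
    fix x assume "x \<in> carrier (quot_module M N)"
    then obtain a where a: "a \<in> carrier M" "x = N +>\<^bsub>M\<^esub> a" by auto
    show "\<zero>\<^bsub>quot_module M N\<^esub> \<oplus>\<^bsub>quot_module M N\<^esub> x = x"
      using a coset_add[OF assms, of "\<zero>\<^bsub>M\<^esub>" a] z by simp
    show "0 \<odot>\<^bsub>quot_module M N\<^esub> x = \<zero>\<^bsub>quot_module M N\<^esub>"
      using a z M.smult_l_null by simp
  qed (auto simp: M.a_ac M.smult_r_distr[simplified] M.smult_l_distr[simplified]
      M.smult_assoc1[simplified] M.smult_one[simplified])
qed

lemma quot_map_lin:
  assumes "module Rat M" "submodule N Rat M"
  shows "(\<lambda>a. N +>\<^bsub>M\<^esub> a) \<in> lin_maps M (quot_module M N)"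
  by (rule lin_mapsI) (auto simp: quot_module_simps coset_add[OF assms] coset_smult[OF assms])

lemma quot_lin_mapsI:
  assumes "module Rat M" "submodule N Rat M" "(\<lambda>a. f (N +>\<^bsub>M\<^esub> a)) \<in> lin_maps M W"
  shows "f \<in> lin_maps (quot_module M N) W"
  by (rule lin_mapsI)
    (auto simp: quot_module_simps coset_add[OF assms(1,2)] coset_smult[OF assms(1,2)] lin_mapsD[OF assms(3)])

lemma induced_coset:
  assumes M: "module Rat M" "submodule N Rat M" "module Rat M'" "submodule N' Rat M'"
    and f: "f \<in> lin_maps M M'" "f ` N \<subseteq> N'" and a: "a \<in> carrier M"
  shows "induced M' N' f (N +>\<^bsub>M\<^esub> a) = N' +>\<^bsub>M'\<^esub> f a"
  unfolding induced_def
proof (rule coset_UN[OF M(1,2) a])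
  fix b assume b: "b \<in> carrier M" "b \<ominus>\<^bsub>M\<^esub> a \<in> N"
  then show "N' +>\<^bsub>M'\<^esub> f b = N' +>\<^bsub>M'\<^esub> f a"
    using coset_eq[OF M(3,4)] lin_mapsD(1)[OF f(1)] a f(2) lin_maps_minus[OF f(1) M(1,3)]
    by (metis image_subset_iff)
qed

lemma induced_lin:
  assumes M: "module Rat M" "submodule N Rat M" "module Rat M'" "submodule N' Rat M'"
    and f: "f \<in> lin_maps M M'" "f ` N \<subseteq> N'"
  shows "induced M' N' f \<in> lin_maps (quot_module M N) (quot_module M' N')"
proof (rule quot_lin_mapsI[OF M(1,2)], rule lin_maps_cong[OF _ M(1)])
  show "(\<lambda>a. N' +>\<^bsub>M'\<^esub> f a) \<in> lin_maps M (quot_module M' N')"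
    by (rule lin_maps_comp[OF f(1) quot_map_lin[OF M(3,4)]])
qed (use induced_coset[OF assms] in simp)

text \<open>The kernel of the projection is \<open>N\<close>, so factoring through it is an instance
  of \<open>linear_factor\<close>.\<close>

lemma lift_quot:
  assumes M: "module Rat M" "submodule N Rat M" "module Rat W"
    and f: "f \<in> lin_maps M W" "\<And>x. x \<in> N \<Longrightarrow> f x = \<zero>\<^bsub>W\<^esub>"
  shows "\<exists>g\<in>lin_maps (quot_module M N) W. \<forall>a\<in>carrier M. g (N +>\<^bsub>M\<^esub> a) = f a"
proof (rule linear_factor[OF M(1) quot_module_module[OF M(1,2)] M(3) quot_map_lin[OF M(1,2)] f(1)])
  fix a assume a: "a \<in> carrier M" "N +>\<^bsub>M\<^esub> a = \<zero>\<^bsub>quot_module M N\<^esub>"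
  then have "a \<in> N" using coset_self[OF M(1,2)] by (auto simp: quot_module_simps)
  then show "f a = \<zero>\<^bsub>W\<^esub>" by (rule f(2))
qed

subsection \<open>Generated subspaces\<close>

lemma submodule_Inter:
  assumes "module Rat M" "\<And>N. N \<in> C \<Longrightarrow> submodule N Rat M" "C \<noteq> {}"
  shows "submodule (\<Inter>C) Rat M"
proof (rule rat_submoduleI[OF assms(1)])
  show "\<Inter>C \<subseteq> carrier M" using assms(2,3) submoduleD(1)[OF assms(1)] by blast
qed (use assms(2) submoduleD(2,3,5)[OF assms(1)] in blast)+

lemma gen_submodule:
  assumes "module Rat M" "S \<subseteq> carrier M"
  shows "submodule (gen_submodule M S) Rat M"
  unfolding gen_submodule_def hull_def
  by (rule submodule_Inter[OF assms(1)]) (use assms carrier_submodule[OF assms(1)] in blast)+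

lemma gen_submodule_incl: "s \<in> S \<Longrightarrow> s \<in> gen_submodule M S"
  unfolding gen_submodule_def by (rule hull_inc)

lemma gen_submodule_minimal:
  assumes "S \<subseteq> N" "submodule N Rat M"
  shows "gen_submodule M S \<subseteq> N"
  unfolding gen_submodule_def using assms by (rule hull_minimal)

lemma gen_submodule_map:
  assumes "module Rat M" "module Rat M'" "f \<in> lin_maps M M'" "submodule N' Rat M'"
    and "S \<subseteq> carrier M" "\<And>s. s \<in> S \<Longrightarrow> f s \<in> N'"
  shows "f ` gen_submodule M S \<subseteq> N'"
proof -
  have "gen_submodule M S \<subseteq> {x \<in> carrier M. f x \<in> N'}"
    by (rule gen_submodule_minimal[OF _ preimage_submodule[OF assms(1-4)]]) (use assms in blast)
  then show ?thesis by blast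
qed

subsection \<open>Free vector spaces\<close>

abbreviation scl :: "rat \<Rightarrow> ('x \<Rightarrow>\<^sub>0 rat) \<Rightarrow> ('x \<Rightarrow>\<^sub>0 rat)" where
  "scl c \<equiv> Poly_Mapping.map ((*) c)"

lemma lookup_scl [simp]: "Poly_Mapping.lookup (scl c f) x = c * Poly_Mapping.lookup f x"
  by (simp add: Poly_Mapping.map.rep_eq when_def)

lemma scl_simps [simp]:
  "scl c (f + g) = scl c f + scl c g" "scl (c + d) f = scl c f + scl d f"
  "scl c (scl d f) = scl (c * d) f" "scl 1 f = f" "scl 0 f = 0" "scl c 0 = 0"
  "scl c (Poly_Mapping.single x d) = Poly_Mapping.single x (c * d)"
  by (auto intro!: poly_mapping_eqI simp: lookup_add algebra_simps lookup_single when_def)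

lemma scl_sum: "scl c (sum f A) = (\<Sum>x\<in>A. scl c (f x))"
  by (auto intro!: poly_mapping_eqI simp: lookup_sum sum_distrib_left)

lemma free_module_simps:
  "carrier (free_module B) = {f. Poly_Mapping.keys f \<subseteq> B}" "zero (free_module B) = 0"
  "add (free_module B) = (+)" "module.smult (free_module B) = scl"
  by (simp_all add: free_module_def)

lemma free_module_module: "module Rat (free_module B)"
proof (rule rat_moduleI)
  fix x y :: "'a \<Rightarrow>\<^sub>0 rat" and c :: rat
  show "x \<in> carrier (free_module B) \<Longrightarrow> y \<in> carrier (free_module B) \<Longrightarrow>
      x \<oplus>\<^bsub>free_module B\<^esub> y \<in> carrier (free_module B)"
    using keys_add[of x y] by (auto simp: free_module_simps)
  show "x \<in> carrier (free_module B) \<Longrightarrow> c \<odot>\<^bsub>free_module B\<^esub> x \<in> carrier (free_module B)"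
    by (auto simp: free_module_simps in_keys_iff)
qed (auto simp: free_module_simps add.assoc add.commute)

lemma free_minus:
  assumes "g \<in> carrier (free_module B)"
  shows "f \<ominus>\<^bsub>free_module B\<^esub> g = f - g"
proof -
  have "\<ominus>\<^bsub>free_module B\<^esub> g = scl (- 1) g"
    using rat_smult_minus[OF free_module_module assms] by (simp add: free_module_simps)
  moreover have "scl (- 1) g = - g" by (rule poly_mapping_eqI) simp
  ultimately show ?thesis by (simp add: a_minus_def free_module_simps)
qed

lemma basis_in_free: "Poly_Mapping.single x c \<in> carrier (free_module B) \<longleftrightarrow> c = 0 \<or> x \<in> B"
  by (auto simp: free_module_simps)

lemma free_sum: "(\<And>a. a \<in> A \<Longrightarrow> f a \<in> carrier (free_module B)) \<Longrightarrow> sum f A \<in> carrier (free_module B)"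
proof (induction A rule: infinite_finite_induct)
  case (insert x F)
  then show ?case using keys_add[of "f x" "sum f F"] by (auto simp: free_module_simps)
qed (auto simp: free_module_simps)

lemma poly_mapping_expand:
  fixes f :: "'x \<Rightarrow>\<^sub>0 rat"
  shows "f = (\<Sum>x\<in>Poly_Mapping.keys f. Poly_Mapping.single x (Poly_Mapping.lookup f x))"
  by (rule poly_mapping_eqI)
    (auto simp: lookup_sum lookup_single when_def in_keys_iff sum.delta cong: if_cong)

lemma free_induct [consumes 1, case_names zero add single]:
  fixes f :: "'x \<Rightarrow>\<^sub>0 rat"
  assumes "f \<in> carrier (free_module B)" "P 0"
    and "\<And>f g. f \<in> carrier (free_module B) \<Longrightarrow> g \<in> carrier (free_module B) \<Longrightarrow> P f \<Longrightarrow> P g \<Longrightarrow> P (f + g)"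
    and "\<And>b c. b \<in> B \<Longrightarrow> P (Poly_Mapping.single b c)"
  shows "P f"
proof -
  have "finite S \<Longrightarrow> S \<subseteq> B \<Longrightarrow> P (\<Sum>x\<in>S. Poly_Mapping.single x (Poly_Mapping.lookup f x))" for S
  proof (induction S rule: finite_induct)
    case (insert x F)
    have "(\<Sum>x\<in>F. Poly_Mapping.single x (Poly_Mapping.lookup f x)) \<in> carrier (free_module B)"
      by (rule free_sum) (use insert in \<open>auto simp: basis_in_free\<close>)
    then show ?case using insert assms(3,4) by (simp add: basis_in_free)
  qed (simp add: assms(2))
  from this[of "Poly_Mapping.keys f"] show ?thesis
    using assms(1) poly_mapping_expand[of f] by (simp add: free_module_simps)
qed

lemma free_ext:
  assumes "f \<in> lin_maps (free_module B) W" "g \<in> lin_maps (free_module B) W" "module Rat W"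
    and "\<And>b. b \<in> B \<Longrightarrow> f (basis_elt b) = g (basis_elt b)" and "v \<in> carrier (free_module B)"
  shows "f v = g v"
  using assms(5)
proof (induction rule: free_induct)
  case zero
  then show ?case using lin_maps_zero[OF assms(1) free_module_module assms(3)]
      lin_maps_zero[OF assms(2) free_module_module assms(3)] by (simp add: free_module_simps)
next
  case (add f g)
  then show ?case using lin_mapsD(2)[OF assms(1)] lin_mapsD(2)[OF assms(2)] by (metis free_module_simps(3))
next
  case (single b c)
  have "Poly_Mapping.single b c = c \<odot>\<^bsub>free_module B\<^esub> basis_elt b" by (simp add: free_module_simps)
  then show ?case using lin_mapsD(3)[OF assms(1)] lin_mapsD(3)[OF assms(2)] assms(4)[OF single] single
    by (metis basis_in_free)
qed

lemma lin_ext_superset: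
  assumes "finite S" "Poly_Mapping.keys f \<subseteq> S"
  shows "lin_ext \<phi> f = (\<Sum>x\<in>S. scl (Poly_Mapping.lookup f x) (\<phi> x))"
  unfolding lin_ext_def
  by (rule sum.mono_neutral_left) (use assms in \<open>auto simp: in_keys_iff\<close>)

lemma lin_ext_add: "lin_ext \<phi> (f + g) = lin_ext \<phi> f + lin_ext \<phi> g"
proof -
  let ?S = "Poly_Mapping.keys f \<union> Poly_Mapping.keys g"
  have "Poly_Mapping.keys (f + g) \<subseteq> ?S" by (rule keys_add)
  then show ?thesis
    using lin_ext_superset[of ?S "f + g" \<phi>] lin_ext_superset[of ?S f \<phi>] lin_ext_superset[of ?S g \<phi>]
    by (simp add: lookup_add sum.distrib)
qed

lemma lin_ext_scl: "lin_ext \<phi> (scl c f) = scl c (lin_ext \<phi> f)"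
proof -
  have "Poly_Mapping.keys (scl c f) \<subseteq> Poly_Mapping.keys f" by (auto simp: in_keys_iff)
  then show ?thesis
    using lin_ext_superset[of "Poly_Mapping.keys f" "scl c f" \<phi>] by (simp add: lin_ext_def scl_sum)
qed

lemma lin_ext_zero [simp]: "lin_ext \<phi> 0 = 0"
  by (simp add: lin_ext_def)

lemma lin_ext_single [simp]: "lin_ext \<phi> (Poly_Mapping.single x c) = scl c (\<phi> x)"
  by (cases "c = 0") (simp_all add: lin_ext_def)

lemma lin_ext_diff: "lin_ext \<phi> (f - g) = lin_ext \<phi> f - lin_ext \<phi> g"
  using lin_ext_add[of \<phi> "f - g" g] by (simp add: algebra_simps)

lemma lin_ext_lin:
  assumes "\<And>b. b \<in> B \<Longrightarrow> \<phi> b \<in> carrier (free_module B')"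
  shows "lin_ext \<phi> \<in> lin_maps (free_module B) (free_module B')"
proof (rule lin_mapsI)
  interpret M: module Rat "free_module B'" by (rule free_module_module)
  fix x assume "x \<in> carrier (free_module B)"
  then show "lin_ext \<phi> x \<in> carrier (free_module B')" unfolding lin_ext_def
    by (intro free_sum) (use assms M.smult_closed in \<open>force simp: free_module_simps\<close>)
qed (simp_all add: free_module_simps lin_ext_add lin_ext_scl)

text \<open>\<open>lin_ext\<close> takes values in finitely supported functions only. For an
  arbitrary target the sum over the support is formed inside \<open>W\<close>, and adding two such
  sums needs the common larger range of summation in \<open>sup\<close>.\<close>

lemma free_universal:
  fixes W :: "(rat, 'w) module"
  assumes W: "module Rat W" and \<phi>: "\<And>b. b \<in> B \<Longrightarrow> \<phi> b \<in> carrier W"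
  shows "\<exists>f\<in>lin_maps (free_module B) W. \<forall>b\<in>B. f (basis_elt b) = \<phi> b"
proof -
  interpret W: module Rat W by fact
  define f where "f v = (\<Oplus>\<^bsub>W\<^esub>x\<in>Poly_Mapping.keys v. Poly_Mapping.lookup v x \<odot>\<^bsub>W\<^esub> \<phi> x)" for v
  have sup: "f v = (\<Oplus>\<^bsub>W\<^esub>x\<in>S. Poly_Mapping.lookup v x \<odot>\<^bsub>W\<^esub> \<phi> x)"
    if "finite S" "Poly_Mapping.keys v \<subseteq> S" "S \<subseteq> B" for S v
    unfolding f_def
    by (rule W.add.finprod_mono_neutral_cong_left) (use that \<phi> in \<open>auto simp: in_keys_iff W.smult_l_null[simplified]\<close>)
  have "f \<in> lin_maps (free_module B) W"
  proof (rule lin_mapsI)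
    fix x assume "x \<in> carrier (free_module B)"
    then have x: "Poly_Mapping.keys x \<subseteq> B" by (simp add: free_module_simps)
    then show "f x \<in> carrier W" unfolding f_def by (intro W.finsum_closed) (use \<phi> in auto)
    fix c
    have k: "Poly_Mapping.keys (scl c x) \<subseteq> Poly_Mapping.keys x" by (auto simp: in_keys_iff)
    have "f (scl c x) = (\<Oplus>\<^bsub>W\<^esub>k\<in>Poly_Mapping.keys x. c \<odot>\<^bsub>W\<^esub> (Poly_Mapping.lookup x k \<odot>\<^bsub>W\<^esub> \<phi> k))"
      unfolding sup[OF finite_keys k x]
      by (rule W.finsum_cong') (use x \<phi> W.smult_assoc1 in \<open>auto simp: subset_iff\<close>)
    also have "\<dots> = c \<odot>\<^bsub>W\<^esub> f x"
      unfolding f_def by (rule W.finsum_smult_ldistr[symmetric]) (use x \<phi> in auto)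
    finally show "f (c \<odot>\<^bsub>free_module B\<^esub> x) = c \<odot>\<^bsub>W\<^esub> f x" by (simp add: free_module_simps)
  next
    fix x y assume "x \<in> carrier (free_module B)" "y \<in> carrier (free_module B)"
    then have xy: "Poly_Mapping.keys x \<union> Poly_Mapping.keys y \<subseteq> B" (is "?S \<subseteq> B")
      by (simp add: free_module_simps)
    have "f (x + y) = (\<Oplus>\<^bsub>W\<^esub>k\<in>?S. Poly_Mapping.lookup x k \<odot>\<^bsub>W\<^esub> \<phi> k \<oplus>\<^bsub>W\<^esub> Poly_Mapping.lookup y k \<odot>\<^bsub>W\<^esub> \<phi> k)"
      unfolding sup[OF _ keys_add xy, simplified]
      by (rule W.finsum_cong') (use xy \<phi> W.smult_l_distr in \<open>auto simp: lookup_add subset_iff\<close>)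
    also have "\<dots> = f x \<oplus>\<^bsub>W\<^esub> f y"
      using sup[of ?S x] sup[of ?S y] xy \<phi>
      by (subst W.finsum_addf) (auto simp: Pi_def subset_iff)
    finally show "f (x \<oplus>\<^bsub>free_module B\<^esub> y) = f x \<oplus>\<^bsub>W\<^esub> f y" by (simp add: free_module_simps)
  qed
  moreover have "f (basis_elt b) = \<phi> b" if "b \<in> B" for b
    unfolding f_def using \<phi>[OF that] W.smult_one by simp
  ultimately show ?thesis by blast
qed

subsection \<open>Tensor products\<close>

text \<open>The bilinearity relations as an inductive set, so that a proof about all of them is a
  distinction of named cases rather than an elimination of nested existentials.\<close>

inductive_set tensor_gens :: "(rat, 'v) module \<Rightarrow> (rat, 'w) module \<Rightarrow> ('v \<times> 'w \<Rightarrow>\<^sub>0 rat) set"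
  for M N where
  addl: "m \<in> carrier M \<Longrightarrow> m' \<in> carrier M \<Longrightarrow> n \<in> carrier N \<Longrightarrow>
    basis_elt (m \<oplus>\<^bsub>M\<^esub> m', n) - basis_elt (m, n) - basis_elt (m', n) \<in> tensor_gens M N"
| addr: "m \<in> carrier M \<Longrightarrow> n \<in> carrier N \<Longrightarrow> n' \<in> carrier N \<Longrightarrow>
    basis_elt (m, n \<oplus>\<^bsub>N\<^esub> n') - basis_elt (m, n) - basis_elt (m, n') \<in> tensor_gens M N"
| smultl: "m \<in> carrier M \<Longrightarrow> n \<in> carrier N \<Longrightarrow>
    basis_elt (c \<odot>\<^bsub>M\<^esub> m, n) - Poly_Mapping.single (m, n) c \<in> tensor_gens M N"
| smultr: "m \<in> carrier M \<Longrightarrow> n \<in> carrier N \<Longrightarrow>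
    basis_elt (m, c \<odot>\<^bsub>N\<^esub> n) - Poly_Mapping.single (m, n) c \<in> tensor_gens M N"

lemma tensor_rel_eq:
  "tensor_rel M N = gen_submodule (free_module (carrier M \<times> carrier N)) (tensor_gens M N)"
proof -
  have "tensor_gens M N = {basis_elt (m \<oplus>\<^bsub>M\<^esub> m', n) - basis_elt (m, n) - basis_elt (m', n) | m m' n.
         m \<in> carrier M \<and> m' \<in> carrier M \<and> n \<in> carrier N}
      \<union> {basis_elt (m, n \<oplus>\<^bsub>N\<^esub> n') - basis_elt (m, n) - basis_elt (m, n') | m n n'.
         m \<in> carrier M \<and> n \<in> carrier N \<and> n' \<in> carrier N}
      \<union> {basis_elt (c \<odot>\<^bsub>M\<^esub> m, n) - Poly_Mapping.single (m, n) c | c m n.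
         m \<in> carrier M \<and> n \<in> carrier N}
      \<union> {basis_elt (m, c \<odot>\<^bsub>N\<^esub> n) - Poly_Mapping.single (m, n) c | c m n.
         m \<in> carrier M \<and> n \<in> carrier N}"
    (is "_ = ?A \<union> ?B \<union> ?C \<union> ?D")
  proof
    show "tensor_gens M N \<subseteq> ?A \<union> ?B \<union> ?C \<union> ?D"
    proof
      fix s assume "s \<in> tensor_gens M N"
      then show "s \<in> ?A \<union> ?B \<union> ?C \<union> ?D"
      proof cases
        case addl then have "s \<in> ?A" by blast then show ?thesis by simp
      next
        case addr then have "s \<in> ?B" by blast then show ?thesis by simp
      next
        case smultl then have "s \<in> ?C" by blast then show ?thesis by simp
      next
        case smultr then have "s \<in> ?D" by blast then show ?thesis by simp
      qed
    qed
    show "?A \<union> ?B \<union> ?C \<union> ?D \<subseteq> tensor_gens M N"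
      by (intro Un_least) (auto intro: tensor_gens.intros)
  qed
  then show ?thesis by (simp only: tensor_rel_def)
qed

lemma tensor_gens_in_free:
  fixes M :: "(rat, 'v) module" and N :: "(rat, 'w) module"
  assumes "module Rat M" "module Rat N"
  shows "tensor_gens M N \<subseteq> carrier (free_module (carrier M \<times> carrier N))" (is "?G \<subseteq> ?F")
proof -
  interpret M: module Rat M by fact
  interpret N: module Rat N by fact
  interpret F: module Rat "free_module (carrier M \<times> carrier N)" by (rule free_module_module)
  have sub: "a - b \<in> ?F" if "a \<in> ?F" "b \<in> ?F" for a b
    using F.minus_closed[OF that] free_minus[OF that(2)] by simp
  have s: "Poly_Mapping.single (m, n) c \<in> ?F" if "m \<in> carrier M" "n \<in> carrier N" for m n c
    using that by (simp add: basis_in_free)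
  show ?thesis by (auto elim!: tensor_gens.cases intro!: sub s)
qed

lemma tensor_rel_submodule:
  assumes "module Rat M" "module Rat N"
  shows "submodule (tensor_rel M N) Rat (free_module (carrier M \<times> carrier N))"
  unfolding tensor_rel_eq by (rule gen_submodule[OF free_module_module tensor_gens_in_free[OF assms]])

lemma tensor_module:
  assumes "module Rat M" "module Rat N"
  shows "module Rat (tensor M N)"
  unfolding tensor_def by (rule quot_module_module[OF free_module_module tensor_rel_submodule[OF assms]])

lemma pure_tensor_closed:
  assumes "m \<in> carrier M" "n \<in> carrier N"
  shows "pure_tensor M N m n \<in> carrier (tensor M N)"
  using assms by (auto simp: tensor_def pure_tensor_def quot_module_simps basis_in_free)

lemma tensor_ext:
  assumes "module Rat M" "module Rat N" "module Rat W"
    and "f \<in> lin_maps (tensor M N) W" "g \<in> lin_maps (tensor M N) W"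
    and eq: "\<And>m n. m \<in> carrier M \<Longrightarrow> n \<in> carrier N \<Longrightarrow> f (pure_tensor M N m n) = g (pure_tensor M N m n)"
    and "t \<in> carrier (tensor M N)"
  shows "f t = g t"
proof -
  let ?F = "free_module (carrier M \<times> carrier N)"
  obtain a where a: "a \<in> carrier ?F" "t = tensor_rel M N +>\<^bsub>?F\<^esub> a"
    using assms(7) by (auto simp: tensor_def quot_module_simps)
  note q = quot_map_lin[OF free_module_module tensor_rel_submodule[OF assms(1,2)], folded tensor_def]
  show ?thesis unfolding a(2)
    by (rule free_ext[OF lin_maps_comp[OF q assms(4)] lin_maps_comp[OF q assms(5)] assms(3) _ a(1)])
       (use eq in \<open>auto simp: pure_tensor_def\<close>)
qed

text \<open>The universal property. It serves to invert the augmentation over the least element, in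
  \<open>tensor_line\<close>.\<close>

lemma tensor_lift:
  fixes M :: "(rat, 'v) module" and N :: "(rat, 'w) module" and W :: "(rat, 'u) module"
  assumes M: "module Rat M" "module Rat N" "module Rat W"
    and b: "\<And>n. n \<in> carrier N \<Longrightarrow> (\<lambda>m. b m n) \<in> lin_maps M W"
    "\<And>m. m \<in> carrier M \<Longrightarrow> (\<lambda>n. b m n) \<in> lin_maps N W"
  shows "\<exists>f\<in>lin_maps (tensor M N) W.
    \<forall>m\<in>carrier M. \<forall>n\<in>carrier N. f (pure_tensor M N m n) = b m n"
proof -
  let ?F = "free_module (carrier M \<times> carrier N)"
  interpret Mm: module Rat M by fact
  interpret Nm: module Rat N by fact
  interpret W: module Rat W by fact
  have cl: "b m n \<in> carrier W" if "m \<in> carrier M" "n \<in> carrier N" for m n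
    using lin_mapsD(1)[OF b(1)] that by blast
  have \<phi>: "(case x of (m, n) \<Rightarrow> b m n) \<in> carrier W" if "x \<in> carrier M \<times> carrier N" for x
    using that cl by auto
  have "\<exists>f\<in>lin_maps ?F W. \<forall>x\<in>carrier M \<times> carrier N. f (basis_elt x) = (case x of (m, n) \<Rightarrow> b m n)"
    by (rule free_universal[OF M(3) \<phi>])
  then obtain f0 where f01: "f0 \<in> lin_maps ?F W"
    and f02: "\<forall>x\<in>carrier M \<times> carrier N. f0 (basis_elt x) = (case x of (m, n) \<Rightarrow> b m n)"
    by (elim bexE)
  have f0: "f0 \<in> lin_maps ?F W"
    "\<And>m n. m \<in> carrier M \<Longrightarrow> n \<in> carrier N \<Longrightarrow> f0 (basis_elt (m, n)) = b m n"
    using f01 f02 by simp_all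
  have mi: "f0 (x - y) = f0 x \<ominus>\<^bsub>W\<^esub> f0 y" if "x \<in> carrier ?F" "y \<in> carrier ?F" for x y
    using lin_maps_minus[OF f0(1) free_module_module M(3) that] free_minus[OF that(2)] by simp
  have si: "f0 (Poly_Mapping.single (m, n) c) = c \<odot>\<^bsub>W\<^esub> b m n" if "m \<in> carrier M" "n \<in> carrier N" for m n c
    using lin_mapsD(3)[OF f0(1), of "basis_elt (m, n)" c] f0(2)[OF that] that
    by (simp add: basis_in_free free_module_simps(4))
  have c: "Poly_Mapping.single (m, n) c \<in> carrier ?F" if "m \<in> carrier M" "n \<in> carrier N" for m n c
    using that by (simp add: basis_in_free)
  have si1: "f0 (basis_elt (m, n)) = b m n" if "m \<in> carrier M" "n \<in> carrier N" for m n
    using f0(2)[OF that] .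
  have sub0: "(x \<oplus>\<^bsub>W\<^esub> y) \<ominus>\<^bsub>W\<^esub> x \<ominus>\<^bsub>W\<^esub> y = \<zero>\<^bsub>W\<^esub>" if "x \<in> carrier W" "y \<in> carrier W" for x y
  proof -
    have "(x \<oplus>\<^bsub>W\<^esub> y) \<ominus>\<^bsub>W\<^esub> x = y"
      using that W.a_comm[OF that] by (simp add: a_minus_def W.a_assoc W.r_neg)
    then show ?thesis using that by (simp add: a_minus_def W.r_neg)
  qed
  have c2: "x - y \<in> carrier ?F" if "x \<in> carrier ?F" "y \<in> carrier ?F" for x y
    using abelian_group.minus_closed[OF module.axioms(2)[OF free_module_module] that] free_minus[OF that(2)] by simp
  have ker: "f0 ` tensor_rel M N \<subseteq> {\<zero>\<^bsub>W\<^esub>}"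
    unfolding tensor_rel_eq
  proof (rule gen_submodule_map[OF free_module_module M(3) f0(1) zero_submodule[OF M(3)] tensor_gens_in_free[OF M(1,2)]])
    fix s assume "s \<in> tensor_gens M N"
    then have "f0 s = \<zero>\<^bsub>W\<^esub>"
    proof cases
      case (addl m m' n)
      then show ?thesis
        using lin_mapsD(2)[OF b(1)[OF addl(4)] addl(2,3)] cl by (simp add: mi si1 c c2 sub0)
    next
      case (addr m n n')
      then show ?thesis
        using lin_mapsD(2)[OF b(2)[OF addr(2)] addr(3,4)] cl by (simp add: mi si1 c c2 sub0)
    next
      case (smultl m n c)
      then show ?thesis
        using lin_mapsD(3)[OF b(1)[OF smultl(3)] smultl(2)] cl by (simp add: mi si c c2 a_minus_def W.r_neg W.smult_one[simplified])
    next
      case (smultr m n c)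
      then show ?thesis
        using lin_mapsD(3)[OF b(2)[OF smultr(2)] smultr(3)] cl by (simp add: mi si c c2 a_minus_def W.r_neg W.smult_one[simplified])
    qed
    then show "f0 s \<in> {\<zero>\<^bsub>W\<^esub>}" by simp
  qed
  then have ker': "f0 x = \<zero>\<^bsub>W\<^esub>" if "x \<in> tensor_rel M N" for x using that by blast
  have "\<exists>f\<in>lin_maps (tensor M N) W. \<forall>a\<in>carrier ?F. f (tensor_rel M N +>\<^bsub>?F\<^esub> a) = f0 a"
    unfolding tensor_def
    by (rule lift_quot[OF free_module_module tensor_rel_submodule[OF M(1,2)] M(3) f0(1) ker'])
  then obtain f where f: "f \<in> lin_maps (tensor M N) W"
    "\<forall>a\<in>carrier ?F. f (tensor_rel M N +>\<^bsub>?F\<^esub> a) = f0 a"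
    by (elim bexE)
  show ?thesis by (rule bexI[OF _ f(1)]) (use f(2) f0(2) c in \<open>simp add: pure_tensor_def\<close>)
qed

lemma pure_tensor_lin:
  assumes "module Rat M" "module Rat N"
  shows "n \<in> carrier N \<Longrightarrow> (\<lambda>m. pure_tensor M N m n) \<in> lin_maps M (tensor M N)"
    and "m \<in> carrier M \<Longrightarrow> (\<lambda>n. pure_tensor M N m n) \<in> lin_maps N (tensor M N)"
proof -
  let ?F = "free_module (carrier M \<times> carrier N)"
  interpret M: module Rat M by fact
  interpret N: module Rat N by fact
  interpret F: module Rat ?F by (rule free_module_module)
  note sub = tensor_rel_submodule[OF assms]
  note q = quot_map_lin[OF free_module_module sub, folded tensor_def]
  have c: "Poly_Mapping.single (m, n) c \<in> carrier ?F" if "m \<in> carrier M" "n \<in> carrier N" for m n c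
    using that by (simp add: basis_in_free)
  have ca: "x + y \<in> carrier ?F" if "x \<in> carrier ?F" "y \<in> carrier ?F" for x y
    using F.a_closed[OF that] by (simp add: free_module_simps(3))
  have eq: "tensor_rel M N +>\<^bsub>?F\<^esub> a = tensor_rel M N +>\<^bsub>?F\<^esub> b"
    if "a \<in> carrier ?F" "b \<in> carrier ?F" "a - b \<in> tensor_rel M N" for a b
    using that coset_eq[OF free_module_module sub] free_minus by metis
  have add: "tensor_rel M N +>\<^bsub>?F\<^esub> (a + b) = (tensor_rel M N +>\<^bsub>?F\<^esub> a) \<oplus>\<^bsub>tensor M N\<^esub> (tensor_rel M N +>\<^bsub>?F\<^esub> b)"
    if "a \<in> carrier ?F" "b \<in> carrier ?F" for a b
    using lin_mapsD(2)[OF q that] by (simp add: free_module_simps(3))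
  have scal: "tensor_rel M N +>\<^bsub>?F\<^esub> (Poly_Mapping.single x c) = c \<odot>\<^bsub>tensor M N\<^esub> (tensor_rel M N +>\<^bsub>?F\<^esub> (basis_elt x))"
    if "x \<in> carrier M \<times> carrier N" for x c
    using lin_mapsD(3)[OF q, of "basis_elt x" c] that by (simp add: free_module_simps(4) basis_in_free)
  show "(\<lambda>m. pure_tensor M N m n) \<in> lin_maps M (tensor M N)" if n: "n \<in> carrier N"
  proof (rule lin_mapsI)
    fix m m' assume m: "m \<in> carrier M" "m' \<in> carrier M"
    have "basis_elt (m \<oplus>\<^bsub>M\<^esub> m', n) - (basis_elt (m, n) + basis_elt (m', n)) \<in> tensor_rel M N"
      unfolding tensor_rel_eq diff_diff_eq[symmetric] by (rule gen_submodule_incl, rule tensor_gens.addl) (simp_all add: m n)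
    then show "pure_tensor M N (m \<oplus>\<^bsub>M\<^esub> m') n = pure_tensor M N m n \<oplus>\<^bsub>tensor M N\<^esub> pure_tensor M N m' n"
      unfolding pure_tensor_def using m n c by (simp add: add[symmetric] eq ca)
  next
    fix k m assume m: "m \<in> carrier M"
    have "basis_elt (k \<odot>\<^bsub>M\<^esub> m, n) - Poly_Mapping.single (m, n) k \<in> tensor_rel M N"
      unfolding tensor_rel_eq by (rule gen_submodule_incl, rule tensor_gens.smultl) (simp_all add: m n)
    then show "pure_tensor M N (k \<odot>\<^bsub>M\<^esub> m) n = k \<odot>\<^bsub>tensor M N\<^esub> pure_tensor M N m n"
      unfolding pure_tensor_def using m n c by (simp add: scal[symmetric] eq)
  qed (simp add: n pure_tensor_closed)
  show "(\<lambda>n. pure_tensor M N m n) \<in> lin_maps N (tensor M N)" if m: "m \<in> carrier M"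
  proof (rule lin_mapsI)
    fix n n' assume n: "n \<in> carrier N" "n' \<in> carrier N"
    have "basis_elt (m, n \<oplus>\<^bsub>N\<^esub> n') - (basis_elt (m, n) + basis_elt (m, n')) \<in> tensor_rel M N"
      unfolding tensor_rel_eq diff_diff_eq[symmetric] by (rule gen_submodule_incl, rule tensor_gens.addr) (simp_all add: m n)
    then show "pure_tensor M N m (n \<oplus>\<^bsub>N\<^esub> n') = pure_tensor M N m n \<oplus>\<^bsub>tensor M N\<^esub> pure_tensor M N m n'"
      unfolding pure_tensor_def using m n c by (simp add: add[symmetric] eq ca)
  next
    fix k n assume n: "n \<in> carrier N"
    have "basis_elt (m, k \<odot>\<^bsub>N\<^esub> n) - Poly_Mapping.single (m, n) k \<in> tensor_rel M N"
      unfolding tensor_rel_eq by (rule gen_submodule_incl, rule tensor_gens.smultr) (simp_all add: m n)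
    then show "pure_tensor M N m (k \<odot>\<^bsub>N\<^esub> n) = k \<odot>\<^bsub>tensor M N\<^esub> pure_tensor M N m n"
      unfolding pure_tensor_def using m n c by (simp add: scal[symmetric] eq)
  qed (simp add: m pure_tensor_closed)
qed

lemma tensor_map:
  fixes M :: "(rat, 'v) module" and N :: "(rat, 'w) module"
    and M' :: "(rat, 'v1) module" and N' :: "(rat, 'w1) module"
  assumes M: "module Rat M" "module Rat N" "module Rat M'" "module Rat N'"
    and f: "f \<in> lin_maps M M'" "g \<in> lin_maps N N'"
  shows "tensor_map M' N' f g \<in> lin_maps (tensor M N) (tensor M' N')"
    and "\<And>m n. m \<in> carrier M \<Longrightarrow> n \<in> carrier N \<Longrightarrow>
       tensor_map M' N' f g (pure_tensor M N m n) = pure_tensor M' N' (f m) (g n)"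
proof -
  let ?F = "free_module (carrier M \<times> carrier N)" and ?F' = "free_module (carrier M' \<times> carrier N')"
  let ?\<phi> = "lin_ext (\<lambda>(m, n). basis_elt (f m, g n))"
  note f' = lin_mapsD[OF f(1)] and g' = lin_mapsD[OF f(2)]
  note sub = tensor_rel_submodule[OF M(1,2)] and sub' = tensor_rel_submodule[OF M(3,4)]
  interpret Mm: module Rat M by fact
  interpret Nm: module Rat N by fact
  have lin: "?\<phi> \<in> lin_maps ?F ?F'"
    by (rule lin_ext_lin) (use f' g' in \<open>auto simp: basis_in_free\<close>)
  have im: "?\<phi> ` tensor_rel M N \<subseteq> tensor_rel M' N'"
    unfolding tensor_rel_eq[of M N]
  proof (rule gen_submodule_map[OF free_module_module free_module_module lin sub' tensor_gens_in_free[OF M(1,2)]])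
    fix s assume "s \<in> tensor_gens M N"
    then have "?\<phi> s \<in> tensor_gens M' N'"
      by cases (simp_all add: lin_ext_diff f' g' tensor_gens.intros)
    then show "?\<phi> s \<in> tensor_rel M' N'"
      unfolding tensor_rel_eq by (rule gen_submodule_incl)
  qed
  show "tensor_map M' N' f g \<in> lin_maps (tensor M N) (tensor M' N')"
    unfolding tensor_map_def tensor_def
    by (rule induced_lin[OF free_module_module sub free_module_module sub' lin im])
  show "tensor_map M' N' f g (pure_tensor M N m n) = pure_tensor M' N' (f m) (g n)"
    if "m \<in> carrier M" "n \<in> carrier N" for m n
    unfolding tensor_map_def pure_tensor_def
    using induced_coset[OF free_module_module sub free_module_module sub' lin im, of "basis_elt (m, n)"] that
    by (simp add: basis_in_free)
qed

section \<open>Sheaves on posets and their cohomology\<close>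

lemma is_sheafD:
  assumes "is_sheaf P F"
  shows "\<And>x. x \<in> carrier P \<Longrightarrow> module Rat (stalk F x)"
    and "\<And>x y. x \<in> carrier P \<Longrightarrow> y \<in> carrier P \<Longrightarrow> x \<sqsubseteq>\<^bsub>P\<^esub> y \<Longrightarrow>
      res F y x \<in> lin_maps (stalk F y) (stalk F x)"
    and "\<And>x v. x \<in> carrier P \<Longrightarrow> v \<in> carrier (stalk F x) \<Longrightarrow> res F x x v = v"
    and "\<And>x y z v. x \<in> carrier P \<Longrightarrow> y \<in> carrier P \<Longrightarrow> z \<in> carrier P \<Longrightarrow> x \<sqsubseteq>\<^bsub>P\<^esub> y \<Longrightarrow> y \<sqsubseteq>\<^bsub>P\<^esub> z \<Longrightarrow>
      v \<in> carrier (stalk F z) \<Longrightarrow> res F y x (res F z y v) = res F z x v"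
  using assms by (simp_all add: is_sheaf_def)

lemma is_sheafI:
  assumes "\<And>x. x \<in> carrier P \<Longrightarrow> module Rat (stalk F x)"
    and "\<And>x y. x \<in> carrier P \<Longrightarrow> y \<in> carrier P \<Longrightarrow> x \<sqsubseteq>\<^bsub>P\<^esub> y \<Longrightarrow>
      res F y x \<in> lin_maps (stalk F y) (stalk F x)"
    and "\<And>x v. x \<in> carrier P \<Longrightarrow> v \<in> carrier (stalk F x) \<Longrightarrow> res F x x v = v"
    and "\<And>x y z v. x \<in> carrier P \<Longrightarrow> y \<in> carrier P \<Longrightarrow> z \<in> carrier P \<Longrightarrow> x \<sqsubseteq>\<^bsub>P\<^esub> y \<Longrightarrow> y \<sqsubseteq>\<^bsub>P\<^esub> z \<Longrightarrow>
      v \<in> carrier (stalk F z) \<Longrightarrow> res F y x (res F z y v) = res F z x v"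
  shows "is_sheaf P F"
  using assms by (simp add: is_sheaf_def)

lemma sheaf_homD:
  assumes "sheaf_hom P F G \<phi>"
  shows "\<And>x. x \<in> carrier P \<Longrightarrow> \<phi> x \<in> lin_maps (stalk F x) (stalk G x)"
    and "\<And>x y v. x \<in> carrier P \<Longrightarrow> y \<in> carrier P \<Longrightarrow> x \<sqsubseteq>\<^bsub>P\<^esub> y \<Longrightarrow> v \<in> carrier (stalk F y) \<Longrightarrow>
      \<phi> x (res F y x v) = res G y x (\<phi> y v)"
    and "\<And>x v. x \<in> carrier P \<Longrightarrow> v \<in> carrier (stalk F x) \<Longrightarrow> \<phi> x v \<in> carrier (stalk G x)"
  using assms by (simp_all add: sheaf_hom_def lin_maps_iff)

lemma sheaf_homI:
  assumes "\<And>x. x \<in> carrier P \<Longrightarrow> \<phi> x \<in> lin_maps (stalk F x) (stalk G x)"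
    and "\<And>x y v. x \<in> carrier P \<Longrightarrow> y \<in> carrier P \<Longrightarrow> x \<sqsubseteq>\<^bsub>P\<^esub> y \<Longrightarrow> v \<in> carrier (stalk F y) \<Longrightarrow>
      \<phi> x (res F y x v) = res G y x (\<phi> y v)"
  shows "sheaf_hom P F G \<phi>"
  using assms by (simp add: sheaf_hom_def)

lemma sheaf_hom_id: "sheaf_hom P F F (\<lambda>x v. v)"
  by (rule sheaf_homI) (simp_all add: lin_maps_id)

lemma sheaf_hom_comp:
  assumes "sheaf_hom P F G \<phi>" "sheaf_hom P G H \<psi>"
  shows "sheaf_hom P F H (\<lambda>x v. \<psi> x (\<phi> x v))"
  by (rule sheaf_homI)
    (simp_all add: lin_maps_comp[OF sheaf_homD(1)[OF assms(1)] sheaf_homD(1)[OF assms(2)]]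
      sheaf_homD(2)[OF assms(1)] sheaf_homD(2)[OF assms(2)] sheaf_homD(3)[OF assms(1)])

lemma sheaf_hom_diff:
  assumes "is_sheaf P F" "is_sheaf P G" "sheaf_hom P F G \<phi>" "sheaf_hom P F G \<psi>"
  shows "sheaf_hom P F G (\<lambda>x v. \<phi> x v \<ominus>\<^bsub>stalk G x\<^esub> \<psi> x v)"
proof (rule sheaf_homI)
  fix x assume x: "x \<in> carrier P"
  show "(\<lambda>v. \<phi> x v \<ominus>\<^bsub>stalk G x\<^esub> \<psi> x v) \<in> lin_maps (stalk F x) (stalk G x)"
    by (rule lin_maps_diff) (simp_all add: x sheaf_homD(1)[OF assms(3)] sheaf_homD(1)[OF assms(4)]
        is_sheafD(1)[OF assms(1)] is_sheafD(1)[OF assms(2)])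
next
  fix x y v assume *: "x \<in> carrier P" "y \<in> carrier P" "x \<sqsubseteq>\<^bsub>P\<^esub> y" "v \<in> carrier (stalk F y)"
  then show "\<phi> x (res F y x v) \<ominus>\<^bsub>stalk G x\<^esub> \<psi> x (res F y x v) = res G y x (\<phi> y v \<ominus>\<^bsub>stalk G y\<^esub> \<psi> y v)"
    by (simp add: lin_maps_minus[OF is_sheafD(2)[OF assms(2)]] is_sheafD(1)[OF assms(2)]
        sheaf_homD[OF assms(3)] sheaf_homD[OF assms(4)])
qed

lemma sheaf_hom_zero_ker:
  assumes "is_sheaf P F" "is_sheaf P G" "sheaf_hom P F G \<phi>" "x \<in> carrier P"
  shows "\<phi> x \<zero>\<^bsub>stalk F x\<^esub> = \<zero>\<^bsub>stalk G x\<^esub>"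
  by (rule lin_maps_zero[OF sheaf_homD(1)[OF assms(3,4)] is_sheafD(1)[OF assms(1,4)] is_sheafD(1)[OF assms(2,4)]])

text \<open>\<open>injective_sheaf\<close> only speaks about sheaves with values in one type, and
  \<open>A\<close> may have another. So the extension starts from the image of \<open>d\<close>,
  which is a subsheaf of \<open>B\<close>; the kernel condition makes \<open>g\<close> descend to
  that image.\<close>

lemma injective_extend:
  fixes A :: "('p, 'a) sheaf" and B J :: "('p, 'u) sheaf"
  assumes A: "is_sheaf P A" and B: "is_sheaf P B" and J: "injective_sheaf P J"
    and d: "sheaf_hom P A B d" and g: "sheaf_hom P A J g"
    and ker: "\<And>x a. x \<in> carrier P \<Longrightarrow> a \<in> carrier (stalk A x) \<Longrightarrow> d x a = \<zero>\<^bsub>stalk B x\<^esub> \<Longrightarrow>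
      g x a = \<zero>\<^bsub>stalk J x\<^esub>"
  shows "\<exists>h. sheaf_hom P B J h \<and> (\<forall>x\<in>carrier P. \<forall>a\<in>carrier (stalk A x). h x (d x a) = g x a)"
proof -
  have J': "is_sheaf P J" using J by (simp add: injective_sheaf_def)
  note mA = is_sheafD(1)[OF A] and mB = is_sheafD(1)[OF B] and mJ = is_sheafD(1)[OF J']
  note dl = sheaf_homD(1)[OF d] and gl = sheaf_homD(1)[OF g]
  define C where "C = \<lparr>stalk = (\<lambda>x. (stalk B x)\<lparr>carrier := d x ` carrier (stalk A x)\<rparr>), res = res B\<rparr>"
  have stC: "stalk C x = (stalk B x)\<lparr>carrier := d x ` carrier (stalk A x)\<rparr>" "res C = res B" for x
    by (simp_all add: C_def)
  have sub: "d x a \<in> carrier (stalk B x)" if "x \<in> carrier P" "a \<in> carrier (stalk A x)" for x a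
    using sheaf_homD(3)[OF d that] .
  have C: "is_sheaf P C"
  proof (rule is_sheafI)
    fix x assume x: "x \<in> carrier P"
    show "module Rat (stalk C x)" unfolding stC
      by (rule submodule_module[OF mB[OF x]], rule image_submodule[OF mA[OF x] mB[OF x] dl[OF x] carrier_submodule[OF mA[OF x]]])
  next
    fix x y assume xy: "x \<in> carrier P" "y \<in> carrier P" "x \<sqsubseteq>\<^bsub>P\<^esub> y"
    have "res B y x (d y a) \<in> d x ` carrier (stalk A x)" if "a \<in> carrier (stalk A y)" for a
      using sheaf_homD(2)[OF d xy that] lin_mapsD(1)[OF is_sheafD(2)[OF A xy] that] by (metis imageI)
    then show "res C y x \<in> lin_maps (stalk C y) (stalk C x)"
      using lin_mapsD[OF is_sheafD(2)[OF B xy]] sub xy by (auto simp: lin_maps_iff stC)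
  qed (auto simp: stC sub is_sheafD(3,4)[OF B])
  have inc: "sheaf_hom P C B (\<lambda>x v. v)"
    by (rule sheaf_homI) (auto simp: lin_maps_iff stC sub)
  have "\<forall>x\<in>carrier P. \<exists>h. h \<in> lin_maps (stalk B x) (stalk J x) \<and> (\<forall>a\<in>carrier (stalk A x). h (d x a) = g x a)"
  proof
    fix x assume x: "x \<in> carrier P"
    show "\<exists>h. h \<in> lin_maps (stalk B x) (stalk J x) \<and> (\<forall>a\<in>carrier (stalk A x). h (d x a) = g x a)"
      by (rule linear_factor[OF mA[OF x] mB[OF x] mJ[OF x] dl[OF x] gl[OF x], unfolded Bex_def]) (rule ker[OF x])
  qed
  then obtain f where f': "\<forall>x\<in>carrier P. f x \<in> lin_maps (stalk B x) (stalk J x) \<and> (\<forall>a\<in>carrier (stalk A x). f x (d x a) = g x a)"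
    by (rule bchoice[THEN exE])
  note fl = f'[rule_format, THEN conjunct1] and f = f'[rule_format, THEN conjunct2, rule_format]
  \<comment> \<open>The maps \<open>f x\<close> were chosen on each stalk separately. On the image
    of \<open>d\<close> they have no freedom left, being determined by \<open>g\<close>, and this
    gives compatibility with restriction.\<close>
  have fh: "sheaf_hom P C J f"
  proof (rule sheaf_homI)
    show "f x \<in> lin_maps (stalk C x) (stalk J x)" if x: "x \<in> carrier P" for x
      using lin_mapsD[OF fl[OF x]] sub[OF x] by (auto simp: lin_maps_iff stC)
  next
    fix x y v assume xy: "x \<in> carrier P" "y \<in> carrier P" "x \<sqsubseteq>\<^bsub>P\<^esub> y" "v \<in> carrier (stalk C y)"
    then obtain a where a: "a \<in> carrier (stalk A y)" "v = d y a" by (auto simp: stC)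
    have r: "res A y x a \<in> carrier (stalk A x)" using lin_mapsD(1)[OF is_sheafD(2)[OF A xy(1-3)] a(1)] .
    have "res C y x v = d x (res A y x a)" using sheaf_homD(2)[OF d xy(1-3) a(1)] a by (simp add: stC)
    then show "f x (res C y x v) = res J y x (f y v)"
      using f[OF xy(1) r] f[OF xy(2) a(1)] sheaf_homD(2)[OF g xy(1-3) a(1)] a(2) by simp
  qed
  have "\<forall>x\<in>carrier P. inj_on (\<lambda>v. v) (carrier (stalk C x))" by simp
  then obtain h where "sheaf_hom P B J h" "\<forall>x\<in>carrier P. \<forall>b\<in>carrier (stalk C x). h x b = f x b"
    using J C B inc fh unfolding injective_sheaf_def by blast
  then show ?thesis using f by (intro exI[of _ h]) (simp add: stC)
qed

section \<open>Comparison of injective resolutions\<close>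

lemma resolutionD:
  assumes "resolution P F \<eta> J d \<infinity>"
  shows "is_sheaf P F" "\<And>n. is_sheaf P (J n)" "sheaf_hom P F (J 0) \<eta>"
    and "\<And>n. sheaf_hom P (J n) (J (Suc n)) (d n)"
    and "\<And>x. x \<in> carrier P \<Longrightarrow> inj_on (\<eta> x) (carrier (stalk F x))"
    and "\<And>x. x \<in> carrier P \<Longrightarrow> \<eta> x ` carrier (stalk F x) = {v \<in> carrier (stalk (J 0) x). d 0 x v = \<zero>\<^bsub>stalk (J (Suc 0)) x\<^esub>}"
    and "\<And>x n. x \<in> carrier P \<Longrightarrow> d n x ` carrier (stalk (J n) x) =
      {v \<in> carrier (stalk (J (Suc n)) x). d (Suc n) x v = \<zero>\<^bsub>stalk (J (Suc (Suc n))) x\<^esub>}"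
  using assms by (auto simp: resolution_def Let_def)

lemma resolution_infinityI:
  assumes "is_sheaf P F" "\<And>n. is_sheaf P (J n)" "sheaf_hom P F (J 0) \<eta>"
    and "\<And>n. sheaf_hom P (J n) (J (Suc n)) (d n)"
    and "\<And>x. x \<in> carrier P \<Longrightarrow> inj_on (\<eta> x) (carrier (stalk F x))"
    and "\<And>x. x \<in> carrier P \<Longrightarrow> \<eta> x ` carrier (stalk F x) = {v \<in> carrier (stalk (J 0) x). d 0 x v = \<zero>\<^bsub>stalk (J (Suc 0)) x\<^esub>}"
    and "\<And>x n. x \<in> carrier P \<Longrightarrow> d n x ` carrier (stalk (J n) x) =
      {v \<in> carrier (stalk (J (Suc n)) x). d (Suc n) x v = \<zero>\<^bsub>stalk (J (Suc (Suc n))) x\<^esub>}"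
  shows "resolution P F \<eta> J d \<infinity>"
  using assms by (simp add: resolution_def Let_def)

lemma resolution_dd:
  assumes "resolution P F \<eta> J d \<infinity>" "x \<in> carrier P"
  shows "\<And>v. v \<in> carrier (stalk F x) \<Longrightarrow> d 0 x (\<eta> x v) = \<zero>\<^bsub>stalk (J (Suc 0)) x\<^esub>"
    and "\<And>v n. v \<in> carrier (stalk (J n) x) \<Longrightarrow> d (Suc n) x (d n x v) = \<zero>\<^bsub>stalk (J (Suc (Suc n))) x\<^esub>"
  using resolutionD(6,7)[OF assms(1,2)] by blast+

text \<open>Each step extends along \<open>d n\<close> by injectivity. For the next extension the
  composite of \<open>e n\<close> with the current map must vanish on the kernel of
  \<open>d n\<close>; that is the invariant \<open>Q\<close>, and it holds because cocycles are
  coboundaries by exactness.\<close>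

lemma lift_resolution:
  fixes F :: "('p, 'v) sheaf" and A :: "nat \<Rightarrow> ('p, 'u) sheaf" and J :: "nat \<Rightarrow> ('p, 'u) sheaf"
  assumes R: "resolution P F \<eta> A d \<infinity>" and S: "resolution P F \<epsilon> J e \<infinity>"
    and inj: "\<And>n. injective_sheaf P (J n)"
  shows "\<exists>\<psi>. (\<forall>n. sheaf_hom P (A n) (J n) (\<psi> n))
    \<and> (\<forall>x\<in>carrier P. \<forall>v\<in>carrier (stalk F x). \<psi> 0 x (\<eta> x v) = \<epsilon> x v)
    \<and> (\<forall>n. \<forall>x\<in>carrier P. \<forall>v\<in>carrier (stalk (A n) x). \<psi> (Suc n) x (d n x v) = e n x (\<psi> n x v))"
proof -
  note RD = resolutionD[OF R] and SD = resolutionD[OF S]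
  define Q where "Q n \<psi> \<longleftrightarrow> sheaf_hom P (A n) (J n) \<psi>
    \<and> (\<forall>x\<in>carrier P. \<forall>v\<in>carrier (stalk (A n) x). d n x v = \<zero>\<^bsub>stalk (A (Suc n)) x\<^esub> \<longrightarrow>
        e n x (\<psi> x v) = \<zero>\<^bsub>stalk (J (Suc n)) x\<^esub>)
    \<and> (n = 0 \<longrightarrow> (\<forall>x\<in>carrier P. \<forall>v\<in>carrier (stalk F x). \<psi> x (\<eta> x v) = \<epsilon> x v))" for n \<psi>
  have "\<exists>f. \<forall>n. Q n (f n) \<and> (\<forall>x\<in>carrier P. \<forall>v\<in>carrier (stalk (A n) x). f (Suc n) x (d n x v) = e n x (f n x v))"
  proof (rule dependent_nat_choice)
    have "\<exists>h. sheaf_hom P (A 0) (J 0) h \<and> (\<forall>x\<in>carrier P. \<forall>a\<in>carrier (stalk F x). h x (\<eta> x a) = \<epsilon> x a)"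
    proof (rule injective_extend[OF RD(1) RD(2) inj RD(3) SD(3)])
      fix x a assume x: "x \<in> carrier P" "a \<in> carrier (stalk F x)" "\<eta> x a = \<zero>\<^bsub>stalk (A 0) x\<^esub>"
      have z: "\<zero>\<^bsub>stalk F x\<^esub> \<in> carrier (stalk F x)"
        using is_sheafD(1)[OF RD(1) x(1)] by (metis carrier_submodule submoduleD(2))
      have "a = \<zero>\<^bsub>stalk F x\<^esub>"
        using inj_onD[OF RD(5)[OF x(1)] _ x(2) z] x(3) sheaf_hom_zero_ker[OF RD(1) RD(2) RD(3) x(1)] by simp
      then show "\<epsilon> x a = \<zero>\<^bsub>stalk (J 0) x\<^esub>" using sheaf_hom_zero_ker[OF SD(1) SD(2) SD(3) x(1)] by simp
    qed
    then obtain h where h: "sheaf_hom P (A 0) (J 0) h" "\<forall>x\<in>carrier P. \<forall>a\<in>carrier (stalk F x). h x (\<eta> x a) = \<epsilon> x a"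
      by blast
    have "e 0 x (h x v) = \<zero>\<^bsub>stalk (J (Suc 0)) x\<^esub>"
      if x: "x \<in> carrier P" "v \<in> carrier (stalk (A 0) x)" "d 0 x v = \<zero>\<^bsub>stalk (A (Suc 0)) x\<^esub>" for x v
    proof -
      have "v \<in> \<eta> x ` carrier (stalk F x)" using RD(6)[OF x(1)] x by simp
      then obtain a where "a \<in> carrier (stalk F x)" "v = \<eta> x a" by blast
      then show ?thesis using h(2) resolution_dd(1)[OF S x(1)] x by simp
    qed
    then have "Q 0 h" using h by (simp add: Q_def)
    then show "\<exists>h. Q 0 h" by blast
  next
    fix f n assume "Q n f"
    then have fh: "sheaf_hom P (A n) (J n) f"
      and fk: "\<And>x v. x \<in> carrier P \<Longrightarrow> v \<in> carrier (stalk (A n) x) \<Longrightarrow> d n x v = \<zero>\<^bsub>stalk (A (Suc n)) x\<^esub> \<Longrightarrow>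
        e n x (f x v) = \<zero>\<^bsub>stalk (J (Suc n)) x\<^esub>" by (simp_all add: Q_def)
    have "\<exists>h. sheaf_hom P (A (Suc n)) (J (Suc n)) h \<and>
      (\<forall>x\<in>carrier P. \<forall>a\<in>carrier (stalk (A n) x). h x (d n x a) = e n x (f x a))"
      by (rule injective_extend[OF RD(2) RD(2) inj RD(4) sheaf_hom_comp[OF fh SD(4)]]) (rule fk)
    then obtain h where h: "sheaf_hom P (A (Suc n)) (J (Suc n)) h"
      "\<forall>x\<in>carrier P. \<forall>a\<in>carrier (stalk (A n) x). h x (d n x a) = e n x (f x a)" by blast
    have "e (Suc n) x (h x v) = \<zero>\<^bsub>stalk (J (Suc (Suc n))) x\<^esub>"
      if x: "x \<in> carrier P" "v \<in> carrier (stalk (A (Suc n)) x)" "d (Suc n) x v = \<zero>\<^bsub>stalk (A (Suc (Suc n))) x\<^esub>" for x v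
    proof -
      have "v \<in> d n x ` carrier (stalk (A n) x)" using RD(7)[OF x(1)] x by simp
      then obtain a where a: "a \<in> carrier (stalk (A n) x)" "v = d n x a" by blast
      then show ?thesis using h(2) resolution_dd(2)[OF S x(1) sheaf_homD(3)[OF fh x(1) a(1)]] x by simp
    qed
    then have "Q (Suc n) h" using h by (simp add: Q_def)
    then show "\<exists>g. Q (Suc n) g \<and> (\<forall>x\<in>carrier P. \<forall>v\<in>carrier (stalk (A n) x). g x (d n x v) = e n x (f x v))"
      using h(2) by blast
  qed
  then obtain f where "\<forall>n. Q n (f n) \<and> (\<forall>x\<in>carrier P. \<forall>v\<in>carrier (stalk (A n) x). f (Suc n) x (d n x v) = e n x (f n x v))" ..
  then show ?thesis by (intro exI[of _ f]) (simp add: Q_def)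
qed

text \<open>\<open>h (Suc n)\<close> extends, along \<open>d (Suc n)\<close>, the difference of
  \<open>\<omega> (Suc n)\<close> and \<open>d n\<close> after \<open>h n\<close>. That difference
  vanishes on cocycles: they are coboundaries, where the equation of the previous degree applies.
  \<open>Q\<close> keeps this as the invariant.\<close>

lemma null_homotopy:
  fixes F :: "('p, 'v) sheaf" and J :: "nat \<Rightarrow> ('p, 'u) sheaf"
  assumes R: "resolution P F \<eta> J d \<infinity>" and inj: "\<And>n. injective_sheaf P (J n)"
    and \<omega>: "\<And>n. sheaf_hom P (J n) (J n) (\<omega> n)"
    and \<omega>0: "\<And>x v. x \<in> carrier P \<Longrightarrow> v \<in> carrier (stalk F x) \<Longrightarrow> \<omega> 0 x (\<eta> x v) = \<zero>\<^bsub>stalk (J 0) x\<^esub>"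
    and \<omega>S: "\<And>n x v. x \<in> carrier P \<Longrightarrow> v \<in> carrier (stalk (J n) x) \<Longrightarrow> \<omega> (Suc n) x (d n x v) = d n x (\<omega> n x v)"
  shows "\<exists>h. (\<forall>n. sheaf_hom P (J (Suc n)) (J n) (h n))
    \<and> (\<forall>n. \<forall>x\<in>carrier P. \<forall>v\<in>carrier (stalk (J (Suc n)) x).
         h (Suc n) x (d (Suc n) x v) = \<omega> (Suc n) x v \<ominus>\<^bsub>stalk (J (Suc n)) x\<^esub> d n x (h n x v))"
proof -
  note RD = resolutionD[OF R]
  note m = is_sheafD(1)[OF RD(2)]
  define Q where "Q n h \<longleftrightarrow> sheaf_hom P (J (Suc n)) (J n) h
    \<and> (\<forall>x\<in>carrier P. \<forall>v\<in>carrier (stalk (J (Suc n)) x). d (Suc n) x v = \<zero>\<^bsub>stalk (J (Suc (Suc n))) x\<^esub> \<longrightarrow>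
        \<omega> (Suc n) x v = d n x (h x v))" for n h
  have "\<exists>f. \<forall>n. Q n (f n) \<and> (\<forall>x\<in>carrier P. \<forall>v\<in>carrier (stalk (J (Suc n)) x).
      f (Suc n) x (d (Suc n) x v) = \<omega> (Suc n) x v \<ominus>\<^bsub>stalk (J (Suc n)) x\<^esub> d n x (f n x v))"
  proof (rule dependent_nat_choice)
    have "\<exists>h. sheaf_hom P (J (Suc 0)) (J 0) h \<and> (\<forall>x\<in>carrier P. \<forall>a\<in>carrier (stalk (J 0) x). h x (d 0 x a) = \<omega> 0 x a)"
    proof (rule injective_extend[OF RD(2) RD(2) inj RD(4) \<omega>])
      fix x a assume x: "x \<in> carrier P" "a \<in> carrier (stalk (J 0) x)" "d 0 x a = \<zero>\<^bsub>stalk (J (Suc 0)) x\<^esub>"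
      then have "a \<in> \<eta> x ` carrier (stalk F x)" using RD(6)[OF x(1)] by simp
      then show "\<omega> 0 x a = \<zero>\<^bsub>stalk (J 0) x\<^esub>" using \<omega>0[OF x(1)] by auto
    qed
    then obtain h where h: "sheaf_hom P (J (Suc 0)) (J 0) h"
      "\<forall>x\<in>carrier P. \<forall>a\<in>carrier (stalk (J 0) x). h x (d 0 x a) = \<omega> 0 x a" by blast
    have "\<omega> (Suc 0) x v = d 0 x (h x v)"
      if x: "x \<in> carrier P" "v \<in> carrier (stalk (J (Suc 0)) x)" "d (Suc 0) x v = \<zero>\<^bsub>stalk (J (Suc (Suc 0))) x\<^esub>" for x v
    proof -
      have "v \<in> d 0 x ` carrier (stalk (J 0) x)" using RD(7)[OF x(1)] x by simp
      then obtain a where "a \<in> carrier (stalk (J 0) x)" "v = d 0 x a" by blast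
      then show ?thesis using h(2) x(1) \<omega>S by simp
    qed
    then have "Q 0 h" using h by (simp add: Q_def)
    then show "\<exists>h. Q 0 h" by blast
  next
    fix f n assume "Q n f"
    then have fh: "sheaf_hom P (J (Suc n)) (J n) f"
      and fk: "\<And>x v. x \<in> carrier P \<Longrightarrow> v \<in> carrier (stalk (J (Suc n)) x) \<Longrightarrow> d (Suc n) x v = \<zero>\<^bsub>stalk (J (Suc (Suc n))) x\<^esub> \<Longrightarrow>
        \<omega> (Suc n) x v = d n x (f x v)" by (simp_all add: Q_def)
    note dfh = sheaf_hom_comp[OF fh RD(4)]
    have "\<exists>h. sheaf_hom P (J (Suc (Suc n))) (J (Suc n)) h \<and>
      (\<forall>x\<in>carrier P. \<forall>a\<in>carrier (stalk (J (Suc n)) x). h x (d (Suc n) x a) = \<omega> (Suc n) x a \<ominus>\<^bsub>stalk (J (Suc n)) x\<^esub> d n x (f x a))"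
    proof (rule injective_extend[OF RD(2) RD(2) inj RD(4) sheaf_hom_diff[OF RD(2) RD(2) \<omega> dfh]])
      fix x v assume x: "x \<in> carrier P" "v \<in> carrier (stalk (J (Suc n)) x)" "d (Suc n) x v = \<zero>\<^bsub>stalk (J (Suc (Suc n))) x\<^esub>"
      show "\<omega> (Suc n) x v \<ominus>\<^bsub>stalk (J (Suc n)) x\<^esub> d n x (f x v) = \<zero>\<^bsub>stalk (J (Suc n)) x\<^esub>"
        unfolding fk[OF x] by (rule minus_self[OF m[OF x(1)] sheaf_homD(3)[OF dfh x(1,2)]])
    qed
    then obtain h where h: "sheaf_hom P (J (Suc (Suc n))) (J (Suc n)) h"
      "\<forall>x\<in>carrier P. \<forall>a\<in>carrier (stalk (J (Suc n)) x). h x (d (Suc n) x a) = \<omega> (Suc n) x a \<ominus>\<^bsub>stalk (J (Suc n)) x\<^esub> d n x (f x a)"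
      by blast
    let ?J = "\<lambda>x. stalk (J (Suc (Suc n))) x"
    have "\<omega> (Suc (Suc n)) x v = d (Suc n) x (h x v)"
      if x: "x \<in> carrier P" "v \<in> carrier (?J x)" "d (Suc (Suc n)) x v = \<zero>\<^bsub>stalk (J (Suc (Suc (Suc n)))) x\<^esub>" for x v
    proof -
      interpret J2: module Rat "?J x" by (rule m[OF x(1)])
      have "v \<in> d (Suc n) x ` carrier (stalk (J (Suc n)) x)" using RD(7)[OF x(1)] x by simp
      then obtain a where a: "a \<in> carrier (stalk (J (Suc n)) x)" "v = d (Suc n) x a" by blast
      note w = sheaf_homD(3)[OF \<omega> x(1) a(1)] and fa = sheaf_homD(3)[OF fh x(1) a(1)]
      have "d (Suc n) x (h x v) = d (Suc n) x (\<omega> (Suc n) x a) \<ominus>\<^bsub>?J x\<^esub> d (Suc n) x (d n x (f x a))"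
        using h(2) a x(1) lin_maps_minus[OF sheaf_homD(1)[OF RD(4) x(1)] m[OF x(1)] m[OF x(1)] w sheaf_homD(3)[OF dfh x(1) a(1)]] by simp
      also have "\<dots> = d (Suc n) x (\<omega> (Suc n) x a)"
        using sheaf_homD(3)[OF RD(4) x(1) w] unfolding resolution_dd(2)[OF R x(1) fa] by (simp add: a_minus_def)
      finally show ?thesis using \<omega>S[OF x(1) a(1)] a(2) by simp
    qed
    then have "Q (Suc n) h" using h by (simp add: Q_def)
    then show "\<exists>g. Q (Suc n) g \<and> (\<forall>x\<in>carrier P. \<forall>v\<in>carrier (stalk (J (Suc n)) x).
       g x (d (Suc n) x v) = \<omega> (Suc n) x v \<ominus>\<^bsub>stalk (J (Suc n)) x\<^esub> d n x (f x v))"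
      using h(2) by blast
  qed
  then obtain f where "\<forall>n. Q n (f n) \<and> (\<forall>x\<in>carrier P. \<forall>v\<in>carrier (stalk (J (Suc n)) x).
      f (Suc n) x (d (Suc n) x v) = \<omega> (Suc n) x v \<ominus>\<^bsub>stalk (J (Suc n)) x\<^esub> d n x (f n x v))" ..
  then show ?thesis by (intro exI[of _ f]) (simp add: Q_def)
qed

section \<open>Global sections and a criterion for acyclicity\<close>

lemma sectionsD:
  assumes "s \<in> carrier (sections P F)"
  shows "\<And>x. x \<in> carrier P \<Longrightarrow> s x \<in> carrier (stalk F x)"
    and "\<And>x y. x \<in> carrier P \<Longrightarrow> y \<in> carrier P \<Longrightarrow> x \<sqsubseteq>\<^bsub>P\<^esub> y \<Longrightarrow> res F y x (s y) = s x"
    and "\<And>x. x \<notin> carrier P \<Longrightarrow> s x = undefined"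
  using assms by (auto simp: sections_def PiE_def extensional_def)

lemma sectionsI:
  assumes "\<And>x. x \<in> carrier P \<Longrightarrow> s x \<in> carrier (stalk F x)"
    and "\<And>x y. x \<in> carrier P \<Longrightarrow> y \<in> carrier P \<Longrightarrow> x \<sqsubseteq>\<^bsub>P\<^esub> y \<Longrightarrow> res F y x (s y) = s x"
  shows "(\<lambda>x\<in>carrier P. s x) \<in> carrier (sections P F)"
  using assms by (simp add: sections_def)

lemma sections_simps:
  "\<zero>\<^bsub>sections P F\<^esub> = (\<lambda>x\<in>carrier P. \<zero>\<^bsub>stalk F x\<^esub>)"
  "s \<oplus>\<^bsub>sections P F\<^esub> t = (\<lambda>x\<in>carrier P. s x \<oplus>\<^bsub>stalk F x\<^esub> t x)"
  "c \<odot>\<^bsub>sections P F\<^esub> s = (\<lambda>x\<in>carrier P. c \<odot>\<^bsub>stalk F x\<^esub> s x)"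
  by (simp_all add: sections_def)

lemma sections_module:
  assumes F: "is_sheaf P F"
  shows "module Rat (sections P F)"
proof -
  let ?S = "carrier (sections P F)"
  note m = is_sheafD(1)[OF F] and r = is_sheafD(2)[OF F]
  note cl = submoduleD[OF m carrier_submodule[OF m]]
  have M: "module Rat (pi_module (carrier P) (stalk F))" by (rule pi_module_module) (rule m)
  have "submodule ?S Rat (pi_module (carrier P) (stalk F))"
  proof (rule rat_submoduleI[OF M]; (unfold pi_module_simps)?)
    show "?S \<subseteq> (\<Pi>\<^sub>E x\<in>carrier P. carrier (stalk F x))" by (auto simp: sections_def)
    show "(\<lambda>x\<in>carrier P. \<zero>\<^bsub>stalk F x\<^esub>) \<in> ?S"
      by (rule sectionsI) (simp_all add: cl(2) lin_maps_zero[OF r m m])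
    fix s assume s: "s \<in> ?S"
    show "(\<lambda>x\<in>carrier P. c \<odot>\<^bsub>stalk F x\<^esub> s x) \<in> ?S" for c
      by (rule sectionsI) (simp_all add: sectionsD[OF s] cl(5) lin_mapsD(3)[OF r])
    fix t assume t: "t \<in> ?S"
    show "(\<lambda>x\<in>carrier P. s x \<oplus>\<^bsub>stalk F x\<^esub> t x) \<in> ?S"
      by (rule sectionsI) (simp_all add: sectionsD[OF s] sectionsD[OF t] cl(3) lin_mapsD(2)[OF r])
  qed
  then show ?thesis
    by (rule module_cong[OF submodule_module[OF M]]) (simp_all add: sections_simps pi_module_simps)
qed

lemma sections_map_lin:
  assumes F: "is_sheaf P F" and G: "is_sheaf P G" and \<phi>: "sheaf_hom P F G \<phi>"
  shows "sections_map P \<phi> \<in> lin_maps (sections P F) (sections P G)"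
proof (rule lin_mapsI)
  fix s assume s: "s \<in> carrier (sections P F)"
  show "sections_map P \<phi> s \<in> carrier (sections P G)" unfolding sections_map_def
    by (rule sectionsI)
      (simp_all add: sheaf_homD(3)[OF \<phi>] sectionsD[OF s] sheaf_homD(2)[OF \<phi>, symmetric])
  show "sections_map P \<phi> (c \<odot>\<^bsub>sections P F\<^esub> s) = c \<odot>\<^bsub>sections P G\<^esub> sections_map P \<phi> s" for c
    by (rule ext) (simp add: sections_map_def sections_def lin_mapsD(3)[OF sheaf_homD(1)[OF \<phi>]] sectionsD[OF s])
  fix t assume t: "t \<in> carrier (sections P F)"
  show "sections_map P \<phi> (s \<oplus>\<^bsub>sections P F\<^esub> t) = sections_map P \<phi> s \<oplus>\<^bsub>sections P G\<^esub> sections_map P \<phi> t"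
    by (rule ext) (simp add: sections_map_def sections_def lin_mapsD(2)[OF sheaf_homD(1)[OF \<phi>]] sectionsD[OF s] sectionsD[OF t])
qed

lemma quot_self:
  assumes "module Rat M" "B = carrier M"
  shows "carrier (quot_module M B) = {\<zero>\<^bsub>quot_module M B\<^esub>}"
proof -
  interpret M: module Rat M by fact
  have "B +>\<^bsub>M\<^esub> a = B" if "a \<in> carrier M" for a
    using coset_eq[OF assms(1) carrier_submodule[OF assms(1)] that M.zero_closed]
      coset_zero[OF assms(1) carrier_submodule[OF assms(1)]] that assms(2) by simp
  then show ?thesis using M.zero_closed by (auto simp: quot_module_simps)
qed

text \<open>The resolution \<open>A\<close> inside the cohomology is the outcome of a choice, so it
  is reached only through comparison maps \<open>\<psi>\<close> to \<open>J\<close> and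
  \<open>\<phi>\<close> back. A cocycle is moved to \<open>J\<close>, bounded there, and moved back;
  the difference between \<open>\<phi>\<close> after \<open>\<psi>\<close> and the identity is
  null-homotopic and hence a coboundary on cocycles.\<close>

lemma gamma_acyclicI:
  fixes P :: "'p gorder" and F :: "('p, 'v) sheaf" and J :: "nat \<Rightarrow> ('p, 'p list \<Rightarrow> 'v) sheaf"
  assumes S: "resolution P F \<epsilon> J e \<infinity>" and injJ: "\<And>n. injective_sheaf P (J n)"
    and exact: "\<And>k s. s \<in> carrier (sections P (J (Suc k))) \<Longrightarrow>
       (\<And>x. x \<in> carrier P \<Longrightarrow> e (Suc k) x (s x) = \<zero>\<^bsub>stalk (J (Suc (Suc k))) x\<^esub>) \<Longrightarrow>
       \<exists>t\<in>carrier (sections P (J k)). \<forall>x\<in>carrier P. s x = e k x (t x)"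
  shows "gamma_acyclic P F"
  unfolding gamma_acyclic_def
proof (intro allI impI)
  fix q :: nat assume "q > 0"
  then obtain k where q: "q = Suc k" by (cases q) auto
  define pr where "pr = (\<lambda>(\<eta>, I :: nat \<Rightarrow> ('p, 'p list \<Rightarrow> 'v) sheaf, d).
            resolution P F \<eta> I d \<infinity> \<and> (\<forall>n. injective_sheaf P (I n)))"
  obtain \<eta> A d where EA: "(SOME z. pr z) = (\<eta>, A, d)" by (cases "SOME z. pr z") auto
  \<comment> \<open>\<open>J\<close> itself shows that there is something to choose, so the chosen
    triple does have the defining property.\<close>
  have "pr (\<epsilon>, J, e)" using S injJ by (simp add: pr_def)
  then have "pr (SOME z. pr z)" by (rule someI)
  then have R: "resolution P F \<eta> A d \<infinity>" and injA: "\<And>n. injective_sheaf P (A n)"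
    unfolding EA by (simp_all add: pr_def)
  have coh: "sheaf_cohomology P F q = complex_cohomology (\<lambda>n. sections P (A n)) (\<lambda>n. sections_map P (d n)) q"
    using EA unfolding sheaf_cohomology_def pr_def by simp
  note RD = resolutionD[OF R] and SD = resolutionD[OF S]
  define M where "M = (sections P (A q))\<lparr>carrier := {v \<in> carrier (sections P (A q)). sections_map P (d q) v = \<zero>\<^bsub>sections P (A (Suc q))\<^esub>}\<rparr>"
  define B where "B = sections_map P (d k) ` carrier (sections P (A k))"
  have coh': "sheaf_cohomology P F q = quot_module M B"
    unfolding coh unfolding complex_cohomology_def M_def B_def q by simp
  note slin = sections_map_lin[OF RD(2) RD(2) RD(4)]
  have mM: "module Rat M" unfolding M_def
    by (rule submodule_module[OF sections_module[OF RD(2)]],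
        rule kernel_submodule[OF sections_module[OF RD(2)] sections_module[OF RD(2)] slin])
  have zero_iff: "sections_map P (d q) s = \<zero>\<^bsub>sections P (A (Suc q))\<^esub> \<longleftrightarrow>
      (\<forall>x\<in>carrier P. d q x (s x) = \<zero>\<^bsub>stalk (A (Suc q)) x\<^esub>)" for s
    by (auto simp: sections_map_def sections_def restrict_def fun_eq_iff)
  have "B = carrier M"
  proof
    show "B \<subseteq> carrier M"
    proof
      fix s assume "s \<in> B"
      then obtain t where t: "t \<in> carrier (sections P (A k))" "s = sections_map P (d k) t"
        unfolding B_def by blast
      have "s \<in> carrier (sections P (A q))" using lin_mapsD(1)[OF slin t(1)] t(2) by (simp add: q)
      moreover have "d q x (s x) = \<zero>\<^bsub>stalk (A (Suc q)) x\<^esub>" if "x \<in> carrier P" for x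
        using resolution_dd(2)[OF R that sectionsD(1)[OF t(1) that]] that
        by (simp add: t(2) q sections_map_def)
      ultimately show "s \<in> carrier M" by (simp add: M_def zero_iff)
    qed
    show "carrier M \<subseteq> B"
    proof
      fix s assume "s \<in> carrier M"
      then have s: "s \<in> carrier (sections P (A q))" and ds: "\<And>x. x \<in> carrier P \<Longrightarrow> d q x (s x) = \<zero>\<^bsub>stalk (A (Suc q)) x\<^esub>"
        by (simp_all add: M_def zero_iff)
      from lift_resolution[OF R S injJ] obtain \<psi> where \<psi>:
        "\<forall>n. sheaf_hom P (A n) (J n) (\<psi> n)"
        "\<forall>x\<in>carrier P. \<forall>v\<in>carrier (stalk F x). \<psi> 0 x (\<eta> x v) = \<epsilon> x v"
        "\<forall>n. \<forall>x\<in>carrier P. \<forall>v\<in>carrier (stalk (A n) x). \<psi> (Suc n) x (d n x v) = e n x (\<psi> n x v)"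
        by (elim exE conjE)
      from lift_resolution[OF S R injA] obtain \<phi> where \<phi>:
        "\<forall>n. sheaf_hom P (J n) (A n) (\<phi> n)"
        "\<forall>x\<in>carrier P. \<forall>v\<in>carrier (stalk F x). \<phi> 0 x (\<epsilon> x v) = \<eta> x v"
        "\<forall>n. \<forall>x\<in>carrier P. \<forall>v\<in>carrier (stalk (J n) x). \<phi> (Suc n) x (e n x v) = d n x (\<phi> n x v)"
        by (elim exE conjE)
      note \<psi> = \<psi>[rule_format] and \<phi> = \<phi>[rule_format]
      define \<omega> where "\<omega> n x v = v \<ominus>\<^bsub>stalk (A n) x\<^esub> \<phi> n x (\<psi> n x v)" for n x v
      have c: "\<phi> n x (\<psi> n x v) \<in> carrier (stalk (A n) x)" if "x \<in> carrier P" "v \<in> carrier (stalk (A n) x)" for n x v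
        by (rule sheaf_homD(3)[OF \<phi>(1) that(1) sheaf_homD(3)[OF \<psi>(1) that]])
      have "sheaf_hom P (A n) (A n) (\<omega> n)" for n
        unfolding \<omega>_def by (rule sheaf_hom_diff[OF RD(2) RD(2) sheaf_hom_id sheaf_hom_comp[OF \<psi>(1) \<phi>(1)]])
      moreover have "\<omega> 0 x (\<eta> x v) = \<zero>\<^bsub>stalk (A 0) x\<^esub>" if "x \<in> carrier P" "v \<in> carrier (stalk F x)" for x v
        using minus_self[OF is_sheafD(1)[OF RD(2) that(1)] sheaf_homD(3)[OF RD(3) that]] that
        by (simp add: \<omega>_def \<psi>(2) \<phi>(2))
      moreover have "\<omega> (Suc n) x (d n x v) = d n x (\<omega> n x v)" if "x \<in> carrier P" "v \<in> carrier (stalk (A n) x)" for n x v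
        unfolding \<omega>_def \<psi>(3)[OF that] \<phi>(3)[OF that(1) sheaf_homD(3)[OF \<psi>(1) that]]
        by (rule lin_maps_minus[OF sheaf_homD(1)[OF RD(4) that(1)] is_sheafD(1)[OF RD(2) that(1)] is_sheafD(1)[OF RD(2) that(1)] that(2) c[OF that], symmetric])
      ultimately have "\<exists>h. (\<forall>n. sheaf_hom P (A (Suc n)) (A n) (h n))
        \<and> (\<forall>n. \<forall>x\<in>carrier P. \<forall>v\<in>carrier (stalk (A (Suc n)) x).
         h (Suc n) x (d (Suc n) x v) = \<omega> (Suc n) x v \<ominus>\<^bsub>stalk (A (Suc n)) x\<^esub> d n x (h n x v))"
        by (rule null_homotopy[OF R injA])
      then obtain h where h: "\<forall>n. sheaf_hom P (A (Suc n)) (A n) (h n)"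
        "\<forall>n. \<forall>x\<in>carrier P. \<forall>v\<in>carrier (stalk (A (Suc n)) x).
         h (Suc n) x (d (Suc n) x v) = \<omega> (Suc n) x v \<ominus>\<^bsub>stalk (A (Suc n)) x\<^esub> d n x (h n x v)"
        by (elim exE conjE)
      note h = h[rule_format, unfolded \<omega>_def]
      have s': "sections_map P (\<psi> q) s \<in> carrier (sections P (J q))"
        using lin_mapsD(1)[OF sections_map_lin[OF RD(2) SD(2) \<psi>(1)] s] .
      have "\<exists>t\<in>carrier (sections P (J k)). \<forall>x\<in>carrier P. sections_map P (\<psi> q) s x = e k x (t x)"
      proof (rule exact[OF s'[unfolded q], folded q])
        fix x assume x: "x \<in> carrier P"
        have "e q x (\<psi> q x (s x)) = \<psi> (Suc q) x (d q x (s x))" using \<psi>(3) x sectionsD(1)[OF s] by simp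
        also have "\<dots> = \<zero>\<^bsub>stalk (J (Suc q)) x\<^esub>"
          using ds[OF x] sheaf_hom_zero_ker[OF RD(2) SD(2) \<psi>(1) x] by simp
        finally show "e q x (sections_map P (\<psi> q) s x) = \<zero>\<^bsub>stalk (J (Suc q)) x\<^esub>"
          using x by (simp add: sections_map_def)
      qed
      then obtain t where t: "t \<in> carrier (sections P (J k))"
        "\<And>x. x \<in> carrier P \<Longrightarrow> \<psi> q x (s x) = e k x (t x)" by (auto simp: sections_map_def)
      \<comment> \<open>A primitive of \<open>s\<close>: the transported primitive \<open>t\<close>
        of its image in \<open>J\<close>, corrected by the homotopy.\<close>
      define u where "u = sections_map P (\<phi> k) t \<oplus>\<^bsub>sections P (A k)\<^esub> sections_map P (h k) s"
      have p: "sections_map P (\<phi> k) t \<in> carrier (sections P (A k))"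
        "sections_map P (h k) s \<in> carrier (sections P (A k))"
        using lin_mapsD(1)[OF sections_map_lin[OF SD(2) RD(2) \<phi>(1)] t(1)]
          lin_mapsD(1)[OF sections_map_lin[OF RD(2) RD(2) h(1)] s[unfolded q]] by auto
      have u: "u \<in> carrier (sections P (A k))" unfolding u_def
        using p submoduleD(3)[OF sections_module[OF RD(2)] carrier_submodule[OF sections_module[OF RD(2)]]] by blast
      have "s x = d k x (u x)" if x: "x \<in> carrier P" for x
      proof -
        let ?A = "stalk (A q) x"
        interpret A: module Rat ?A by (rule is_sheafD(1)[OF RD(2) x])
        have sx: "s x \<in> carrier ?A" using sectionsD(1)[OF s x] .
        have tx: "t x \<in> carrier (stalk (J k) x)" using sectionsD(1)[OF t(1) x] .
        have a: "\<phi> k x (t x) \<in> carrier (stalk (A k) x)" "h k x (s x) \<in> carrier (stalk (A k) x)"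
          using sheaf_homD(3)[OF \<phi>(1) x tx] sheaf_homD(3)[OF h(1) x sx[unfolded q]] by auto
        have b: "d k x (\<phi> k x (t x)) \<in> carrier ?A" "d k x (h k x (s x)) \<in> carrier ?A"
          unfolding q using sheaf_homD(3)[OF RD(4) x] a by auto
        have "\<zero>\<^bsub>?A\<^esub> = h q x (d q x (s x))"
          using ds[OF x] sheaf_hom_zero_ker[OF RD(2) RD(2) h(1) x] by simp
        also have "\<dots> = s x \<ominus>\<^bsub>?A\<^esub> \<phi> q x (\<psi> q x (s x)) \<ominus>\<^bsub>?A\<^esub> d k x (h k x (s x))"
          using h(2)[OF x sx[unfolded q]] by (simp add: q)
        also have "\<phi> q x (\<psi> q x (s x)) = d k x (\<phi> k x (t x))"
          using t(2)[OF x] \<phi>(3)[OF x tx] by (simp add: q)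
        finally have "s x \<ominus>\<^bsub>?A\<^esub> (d k x (\<phi> k x (t x)) \<oplus>\<^bsub>?A\<^esub> d k x (h k x (s x))) = \<zero>\<^bsub>?A\<^esub>"
          using sx b by (simp add: a_minus_def A.minus_add A.a_assoc)
        then have "s x = d k x (\<phi> k x (t x)) \<oplus>\<^bsub>?A\<^esub> d k x (h k x (s x))"
          using minus_zero_eq[OF A.module_axioms sx] b by simp
        also have "\<dots> = d k x (u x)"
          using lin_mapsD(2)[OF sheaf_homD(1)[OF RD(4) x] a] x by (simp add: u_def sections_def sections_map_def q)
        finally show ?thesis .
      qed
      then have "s = sections_map P (d k) u"
        using sectionsD(3)[OF s] by (auto simp: sections_map_def restrict_def)
      then show "s \<in> B" unfolding B_def using u by blast
    qed
  qed
  then show "carrier (sheaf_cohomology P F q) = {\<zero>\<^bsub>sheaf_cohomology P F q\<^esub>}"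
    unfolding coh' by (rule quot_self[OF mM])
qed

section \<open>An injective resolution adapted to a covering by components\<close>

text \<open>The expression to which \<open>cob_cob\<close> reduces after unfolding the recursion and
  applying the induction hypothesis.\<close>

lemma minus_minus_zero:
  assumes "module Rat M" "x \<in> carrier M"
  shows "x \<ominus>\<^bsub>M\<^esub> (x \<ominus>\<^bsub>M\<^esub> \<zero>\<^bsub>M\<^esub>) = \<zero>\<^bsub>M\<^esub>"
proof -
  interpret M: module Rat M by fact
  have z: "\<ominus>\<^bsub>M\<^esub> \<zero>\<^bsub>M\<^esub> = \<zero>\<^bsub>M\<^esub>" by (rule M.minus_equality) simp_all
  have "x \<ominus>\<^bsub>M\<^esub> \<zero>\<^bsub>M\<^esub> = x \<oplus>\<^bsub>M\<^esub> \<zero>\<^bsub>M\<^esub>" by (simp only: a_minus_def z)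
  then have "x \<ominus>\<^bsub>M\<^esub> \<zero>\<^bsub>M\<^esub> = x" using assms(2) by simp
  then have "x \<ominus>\<^bsub>M\<^esub> (x \<ominus>\<^bsub>M\<^esub> \<zero>\<^bsub>M\<^esub>) = x \<ominus>\<^bsub>M\<^esub> x" by (rule arg_cong)
  then show ?thesis using M.r_neg[OF assms(2)] by (simp only: a_minus_def)
qed

text \<open>A section of \<open>F\<close> over \<open>p\<close> is a family over the elements of \<open>T\<close> below \<open>p\<close> that is compatible
  along \<open>rel\<close>. Each component of \<open>{t \<in> T. t \<sqsubseteq> p}\<close> with respect to \<open>rel\<close> has a greatest element
  \<open>peak p t\<close>, and each component of \<open>T\<close> a greatest element \<open>gpeak t\<close>.\<close>

locale component_cover =
  fixes P :: "'p gorder" (structure) and F :: "('p, 'v) sheaf" and T :: "'p set"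
    and rel :: "'p \<Rightarrow> 'p \<Rightarrow> bool" and peak :: "'p \<Rightarrow> 'p \<Rightarrow> 'p" and gpeak :: "'p \<Rightarrow> 'p"
  assumes sheaf: "is_sheaf P F"
    and P_refl: "p \<in> carrier P \<Longrightarrow> p \<sqsubseteq> p"
    and P_trans: "p \<in> carrier P \<Longrightarrow> q \<in> carrier P \<Longrightarrow> r \<in> carrier P \<Longrightarrow> p \<sqsubseteq> q \<Longrightarrow> q \<sqsubseteq> r \<Longrightarrow> p \<sqsubseteq> r"
    and T_sub: "T \<subseteq> carrier P"
    and rel_le: "t \<in> T \<Longrightarrow> t' \<in> T \<Longrightarrow> rel t t' \<Longrightarrow> t \<sqsubseteq> t'"
    and rel_refl: "t \<in> T \<Longrightarrow> rel t t"
    and rel_trans: "t \<in> T \<Longrightarrow> t' \<in> T \<Longrightarrow> t'' \<in> T \<Longrightarrow> rel t t' \<Longrightarrow> rel t' t'' \<Longrightarrow> rel t t''"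
    and peak: "p \<in> carrier P \<Longrightarrow> t \<in> T \<Longrightarrow> t \<sqsubseteq> p \<Longrightarrow> peak p t \<in> T \<and> peak p t \<sqsubseteq> p \<and> rel t (peak p t)"
    and peak_eq: "p \<in> carrier P \<Longrightarrow> t \<in> T \<Longrightarrow> t' \<in> T \<Longrightarrow> rel t t' \<Longrightarrow> t' \<sqsubseteq> p \<Longrightarrow> peak p t = peak p t'"
    and gpeak: "t \<in> T \<Longrightarrow> gpeak t \<in> T \<and> rel t (gpeak t)"
    and gpeak_eq: "t \<in> T \<Longrightarrow> t' \<in> T \<Longrightarrow> rel t t' \<Longrightarrow> gpeak t = gpeak t'"
    and separated: "p \<in> carrier P \<Longrightarrow> v \<in> carrier (stalk F p) \<Longrightarrow>
      (\<And>t. t \<in> T \<Longrightarrow> t \<sqsubseteq> p \<Longrightarrow> res F p t v = \<zero>\<^bsub>stalk F t\<^esub>) \<Longrightarrow> v = \<zero>\<^bsub>stalk F p\<^esub>"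
    and glue: "p \<in> carrier P \<Longrightarrow> (\<And>t. t \<in> T \<Longrightarrow> t \<sqsubseteq> p \<Longrightarrow> s t \<in> carrier (stalk F t)) \<Longrightarrow>
      (\<And>t t'. t \<in> T \<Longrightarrow> t' \<in> T \<Longrightarrow> rel t t' \<Longrightarrow> t' \<sqsubseteq> p \<Longrightarrow> res F t' t (s t') = s t) \<Longrightarrow>
      \<exists>v\<in>carrier (stalk F p). \<forall>t\<in>T. t \<sqsubseteq> p \<longrightarrow> res F p t v = s t"
begin

text \<open>Chains are listed from the largest element down, so that the largest element, on which
  the position in \<open>P\<close> depends, is the head, and the stalk is taken at the last entry.\<close>

fun desc :: "'p list \<Rightarrow> bool" where
  "desc [] = False"
| "desc [t] = (t \<in> T)"
| "desc (m # t # ts) = (m \<in> T \<and> rel t m \<and> desc (t # ts))"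

definition chains :: "'p set \<Rightarrow> nat \<Rightarrow> 'p list set" where
  "chains S n = {ts. length ts = Suc n \<and> desc ts \<and> hd ts \<in> S}"

abbreviation val :: "'p list \<Rightarrow> (rat, 'v) module" where
  "val ts \<equiv> stalk F (last ts)"

text \<open>The simplicial coboundary with coefficients. Deleting the head contributes the first
  term, and subtracting the recursive call on the tail produces the alternating signs. Only deleting
  the last entry changes the stalk, so the restriction map occurs in the two-element clause
  alone.\<close>

fun cob :: "('p list \<Rightarrow> 'v) \<Rightarrow> 'p list \<Rightarrow> 'v" where
  "cob c [t1, t0] = c [t0] \<ominus>\<^bsub>stalk F t0\<^esub> res F t1 t0 (c [t1])"
| "cob c (m # t1 # t0 # ts) = c (t1 # t0 # ts) \<ominus>\<^bsub>val (t0 # ts)\<^esub> cob (\<lambda>us. c (m # us)) (t1 # t0 # ts)"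
| "cob c _ = undefined"

text \<open>Deleting the head of a chain makes a smaller element the head, so the faces of chains
  with head in \<open>S\<close> stay such chains only if \<open>S\<close> is closed
  downwards.\<close>

definition down :: "'p set \<Rightarrow> bool" where
  "down S \<longleftrightarrow> S \<subseteq> T \<and> (\<forall>t\<in>T. \<forall>t'\<in>S. rel t t' \<longrightarrow> t \<in> S)"

text \<open>\<open>m\<close> names a cone point on each component of \<open>S\<close>. The elements
  of \<open>T\<close> below \<open>p\<close> with \<open>peak p\<close>, and all of \<open>T\<close>
  with \<open>gpeak\<close>, are both of this kind, so one cone argument yields exactness on stalks
  and on global sections.\<close>

definition coned :: "'p set \<Rightarrow> ('p \<Rightarrow> 'p) \<Rightarrow> bool" where
  "coned S m \<longleftrightarrow> down S \<and> (\<forall>t\<in>S. m t \<in> S \<and> rel t (m t)) \<and> (\<forall>t\<in>T. \<forall>t'\<in>S. rel t t' \<longrightarrow> m t = m t')"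

definition region :: "'p \<Rightarrow> 'p set" where
  "region p = {t \<in> T. t \<sqsubseteq> p}"

section \<open>Chains and their coboundary\<close>

lemma desc_last: "desc ts \<Longrightarrow> last ts \<in> T"
  by (induction ts rule: desc.induct) auto

lemma desc_hd: "desc ts \<Longrightarrow> hd ts \<in> T"
  by (induction ts rule: desc.induct) auto

lemma desc_last_hd: "desc ts \<Longrightarrow> rel (last ts) (hd ts)"
proof (induction ts rule: desc.induct)
  case (3 m t ts)
  then show ?case using rel_trans[of "last (t # ts)" t m] desc_last[of "t # ts"] desc_hd[of "t # ts"] by simp
qed (auto simp: rel_refl)

lemma mod_T: "t \<in> T \<Longrightarrow> module Rat (stalk F t)"
  using is_sheafD(1)[OF sheaf] T_sub by blast

lemma res_T: "t \<in> T \<Longrightarrow> t' \<in> T \<Longrightarrow> rel t t' \<Longrightarrow> res F t' t \<in> lin_maps (stalk F t') (stalk F t)"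
  using is_sheafD(2)[OF sheaf] T_sub rel_le by blast

lemma res_res_T: "t \<in> T \<Longrightarrow> t' \<in> T \<Longrightarrow> t'' \<in> T \<Longrightarrow> rel t t' \<Longrightarrow> rel t' t'' \<Longrightarrow> v \<in> carrier (stalk F t'') \<Longrightarrow>
  res F t' t (res F t'' t' v) = res F t'' t v"
  using is_sheafD(4)[OF sheaf] T_sub rel_le by (meson subsetD)

lemma down_below: "m \<in> T \<Longrightarrow> down {t \<in> T. rel t m}"
  using rel_trans unfolding down_def by blast

lemma down_T: "down T"
  by (simp add: down_def)

lemma down_region: "p \<in> carrier P \<Longrightarrow> down (region p)"
  unfolding down_def region_def using P_trans rel_le T_sub by blast

lemma coned_region: "p \<in> carrier P \<Longrightarrow> coned (region p) (peak p)"
  unfolding coned_def using down_region peak peak_eq by (auto simp: region_def)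

lemma coned_T: "coned T gpeak"
  unfolding coned_def using down_T gpeak gpeak_eq by auto

text \<open>Fixing the head leaves a chain in the down-closed set below it; this is the recursion
  along which the statements on \<open>cob\<close> are proved.\<close>

lemma chains_Cons: "m # ts \<in> chains S (Suc n) \<longleftrightarrow> m \<in> S \<and> m \<in> T \<and> ts \<in> chains {t \<in> T. rel t m} n"
  by (cases ts) (auto simp: chains_def dest: desc_hd)

lemma chains_mono: "S \<subseteq> S' \<Longrightarrow> chains S n \<subseteq> chains S' n"
  by (auto simp: chains_def)

lemma chains_0: "S \<subseteq> T \<Longrightarrow> chains S 0 = (\<lambda>t. [t]) ` S"
  by (auto simp: chains_def length_Suc_conv)

lemma chains_tl:
  assumes "down S" "m # ts \<in> chains S (Suc n)"
  shows "ts \<in> chains S n"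
proof -
  have "ts \<in> chains {t \<in> T. rel t m} n" "m \<in> S" using assms(2) by (simp_all add: chains_Cons)
  then show ?thesis using assms(1) by (auto simp: chains_def down_def)
qed

lemma chains_last: "down S \<Longrightarrow> ts \<in> chains S n \<Longrightarrow> last ts \<in> S"
  using desc_last_hd[of ts] desc_last[of ts] unfolding chains_def down_def by blast

lemma chains_last_T: "ts \<in> chains S n \<Longrightarrow> last ts \<in> T"
  using desc_last by (auto simp: chains_def)

lemma chain_ind_cases:
  assumes "ts \<in> chains S (Suc n)"
  obtains (two) t1 t0 where "n = 0" "ts = [t1, t0]" "t1 \<in> S" "t1 \<in> T" "t0 \<in> T" "rel t0 t1"
  | (more) m t1 t0 us k where "n = Suc k" "ts = m # t1 # t0 # us" "m \<in> S" "m \<in> T"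
      "t1 # t0 # us \<in> chains {t \<in> T. rel t m} (Suc k)"
proof -
  obtain m t1 us where ts: "ts = m # t1 # us" using assms by (auto simp: chains_def length_Suc_conv)
  show thesis
  proof (cases us)
    case Nil
    then show ?thesis using two assms ts by (auto simp: chains_def)
  next
    case (Cons t0 vs)
    then obtain k where "n = Suc k" using assms ts by (auto simp: chains_def)
    then show ?thesis using more[of k m t1 t0 vs] assms ts Cons by (simp add: chains_Cons)
  qed
qed

text \<open>The set \<open>S\<close> varies in the induction, since the recursive call of
  \<open>cob\<close> runs over chains with head below \<open>m\<close> instead of chains with head
  in \<open>S\<close>.\<close>

lemma cob_closed:
  "ts \<in> chains S (Suc n) \<Longrightarrow> down S \<Longrightarrow> (\<And>us. us \<in> chains S n \<Longrightarrow> c us \<in> carrier (val us)) \<Longrightarrow>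
    cob c ts \<in> carrier (val ts)"
proof (induction n arbitrary: ts S c)
  case 0
  from 0(1) show ?case
  proof (cases rule: chain_ind_cases)
    case (two t1 t0)
    interpret M: module Rat "stalk F t0" using mod_T two by blast
    have "[t0] \<in> chains S 0" "[t1] \<in> chains S 0" using two 0(2) by (auto simp: chains_def down_def)
    then have "c [t0] \<in> carrier (stalk F t0)" "c [t1] \<in> carrier (stalk F t1)" using 0(3) by force+
    then show ?thesis using two lin_mapsD(1)[OF res_T[of t0 t1]] by simp
  qed simp
next
  case (Suc n)
  from Suc(2) show ?case
  proof (cases rule: chain_ind_cases)
    case (more m t1 t0 us k)
    have tl: "t1 # t0 # us \<in> chains S (Suc n)" using chains_tl Suc(2,3) more by blast
    have l: "last (t0 # us) \<in> T" using chains_last_T[OF tl] by simp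
    interpret M: module Rat "val (t0 # us)" by (rule mod_T[OF l])
    have "cob (\<lambda>vs. c (m # vs)) (t1 # t0 # us) \<in> carrier (val (t1 # t0 # us))"
    proof (rule Suc(1)[OF _ down_below[OF more(4)]])
      show "t1 # t0 # us \<in> chains {t \<in> T. rel t m} (Suc n)" using more by simp
      fix vs assume vs: "vs \<in> chains {t \<in> T. rel t m} n"
      then have "m # vs \<in> chains S (Suc n)" using more by (simp add: chains_Cons)
      then show "c (m # vs) \<in> carrier (val vs)" using Suc(4)[of "m # vs"] vs by (auto simp: chains_def split: if_splits)
    qed
    then have k: "cob (\<lambda>vs. c (m # vs)) (t1 # t0 # us) \<in> carrier (val (t0 # us))" by simp
    have k2: "c (t1 # t0 # us) \<in> carrier (val (t0 # us))" using Suc(4)[OF tl] by simp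
    have vt: "last ts = last (t0 # us)" by (simp add: more(2))
    have "cob c ts = c (t1 # t0 # us) \<ominus>\<^bsub>val (t0 # us)\<^esub> cob (\<lambda>us. c (m # us)) (t1 # t0 # us)"
      by (simp only: more(2) cob.simps)
    then show ?thesis unfolding vt using M.minus_closed[OF k2 k] by (simp only:)
  qed simp
qed

lemma cob_cong:
  "ts \<in> chains S (Suc n) \<Longrightarrow> down S \<Longrightarrow> (\<And>us. us \<in> chains S n \<Longrightarrow> c us = c' us) \<Longrightarrow> cob c ts = cob c' ts"
proof (induction n arbitrary: ts S c c')
  case 0
  from 0(1) show ?case
  proof (cases rule: chain_ind_cases)
    case (two t1 t0)
    have "[t0] \<in> chains S 0" "[t1] \<in> chains S 0" using two 0(2) by (auto simp: chains_def down_def)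
    then show ?thesis using two 0(3) by simp
  qed simp
next
  case (Suc n)
  from Suc(2) show ?case
  proof (cases rule: chain_ind_cases)
    case (more m t1 t0 us k)
    have tl: "t1 # t0 # us \<in> chains S (Suc n)" using chains_tl Suc(2,3) more by blast
    have "cob (\<lambda>vs. c (m # vs)) (t1 # t0 # us) = cob (\<lambda>vs. c' (m # vs)) (t1 # t0 # us)"
      by (rule Suc(1)[OF _ down_below[OF more(4)]])
        (use more Suc(4) in \<open>auto simp: chains_Cons\<close>)
    then show ?thesis using Suc(4)[OF tl] more by simp
  qed simp
qed

lemma cob_lin:
  "ts \<in> chains S (Suc n) \<Longrightarrow> down S \<Longrightarrow> (\<And>us. us \<in> chains S n \<Longrightarrow> c us \<in> carrier (val us)) \<Longrightarrow>
    (\<And>us. us \<in> chains S n \<Longrightarrow> c' us \<in> carrier (val us)) \<Longrightarrow>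
    cob (\<lambda>us. k \<odot>\<^bsub>val us\<^esub> c us \<oplus>\<^bsub>val us\<^esub> c' us) ts = k \<odot>\<^bsub>val ts\<^esub> cob c ts \<oplus>\<^bsub>val ts\<^esub> cob c' ts"
proof (induction n arbitrary: ts S c c')
  case 0
  from 0(1) show ?case
  proof (cases rule: chain_ind_cases)
    case (two t1 t0)
    interpret M: module Rat "stalk F t0" using mod_T two by blast
    interpret M1: module Rat "stalk F t1" using mod_T two by blast
    have "[t0] \<in> chains S 0" "[t1] \<in> chains S 0" using two 0(2) by (auto simp: chains_def down_def)
    then have "c [t0] \<in> carrier (stalk F t0)" "c [t1] \<in> carrier (stalk F t1)"
      "c' [t0] \<in> carrier (stalk F t0)" "c' [t1] \<in> carrier (stalk F t1)" using 0(3,4) by force+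
    then show ?thesis using two lin_mapsD[OF res_T[of t0 t1]]
      by (simp add: a_minus_def M.smult_r_distr M.smult_r_minus M.minus_add M.a_ac)
  qed simp
next
  case (Suc n)
  from Suc(2) show ?case
  proof (cases rule: chain_ind_cases)
    case (more m t1 t0 us j)
    have tl: "t1 # t0 # us \<in> chains S (Suc n)" using chains_tl Suc(2,3) more by blast
    have tl': "t1 # t0 # us \<in> chains {t \<in> T. rel t m} (Suc n)" using more by simp
    note dn = down_below[OF more(4)]
    interpret M: module Rat "val (t0 # us)" by (rule mod_T) (use chains_last_T[OF tl] in simp)
    have mc: "m # vs \<in> chains S (Suc n)" and lv: "last (m # vs) = last vs" if "vs \<in> chains {t \<in> T. rel t m} n" for vs
      using more that by (auto simp: chains_Cons) (auto simp: chains_def)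
    have cl: "c (m # vs) \<in> carrier (val vs)" "c' (m # vs) \<in> carrier (val vs)" if "vs \<in> chains {t \<in> T. rel t m} n" for vs
      using Suc(4,5)[OF mc[OF that]] lv[OF that] by simp_all
    let ?c = "\<lambda>vs. c (m # vs)" and ?c' = "\<lambda>vs. c' (m # vs)"
    have "cob (\<lambda>vs. k \<odot>\<^bsub>val (m # vs)\<^esub> ?c vs \<oplus>\<^bsub>val (m # vs)\<^esub> ?c' vs) (t1 # t0 # us)
        = cob (\<lambda>vs. k \<odot>\<^bsub>val vs\<^esub> ?c vs \<oplus>\<^bsub>val vs\<^esub> ?c' vs) (t1 # t0 # us)"
      by (rule cob_cong[OF tl' dn]) (simp only: lv)
    also have "\<dots> = k \<odot>\<^bsub>val (t1 # t0 # us)\<^esub> cob ?c (t1 # t0 # us) \<oplus>\<^bsub>val (t1 # t0 # us)\<^esub> cob ?c' (t1 # t0 # us)"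
      by (rule Suc(1)[OF tl' dn]) (use cl in auto)
    finally have e: "cob (\<lambda>vs. k \<odot>\<^bsub>val (m # vs)\<^esub> ?c vs \<oplus>\<^bsub>val (m # vs)\<^esub> ?c' vs) (t1 # t0 # us) =
       k \<odot>\<^bsub>val (t0 # us)\<^esub> cob ?c (t1 # t0 # us) \<oplus>\<^bsub>val (t0 # us)\<^esub> cob ?c' (t1 # t0 # us)" by simp
    have q: "cob ?c (t1 # t0 # us) \<in> carrier (val (t0 # us))" "cob ?c' (t1 # t0 # us) \<in> carrier (val (t0 # us))"
      using cob_closed[OF tl' dn, of ?c] cob_closed[OF tl' dn, of ?c'] cl by auto
    have q2: "c (t1 # t0 # us) \<in> carrier (val (t0 # us))" "c' (t1 # t0 # us) \<in> carrier (val (t0 # us))"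
      using Suc(4,5)[OF tl] by simp_all
    have vt: "last ts = last (t0 # us)" "last (t1 # t0 # us) = last (t0 # us)" by (simp_all add: more(2))
    show ?thesis unfolding vt(1) unfolding more(2) cob.simps e vt(2) using q q2
      by (simp add: a_minus_def M.smult_r_distr M.smult_r_minus M.minus_add M.a_ac del: last.simps cob.simps)
  qed simp
qed

lemma cob_diff:
  assumes "ts \<in> chains S (Suc n)" "down S" "\<And>us. us \<in> chains S n \<Longrightarrow> c us \<in> carrier (val us)"
    "\<And>us. us \<in> chains S n \<Longrightarrow> c' us \<in> carrier (val us)"
  shows "cob (\<lambda>us. c us \<ominus>\<^bsub>val us\<^esub> c' us) ts = cob c ts \<ominus>\<^bsub>val ts\<^esub> cob c' ts"
proof -
  have e: "v \<ominus>\<^bsub>val us\<^esub> w = (- 1) \<odot>\<^bsub>val us\<^esub> w \<oplus>\<^bsub>val us\<^esub> v"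
    if "us \<in> chains S k" "v \<in> carrier (val us)" "w \<in> carrier (val us)" for us v w k
  proof -
    interpret M: module Rat "val us" by (rule mod_T[OF chains_last_T[OF that(1)]])
    show ?thesis using that(2,3) rat_smult_minus[OF M.module_axioms that(3)] by (simp add: a_minus_def M.a_comm)
  qed
  have "cob (\<lambda>us. c us \<ominus>\<^bsub>val us\<^esub> c' us) ts = cob (\<lambda>us. (- 1) \<odot>\<^bsub>val us\<^esub> c' us \<oplus>\<^bsub>val us\<^esub> c us) ts"
    by (rule cob_cong[OF assms(1,2)]) (rule e[OF _ assms(3,4)])
  also have "\<dots> = (- 1) \<odot>\<^bsub>val ts\<^esub> cob c' ts \<oplus>\<^bsub>val ts\<^esub> cob c ts"
    by (rule cob_lin[OF assms(1,2)]) (rule assms(4), assumption, rule assms(3))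
  also have "\<dots> = cob c ts \<ominus>\<^bsub>val ts\<^esub> cob c' ts"
    by (rule e[symmetric, OF assms(1) cob_closed[OF assms(1-3)] cob_closed[OF assms(1,2,4)]])
  finally show ?thesis .
qed

text \<open>Write \<open>c'\<close> for \<open>c\<close> with \<open>m\<close> put in front of its
  argument. Unfolding both coboundaries at the head \<open>m\<close> gives
  \<open>cob c - (cob c - cob (cob c'))\<close> on the tail, and the last term is zero by
  induction.\<close>

lemma cob_cob:
  "ts \<in> chains S (Suc (Suc n)) \<Longrightarrow> down S \<Longrightarrow> (\<And>us. us \<in> chains S n \<Longrightarrow> c us \<in> carrier (val us)) \<Longrightarrow>
    cob (cob c) ts = \<zero>\<^bsub>val ts\<^esub>"
proof (induction n arbitrary: ts S c)
  case 0
  from 0(1) obtain m t1 t0 where ts: "ts = [m, t1, t0]" by (auto simp: chains_def length_Suc_conv)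
  have T: "m \<in> S" "m \<in> T" "t1 \<in> T" "t0 \<in> T" "rel t1 m" "rel t0 t1" using 0(1) by (auto simp: ts chains_def)
  have "rel t0 m" using rel_trans T by blast
  then have "[m] \<in> chains S 0" "[t1] \<in> chains S 0" "[t0] \<in> chains S 0" using T 0(2) by (auto simp: chains_def down_def)
  then have cc: "c [m] \<in> carrier (stalk F m)" "c [t1] \<in> carrier (stalk F t1)" "c [t0] \<in> carrier (stalk F t0)"
    using 0(3) by force+
  interpret M: module Rat "stalk F t0" using mod_T T by blast
  have r: "res F t1 t0 (c [t1] \<ominus>\<^bsub>stalk F t1\<^esub> res F m t1 (c [m])) = res F t1 t0 (c [t1]) \<ominus>\<^bsub>stalk F t0\<^esub> res F m t0 (c [m])"
    using lin_maps_minus[OF res_T mod_T mod_T] T cc lin_mapsD(1)[OF res_T[of t1 m]] res_res_T by simp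
  have cl: "res F t1 t0 (c [t1]) \<in> carrier (stalk F t0)" "res F m t0 (c [m]) \<in> carrier (stalk F t0)"
    using lin_mapsD(1)[OF res_T] T cc \<open>rel t0 m\<close> by blast+
  have al: "(a \<ominus>\<^bsub>stalk F t0\<^esub> b) \<ominus>\<^bsub>stalk F t0\<^esub> ((a \<ominus>\<^bsub>stalk F t0\<^esub> e) \<ominus>\<^bsub>stalk F t0\<^esub> (b \<ominus>\<^bsub>stalk F t0\<^esub> e)) = \<zero>\<^bsub>stalk F t0\<^esub>"
    if "a \<in> carrier (stalk F t0)" "b \<in> carrier (stalk F t0)" "e \<in> carrier (stalk F t0)" for a b e
  proof -
    have "(a \<ominus>\<^bsub>stalk F t0\<^esub> e) \<ominus>\<^bsub>stalk F t0\<^esub> (b \<ominus>\<^bsub>stalk F t0\<^esub> e) = a \<oplus>\<^bsub>stalk F t0\<^esub> (\<ominus>\<^bsub>stalk F t0\<^esub> e \<oplus>\<^bsub>stalk F t0\<^esub> (e \<oplus>\<^bsub>stalk F t0\<^esub> \<ominus>\<^bsub>stalk F t0\<^esub> b))"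
      using that by (simp add: a_minus_def M.minus_add M.a_assoc M.a_comm)
    then have "(a \<ominus>\<^bsub>stalk F t0\<^esub> e) \<ominus>\<^bsub>stalk F t0\<^esub> (b \<ominus>\<^bsub>stalk F t0\<^esub> e) = a \<ominus>\<^bsub>stalk F t0\<^esub> b"
      using that by (simp add: a_minus_def M.r_neg1)
    then show ?thesis using that by (simp add: a_minus_def M.r_neg)
  qed
  show ?case using al[OF cc(3) cl] by (simp add: ts r)
next
  case (Suc n)
  from Suc(2) obtain m ts' where ts: "ts = m # ts'" by (auto simp: chains_def length_Suc_conv)
  have m: "m \<in> S" "m \<in> T" and tl': "ts' \<in> chains {t \<in> T. rel t m} (Suc (Suc n))"
    using Suc(2) by (simp_all add: ts chains_Cons)
  have tl: "ts' \<in> chains S (Suc (Suc n))" using chains_tl Suc(2,3) ts by blast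
  let ?S = "{t \<in> T. rel t m}" and ?c = "\<lambda>vs. c (m # vs)"
  note dn = down_below[OF m(2)]
  have ne: "vs \<noteq> []" if "vs \<in> chains S' k" for vs S' k using that by (auto simp: chains_def)
  have unf: "cob b (m # vs) = b vs \<ominus>\<^bsub>val vs\<^esub> cob (\<lambda>us. b (m # us)) vs" if "vs \<in> chains S' (Suc k)" for b vs S' k
    using that by (cases rule: chain_ind_cases) auto
  interpret M: module Rat "val ts'" by (rule mod_T[OF chains_last_T[OF tl]])
  have cS: "c us \<in> carrier (val us)" if "us \<in> chains ?S (Suc n)" for us
  proof -
    have "us \<in> chains S (Suc n)" using chains_tl[OF Suc(3), of m us] that m by (simp add: chains_Cons)
    then show ?thesis by (rule Suc(4))
  qed
  have cc: "?c us \<in> carrier (val us)" if "us \<in> chains ?S n" for us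
    using Suc(4)[of "m # us"] that m ne[OF that] by (simp add: chains_Cons)
  have "cob (cob c) ts = cob c ts' \<ominus>\<^bsub>val ts'\<^esub> cob (\<lambda>us. cob c (m # us)) ts'"
    using unf[OF tl] by (simp add: ts)
  also have "cob (\<lambda>us. cob c (m # us)) ts' = cob (\<lambda>us. c us \<ominus>\<^bsub>val us\<^esub> cob ?c us) ts'"
    by (rule cob_cong[OF tl' dn]) (rule unf)
  also have "\<dots> = cob c ts' \<ominus>\<^bsub>val ts'\<^esub> cob (cob ?c) ts'"
    by (rule cob_diff[OF tl' dn]) (use cS cob_closed[OF _ dn cc] in auto)
  also have "cob (cob ?c) ts' = \<zero>\<^bsub>val ts'\<^esub>" by (rule Suc(1)[OF tl' dn cc])
  finally have e: "cob (cob c) ts = cob c ts' \<ominus>\<^bsub>val ts'\<^esub> (cob c ts' \<ominus>\<^bsub>val ts'\<^esub> \<zero>\<^bsub>val ts'\<^esub>)" .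
  have "cob c ts' \<in> carrier (val ts')" by (rule cob_closed[OF tl Suc(3)]) (rule Suc(4))
  then have "cob c ts' \<ominus>\<^bsub>val ts'\<^esub> (cob c ts' \<ominus>\<^bsub>val ts'\<^esub> \<zero>\<^bsub>val ts'\<^esub>) = \<zero>\<^bsub>val ts'\<^esub>"
    by (rule minus_minus_zero[OF M.module_axioms])
  then show ?case using ne[OF tl] unfolding e by (simp add: ts)
qed

text \<open>Putting the cone point in front of a chain is a contracting homotopy: expanded at its
  head, the vanishing coboundary of \<open>c\<close> on the longer chain reads \<open>c us\<close>
  minus the coboundary of the coned cochain. Chains may repeat entries, so the cone point may be put
  in front even of a chain that begins with it.\<close>

lemma cocycle_cob:
  assumes S: "coned S m" and c: "\<And>us. us \<in> chains S (Suc n) \<Longrightarrow> c us \<in> carrier (val us)"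
    and z: "\<And>us. us \<in> chains S (Suc (Suc n)) \<Longrightarrow> cob c us = \<zero>\<^bsub>val us\<^esub>"
  shows "\<And>us. us \<in> chains S n \<Longrightarrow> c (m (last us) # us) \<in> carrier (val us)"
    and "\<And>us. us \<in> chains S (Suc n) \<Longrightarrow> cob (\<lambda>vs. c (m (last vs) # vs)) us = c us"
proof -
  have dS: "down S" and m: "\<And>t. t \<in> S \<Longrightarrow> m t \<in> S \<and> rel t (m t)"
    and meq: "\<And>t t'. t \<in> T \<Longrightarrow> t' \<in> S \<Longrightarrow> rel t t' \<Longrightarrow> m t = m t'" using S by (auto simp: coned_def)
  have ml: "m (last us) = m (hd us)" if "us \<in> chains S k" for us k
    using that desc_last_hd desc_last meq by (auto simp: chains_def)
  have ext: "m (last us) # us \<in> chains S (Suc k)" if us: "us \<in> chains S k" for us k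
  proof -
    have "hd us \<in> S" using us by (simp add: chains_def)
    then have "m (hd us) \<in> S" "rel (hd us) (m (hd us))" "hd us \<in> T" using m[of "hd us"] dS by (auto simp: down_def)
    moreover have "m (hd us) \<in> T" using \<open>m (hd us) \<in> S\<close> dS by (auto simp: down_def)
    moreover have "us \<in> chains {t \<in> T. rel t (m (hd us))} k" using calculation us by (simp add: chains_def)
    ultimately show ?thesis by (simp add: chains_Cons ml[OF us])
  qed
  have ne: "us \<noteq> []" if "us \<in> chains S k" for us k using that by (auto simp: chains_def)
  show "c (m (last us) # us) \<in> carrier (val us)" if "us \<in> chains S n" for us
    using c[OF ext[OF that]] ne[OF that] by simp
  show "cob (\<lambda>vs. c (m (last vs) # vs)) us = c us" if us: "us \<in> chains S (Suc n)" for us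
  proof -
    let ?m = "m (last us)"
    interpret M: module Rat "val us" by (rule mod_T[OF chains_last_T[OF us]])
    \<comment> \<open>All faces of \<open>us\<close> lie in one component, where the cone point is
      constant; restricting to that component lets the varying \<open>m (last vs)\<close> be
      replaced by the fixed \<open>?m\<close>.\<close>
    let ?S = "{t \<in> S. m t = ?m}"
    have dS': "down ?S" using dS meq by (auto simp: down_def)
    have uS: "us \<in> chains ?S (Suc n)" using us ml[OF us] by (auto simp: chains_def)
    have "cob (\<lambda>vs. c (m (last vs) # vs)) us = cob (\<lambda>vs. c (?m # vs)) us"
    proof (rule cob_cong[OF uS dS'])
      fix vs assume vs: "vs \<in> chains ?S n"
      then have "vs \<in> chains S n" using chains_mono[of ?S S] by blast
      then have "m (last vs) = ?m" using ml vs by (auto simp: chains_def)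
      then show "c (m (last vs) # vs) = c (?m # vs)" by simp
    qed
    moreover have "cob c (?m # us) = c us \<ominus>\<^bsub>val us\<^esub> cob (\<lambda>vs. c (?m # vs)) us"
      using us by (cases rule: chain_ind_cases) auto
    moreover have "cob c (?m # us) = \<zero>\<^bsub>val us\<^esub>" using z[OF ext[OF us]] ne[OF us] by simp
    moreover have "cob (\<lambda>vs. c (m (last vs) # vs)) us \<in> carrier (val us)"
      by (rule cob_closed[OF us dS]) (use c[OF ext] ne in auto)
    ultimately have "c us = cob (\<lambda>vs. c (m (last vs) # vs)) us"
      by (intro minus_zero_eq[OF M.module_axioms c[OF us]]) simp_all
    then show ?thesis by (rule sym)
  qed
qed

section \<open>The injective resolution by products over chains\<close>

definition bar :: "nat \<Rightarrow> ('p, 'p list \<Rightarrow> 'v) sheaf" where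
  "bar n = \<lparr>stalk = (\<lambda>p. pi_module (chains (region p) n) val),
     res = (\<lambda>q p c. restrict c (chains (region p) n))\<rparr>"

lemma bar_simps:
  "stalk (bar n) p = pi_module (chains (region p) n) val"
  "res (bar n) q p c = restrict c (chains (region p) n)"
  by (simp_all add: bar_def)

lemmas bar_ops = bar_simps pi_module_simps

lemma region_mono: "p \<in> carrier P \<Longrightarrow> q \<in> carrier P \<Longrightarrow> p \<sqsubseteq> q \<Longrightarrow> chains (region p) n \<subseteq> chains (region q) n"
  by (rule chains_mono) (use P_trans T_sub in \<open>unfold region_def, blast\<close>)

lemma val_mod: "us \<in> chains S n \<Longrightarrow> module Rat (val us)"
  by (rule mod_T) (rule chains_last_T)

lemma barD: "c \<in> carrier (stalk (bar n) p) \<Longrightarrow> us \<in> chains (region p) n \<Longrightarrow> c us \<in> carrier (val us)"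
  by (auto simp: bar_ops)

lemma bar_sheaf: "is_sheaf P (bar n)"
proof (rule is_sheafI)
  show "module Rat (stalk (bar n) p)" for p
    unfolding bar_simps by (rule pi_module_module) (rule val_mod)
next
  fix p q assume pq: "p \<in> carrier P" "q \<in> carrier P" "p \<sqsubseteq> q"
  note sub = region_mono[OF pq, of n]
  show "res (bar n) q p \<in> lin_maps (stalk (bar n) q) (stalk (bar n) p)"
    by (rule lin_mapsI) (use sub in \<open>auto simp: bar_ops restrict_def fun_eq_iff subset_iff PiE_iff extensional_def\<close>)
next
  fix p c assume "p \<in> carrier P" "c \<in> carrier (stalk (bar n) p)"
  then show "res (bar n) p p c = c" by (auto simp: bar_ops PiE_restrict)
next
  fix p q r c assume "p \<in> carrier P" "q \<in> carrier P" "r \<in> carrier P" "p \<sqsubseteq> q" "q \<sqsubseteq> r"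
  then show "res (bar n) q p (res (bar n) r q c) = res (bar n) r p c"
    using region_mono[of p q n] by (auto simp: bar_simps restrict_def fun_eq_iff)
qed

definition bar_diff :: "nat \<Rightarrow> 'p \<Rightarrow> ('p list \<Rightarrow> 'v) \<Rightarrow> ('p list \<Rightarrow> 'v)" where
  "bar_diff n p c = (\<lambda>us\<in>chains (region p) (Suc n). cob c us)"

definition bar_aug :: "'p \<Rightarrow> 'v \<Rightarrow> ('p list \<Rightarrow> 'v)" where
  "bar_aug p v = (\<lambda>us\<in>chains (region p) 0. res F p (last us) v)"

lemma bar_diff_hom: "sheaf_hom P (bar n) (bar (Suc n)) (bar_diff n)"
proof (rule sheaf_homI)
  fix p assume p: "p \<in> carrier P"
  note d = down_region[OF p]
  show "bar_diff n p \<in> lin_maps (stalk (bar n) p) (stalk (bar (Suc n)) p)"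
  proof (rule lin_mapsI_comb)
    show "module Rat (stalk (bar n) p)" "module Rat (stalk (bar (Suc n)) p)" by (rule is_sheafD(1)[OF bar_sheaf p])+
    fix c assume c: "c \<in> carrier (stalk (bar n) p)"
    show "bar_diff n p c \<in> carrier (stalk (bar (Suc n)) p)"
      using cob_closed[OF _ d barD[OF c]] by (auto simp: bar_ops bar_diff_def)
    fix c' k assume c': "c' \<in> carrier (stalk (bar n) p)"
    let ?s = "k \<odot>\<^bsub>stalk (bar n) p\<^esub> c \<oplus>\<^bsub>stalk (bar n) p\<^esub> c'"
    show "bar_diff n p ?s = k \<odot>\<^bsub>stalk (bar (Suc n)) p\<^esub> bar_diff n p c \<oplus>\<^bsub>stalk (bar (Suc n)) p\<^esub> bar_diff n p c'" (is "_ = ?r")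
    proof
      fix us
      show "bar_diff n p ?s us = ?r us"
      proof (cases "us \<in> chains (region p) (Suc n)")
        case True
        have "cob ?s us = cob (\<lambda>us. k \<odot>\<^bsub>val us\<^esub> c us \<oplus>\<^bsub>val us\<^esub> c' us) us"
          by (rule cob_cong[OF True d]) (simp add: bar_ops)
        also have "\<dots> = k \<odot>\<^bsub>val us\<^esub> cob c us \<oplus>\<^bsub>val us\<^esub> cob c' us"
          by (rule cob_lin[OF True d barD[OF c] barD[OF c']])
        finally show ?thesis using True by (simp add: bar_ops bar_diff_def)
      qed (simp add: bar_ops bar_diff_def)
    qed
  qed
next
  fix p q c assume pq: "p \<in> carrier P" "q \<in> carrier P" "p \<sqsubseteq> q"
  show "bar_diff n p (res (bar n) q p c) = res (bar (Suc n)) q p (bar_diff n q c)"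
  proof
    fix us
    show "bar_diff n p (res (bar n) q p c) us = res (bar (Suc n)) q p (bar_diff n q c) us"
      using cob_cong[OF _ down_region[OF pq(1)], of us n "restrict c (chains (region p) n)" c] region_mono[OF pq, of "Suc n"]
      by (auto simp: bar_simps bar_diff_def)
  qed
qed

lemma chains_0_region: "us \<in> chains (region p) 0 \<longleftrightarrow> (\<exists>t\<in>T. t \<sqsubseteq> p \<and> us = [t])"
proof -
  have "chains (region p) 0 = (\<lambda>t. [t]) ` region p" by (rule chains_0) (auto simp: region_def)
  then show ?thesis by (auto simp: region_def)
qed

lemma bar_aug_hom: "sheaf_hom P F (bar 0) bar_aug"
proof (rule sheaf_homI)
  fix p assume p: "p \<in> carrier P"
  have l: "res F p t \<in> lin_maps (stalk F p) (stalk F t)" if "t \<in> T" "t \<sqsubseteq> p" for t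
    using is_sheafD(2)[OF sheaf _ p] T_sub that by blast
  show "bar_aug p \<in> lin_maps (stalk F p) (stalk (bar 0) p)"
    by (rule lin_mapsI)
      (auto simp: bar_ops bar_aug_def chains_0_region lin_mapsD[OF l] fun_eq_iff restrict_def)
next
  fix p q v assume pq: "p \<in> carrier P" "q \<in> carrier P" "p \<sqsubseteq> q" "v \<in> carrier (stalk F q)"
  have "res F p t (res F q p v) = res F q t v" if "t \<in> T" "t \<sqsubseteq> p" for t
    using is_sheafD(4)[OF sheaf _ pq(1,2) that(2) pq(3,4)] T_sub that by blast
  then have "res F p (last us) (res F q p v) = res F q (last us) v" if "us \<in> chains (region p) 0" for us
    using that by (auto simp: chains_0_region)
  then show "bar_aug p (res F q p v) = res (bar 0) q p (bar_aug q v)"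
    using region_mono[OF pq(1-3), of 0] by (intro ext) (auto simp: bar_simps bar_aug_def)
qed

lemma bar_diff_bar_diff:
  assumes "p \<in> carrier P" "c \<in> carrier (stalk (bar n) p)"
  shows "bar_diff (Suc n) p (bar_diff n p c) = \<zero>\<^bsub>stalk (bar (Suc (Suc n))) p\<^esub>"
proof
  fix us
  note d = down_region[OF assms(1)]
  show "bar_diff (Suc n) p (bar_diff n p c) us = \<zero>\<^bsub>stalk (bar (Suc (Suc n))) p\<^esub> us"
  proof (cases "us \<in> chains (region p) (Suc (Suc n))")
    case True
    have "cob (bar_diff n p c) us = cob (cob c) us"
      by (rule cob_cong[OF True d]) (simp add: bar_diff_def)
    also have "\<dots> = \<zero>\<^bsub>val us\<^esub>" by (rule cob_cob[OF True d barD[OF assms(2)]])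
    finally show ?thesis using True by (simp add: bar_ops bar_diff_def)
  qed (simp add: bar_ops bar_diff_def)
qed

text \<open>In degree zero, injectivity of the augmentation is \<open>separated\<close> and the
  description of its image is \<open>glue\<close>, since a 0-cocycle is a compatible family. In
  higher degrees the components of the region below \<open>p\<close> have the cone points given by
  \<open>peak p\<close>.\<close>

lemma bar_resolution: "resolution P F bar_aug bar bar_diff \<infinity>"
proof (rule resolution_infinityI[OF sheaf bar_sheaf bar_aug_hom bar_diff_hom])
  fix p assume p: "p \<in> carrier P"
  interpret M: module Rat "stalk F p" by (rule is_sheafD(1)[OF sheaf p])
  have l: "res F p t \<in> lin_maps (stalk F p) (stalk F t)" if "t \<in> T" "t \<sqsubseteq> p" for t
    using is_sheafD(2)[OF sheaf _ p] T_sub that by blast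
  show "inj_on (bar_aug p) (carrier (stalk F p))"
  proof (rule inj_onI)
    fix v w assume vw: "v \<in> carrier (stalk F p)" "w \<in> carrier (stalk F p)" "bar_aug p v = bar_aug p w"
    have "v \<ominus>\<^bsub>stalk F p\<^esub> w = \<zero>\<^bsub>stalk F p\<^esub>"
    proof (rule separated[OF p])
      show "v \<ominus>\<^bsub>stalk F p\<^esub> w \<in> carrier (stalk F p)" using vw by simp
      fix t assume t: "t \<in> T" "t \<sqsubseteq> p"
      interpret N: module Rat "stalk F t" by (rule mod_T[OF t(1)])
      have "bar_aug p v [t] = bar_aug p w [t]" using vw by simp
      then have "res F p t v = res F p t w" using t by (simp add: bar_aug_def chains_0_region)
      then show "res F p t (v \<ominus>\<^bsub>stalk F p\<^esub> w) = \<zero>\<^bsub>stalk F t\<^esub>"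
        using lin_maps_minus[OF l[OF t] M.module_axioms N.module_axioms vw(1,2)] lin_mapsD(1)[OF l[OF t] vw(2)]
        by (simp add: a_minus_def N.r_neg)
    qed
    then show "v = w" using minus_zero_eq[OF M.module_axioms] vw by blast
  qed
  show "bar_aug p ` carrier (stalk F p) = {v \<in> carrier (stalk (bar 0) p). bar_diff 0 p v = \<zero>\<^bsub>stalk (bar (Suc 0)) p\<^esub>}" (is "?A = ?B")
  proof
    show "?A \<subseteq> ?B"
    proof
      fix c assume "c \<in> ?A"
      then obtain v where v: "v \<in> carrier (stalk F p)" "c = bar_aug p v" by blast
      have "cob c us = \<zero>\<^bsub>val us\<^esub>" if us: "us \<in> chains (region p) (Suc 0)" for us
        using us
      proof (cases rule: chain_ind_cases)
        case (two t1 t0)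
        then have r: "t1 \<sqsubseteq> p" "t0 \<sqsubseteq> t1" using rel_le by (auto simp: region_def)
        have r0: "t0 \<sqsubseteq> p" using chains_last[OF down_region[OF p] us] two by (simp add: region_def)
        interpret N: module Rat "stalk F t0" by (rule mod_T) (rule two)
        have "res F t1 t0 (res F p t1 v) = res F p t0 v"
          using is_sheafD(4)[OF sheaf _ _ p r(2,1) v(1)] two T_sub by blast
        moreover have "res F p t0 v \<in> carrier (stalk F t0)" using lin_mapsD(1)[OF l[OF two(5) r0] v(1)] .
        ultimately show ?thesis using two r r0 by (simp add: v bar_aug_def chains_0_region a_minus_def N.r_neg)
      qed simp
      then have "bar_diff 0 p c = \<zero>\<^bsub>stalk (bar (Suc 0)) p\<^esub>"
        by (intro ext) (simp add: bar_diff_def bar_ops)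
      then show "c \<in> ?B" using sheaf_homD(3)[OF bar_aug_hom p v(1)] v(2) by simp
    qed
    show "?B \<subseteq> ?A"
    proof
      fix c assume c: "c \<in> ?B"
      then have cc: "c \<in> carrier (stalk (bar 0) p)" by simp
      have z: "cob c us = \<zero>\<^bsub>val us\<^esub>" if us: "us \<in> chains (region p) (Suc 0)" for us
      proof -
        have "bar_diff 0 p c us = \<zero>\<^bsub>stalk (bar (Suc 0)) p\<^esub> us" using c by simp
        then show ?thesis using us by (simp add: bar_diff_def bar_ops)
      qed
      have "\<exists>v\<in>carrier (stalk F p). \<forall>t\<in>T. t \<sqsubseteq> p \<longrightarrow> res F p t v = c [t]"
      proof (rule glue[OF p])
        show ct: "c [t] \<in> carrier (stalk F t)" if "t \<in> T" "t \<sqsubseteq> p" for t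
          using barD[OF cc, of "[t]"] that by (simp add: chains_0_region)
        fix t t' assume t: "t \<in> T" "t' \<in> T" "rel t t'" "t' \<sqsubseteq> p"
        have tp: "t \<sqsubseteq> p" using down_region[OF p] t by (auto simp: down_def region_def)
        have "[t', t] \<in> chains (region p) (Suc 0)" using t by (simp add: chains_def region_def)
        from z[OF this] have "c [t] \<ominus>\<^bsub>stalk F t\<^esub> res F t' t (c [t']) = \<zero>\<^bsub>stalk F t\<^esub>" by simp
        then show "res F t' t (c [t']) = c [t]"
          using minus_zero_eq[OF mod_T[OF t(1)] ct[OF t(1) tp] lin_mapsD(1)[OF res_T[OF t(1-3)] ct[OF t(2,4)]]] by simp
      qed
      then obtain v where v: "v \<in> carrier (stalk F p)" "\<forall>t\<in>T. t \<sqsubseteq> p \<longrightarrow> res F p t v = c [t]" by blast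
      have "c = bar_aug p v"
      proof
        fix us
        show "c us = bar_aug p v us"
        proof (cases "us \<in> chains (region p) 0")
          case True
          then show ?thesis using v(2) by (auto simp: bar_aug_def chains_0_region)
        next
          case False
          then show ?thesis using cc by (auto simp: bar_aug_def bar_ops PiE_def extensional_def)
        qed
      qed
      then show "c \<in> ?A" using v(1) by blast
    qed
  qed
  fix n
  show "bar_diff n p ` carrier (stalk (bar n) p) =
     {v \<in> carrier (stalk (bar (Suc n)) p). bar_diff (Suc n) p v = \<zero>\<^bsub>stalk (bar (Suc (Suc n))) p\<^esub>}" (is "?A = ?B")
  proof
    show "?A \<subseteq> ?B" using bar_diff_bar_diff[OF p] sheaf_homD(3)[OF bar_diff_hom p] by blast
    show "?B \<subseteq> ?A"
    proof
      fix c assume c: "c \<in> ?B"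
      then have cc: "c \<in> carrier (stalk (bar (Suc n)) p)" by simp
      have z: "cob c us = \<zero>\<^bsub>val us\<^esub>" if us: "us \<in> chains (region p) (Suc (Suc n))" for us
      proof -
        have "bar_diff (Suc n) p c us = \<zero>\<^bsub>stalk (bar (Suc (Suc n))) p\<^esub> us" using c by simp
        then show ?thesis using us by (simp add: bar_diff_def bar_ops)
      qed
      have *: "\<And>us. us \<in> chains (region p) n \<Longrightarrow> c (peak p (last us) # us) \<in> carrier (val us)"
      "\<And>us. us \<in> chains (region p) (Suc n) \<Longrightarrow> cob (\<lambda>vs. c (peak p (last vs) # vs)) us = c us"
      by (rule cocycle_cob[OF coned_region[OF p], of n c]; simp add: barD[OF cc] z)+
      define b where "b = (\<lambda>us\<in>chains (region p) n. c (peak p (last us) # us))"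
      have "b \<in> carrier (stalk (bar n) p)" using *(1) by (auto simp: b_def bar_ops)
      moreover have "bar_diff n p b = c"
      proof
        fix us
        show "bar_diff n p b us = c us"
        proof (cases "us \<in> chains (region p) (Suc n)")
          case True
          have "cob b us = cob (\<lambda>vs. c (peak p (last vs) # vs)) us"
            by (rule cob_cong[OF True down_region[OF p]]) (simp add: b_def)
          then show ?thesis using *(2)[OF True] True by (simp add: bar_diff_def)
        next
          case False
          then show ?thesis using cc by (auto simp: bar_diff_def bar_ops PiE_def extensional_def)
        qed
      qed
      ultimately show "c \<in> ?A" by blast
    qed
  qed
qed

text \<open>The factor of a chain is present over \<open>p\<close> exactly when the head of the
  chain lies below \<open>p\<close>: it is the direct image of one vector space from the point
  \<open>hd us\<close>. A map into it is the same as a linear map on the stalk at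
  \<open>hd us\<close>, and linear maps extend.\<close>

lemma bar_injective: "injective_sheaf P (bar n)"
  unfolding injective_sheaf_def
proof (intro conjI allI impI bar_sheaf, elim conjE)
  fix A B :: "('p, 'p list \<Rightarrow> 'v) sheaf" and m f
  assume A: "is_sheaf P A" and B: "is_sheaf P B" and m: "sheaf_hom P A B m" and f: "sheaf_hom P A (bar n) f"
    and inj: "\<forall>p\<in>carrier P. inj_on (m p) (carrier (stalk A p))"
  define Ch where "Ch = chains T n"
  have hd_T: "hd us \<in> carrier P" if "us \<in> Ch" for us using that T_sub by (auto simp: Ch_def chains_def)
  have self: "us \<in> chains (region (hd us)) n" if "us \<in> Ch" for us
    using that P_refl hd_T[OF that] by (auto simp: Ch_def chains_def region_def)
  have flin: "(\<lambda>a. f (hd us) a us) \<in> lin_maps (stalk A (hd us)) (val us)" if "us \<in> Ch" for us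
    using lin_mapsD[OF sheaf_homD(1)[OF f hd_T[OF that]]] self[OF that] barD[OF _ self[OF that]]
    by (intro lin_mapsI) (simp_all add: bar_ops)
  have "\<exists>h\<in>lin_maps (stalk B (hd us)) (val us). \<forall>a\<in>carrier (stalk A (hd us)). h (m (hd us) a) = f (hd us) a us"
    if us: "us \<in> Ch" for us
  proof (rule linear_factor[OF is_sheafD(1)[OF A hd_T[OF us]] is_sheafD(1)[OF B hd_T[OF us]] val_mod[OF self[OF us]]
        sheaf_homD(1)[OF m hd_T[OF us]] flin[OF us]])
    fix a assume a: "a \<in> carrier (stalk A (hd us))" "m (hd us) a = \<zero>\<^bsub>stalk B (hd us)\<^esub>"
    have z: "\<zero>\<^bsub>stalk A (hd us)\<^esub> \<in> carrier (stalk A (hd us))"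
      by (rule submoduleD(2)[OF is_sheafD(1)[OF A hd_T[OF us]] carrier_submodule[OF is_sheafD(1)[OF A hd_T[OF us]]]])
    have "a = \<zero>\<^bsub>stalk A (hd us)\<^esub>"
      using inj_onD[OF inj[rule_format, OF hd_T[OF us]] _ a(1) z] a(2) sheaf_hom_zero_ker[OF A B m hd_T[OF us]] by simp
    then show "f (hd us) a us = \<zero>\<^bsub>val us\<^esub>"
      using lin_maps_zero[OF flin[OF us] is_sheafD(1)[OF A hd_T[OF us]] val_mod[OF self[OF us]]] by simp
  qed
  then have "\<forall>us\<in>Ch. \<exists>h. h \<in> lin_maps (stalk B (hd us)) (val us) \<and> (\<forall>a\<in>carrier (stalk A (hd us)). h (m (hd us) a) = f (hd us) a us)"
    by blast
  then obtain h where h: "\<forall>us\<in>Ch. h us \<in> lin_maps (stalk B (hd us)) (val us) \<and> (\<forall>a\<in>carrier (stalk A (hd us)). h us (m (hd us) a) = f (hd us) a us)"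
    by (rule bchoice[THEN exE])
  then have hl: "h us \<in> lin_maps (stalk B (hd us)) (val us)"
    and hm: "a \<in> carrier (stalk A (hd us)) \<Longrightarrow> h us (m (hd us) a) = f (hd us) a us" if "us \<in> Ch" for us a
    using that by blast+
  define g where "g p b = (\<lambda>us\<in>chains (region p) n. h us (res B p (hd us) b))" for p b
  have inCh: "us \<in> Ch" "hd us \<sqsubseteq> p" if "us \<in> chains (region p) n" for us p
    using that by (auto simp: Ch_def chains_def region_def)
  have rl: "res B p (hd us) \<in> lin_maps (stalk B p) (stalk B (hd us))" if "p \<in> carrier P" "us \<in> chains (region p) n" for us p
    using is_sheafD(2)[OF B hd_T[OF inCh(1)[OF that(2)]] that(1) inCh(2)[OF that(2)]] .
  have "sheaf_hom P B (bar n) g"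
  proof (rule sheaf_homI)
    fix p assume p: "p \<in> carrier P"
    note hr = lin_maps_comp[OF rl[OF p] hl[OF inCh(1)]]
    show "g p \<in> lin_maps (stalk B p) (stalk (bar n) p)"
      by (rule lin_mapsI) (auto simp: g_def bar_ops fun_eq_iff restrict_def lin_mapsD[OF hr])
  next
    fix p q b assume pq: "p \<in> carrier P" "q \<in> carrier P" "p \<sqsubseteq> q" "b \<in> carrier (stalk B q)"
    have "res B p (hd us) (res B q p b) = res B q (hd us) b" if "us \<in> chains (region p) n" for us
      using is_sheafD(4)[OF B hd_T[OF inCh(1)[OF that]] pq(1,2) inCh(2)[OF that] pq(3,4)] .
    then show "g p (res B q p b) = res (bar n) q p (g q b)"
      using region_mono[OF pq(1-3), of n] by (intro ext) (auto simp: g_def bar_simps)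
  qed
  moreover have "g p (m p a) = f p a" if p: "p \<in> carrier P" and a: "a \<in> carrier (stalk A p)" for p a
  proof
    fix us
    show "g p (m p a) us = f p a us"
    proof (cases "us \<in> chains (region p) n")
      case True
      note hp = hd_T[OF inCh(1)[OF True]] and le = inCh(2)[OF True]
      have "g p (m p a) us = h us (m (hd us) (res A p (hd us) a))"
        using True sheaf_homD(2)[OF m hp p le a] by (simp add: g_def)
      also have "\<dots> = f (hd us) (res A p (hd us) a) us"
        by (rule hm[OF inCh(1)[OF True]]) (rule lin_mapsD(1)[OF is_sheafD(2)[OF A hp p le] a])
      also have "\<dots> = f p a us" using sheaf_homD(2)[OF f hp p le a] self[OF inCh(1)[OF True]] by (simp add: bar_simps)
      finally show ?thesis .
    next
      case False
      then show ?thesis using sheaf_homD(3)[OF f p a] by (auto simp: g_def bar_ops PiE_def extensional_def)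
    qed
  qed
  ultimately show "\<exists>g. sheaf_hom P B (bar n) g \<and> (\<forall>p\<in>carrier P. \<forall>a\<in>carrier (stalk A p). g p (m p a) = f p a)"
    by blast
qed

text \<open>A global section of \<open>bar\<close> is the same thing as one cochain on all chains of
  \<open>T\<close>, so global cocycles are bounded by coning over \<open>gpeak\<close>.\<close>

theorem acyclic: "gamma_acyclic P F"
proof (rule gamma_acyclicI[OF bar_resolution bar_injective])
  fix k s assume s: "s \<in> carrier (sections P (bar (Suc k)))"
    and z: "\<And>p. p \<in> carrier P \<Longrightarrow> bar_diff (Suc k) p (s p) = \<zero>\<^bsub>stalk (bar (Suc (Suc k))) p\<^esub>"
  \<comment> \<open>The component at a chain can be read off over its own head, the smallest place
    where it occurs; by compatibility it is the same everywhere.\<close>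
  define c where "c us = s (hd us) us" for us
  have cs: "s p us = c us" if "p \<in> carrier P" "us \<in> chains (region p) n" for p us n
  proof -
    have hd: "hd us \<in> carrier P" "hd us \<sqsubseteq> p" "us \<in> chains (region (hd us)) n"
      using that T_sub P_refl by (auto simp: chains_def region_def)
    show ?thesis
    proof (cases "n = Suc k")
      case True
      have "s (hd us) = res (bar (Suc k)) p (hd us) (s p)" using sectionsD(2)[OF s hd(1) that(1) hd(2)] by simp
      then show ?thesis using hd True by (simp add: c_def bar_simps)
    next
      \<comment> \<open>Chains of another length lie outside the index set of the product, so both
        sides are \<open>undefined\<close>.\<close>
      case False
      then have "us \<notin> chains (region q) (Suc k)" for q using that(2) by (auto simp: chains_def)
      then show ?thesis using sectionsD(1)[OF s that(1)] sectionsD(1)[OF s hd(1)]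
        by (auto simp: c_def bar_ops PiE_def extensional_def)
    qed
  qed
  have hdT: "hd us \<in> carrier P" "us \<in> chains (region (hd us)) n" if "us \<in> chains T n" for us n
    using that T_sub P_refl by (auto simp: chains_def region_def)
  have cc: "c us \<in> carrier (val us)" if "us \<in> chains T (Suc k)" for us
    unfolding c_def by (rule barD[OF sectionsD(1)[OF s hdT(1)[OF that]] hdT(2)[OF that]])
  have cz: "cob c us = \<zero>\<^bsub>val us\<^esub>" if us: "us \<in> chains T (Suc (Suc k))" for us
  proof -
    have "bar_diff (Suc k) (hd us) (s (hd us)) us = \<zero>\<^bsub>stalk (bar (Suc (Suc k))) (hd us)\<^esub> us"
      using z[OF hdT(1)[OF us]] by simp
    then have "cob (s (hd us)) us = \<zero>\<^bsub>val us\<^esub>" using hdT(2)[OF us] by (simp add: bar_diff_def bar_ops)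
    moreover have "cob (s (hd us)) us = cob c us"
      by (rule cob_cong[OF hdT(2)[OF us] down_region[OF hdT(1)[OF us]]]) (rule cs[OF hdT(1)[OF us]])
    ultimately show ?thesis by simp
  qed
  have *: "\<And>us. us \<in> chains T k \<Longrightarrow> c (gpeak (last us) # us) \<in> carrier (val us)"
    "\<And>us. us \<in> chains T (Suc k) \<Longrightarrow> cob (\<lambda>vs. c (gpeak (last vs) # vs)) us = c us"
    by (rule cocycle_cob[OF coned_T, of k c]; simp add: cc cz)+
  define b where "b us = c (gpeak (last us) # us)" for us
  define t where "t = (\<lambda>p\<in>carrier P. \<lambda>us\<in>chains (region p) k. b us)"
  have regT: "chains (region p) n \<subseteq> chains T n" for p n by (rule chains_mono) (auto simp: region_def)
  have "t \<in> carrier (sections P (bar k))" unfolding t_def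
  proof (rule sectionsI)
    fix p assume "p \<in> carrier P"
    show "(\<lambda>us\<in>chains (region p) k. b us) \<in> carrier (stalk (bar k) p)"
      using *(1) regT[of p k] by (auto simp: bar_ops b_def)
  next
    fix p q assume "p \<in> carrier P" "q \<in> carrier P" "p \<sqsubseteq> q"
    from region_mono[OF this, of k]
    show "res (bar k) q p (\<lambda>us\<in>chains (region q) k. b us) = (\<lambda>us\<in>chains (region p) k. b us)"
      by (auto simp: bar_simps fun_eq_iff restrict_def)
  qed
  moreover have "s p = bar_diff k p (t p)" if p: "p \<in> carrier P" for p
  proof
    fix us
    show "s p us = bar_diff k p (t p) us"
    proof (cases "us \<in> chains (region p) (Suc k)")
      case True
      have "cob (t p) us = cob (\<lambda>vs. c (gpeak (last vs) # vs)) us"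
        by (rule cob_cong[OF True down_region[OF p]]) (simp add: t_def p b_def)
      also have "\<dots> = c us" by (rule *(2)) (rule subsetD[OF regT True])
      finally show ?thesis using cs[OF p True] True by (simp add: bar_diff_def)
    next
      case False
      then show ?thesis using sectionsD(1)[OF s p] by (auto simp: bar_diff_def bar_ops PiE_def extensional_def)
    qed
  qed
  ultimately show "\<exists>t\<in>carrier (sections P (bar k)). \<forall>p\<in>carrier P. s p = bar_diff k p (t p)" by blast
qed

end

section \<open>Ranks in finite posets\<close>

definition poset :: "'p gorder \<Rightarrow> bool" where
  "poset P \<longleftrightarrow> eq P = (=) \<and> (\<forall>x\<in>carrier P. x \<sqsubseteq>\<^bsub>P\<^esub> x)
    \<and> (\<forall>x\<in>carrier P. \<forall>y\<in>carrier P. x \<sqsubseteq>\<^bsub>P\<^esub> y \<longrightarrow> y \<sqsubseteq>\<^bsub>P\<^esub> x \<longrightarrow> x = y)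
    \<and> (\<forall>x\<in>carrier P. \<forall>y\<in>carrier P. \<forall>z\<in>carrier P. x \<sqsubseteq>\<^bsub>P\<^esub> y \<longrightarrow> y \<sqsubseteq>\<^bsub>P\<^esub> z \<longrightarrow> x \<sqsubseteq>\<^bsub>P\<^esub> z)"

lemma posetD:
  assumes "poset P"
  shows "\<And>x. x \<in> carrier P \<Longrightarrow> x \<sqsubseteq>\<^bsub>P\<^esub> x"
    and "\<And>x y. x \<in> carrier P \<Longrightarrow> y \<in> carrier P \<Longrightarrow> x \<sqsubseteq>\<^bsub>P\<^esub> y \<Longrightarrow> y \<sqsubseteq>\<^bsub>P\<^esub> x \<Longrightarrow> x = y"
    and "\<And>x y z. x \<in> carrier P \<Longrightarrow> y \<in> carrier P \<Longrightarrow> z \<in> carrier P \<Longrightarrow> x \<sqsubseteq>\<^bsub>P\<^esub> y \<Longrightarrow> y \<sqsubseteq>\<^bsub>P\<^esub> z \<Longrightarrow> x \<sqsubseteq>\<^bsub>P\<^esub> z"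
    and "\<And>x y. x \<sqsubset>\<^bsub>P\<^esub> y \<longleftrightarrow> x \<sqsubseteq>\<^bsub>P\<^esub> y \<and> x \<noteq> y"
proof -
  note q = assms[unfolded poset_def]
  note e = q[THEN conjunct1] and r = q[THEN conjunct2, THEN conjunct1]
    and a = q[THEN conjunct2, THEN conjunct2, THEN conjunct1] and t = q[THEN conjunct2, THEN conjunct2, THEN conjunct2]
  show "x \<sqsubseteq>\<^bsub>P\<^esub> x" if "x \<in> carrier P" for x using r that by blast
  show "x = y" if "x \<in> carrier P" "y \<in> carrier P" "x \<sqsubseteq>\<^bsub>P\<^esub> y" "y \<sqsubseteq>\<^bsub>P\<^esub> x" for x y using a that by blast
  show "x \<sqsubseteq>\<^bsub>P\<^esub> z" if "x \<in> carrier P" "y \<in> carrier P" "z \<in> carrier P" "x \<sqsubseteq>\<^bsub>P\<^esub> y" "y \<sqsubseteq>\<^bsub>P\<^esub> z" for x y z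
    using t that by blast
  show "x \<sqsubset>\<^bsub>P\<^esub> y \<longleftrightarrow> x \<sqsubseteq>\<^bsub>P\<^esub> y \<and> x \<noteq> y" for x y by (simp add: lless_def e)
qed

lemma is_lub_iff:
  "is_lub P s B \<longleftrightarrow> s \<in> carrier P \<and> (\<forall>x\<in>B \<inter> carrier P. x \<sqsubseteq>\<^bsub>P\<^esub> s)
     \<and> (\<forall>u\<in>carrier P. (\<forall>x\<in>B \<inter> carrier P. x \<sqsubseteq>\<^bsub>P\<^esub> u) \<longrightarrow> s \<sqsubseteq>\<^bsub>P\<^esub> u)"
  by (auto simp: least_def Upper_def)

lemma poset_bottom_eq:
  assumes "poset P" "b \<in> carrier P" "\<And>x. x \<in> carrier P \<Longrightarrow> b \<sqsubseteq>\<^bsub>P\<^esub> x"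
  shows "\<bottom>\<^bsub>P\<^esub> = b"
  unfolding bottom_def
  by (rule some_equality) (use assms posetD(2)[OF assms(1)] in \<open>auto simp: least_def\<close>)

text \<open>Strict monotonicity bounds the length of chains below \<open>x\<close> by
  \<open>\<rho> x\<close>, and \<open>pred\<close> builds a chain of that length. Together they
  identify \<open>\<rho>\<close> with \<open>rank\<close>, so ranks are known without evaluating the
  maximum in their definition. The same \<open>\<rho>\<close> works on every principal
  ideal.\<close>

locale ranked =
  fixes P :: "'p gorder" (structure) and \<rho> :: "'p \<Rightarrow> nat"
  assumes poset: "poset P" and fin: "finite (carrier P)"
    and mono: "x \<in> carrier P \<Longrightarrow> y \<in> carrier P \<Longrightarrow> x \<sqsubseteq> y \<Longrightarrow> x \<noteq> y \<Longrightarrow> \<rho> x < \<rho> y"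
    and pred: "x \<in> carrier P \<Longrightarrow> 0 < \<rho> x \<Longrightarrow> \<exists>y\<in>carrier P. y \<sqsubseteq> x \<and> y \<noteq> x \<and> Suc (\<rho> y) = \<rho> x"
begin

lemma chain_exists:
  "x \<in> carrier P \<Longrightarrow> \<rho> x = n \<Longrightarrow> \<exists>C \<subseteq> carrier (poset_below P x).
     (\<forall>u\<in>C. \<forall>v\<in>C. u \<sqsubseteq> v \<or> v \<sqsubseteq> u) \<and> card C = Suc n"
proof (induction n arbitrary: x)
  case 0
  then show ?case by (intro exI[of _ "{x}"]) (auto simp: poset_below_def posetD[OF poset])
next
  case (Suc n)
  then obtain y where y: "y \<in> carrier P" "y \<sqsubseteq> x" "y \<noteq> x" "\<rho> y = n" using pred[of x] by auto
  then obtain C where C: "C \<subseteq> carrier (poset_below P y)" "\<forall>u\<in>C. \<forall>v\<in>C. u \<sqsubseteq> v \<or> v \<sqsubseteq> u" "card C = Suc n"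
    using Suc(1)[OF y(1,4)] by blast
  have Cy: "u \<in> carrier P" "u \<sqsubseteq> y" "u \<sqsubseteq> x" if "u \<in> C" for u
    using C(1) that y posetD(3)[OF poset _ y(1) Suc(2) _ y(2)] by (auto simp: poset_below_def)
  have "x \<notin> C" using Cy y posetD(2)[OF poset] by blast
  moreover have "finite C" using C(3) card.infinite by fastforce
  ultimately have "card (insert x C) = Suc (Suc n)" using C(3) by simp
  then show ?case using Cy C(2) Suc(2) posetD(1)[OF poset]
    by (intro exI[of _ "insert x C"]) (auto simp: poset_below_def)
qed

lemma rank_eq:
  assumes "x \<in> carrier P"
  shows "rank P x = \<rho> x"
proof -
  let ?S = "{card C - 1 | C. C \<subseteq> carrier (poset_below P x) \<and> (\<forall>u\<in>C. \<forall>v\<in>C. u \<sqsubseteq> v \<or> v \<sqsubseteq> u)}"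
  have bd: "card C - 1 \<le> \<rho> x"
    if C: "C \<subseteq> carrier (poset_below P x)" "\<forall>u\<in>C. \<forall>v\<in>C. u \<sqsubseteq> v \<or> v \<sqsubseteq> u" for C
  proof -
    have CP: "u \<in> carrier P" "u \<sqsubseteq> x" if "u \<in> C" for u using C(1) that by (auto simp: poset_below_def)
    have "inj_on \<rho> C" using C(2) CP mono by (intro inj_onI) (metis less_irrefl)
    moreover have "\<rho> ` C \<subseteq> {..\<rho> x}"
    proof
      fix n assume "n \<in> \<rho> ` C"
      then obtain u where u: "u \<in> C" "n = \<rho> u" by blast
      then show "n \<in> {..\<rho> x}" using mono[of u x] CP[of u] assms by (cases "u = x") auto
    qed
    ultimately have "card C \<le> card {..\<rho> x}" using card_inj_on_le by blast
    then show ?thesis by simp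
  qed
  have "?S \<subseteq> {..\<rho> x}" using bd by auto
  then have "finite ?S" using finite_subset by blast
  moreover obtain C where "C \<subseteq> carrier (poset_below P x)" "\<forall>u\<in>C. \<forall>v\<in>C. u \<sqsubseteq> v \<or> v \<sqsubseteq> u" "card C = Suc (\<rho> x)"
    using chain_exists[OF assms refl] by blast
  then have "\<rho> x \<in> ?S" by (intro CollectI exI[of _ C]) simp
  ultimately show ?thesis unfolding rank_def using bd by (intro Max_eqI) auto
qed

lemma below_simps:
  "carrier (poset_below P x) = {z \<in> carrier P. z \<sqsubseteq> x}" "u \<sqsubseteq>\<^bsub>poset_below P x\<^esub> v \<longleftrightarrow> u \<sqsubseteq> v"
  "u \<sqsubset>\<^bsub>poset_below P x\<^esub> v \<longleftrightarrow> u \<sqsubset> v"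
  by (simp_all add: poset_below_def lless_def)

lemma ranked_below:
  assumes "x \<in> carrier P"
  shows "ranked (poset_below P x) \<rho>"
proof
  show "poset (poset_below P x)"
    using poset unfolding poset_def by (simp add: poset_below_def) blast
  show "finite (carrier (poset_below P x))" using fin by (simp add: below_simps)
  show "\<rho> u < \<rho> v" if "u \<in> carrier (poset_below P x)" "v \<in> carrier (poset_below P x)" "u \<sqsubseteq>\<^bsub>poset_below P x\<^esub> v" "u \<noteq> v" for u v
    using that mono by (simp add: below_simps)
  show "\<exists>y\<in>carrier (poset_below P x). y \<sqsubseteq>\<^bsub>poset_below P x\<^esub> u \<and> y \<noteq> u \<and> Suc (\<rho> y) = \<rho> u"
    if "u \<in> carrier (poset_below P x)" "0 < \<rho> u" for u
    using that pred[of u] posetD(3)[OF poset _ _ assms] by (simp add: below_simps) blast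
qed

end

section \<open>Geometric lattices\<close>

inductive satchain :: "'a gorder \<Rightarrow> 'a \<Rightarrow> nat \<Rightarrow> 'a \<Rightarrow> bool" for L where
  base: "x \<in> carrier L \<Longrightarrow> satchain L x 0 x"
| step: "covers L x y \<Longrightarrow> satchain L y n z \<Longrightarrow> satchain L x (Suc n) z"

inductive_cases satchain_0E: "satchain L x 0 z"
inductive_cases satchain_SucE: "satchain L x (Suc n) z"

lemma satchain_snoc: "satchain L x n y \<Longrightarrow> covers L y z \<Longrightarrow> satchain L x (Suc n) z"
proof (induction rule: satchain.induct)
  case (base x)
  then show ?case by (meson covers_def satchain.intros)
qed (auto intro: satchain.step)

lemma satchain_trans: "satchain L x n y \<Longrightarrow> satchain L y m z \<Longrightarrow> satchain L x (n + m) z"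
  by (induction rule: satchain.induct) (auto intro: satchain.step)

lemma satchain_lastE:
  "satchain L x (Suc n) z \<Longrightarrow> \<exists>y. satchain L x n y \<and> covers L y z"
proof (induction n arbitrary: x)
  case 0
  then obtain y where y: "covers L x y" "satchain L y 0 z" by (auto elim: satchain_SucE)
  then have "y = z" by (auto elim: satchain_0E)
  moreover have "satchain L x 0 x" using y(1) by (intro satchain.base) (simp add: covers_def)
  ultimately show ?case using y(1) by blast
next
  case (Suc n)
  then obtain y where "covers L x y" "satchain L y (Suc n) z" by (auto elim: satchain_SucE)
  then show ?case using Suc(1) by (meson satchain.step)
qed

locale geom_lattice =
  fixes L :: "'a gorder" (structure)
  assumes geom: "geometric_lattice L"
begin

sublocale lat: Lattice.lattice L
  using geom by (simp add: geometric_lattice_def)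

lemma finL: "finite (carrier L)" and neL: "carrier L \<noteq> {}"
  using geom by (simp_all add: geometric_lattice_def)

lemma posL: "poset L"
  unfolding poset_def using lat.eq_is_equal lat.le_antisym lat.le_trans lat.le_refl by blast

lemmas L_refl = posetD(1)[OF posL] and L_antisym = posetD(2)[OF posL]
  and L_trans = posetD(3)[OF posL] and L_less = posetD(4)[OF posL]

lemma bottom: "\<bottom> \<in> carrier L" "x \<in> carrier L \<Longrightarrow> \<bottom> \<sqsubseteq> x"
proof -
  obtain b where "greatest L b (Lower L (carrier L))"
    using lat.finite_inf_greatest[OF finL subset_refl neL] by blast
  then have "least L b (carrier L)" by (auto simp: greatest_def least_def Lower_def)
  then have "least L \<bottom> (carrier L)" unfolding bottom_def by (rule someI)
  then show "\<bottom> \<in> carrier L" "x \<in> carrier L \<Longrightarrow> \<bottom> \<sqsubseteq> x" by (auto simp: least_def)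
qed

lemma le_bottom: "x \<in> carrier L \<Longrightarrow> x \<sqsubseteq> \<bottom> \<Longrightarrow> x = \<bottom>"
  using L_antisym[OF _ bottom(1) _ bottom(2)] by simp

lemma join_iff:
  "x \<in> carrier L \<Longrightarrow> y \<in> carrier L \<Longrightarrow> z \<in> carrier L \<Longrightarrow> x \<squnion> y \<sqsubseteq> z \<longleftrightarrow> x \<sqsubseteq> z \<and> y \<sqsubseteq> z"
  using lat.join_left[of x y] lat.join_right[of x y] lat.join_le[of x z y] lat.join_closed[of x y]
    L_trans[of x "x \<squnion> y" z] L_trans[of y "x \<squnion> y" z] by blast

lemma atomD: "a \<in> atoms L \<Longrightarrow> a \<in> carrier L" "a \<in> atoms L \<Longrightarrow> a \<noteq> \<bottom>"
  "a \<in> atoms L \<Longrightarrow> x \<in> carrier L \<Longrightarrow> x \<sqsubseteq> a \<Longrightarrow> x = \<bottom> \<or> x = a"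
  using bottom by (auto simp: atoms_def covers_def L_less)

lemma atomistic:
  assumes "x \<in> carrier L" "y \<in> carrier L" "\<And>a. a \<in> atoms L \<Longrightarrow> a \<sqsubseteq> x \<Longrightarrow> a \<sqsubseteq> y"
  shows "x \<sqsubseteq> y"
proof -
  obtain A where "A \<subseteq> atoms L" "is_lub L x A" using geom assms(1) unfolding geometric_lattice_def by blast
  then have A: "A \<subseteq> atoms L" "\<And>a. a \<in> A \<Longrightarrow> a \<sqsubseteq> x"
    and l: "\<forall>u\<in>carrier L. (\<forall>z\<in>A \<inter> carrier L. z \<sqsubseteq> u) \<longrightarrow> x \<sqsubseteq> u"
    using atomD(1) unfolding is_lub_iff by auto
  have "\<forall>z\<in>A \<inter> carrier L. z \<sqsubseteq> y" using A assms(3) by auto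
  then show ?thesis using l assms(2) by blast
qed

lemma atom_exists:
  assumes "x \<in> carrier L" "x \<noteq> \<bottom>"
  shows "\<exists>a\<in>atoms L. a \<sqsubseteq> x"
proof (rule ccontr)
  assume "\<not> ?thesis"
  then have "x \<sqsubseteq> \<bottom>" by (intro atomistic[OF assms(1) bottom(1)]) blast
  then show False using le_bottom assms by simp
qed

lemma cover_step:
  assumes "x \<in> carrier L" "z \<in> carrier L" "x \<sqsubseteq> z" "x \<noteq> z"
  shows "\<exists>y. covers L x y \<and> y \<sqsubseteq> z"
proof -
  define S where "S = {w \<in> carrier L. x \<sqsubseteq> w \<and> x \<noteq> w \<and> w \<sqsubseteq> z}"
  \<comment> \<open>The size of the principal ideal is a strictly increasing measure, so a minimizer
    in \<open>S\<close> has nothing strictly between it and \<open>x\<close>.\<close>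
  define f where "f w = card {u \<in> carrier L. u \<sqsubseteq> w}" for w
  have "z \<in> S" using assms L_refl by (simp add: S_def)
  then obtain y where y: "y \<in> S" "\<And>w. w \<in> S \<Longrightarrow> f y \<le> f w"
    using ex_has_least_nat[of "\<lambda>w. w \<in> S" z f] by blast
  have "\<not> (x \<sqsubset> w \<and> w \<sqsubset> y)" if w: "w \<in> carrier L" for w
  proof
    assume *: "x \<sqsubset> w \<and> w \<sqsubset> y"
    have yc: "y \<in> carrier L" "y \<sqsubseteq> z" using y(1) by (auto simp: S_def)
    have "w \<in> S" using * w yc L_trans[OF w yc(1) assms(2)] by (simp add: S_def L_less)
    moreover have "{u \<in> carrier L. u \<sqsubseteq> w} \<subset> {u \<in> carrier L. u \<sqsubseteq> y}"
    proof
      show "{u \<in> carrier L. u \<sqsubseteq> w} \<subseteq> {u \<in> carrier L. u \<sqsubseteq> y}"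
        using L_trans[OF _ w yc(1)] * by (auto simp: L_less)
      have "\<not> y \<sqsubseteq> w" using * L_antisym[OF w yc(1)] by (auto simp: L_less)
      then show "{u \<in> carrier L. u \<sqsubseteq> w} \<noteq> {u \<in> carrier L. u \<sqsubseteq> y}" using yc L_refl[OF yc(1)] by blast
    qed
    then have "f w < f y" unfolding f_def using finL by (intro psubset_card_mono) auto
    ultimately show False using y(2) by fastforce
  qed
  then show ?thesis using y(1) assms(1) by (auto simp: S_def covers_def L_less)
qed

section \<open>Saturated chains and the rank of an element\<close>

lemma covers_le: "covers L x y \<Longrightarrow> x \<in> carrier L \<and> y \<in> carrier L \<and> x \<sqsubseteq> y \<and> x \<noteq> y"
  by (simp add: covers_def L_less)

lemma satchain_le: "satchain L x n z \<Longrightarrow> x \<in> carrier L \<and> z \<in> carrier L \<and> x \<sqsubseteq> z"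
proof (induction rule: satchain.induct)
  case (step x y n z)
  then show ?case using covers_le[OF step(1)] L_trans[of x y z] by blast
qed (use L_refl in blast)

lemma satchain_exists:
  assumes "x \<in> carrier L" "z \<in> carrier L" "x \<sqsubseteq> z"
  shows "\<exists>n. satchain L x n z"
  using assms
proof (induction "card {w \<in> carrier L. x \<sqsubseteq> w}" arbitrary: x rule: less_induct)
  case less
  show ?case
  proof (cases "x = z")
    case True
    then show ?thesis using satchain.base[OF less.prems(1)] by blast
  next
    case False
    then obtain y where y: "covers L x y" "y \<sqsubseteq> z" using cover_step[OF less.prems False] by blast
    note c = covers_le[OF y(1)]
    have "{w \<in> carrier L. y \<sqsubseteq> w} \<subset> {w \<in> carrier L. x \<sqsubseteq> w}"
    proof
      show "{w \<in> carrier L. y \<sqsubseteq> w} \<subseteq> {w \<in> carrier L. x \<sqsubseteq> w}" using c L_trans[of x y] by blast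
      show "{w \<in> carrier L. y \<sqsubseteq> w} \<noteq> {w \<in> carrier L. x \<sqsubseteq> w}" using c L_antisym[of x y] L_refl[of x] by blast
    qed
    then have "card {w \<in> carrier L. y \<sqsubseteq> w} < card {w \<in> carrier L. x \<sqsubseteq> w}"
      using finL by (intro psubset_card_mono) auto
    then obtain n where "satchain L y n z" using less.hyps[of y] c less.prems(2) y(2) by blast
    then show ?thesis using satchain.step[OF y(1)] by blast
  qed
qed

lemma semimodular:
  assumes "x \<in> carrier L" "y \<in> carrier L" "covers L (x \<sqinter> y) x"
  shows "covers L y (x \<squnion> y)"
  using geom assms by (simp add: geometric_lattice_def)

text \<open>The Jordan-Dedekind property. Two different covers \<open>y\<close> and
  \<open>y'\<close> of \<open>x\<close> meet in \<open>x\<close>, so by semimodularity their join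
  covers both; a saturated chain through the join links the chains through \<open>y\<close> and
  through \<open>y'\<close>, and the induction hypothesis applies to each.\<close>

lemma satchain_unique: "satchain L x n z \<Longrightarrow> satchain L x m z \<Longrightarrow> n = m"
proof (induction n arbitrary: x m)
  case 0
  then have xz: "x = z" by (auto elim: satchain_0E)
  show ?case
  proof (cases m)
    case (Suc k)
    then obtain y where y: "covers L x y" "satchain L y k z" using 0(2) by (auto elim: satchain_SucE)
    then show ?thesis using xz covers_le[OF y(1)] satchain_le[OF y(2)] L_antisym by blast
  qed simp
next
  case (Suc n)
  from Suc(2) obtain y where y: "covers L x y" "satchain L y n z" by (auto elim: satchain_SucE)
  note cy = covers_le[OF y(1)] and sy = satchain_le[OF y(2)]
  show ?case
  proof (cases m)
    case 0
    then have "x = z" using Suc(3) by (auto elim: satchain_0E)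
    then show ?thesis using cy sy L_antisym by blast
  next
    case (Suc k)
    then obtain y' where y': "covers L x y'" "satchain L y' k z" using Suc.prems(2) by (auto elim: satchain_SucE)
    note cy' = covers_le[OF y'(1)] and sy' = satchain_le[OF y'(2)]
    show ?thesis
    proof (cases "y = y'")
      case True
      then show ?thesis using Suc.IH[OF y(2)] y'(2) Suc by blast
    next
      case False
      have mm: "u \<sqinter> v = x" if uv: "covers L x u" "covers L x v" "u \<noteq> v" for u v
      proof (rule ccontr)
        note cu = covers_le[OF uv(1)] and cv = covers_le[OF uv(2)]
        let ?m = "u \<sqinter> v"
        have mc: "?m \<in> carrier L" "?m \<sqsubseteq> u" "?m \<sqsubseteq> v" "x \<sqsubseteq> ?m"
          using cu cv lat.meet_closed[of u v] lat.meet_left[of u v] lat.meet_right[of u v] lat.meet_le[of x u v] by auto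
        assume ne: "?m \<noteq> x"
        have "?m = w" if "covers L x w" "?m \<sqsubseteq> w" for w
          using that mc(1,4) ne unfolding covers_def L_less by blast
        then have "?m = u" "?m = v" using uv(1,2) mc by blast+
        then show False using uv(3) by simp
      qed
      let ?w = "y \<squnion> y'"
      have w: "covers L y' ?w" using semimodular[of y y'] mm[OF y(1) y'(1) False] y(1) cy cy' by simp
      have w': "covers L y ?w" using semimodular[of y' y] mm[OF y'(1) y(1)] False y'(1) cy cy' join_comm[of L y y'] by simp
      have "?w \<sqsubseteq> z" using join_iff[of y y' z] cy cy' sy sy' by blast
      then obtain j where j: "satchain L ?w j z" using satchain_exists[of ?w z] covers_le[OF w] sy by blast
      have "n = Suc j" using Suc.IH[OF y(2) satchain.step[OF w' j]] .
      then have "satchain L y' n z" using satchain.step[OF w j] by simp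
      then have "n = k" using Suc.IH[of y' k] y'(2) by blast
      then show ?thesis using Suc by simp
    qed
  qed
qed

definition rk :: "'a \<Rightarrow> nat" where
  "rk x = (THE n. satchain L \<bottom> n x)"

lemma rkI: "satchain L \<bottom> n x \<Longrightarrow> rk x = n"
  unfolding rk_def by (rule the_equality) (auto intro: satchain_unique)

lemma rk_sat: "x \<in> carrier L \<Longrightarrow> satchain L \<bottom> (rk x) x"
proof -
  assume x: "x \<in> carrier L"
  obtain n where "satchain L \<bottom> n x" using satchain_exists[OF bottom(1) x bottom(2)[OF x]] by blast
  then show ?thesis using rkI by simp
qed

lemma rk_bottom: "rk \<bottom> = 0"
  by (rule rkI) (rule satchain.base[OF bottom(1)])

lemma rk_covers: "covers L x y \<Longrightarrow> rk y = Suc (rk x)"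
  using rkI[OF satchain_snoc[OF rk_sat]] covers_le by simp

lemma rk_mono: "x \<in> carrier L \<Longrightarrow> y \<in> carrier L \<Longrightarrow> x \<sqsubseteq> y \<Longrightarrow> x \<noteq> y \<Longrightarrow> rk x < rk y"
proof -
  assume *: "x \<in> carrier L" "y \<in> carrier L" "x \<sqsubseteq> y" "x \<noteq> y"
  obtain n where n: "satchain L x n y" using satchain_exists[OF *(1-3)] by blast
  have "n \<noteq> 0"
  proof
    assume "n = 0"
    then have "satchain L x 0 y" using n by simp
    then show False using *(4) by (auto elim: satchain_0E)
  qed
  moreover have "rk y = rk x + n" using satchain_trans[OF rk_sat[OF *(1)] n] by (rule rkI)
  ultimately show ?thesis by simp
qed

lemma rk_pred: "x \<in> carrier L \<Longrightarrow> 0 < rk x \<Longrightarrow> \<exists>y. covers L y x"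
  using rk_sat[of x] satchain_lastE[of L "\<bottom>" "rk x - 1" x] by auto

text \<open>An atom not below \<open>v\<close> meets \<open>v\<close> in the bottom element, which
  it covers, so semimodularity makes the join a cover of \<open>v\<close>.\<close>

lemma rk_join_atom:
  assumes "v \<in> carrier L" "a \<in> atoms L" "\<not> a \<sqsubseteq> v"
  shows "rk (v \<squnion> a) = Suc (rk v)"
proof -
  have a: "a \<in> carrier L" using assms(2) by (rule atomD)
  have "a \<sqinter> v = \<bottom>"
    using atomD(3)[OF assms(2), of "a \<sqinter> v"] lat.meet_left[OF a assms(1)] lat.meet_right[OF a assms(1)]
      lat.meet_closed[OF a assms(1)] assms(3) by metis
  then have "covers L (a \<sqinter> v) a" using assms(2) by (simp add: atoms_def)
  then have "covers L v (a \<squnion> v)" using semimodular[OF a assms(1)] by blast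
  then show ?thesis using rk_covers join_comm[of L v a] by metis
qed

text \<open>The bottom element is added to make the empty join meaningful.\<close>

definition Join :: "'a set \<Rightarrow> 'a" where
  "Join B = \<Squnion> (insert \<bottom> B)"

lemma Sup_least: "B \<subseteq> carrier L \<Longrightarrow> B \<noteq> {} \<Longrightarrow> is_lub L (\<Squnion> B) B"
  using lat.finite_sup_least finL finite_subset by blast

lemma Join_lub:
  assumes "B \<subseteq> carrier L"
  shows "Join B \<in> carrier L" "\<And>x. x \<in> B \<Longrightarrow> x \<sqsubseteq> Join B"
    "\<And>u. u \<in> carrier L \<Longrightarrow> (\<And>x. x \<in> B \<Longrightarrow> x \<sqsubseteq> u) \<Longrightarrow> Join B \<sqsubseteq> u"
proof -
  have "is_lub L (Join B) (insert \<bottom> B)" unfolding Join_def by (rule Sup_least) (use assms bottom in auto)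
  then show "Join B \<in> carrier L" "\<And>x. x \<in> B \<Longrightarrow> x \<sqsubseteq> Join B"
    "\<And>u. u \<in> carrier L \<Longrightarrow> (\<And>x. x \<in> B \<Longrightarrow> x \<sqsubseteq> u) \<Longrightarrow> Join B \<sqsubseteq> u"
    using assms bottom by (auto simp: is_lub_iff)
qed

lemma Join_le_iff: "B \<subseteq> carrier L \<Longrightarrow> u \<in> carrier L \<Longrightarrow> Join B \<sqsubseteq> u \<longleftrightarrow> (\<forall>x\<in>B. x \<sqsubseteq> u)"
proof -
  assume B: "B \<subseteq> carrier L" "u \<in> carrier L"
  show ?thesis
  proof
    assume *: "Join B \<sqsubseteq> u"
    show "\<forall>x\<in>B. x \<sqsubseteq> u"
    proof
      fix x assume "x \<in> B"
      then show "x \<sqsubseteq> u" using L_trans[OF _ Join_lub(1)[OF B(1)] B(2) Join_lub(2)[OF B(1)] *] B(1) by blast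
    qed
  qed (use Join_lub(3)[OF B] in blast)
qed

lemma Join_eq_Sup:
  assumes "B \<subseteq> carrier L" "B \<noteq> {}"
  shows "\<Squnion> B = Join B"
proof -
  note S = Sup_least[OF assms, unfolded is_lub_iff] and J = Join_lub[OF assms(1)]
  have c: "\<Squnion> B \<in> carrier L" "\<And>x. x \<in> B \<Longrightarrow> x \<sqsubseteq> \<Squnion> B" using S assms(1) by auto
  have "\<Squnion> B \<sqsubseteq> Join B" using S J(1,2) by simp
  then show ?thesis using L_antisym[OF c(1) J(1)] J(3)[OF c] by simp
qed

end

section \<open>Iterated blowups\<close>

text \<open>The element of the iterated blowup over \<open>x\<close> in which exactly the members of \<open>T\<close> occur as
  exceptional labels; the blown up elements are listed with the last one first.\<close>

fun enc :: "'a list \<Rightarrow> 'a set \<Rightarrow> 'a \<Rightarrow> 'a blow" where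
  "enc [] T x = Elt x"
| "enc (p # qs) T x = (if p \<in> T then Exc (Elt p) (enc qs T x) else enc qs T x)"

text \<open>Whether the pair survives all blowups. An element labelled \<open>p\<close> arises from
  one that was not above \<open>p\<close> and had a join with \<open>p\<close> before the blowup;
  that join keeps the other labels and lies over \<open>x \<squnion> p\<close>, so it is the pair
  whose validity is tested at the earlier stage.\<close>

fun valid :: "'a gorder \<Rightarrow> 'a list \<Rightarrow> 'a set \<Rightarrow> 'a \<Rightarrow> bool" where
  "valid L [] T x \<longleftrightarrow> True"
| "valid L (p # qs) T x \<longleftrightarrow> \<not> p \<sqsubseteq>\<^bsub>L\<^esub> x \<and> valid L qs T (if p \<in> T then x \<squnion>\<^bsub>L\<^esub> p else x)"

fun blow_seq :: "'a gorder \<Rightarrow> 'a list \<Rightarrow> 'a blow gorder" where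
  "blow_seq L [] = base_poset L"
| "blow_seq L (p # qs) = blowup (Elt p) (blow_seq L qs)"

lemma iterated_blowup_eq: "iterated_blowup L ps = blow_seq L (rev ps)"
proof -
  have "foldr (\<lambda>p P. blowup (Elt p) P) qs (base_poset L) = blow_seq L qs" for qs
    by (induction qs) simp_all
  then show ?thesis unfolding iterated_blowup_def by (metis foldr_conv_fold rev_rev_ident)
qed

lemma enc_cong: "T \<inter> set qs = T' \<inter> set qs \<Longrightarrow> enc qs T x = enc qs T' x"
proof (induction qs)
  case (Cons p qs)
  then have "p \<in> T \<longleftrightarrow> p \<in> T'" "T \<inter> set qs = T' \<inter> set qs" by auto
  then show ?case using Cons(1) by simp
qed simp

lemma valid_cong: "T \<inter> set qs = T' \<inter> set qs \<Longrightarrow> valid L qs T x = valid L qs T' x"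
proof (induction qs arbitrary: x)
  case (Cons p qs)
  then have "p \<in> T \<longleftrightarrow> p \<in> T'" "T \<inter> set qs = T' \<inter> set qs" by auto
  then show ?case using Cons(1) by simp
qed simp

lemma enc_Exc: "enc qs T x = Exc u w \<Longrightarrow> u \<in> Elt ` set qs"
  by (induction qs) (auto split: if_splits)

lemma enc_inj: "distinct qs \<Longrightarrow> enc qs T x = enc qs T' x' \<Longrightarrow> T \<inter> set qs = T' \<inter> set qs \<and> x = x'"
proof (induction qs)
  case (Cons p qs)
  then show ?case using enc_Exc[of qs T' x' "Elt p"] enc_Exc[of qs T x "Elt p"]
    by (auto split: if_splits dest: sym)
qed simp

context geom_lattice
begin

text \<open>Shrinking \<open>T\<close> or \<open>x\<close> shrinks every join formed along the list,
  which makes it easier not to lie above the next entry.\<close>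

lemma valid_mono:
  "valid L qs T' x' \<Longrightarrow> T \<inter> set qs \<subseteq> T' \<Longrightarrow> x \<sqsubseteq> x' \<Longrightarrow> x \<in> carrier L \<Longrightarrow> x' \<in> carrier L \<Longrightarrow> set qs \<subseteq> carrier L \<Longrightarrow>
   valid L qs T x"
proof (induction qs arbitrary: x x')
  case (Cons p qs)
  have p: "p \<in> carrier L" using Cons by simp
  have "\<not> p \<sqsubseteq> x" using Cons(2) L_trans[OF p Cons(5,6) _ Cons(4)] by auto
  moreover have "valid L qs T (if p \<in> T then x \<squnion> p else x)"
  proof (rule Cons(1))
    show "valid L qs T' (if p \<in> T' then x' \<squnion> p else x')" using Cons(2) by simp
    have le: "x \<sqsubseteq> x' \<squnion> p" "p \<sqsubseteq> x' \<squnion> p" "x' \<squnion> p \<in> carrier L"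
      using L_trans[OF Cons(5,6) _ Cons(4), of "x' \<squnion> p"] lat.join_left[OF Cons(6) p] lat.join_right[OF Cons(6) p]
        lat.join_closed[OF Cons(6) p] by simp_all
    then show "(if p \<in> T then x \<squnion> p else x) \<sqsubseteq> (if p \<in> T' then x' \<squnion> p else x')"
      using Cons(3,4) join_iff[OF Cons(5) p le(3)] by auto
  qed (use Cons p in auto)
  ultimately show ?case by simp
qed simp

text \<open>The closed form of the recursion: on reaching \<open>p\<close>, the element has been
  joined with the members of \<open>T\<close> listed before \<open>p\<close>, those blown up after
  it. In this form validity can be compared with nestedness.\<close>

lemma valid_iff:
  "x \<in> carrier L \<Longrightarrow> set qs \<subseteq> carrier L \<Longrightarrow>
   valid L qs T x \<longleftrightarrow> (\<forall>us p vs. qs = us @ p # vs \<longrightarrow> \<not> p \<sqsubseteq> Join (insert x (T \<inter> set us)))"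
proof (induction qs arbitrary: x)
  case (Cons q qs)
  have q: "q \<in> carrier L" using Cons by simp
  let ?y = "if q \<in> T then x \<squnion> q else x"
  have y: "?y \<in> carrier L" using Cons q by simp
  have J: "Join (insert ?y (T \<inter> set us)) = Join (insert x (T \<inter> set (q # us)))" if "set us \<subseteq> carrier L" for us
  proof -
    have c1: "insert ?y (T \<inter> set us) \<subseteq> carrier L" and c2: "insert x (T \<inter> set (q # us)) \<subseteq> carrier L"
      using that y Cons(2,3) by auto
    note J1 = Join_lub[OF c1] and J2 = Join_lub[OF c2]
    have same: "(\<forall>w\<in>insert ?y (T \<inter> set us). w \<sqsubseteq> t) \<longleftrightarrow> (\<forall>w\<in>insert x (T \<inter> set (q # us)). w \<sqsubseteq> t)"
      if t: "t \<in> carrier L" for t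
      using join_iff[OF Cons(2) q t] by auto
    show ?thesis
    proof (rule L_antisym[OF J1(1) J2(1)])
      show "Join (insert ?y (T \<inter> set us)) \<sqsubseteq> Join (insert x (T \<inter> set (q # us)))"
        unfolding Join_le_iff[OF c1 J2(1)] same[OF J2(1)] using J2(2) by blast
      show "Join (insert x (T \<inter> set (q # us))) \<sqsubseteq> Join (insert ?y (T \<inter> set us))"
        unfolding Join_le_iff[OF c2 J1(1)] same[OF J1(1), symmetric] using J1(2) by blast
    qed
  qed
  have Jx: "Join (insert x {}) = x"
  proof -
    have c: "{x} \<subseteq> carrier L" using Cons(2) by simp
    show ?thesis
      by (rule L_antisym[OF Join_lub(1)[OF c] Cons(2)]) (use Join_lub(2)[OF c] Join_le_iff[OF c Cons(2)] L_refl[OF Cons(2)] in auto)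
  qed
  have "valid L (q # qs) T x \<longleftrightarrow> \<not> q \<sqsubseteq> x \<and> (\<forall>us p vs. qs = us @ p # vs \<longrightarrow> \<not> p \<sqsubseteq> Join (insert ?y (T \<inter> set us)))"
    using Cons(1)[OF y] Cons(3) by simp
  also have "\<dots> \<longleftrightarrow> \<not> q \<sqsubseteq> x \<and> (\<forall>us p vs. qs = us @ p # vs \<longrightarrow> \<not> p \<sqsubseteq> Join (insert x (T \<inter> set (q # us))))"
  proof -
    have "Join (insert ?y (T \<inter> set us)) = Join (insert x (T \<inter> set (q # us)))" if "qs = us @ p # vs" for us p vs
      by (rule J) (use that Cons(3) in auto)
    then show ?thesis by metis
  qed
  also have "\<dots> \<longleftrightarrow> (\<forall>us p vs. q # qs = us @ p # vs \<longrightarrow> \<not> p \<sqsubseteq> Join (insert x (T \<inter> set us)))"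
  proof
    assume *: "\<not> q \<sqsubseteq> x \<and> (\<forall>us p vs. qs = us @ p # vs \<longrightarrow> \<not> p \<sqsubseteq> Join (insert x (T \<inter> set (q # us))))"
    show "\<forall>us p vs. q # qs = us @ p # vs \<longrightarrow> \<not> p \<sqsubseteq> Join (insert x (T \<inter> set us))"
    proof (intro allI impI)
      fix us p vs assume e: "q # qs = us @ p # vs"
      show "\<not> p \<sqsubseteq> Join (insert x (T \<inter> set us))"
      proof (cases us)
        case Nil
        then show ?thesis using e * Jx by simp
      next
        case (Cons u us')
        then have "qs = us' @ p # vs" "us = q # us'" using e by simp_all
        then show ?thesis using * by blast
      qed
    qed
  next
    assume *: "\<forall>us p vs. q # qs = us @ p # vs \<longrightarrow> \<not> p \<sqsubseteq> Join (insert x (T \<inter> set us))"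
    have "\<not> q \<sqsubseteq> x" using *[rule_format, of "[]" q qs] Jx by simp
    moreover have "\<not> p \<sqsubseteq> Join (insert x (T \<inter> set (q # us)))" if "qs = us @ p # vs" for us p vs
      using *[rule_format, of "q # us" p vs] that by simp
    ultimately show "\<not> q \<sqsubseteq> x \<and> (\<forall>us p vs. qs = us @ p # vs \<longrightarrow> \<not> p \<sqsubseteq> Join (insert x (T \<inter> set (q # us))))"
      by blast
  qed
  finally show ?case .
qed simp

section \<open>The explicit model of the iterated blowup\<close>

definition admissible :: "'a list \<Rightarrow> bool" where
  "admissible qs \<longleftrightarrow> distinct qs \<and> set qs \<subseteq> carrier L - {\<bottom>}
    \<and> (\<forall>us p vs. qs = us @ p # vs \<longrightarrow> (\<forall>q\<in>set vs. \<not> q \<sqsubseteq> p))"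

lemma admissible_Cons:
  assumes "admissible (p # qs)"
  shows "admissible qs" "p \<in> carrier L" "p \<notin> set qs" "\<And>q. q \<in> set qs \<Longrightarrow> \<not> q \<sqsubseteq> p" "set qs \<subseteq> carrier L"
  using assms unfolding admissible_def
  by (auto simp: Cons_eq_append_conv) (metis append_Cons)+

lemma valid_empty: "valid L qs {} x \<longleftrightarrow> (\<forall>q\<in>set qs. \<not> q \<sqsubseteq> x)"
  by (induction qs) auto

lemma blowup_simps:
  "carrier (blowup p P) = not_above P p \<union> Exc p ` joinable P p"
  "u \<sqsubseteq>\<^bsub>blowup p P\<^esub> v \<longleftrightarrow> (u \<in> not_above P p \<and> v \<in> not_above P p \<and> u \<sqsubseteq>\<^bsub>P\<^esub> v)
       \<or> (\<exists>x\<in>joinable P p. \<exists>y\<in>joinable P p. u = Exc p x \<and> v = Exc p y \<and> x \<sqsubseteq>\<^bsub>P\<^esub> y)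
       \<or> (\<exists>y\<in>joinable P p. u \<in> not_above P p \<and> v = Exc p y \<and> u \<sqsubseteq>\<^bsub>P\<^esub> y)"
  by (simp_all add: blowup_def)

text \<open>Carrier and order must be proved together, because the next blowup is defined through
  the order relation and the existence of joins in the present poset.\<close>

lemma blow_seq_structure:
  assumes "admissible qs"
  shows "carrier (blow_seq L qs) = {enc qs T x | T x. x \<in> carrier L \<and> valid L qs T x}"
    and "\<And>T x T' x'. x \<in> carrier L \<Longrightarrow> x' \<in> carrier L \<Longrightarrow> valid L qs T x \<Longrightarrow> valid L qs T' x' \<Longrightarrow>
      enc qs T x \<sqsubseteq>\<^bsub>blow_seq L qs\<^esub> enc qs T' x' \<longleftrightarrow> T \<inter> set qs \<subseteq> T' \<and> x \<sqsubseteq> x'"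
  using assms
proof (induction qs)
  case Nil
  { case 1 show ?case by (auto simp: base_poset_def) }
  { case (2 x x' T T') then show ?case by (auto simp: base_poset_def) }
next
  case (Cons p qs)
  have "admissible (p # qs)" if "admissible (p # qs)" by fact
  let ?P = "blow_seq L qs"
  have main: "carrier (blow_seq L (p # qs)) = {enc (p # qs) T x | T x. x \<in> carrier L \<and> valid L (p # qs) T x}
    \<and> (\<forall>T x T' x'. x \<in> carrier L \<longrightarrow> x' \<in> carrier L \<longrightarrow> valid L (p # qs) T x \<longrightarrow> valid L (p # qs) T' x' \<longrightarrow>
      enc (p # qs) T x \<sqsubseteq>\<^bsub>blow_seq L (p # qs)\<^esub> enc (p # qs) T' x' \<longleftrightarrow> T \<inter> set (p # qs) \<subseteq> T' \<and> x \<sqsubseteq> x')"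
    if adm: "admissible (p # qs)"
  proof -
    note a = admissible_Cons[OF adm]
    have dq: "distinct qs" using a(1) by (simp add: admissible_def)
    note car = Cons.IH(1)[OF a(1)] and le = Cons.IH(2)[OF _ _ _ _ a(1)]
    \<comment> \<open>The blowups so far were at elements not below \<open>p\<close>, so
      \<open>p\<close> is still present, without labels, when its turn comes.\<close>
    have vp: "valid L qs {} p" using a(4) by (simp add: valid_empty)
    have encp: "Elt p = enc qs {} p" by (induction qs) simp_all
    have above: "Elt p \<sqsubseteq>\<^bsub>?P\<^esub> enc qs T x \<longleftrightarrow> p \<sqsubseteq> x" if "x \<in> carrier L" "valid L qs T x" for T x
      using le[OF a(2) that(1) vp that(2)] encp by simp
    have na: "u \<in> not_above ?P (Elt p) \<longleftrightarrow> (\<exists>T x. u = enc qs T x \<and> x \<in> carrier L \<and> valid L qs T x \<and> \<not> p \<sqsubseteq> x)" for u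
      unfolding not_above_def car using above by auto
    have na1: "enc qs T x \<in> not_above ?P (Elt p)" if "x \<in> carrier L" "valid L qs T x" "\<not> p \<sqsubseteq> x" for T x
      using na that by blast
    have v1: "valid L qs T x" if "x \<in> carrier L" "valid L qs T (x \<squnion> p)" for T x
      by (rule valid_mono[OF that(2)]) (use that a lat.join_left in auto)
    \<comment> \<open>A join with \<open>p\<close> keeps the labels \<open>T\<close> and lies over
      \<open>x \<squnion> p\<close>. The coordinates of any upper bound dominate those of this pair,
      so by \<open>valid_mono\<close> the pair is valid as soon as some upper bound exists.\<close>
    have lub: "(\<exists>s. is_lub ?P s {Elt p, enc qs T x}) \<longleftrightarrow> valid L qs T (x \<squnion> p)"
      if x: "x \<in> carrier L" "valid L qs T x" for T x
    proof
      assume "\<exists>s. is_lub ?P s {Elt p, enc qs T x}"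
      then obtain s where s: "is_lub ?P s {Elt p, enc qs T x}" by blast
      then have sc: "s \<in> carrier ?P" by (simp add: is_lub_iff)
      then obtain T' x' where s': "s = enc qs T' x'" "x' \<in> carrier L" "valid L qs T' x'" unfolding car by blast
      have "Elt p \<in> carrier ?P" "enc qs T x \<in> carrier ?P" unfolding car using encp vp a(2) x by blast+
      then have u: "Elt p \<sqsubseteq>\<^bsub>?P\<^esub> s" "enc qs T x \<sqsubseteq>\<^bsub>?P\<^esub> s" using s by (simp_all add: is_lub_iff)
      have "p \<sqsubseteq> x'" "T \<inter> set qs \<subseteq> T'" "x \<sqsubseteq> x'"
        using u above[OF s'(2,3)] le[OF x(1) s'(2) x(2) s'(3)] s'(1) by auto
      then show "valid L qs T (x \<squnion> p)"
        using valid_mono[OF s'(3), of T "x \<squnion> p"] join_iff[OF x(1) a(2) s'(2)] s'(2) x a by simp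
    next
      assume v: "valid L qs T (x \<squnion> p)"
      have j: "x \<squnion> p \<in> carrier L" using x a by simp
      have "is_lub ?P (enc qs T (x \<squnion> p)) {Elt p, enc qs T x}"
        unfolding is_lub_iff
      proof (intro conjI ballI impI)
        show "enc qs T (x \<squnion> p) \<in> carrier ?P" unfolding car using j v by blast
        fix w assume "w \<in> {Elt p, enc qs T x} \<inter> carrier ?P"
        then show "w \<sqsubseteq>\<^bsub>?P\<^esub> enc qs T (x \<squnion> p)"
          using above[OF j v] le[OF x(1) j x(2) v] lat.join_left[OF x(1) a(2)] lat.join_right[OF x(1) a(2)] by auto
      next
        fix u assume u: "u \<in> carrier ?P" "\<forall>w\<in>{Elt p, enc qs T x} \<inter> carrier ?P. w \<sqsubseteq>\<^bsub>?P\<^esub> u"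
        then obtain T' x' where u': "u = enc qs T' x'" "x' \<in> carrier L" "valid L qs T' x'" unfolding car by blast
        have "Elt p \<in> carrier ?P" "enc qs T x \<in> carrier ?P" unfolding car using encp vp a(2) x by blast+
        then have "Elt p \<sqsubseteq>\<^bsub>?P\<^esub> u" "enc qs T x \<sqsubseteq>\<^bsub>?P\<^esub> u" using u(2) by simp_all
        then have "p \<sqsubseteq> x'" "T \<inter> set qs \<subseteq> T'" "x \<sqsubseteq> x'"
          using above[OF u'(2,3)] le[OF x(1) u'(2) x(2) u'(3)] u'(1) by auto
        then show "enc qs T (x \<squnion> p) \<sqsubseteq>\<^bsub>?P\<^esub> u"
          using le[OF j u'(2) v u'(3)] join_iff[OF x(1) a(2) u'(2)] u'(1) by simp
      qed
      then show "\<exists>s. is_lub ?P s {Elt p, enc qs T x}" by blast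
    qed
    have jo: "u \<in> joinable ?P (Elt p) \<longleftrightarrow> (\<exists>T x. u = enc qs T x \<and> x \<in> carrier L \<and> \<not> p \<sqsubseteq> x \<and> valid L qs T (x \<squnion> p))" for u
    proof
      assume "u \<in> joinable ?P (Elt p)"
      then have u: "u \<in> not_above ?P (Elt p)" "\<exists>s. is_lub ?P s {Elt p, u}" by (simp_all add: joinable_def)
      obtain T x where T: "u = enc qs T x" "x \<in> carrier L" "valid L qs T x" "\<not> p \<sqsubseteq> x" using u(1) na by blast
      have "valid L qs T (x \<squnion> p)" using u(2) lub[OF T(2,3)] T(1) by simp
      then show "\<exists>T x. u = enc qs T x \<and> x \<in> carrier L \<and> \<not> p \<sqsubseteq> x \<and> valid L qs T (x \<squnion> p)" using T by blast
    next
      assume "\<exists>T x. u = enc qs T x \<and> x \<in> carrier L \<and> \<not> p \<sqsubseteq> x \<and> valid L qs T (x \<squnion> p)"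
      then obtain T x where T: "u = enc qs T x" "x \<in> carrier L" "\<not> p \<sqsubseteq> x" "valid L qs T (x \<squnion> p)" by blast
      have v: "valid L qs T x" by (rule v1[OF T(2,4)])
      have "\<exists>s. is_lub ?P s {Elt p, u}" using lub[OF T(2) v] T(1,4) by simp
      then show "u \<in> joinable ?P (Elt p)" using na1[OF T(2) v T(3)] T(1) by (simp add: joinable_def)
    qed
    have jo1: "enc qs T x \<in> joinable ?P (Elt p)" if "x \<in> carrier L" "valid L qs T (x \<squnion> p)" "\<not> p \<sqsubseteq> x" for T x
      using jo that by blast
    have insT: "enc qs (insert p T) x = enc qs T x" "valid L qs (insert p T) y = valid L qs T y"
      "enc qs (T - {p}) x = enc qs T x" "valid L qs (T - {p}) y = valid L qs T y" for T x y
      using a(3) by (auto intro!: enc_cong valid_cong)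
    \<comment> \<open>No element of the earlier poset carries the label \<open>p\<close>, so the new
      exceptional elements are disjoint from the old ones.\<close>
    have notExc: "Exc (Elt p) w \<notin> not_above ?P (Elt p)" for w
    proof
      assume "Exc (Elt p) w \<in> not_above ?P (Elt p)"
      then obtain T x where "enc qs T x = Exc (Elt p) w" using na by metis
      from enc_Exc[OF this] show False using a(3) by auto
    qed
    have carr: "carrier (blow_seq L (p # qs)) = {enc (p # qs) T x | T x. x \<in> carrier L \<and> valid L (p # qs) T x}" (is "?A = ?B")
    proof
      show "?A \<subseteq> ?B"
      proof
        fix w assume "w \<in> ?A"
        then consider "w \<in> not_above ?P (Elt p)" | u where "u \<in> joinable ?P (Elt p)" "w = Exc (Elt p) u"
          by (auto simp: blowup_simps)
        then show "w \<in> ?B"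
        proof cases
          case 1
          then obtain T x where T: "w = enc qs T x" "x \<in> carrier L" "valid L qs T x" "\<not> p \<sqsubseteq> x" using na by blast
          then have "w = enc (p # qs) (T - {p}) x" "valid L (p # qs) (T - {p}) x" by (simp_all add: insT)
          then show ?thesis using T(2) by blast
        next
          case 2
          then obtain T x where T: "u = enc qs T x" "x \<in> carrier L" "\<not> p \<sqsubseteq> x" "valid L qs T (x \<squnion> p)" using jo by blast
          then have "w = enc (p # qs) (insert p T) x" "valid L (p # qs) (insert p T) x" using 2 by (simp_all add: insT)
          then show ?thesis using T(2) by blast
        qed
      qed
      show "?B \<subseteq> ?A"
      proof
        fix w assume "w \<in> ?B"
        then obtain T x where T: "w = enc (p # qs) T x" "x \<in> carrier L" "valid L (p # qs) T x" by blast
        then show "w \<in> ?A"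
          using na1[of x T] jo1[of x T] by (cases "p \<in> T") (auto simp: blowup_simps)
      qed
    qed
    have lee: "enc (p # qs) T x \<sqsubseteq>\<^bsub>blow_seq L (p # qs)\<^esub> enc (p # qs) T' x' \<longleftrightarrow> T \<inter> set (p # qs) \<subseteq> T' \<and> x \<sqsubseteq> x'"
      if x: "x \<in> carrier L" "x' \<in> carrier L" and v: "valid L (p # qs) T x" "valid L (p # qs) T' x'" for T x T' x'
    proof -
      have nx: "\<not> p \<sqsubseteq> x" "\<not> p \<sqsubseteq> x'" using v by auto
      have vx: "valid L qs T x" using v(1) v1[OF x(1)] by (cases "p \<in> T") auto
      have vx': "valid L qs T' x'" using v(2) v1[OF x(2)] by (cases "p \<in> T'") auto
      note le' = le[OF x vx vx']
      consider "p \<in> T" "p \<in> T'" | "p \<in> T" "p \<notin> T'" | "p \<notin> T" "p \<in> T'" | "p \<notin> T" "p \<notin> T'" by blast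
      then show ?thesis
      proof cases
        case 1
        then have "enc qs T x \<in> joinable ?P (Elt p)" "enc qs T' x' \<in> joinable ?P (Elt p)" using jo1 x nx v by auto
        then show ?thesis using 1 le' notExc by (auto simp: blowup_simps)
      next
        case 2
        have "enc qs T' x' \<noteq> Exc (Elt p) w" for w using enc_Exc a(3) by fastforce
        then show ?thesis using 2 notExc by (auto simp: blowup_simps)
      next
        case 3
        then have m: "enc qs T x \<in> not_above ?P (Elt p)" "enc qs T' x' \<in> joinable ?P (Elt p)" using jo1 na1 x nx v vx by auto
        have "enc qs T x \<noteq> Exc (Elt p) w" for w using enc_Exc a(3) by fastforce
        then show ?thesis using 3 m le' notExc by (auto simp: blowup_simps)
      next
        case 4
        then have m: "enc qs T x \<in> not_above ?P (Elt p)" "enc qs T' x' \<in> not_above ?P (Elt p)" using na1 x nx vx vx' by auto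
        have "enc qs T' x' \<noteq> Exc (Elt p) w" for w using enc_Exc a(3) by fastforce
        then show ?thesis using 4 m le' by (auto simp: blowup_simps)
      qed
    qed
    show ?thesis using carr lee by blast
  qed
  { case 1 then show ?case using main by blast }
  { case 2 then show ?case using main by blast }
qed

section \<open>Joins inside a building set\<close>

lemma max_above:
  assumes "C \<subseteq> carrier L" "c \<in> C"
  shows "\<exists>a\<in>C. c \<sqsubseteq> a \<and> (\<forall>b\<in>C. a \<sqsubseteq> b \<longrightarrow> b = a)"
proof -
  let ?D = "{b \<in> C. c \<sqsubseteq> b}"
  have D: "finite ?D" "?D \<noteq> {}" using assms finL finite_subset[OF assms(1)] L_refl[of c] by auto
  then have "Max (rk ` ?D) \<in> rk ` ?D" by simp
  then obtain a where a: "a \<in> ?D" "rk a = Max (rk ` ?D)" by auto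
  have "b = a" if b: "b \<in> C" "a \<sqsubseteq> b" for b
  proof (rule ccontr)
    assume "b \<noteq> a"
    have c: "a \<in> carrier L" "b \<in> carrier L" "c \<in> carrier L" using a b assms by auto
    have "b \<in> ?D" using L_trans[OF c(3,1,2) _ b(2)] a b by auto
    then have "rk b \<le> rk a" using D a(2) by simp
    then show False using rk_mono[OF c(1,2) b(2)] \<open>b \<noteq> a\<close> by simp
  qed
  then show ?thesis using a(1) by blast
qed

text \<open>Under the product decomposition of the interval below \<open>x\<close>, each
  \<open>y g\<close> is a tuple supported in the coordinate \<open>g\<close>. If these elements join
  to \<open>x\<close>, the tuple of all their coordinates is the top one, so each coordinate is
  full. In this form the building set axiom enters the comparison with nested sets.\<close>

lemma building_Join:
  assumes G: "building_set L G" and x: "x \<in> carrier L" "x \<noteq> \<bottom>"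
    and y: "\<And>g. g \<in> max_below L G x \<Longrightarrow> y g \<in> carrier L \<and> y g \<sqsubseteq> g"
    and J: "x \<sqsubseteq> Join (y ` max_below L G x)" and g: "g \<in> max_below L G x"
  shows "y g = g"
proof -
  define M where "M = max_below L G x"
  define Pr where "Pr = (\<Pi>\<^sub>E g\<in>M. \<lbrace>\<bottom>..g\<rbrace>)"
  have GL: "G \<subseteq> carrier L" using G by (auto simp: building_set_def)
  have M: "h \<in> carrier L" "h \<sqsubseteq> x" if "h \<in> M" for h using that GL by (auto simp: M_def max_below_def)
  have y: "y h \<in> carrier L" "y h \<sqsubseteq> h" if "h \<in> M" for h using y that by (auto simp: M_def)
  have "\<forall>x\<in>carrier L - {\<bottom>}. let M = max_below L G x; Pr = (\<Pi>\<^sub>E g\<in>M. \<lbrace>\<bottom>..g\<rbrace>)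
          in \<exists>\<phi>. bij_betw \<phi> Pr \<lbrace>\<bottom>..x\<rbrace>
             \<and> (\<forall>u\<in>Pr. \<forall>v\<in>Pr. \<phi> u \<sqsubseteq> \<phi> v \<longleftrightarrow> (\<forall>g\<in>M. u g \<sqsubseteq> v g))
             \<and> (\<forall>g\<in>M. \<phi> (\<lambda>h\<in>M. if h = g then g else \<bottom>) = g)"
    using G unfolding building_set_def by (elim conjE)
  from bspec[OF this, of x, unfolded Let_def, folded M_def, folded Pr_def] x
  obtain \<phi> where bij: "bij_betw \<phi> Pr \<lbrace>\<bottom>..x\<rbrace>"
    and ord: "\<forall>u\<in>Pr. \<forall>v\<in>Pr. \<phi> u \<sqsubseteq> \<phi> v \<longleftrightarrow> (\<forall>g\<in>M. u g \<sqsubseteq> v g)"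
    and unit: "\<forall>g\<in>M. \<phi> (\<lambda>h\<in>M. if h = g then g else \<bottom>) = g"
    by blast
  have int: "u \<in> \<lbrace>\<bottom>..h\<rbrace> \<longleftrightarrow> u \<in> carrier L \<and> u \<sqsubseteq> h" for u h
    using bottom(2) by (auto simp: at_least_at_most_def)
  define \<delta> where "\<delta> h = (\<lambda>k\<in>M. if k = h then h else \<bottom>)" for h
  have \<delta>P: "\<delta> h \<in> Pr" if "h \<in> M" for h
    using that M L_refl bottom by (auto simp: \<delta>_def Pr_def int)
  have \<phi>P: "\<phi> u \<in> carrier L" "\<phi> u \<sqsubseteq> x" if "u \<in> Pr" for u
    using bij_betwE[OF bij] that int by auto
  have "\<forall>h\<in>M. \<exists>u. u \<in> Pr \<and> \<phi> u = y h"
  proof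
    fix h assume h: "h \<in> M"
    have "y h \<sqsubseteq> x" by (rule L_trans[OF y(1)[OF h] M(1)[OF h] x(1) y(2)[OF h] M(2)[OF h]])
    then have "y h \<in> \<phi> ` Pr" using bij_betw_imp_surj_on[OF bij] int y(1)[OF h] by blast
    then show "\<exists>u. u \<in> Pr \<and> \<phi> u = y h" by auto
  qed
  then obtain u where u: "\<forall>h\<in>M. u h \<in> Pr \<and> \<phi> (u h) = y h" by (rule bchoice[THEN exE])
  have uP: "u h \<in> Pr" "\<phi> (u h) = y h" if "h \<in> M" for h using u that by auto
  have uc: "u h k \<in> carrier L" "u h k \<sqsubseteq> k" if "h \<in> M" "k \<in> M" for h k
    using uP(1)[OF that(1)] that(2) int[of _ k] by (auto simp: Pr_def PiE_iff)
  \<comment> \<open>\<open>\<phi>\<close> sends the unit tuple \<open>\<delta> h\<close> to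
    \<open>h\<close>, and \<open>y h\<close> lies below \<open>h\<close>, so the tuple of
    \<open>y h\<close> lies below the unit tuple.\<close>
  have off: "u h k = \<bottom>" if "h \<in> M" "k \<in> M" "k \<noteq> h" for h k
  proof -
    have "\<phi> (u h) \<sqsubseteq> \<phi> (\<delta> h)" using uP(2)[OF that(1)] y(2)[OF that(1)] unit that(1) by (simp add: \<delta>_def)
    then have "\<forall>g\<in>M. u h g \<sqsubseteq> \<delta> h g" using ord uP(1)[OF that(1)] \<delta>P[OF that(1)] by simp
    then have "u h k \<sqsubseteq> \<delta> h k" using that(2) by blast
    then have "u h k \<sqsubseteq> \<bottom>" using that by (simp add: \<delta>_def)
    then show ?thesis using le_bottom uc(1)[OF that(1,2)] by blast
  qed
  define v where "v = (\<lambda>h\<in>M. u h h)"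
  have vP: "v \<in> Pr" using uc by (auto simp: v_def Pr_def int)
  have "y h \<sqsubseteq> \<phi> v" if h: "h \<in> M" for h
  proof -
    have "u h k \<sqsubseteq> v k" if k: "k \<in> M" for k
      using off[OF h k] L_refl[OF uc(1)[OF h h]] bottom(2)[OF uc(1)[OF k k]] k by (cases "k = h") (simp_all add: v_def)
    then have "\<phi> (u h) \<sqsubseteq> \<phi> v" using ord uP(1)[OF h] vP by simp
    then show ?thesis using uP(2)[OF h] by simp
  qed
  then have "Join (y ` M) \<sqsubseteq> \<phi> v" using y(1) by (intro Join_lub(3) \<phi>P(1)[OF vP]) auto
  then have "x \<sqsubseteq> \<phi> v"
    using L_trans[OF x(1) _ \<phi>P(1)[OF vP] J[folded M_def]] Join_lub(1)[of "y ` M"] y(1) by auto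
  then have xv: "\<phi> v = x" using L_antisym[OF _ x(1)] \<phi>P[OF vP] by blast
  have g: "g \<in> M" using g by (simp add: M_def)
  define t where "t = (\<lambda>h\<in>M. h)"
  have tP: "t \<in> Pr" using M L_refl by (auto simp: t_def Pr_def int)
  have "\<phi> t \<sqsubseteq> \<phi> v" using \<phi>P(2)[OF tP] xv by simp
  then have "\<forall>h\<in>M. t h \<sqsubseteq> v h" using ord tP vP by simp
  then have "g \<sqsubseteq> u g g" using g by (simp add: t_def v_def)
  then have "\<delta> g k \<sqsubseteq> u g k" if "k \<in> M" for k
    using that bottom(2)[OF uc(1)[OF g that]] by (simp add: \<delta>_def)
  then have "\<phi> (\<delta> g) \<sqsubseteq> \<phi> (u g)" using ord \<delta>P[OF g] uP(1)[OF g] by simp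
  then have "g \<sqsubseteq> y g" using unit g uP(2)[OF g] by (simp add: \<delta>_def)
  then show ?thesis using L_antisym[OF y(1)[OF g] M(1)[OF g] y(2)[OF g]] by simp
qed

end

section \<open>The face structure of the iterated blowup\<close>

lemma nested_subset: "S \<in> nested_sets L H \<Longrightarrow> S' \<subseteq> S \<Longrightarrow> S' \<in> nested_sets L H"
  unfolding nested_sets_def by blast

locale blowup_setting = geom_lattice L for L :: "'a gorder" (structure) +
  fixes H :: "'a set" and ps :: "'a list" and K :: "'a blow gorder"
  assumes pbs: "partial_building_set L H" and order: "blowup_order L H ps" and K: "K = iterated_blowup L ps"
begin

section \<open>Pairs as coordinates on the blowup\<close>

definition qs :: "'a list" where "qs = rev ps"

lemma set_qs: "set qs = H - atoms L" and distinct_qs: "distinct qs"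
  using order by (simp_all add: qs_def blowup_order_def)

lemma H_car: "h \<in> H \<Longrightarrow> h \<in> carrier L" and H_ne: "h \<in> H \<Longrightarrow> h \<noteq> \<bottom>"
  using pbs by (auto simp: partial_building_set_def building_set_def)

lemma qs_later:
  assumes "qs = us @ p # vs" "q \<in> set vs"
  shows "\<not> q \<sqsubseteq> p"
proof
  assume le: "q \<sqsubseteq> p"
  have "ps = rev qs" by (simp add: qs_def)
  then have ps: "ps = rev vs @ p # rev us" using assms(1) by simp
  have "q \<in> set (rev vs)" using assms(2) by simp
  then obtain i where "i < length (rev vs)" "rev vs ! i = q" unfolding in_set_conv_nth by blast
  then have i: "i < length vs" "rev vs ! i = q" by simp_all
  have q: "ps ! i = q" and p: "ps ! length vs = p" using i by (simp_all add: ps nth_append)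
  have "i < length ps" "length vs < length ps" using i by (simp_all add: ps)
  then have "length vs \<le> i" using order le q p unfolding blowup_order_def by blast
  then show False using i by simp
qed

lemma qs_car: "set qs \<subseteq> carrier L"
  using set_qs H_car by auto

lemma adm: "admissible qs"
  unfolding admissible_def using distinct_qs set_qs H_car H_ne qs_later by auto

text \<open>Bounding \<open>T\<close> by the list normalizes the label set: \<open>enc\<close> looks
  only at labels in the list, and with this bound distinct pairs have distinct codes.\<close>

definition V :: "'a set \<Rightarrow> 'a \<Rightarrow> bool" where
  "V T x \<longleftrightarrow> T \<subseteq> set qs \<and> x \<in> carrier L \<and> valid L qs T x"

abbreviation e :: "'a set \<Rightarrow> 'a \<Rightarrow> 'a blow" where "e \<equiv> enc qs"

lemma K_seq: "K = blow_seq L qs"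
  by (simp add: K iterated_blowup_eq qs_def)

lemma K_carrier: "w \<in> carrier K \<longleftrightarrow> (\<exists>T x. V T x \<and> w = e T x)"
proof
  assume "w \<in> carrier K"
  then obtain T x where w: "w = e T x" "x \<in> carrier L" "valid L qs T x"
    using blow_seq_structure(1)[OF adm] K_seq by auto
  have i: "(T \<inter> set qs) \<inter> set qs = T \<inter> set qs" by blast
  have "w = e (T \<inter> set qs) x" "valid L qs (T \<inter> set qs) x"
    using w enc_cong[OF i] valid_cong[OF i] by simp_all
  then show "\<exists>T x. V T x \<and> w = e T x" using w(2) by (intro exI[of _ "T \<inter> set qs"] exI[of _ x]) (simp add: V_def)
next
  assume "\<exists>T x. V T x \<and> w = e T x"
  then show "w \<in> carrier K" using blow_seq_structure(1)[OF adm] K_seq by (auto simp: V_def)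
qed

lemma e_in: "V T x \<Longrightarrow> e T x \<in> carrier K"
  using K_carrier by blast

lemma K_le: "V T x \<Longrightarrow> V T' x' \<Longrightarrow> e T x \<sqsubseteq>\<^bsub>K\<^esub> e T' x' \<longleftrightarrow> T \<subseteq> T' \<and> x \<sqsubseteq> x'"
  using blow_seq_structure(2)[OF adm, of x x' T T'] K_seq by (auto simp: V_def)

lemma e_inj: "V T x \<Longrightarrow> V T' x' \<Longrightarrow> e T x = e T' x' \<longleftrightarrow> T = T' \<and> x = x'"
  using enc_inj[OF distinct_qs, of T x T' x'] by (auto simp: V_def)

text \<open>Consequently the ideal below \<open>e T x\<close> is the product of the Boolean lattice
  of subsets of \<open>T\<close> with the interval below \<open>x\<close> in \<open>L\<close>. Ranks
  and apexes are read off from this product.\<close>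

lemma V_mono: "V T' x' \<Longrightarrow> T \<subseteq> T' \<Longrightarrow> x \<sqsubseteq> x' \<Longrightarrow> x \<in> carrier L \<Longrightarrow> V T x"
  using valid_mono[of qs T' x' T x] qs_car by (auto simp: V_def)

lemma V_car: "V T x \<Longrightarrow> x \<in> carrier L" "V T x \<Longrightarrow> T \<subseteq> set qs" "V T x \<Longrightarrow> finite T"
  by (auto simp: V_def intro: finite_subset)

lemma V_bot: "V {} \<bottom>"
  unfolding V_def using bottom(1) valid_empty[of qs "\<bottom>"] le_bottom set_qs H_ne H_car by auto

lemma poset_K: "poset K"
  unfolding poset_def
proof (intro conjI ballI impI)
  show "eq K = (=)" unfolding K_seq by (cases qs) (simp_all add: base_poset_def blowup_def)
  fix w assume "w \<in> carrier K"
  then obtain T x where w: "V T x" "w = e T x" using K_carrier by blast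
  then show "w \<sqsubseteq>\<^bsub>K\<^esub> w" using K_le[OF w(1) w(1)] L_refl V_car by simp
  fix w' assume "w' \<in> carrier K"
  then obtain T' x' where w': "V T' x'" "w' = e T' x'" using K_carrier by blast
  show "w = w'" if "w \<sqsubseteq>\<^bsub>K\<^esub> w'" "w' \<sqsubseteq>\<^bsub>K\<^esub> w"
    using that K_le[OF w(1) w'(1)] K_le[OF w'(1) w(1)] w(2) w'(2) L_antisym[of x x'] V_car(1)[OF w(1)] V_car(1)[OF w'(1)] by auto
  fix w'' assume "w'' \<in> carrier K"
  then obtain T'' x'' where w'': "V T'' x''" "w'' = e T'' x''" using K_carrier by blast
  show "w \<sqsubseteq>\<^bsub>K\<^esub> w''" if "w \<sqsubseteq>\<^bsub>K\<^esub> w'" "w' \<sqsubseteq>\<^bsub>K\<^esub> w''"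
    using that K_le[OF w(1) w'(1)] K_le[OF w'(1) w''(1)] K_le[OF w(1) w''(1)] w(2) w'(2) w''(2)
      L_trans[of x x' x''] V_car(1)[OF w(1)] V_car(1)[OF w'(1)] V_car(1)[OF w''(1)] by auto
qed

lemma bottom_K: "\<bottom>\<^bsub>K\<^esub> = e {} \<bottom>"
proof (rule poset_bottom_eq[OF poset_K e_in[OF V_bot]])
  fix w assume "w \<in> carrier K"
  then obtain T x where w: "V T x" "w = e T x" using K_carrier by blast
  then show "e {} \<bottom> \<sqsubseteq>\<^bsub>K\<^esub> w" using K_le[OF V_bot w(1)] bottom(2) V_car(1) by simp
qed

lemma bottom_K_least: "\<bottom>\<^bsub>K\<^esub> \<in> carrier K" "w \<in> carrier K \<Longrightarrow> \<bottom>\<^bsub>K\<^esub> \<sqsubseteq>\<^bsub>K\<^esub> w"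
proof -
  show "\<bottom>\<^bsub>K\<^esub> \<in> carrier K" unfolding bottom_K by (rule e_in[OF V_bot])
  assume "w \<in> carrier K"
  then obtain T x where w: "V T x" "w = e T x" using K_carrier by blast
  then show "\<bottom>\<^bsub>K\<^esub> \<sqsubseteq>\<^bsub>K\<^esub> w" unfolding bottom_K using K_le[OF V_bot w(1)] bottom(2) V_car(1) by simp
qed

definition height :: "'a blow \<Rightarrow> nat" where
  "height w = (THE n. \<exists>T x. V T x \<and> w = e T x \<and> n = card T + rk x)"

lemma height_e: "V T x \<Longrightarrow> height (e T x) = card T + rk x"
  unfolding height_def by (rule the_equality) (auto simp: e_inj)

sublocale ranked K height
proof
  show "poset K" by (rule poset_K)
  have "carrier K \<subseteq> (\<lambda>(T, x). e T x) ` (Pow (set qs) \<times> carrier L)"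
    using K_carrier V_car(1,2) by fastforce
  then show "finite (carrier K)" using finL by (auto intro: finite_subset)
  show "height w < height w'" if *: "w \<in> carrier K" "w' \<in> carrier K" "w \<sqsubseteq>\<^bsub>K\<^esub> w'" "w \<noteq> w'" for w w'
  proof -
    obtain T x where w: "V T x" "w = e T x" using *(1) K_carrier by blast
    obtain T' x' where w': "V T' x'" "w' = e T' x'" using *(2) K_carrier by blast
    have le: "T \<subseteq> T'" "x \<sqsubseteq> x'" using *(3) K_le[OF w(1) w'(1)] w w' by auto
    have "card T \<le> card T'" using le(1) V_car(3)[OF w'(1)] by (simp add: card_mono)
    moreover have "rk x \<le> rk x'" using rk_mono[of x x'] le(2) V_car(1)[OF w(1)] V_car(1)[OF w'(1)] by (cases "x = x'") auto
    moreover have "T \<noteq> T' \<or> x \<noteq> x'" using *(4) w w' by auto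
    then have "card T < card T' \<or> rk x < rk x'"
      using psubset_card_mono[OF V_car(3)[OF w'(1)], of T] le rk_mono[of x x'] V_car(1)[OF w(1)] V_car(1)[OF w'(1)] by blast
    ultimately show ?thesis using w w' by (auto simp: height_e)
  qed
  show "\<exists>w'\<in>carrier K. w' \<sqsubseteq>\<^bsub>K\<^esub> w \<and> w' \<noteq> w \<and> Suc (height w') = height w" if *: "w \<in> carrier K" "0 < height w" for w
  proof -
    obtain T x where w: "V T x" "w = e T x" using *(1) K_carrier by blast
    have x: "x \<in> carrier L" and fT: "finite T" using V_car[OF w(1)] by auto
    show ?thesis
    \<comment> \<open>An element of the next lower rank is reached by descending in \<open>L\<close>
      when there are no labels, and otherwise by dropping a label.\<close>
    proof (cases "T = {}")
      case True
      then have "0 < rk x" using *(2) w by (simp add: height_e)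
      then obtain y where y: "covers L y x" using rk_pred[OF x] by blast
      note c = covers_le[OF y]
      have V: "V T y" by (rule V_mono[OF w(1)]) (use c in auto)
      show ?thesis
        by (rule bexI[OF _ e_in[OF V]])
          (use K_le[OF V w(1)] e_inj[OF V w(1)] c rk_covers[OF y] w in \<open>auto simp: height_e V\<close>)
    next
      case False
      then obtain t where t: "t \<in> T" by blast
      have V: "V (T - {t}) x" by (rule V_mono[OF w(1)]) (use L_refl x in auto)
      have "card T = Suc (card (T - {t}))" using card.remove[OF fT t] .
      then show ?thesis
        by (intro bexI[OF _ e_in[OF V]])
          (use K_le[OF V w(1)] e_inj[OF V w(1)] L_refl[OF x] t w in \<open>auto simp: height_e V\<close>)
    qed
  qed
qed

lemma height_bottom: "height \<bottom>\<^bsub>K\<^esub> = 0"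
  unfolding bottom_K using height_e[OF V_bot] rk_bottom by simp

text \<open>In the product of a Boolean lattice with a geometric interval, a label serves if there
  is one: adding it to a label set is a join and raises the rank by one. Without labels an atom of
  \<open>L\<close> serves, by semimodularity. The bound \<open>w\<close> matters: joins need not
  exist in all of \<open>K\<close>, while those formed below \<open>w\<close> are valid by
  \<open>V_mono\<close>.\<close>

lemma apex_exists:
  assumes "w \<in> carrier K" "w \<noteq> \<bottom>\<^bsub>K\<^esub>"
  shows "\<exists>a\<in>carrier K. a \<sqsubseteq>\<^bsub>K\<^esub> w \<and> a \<noteq> \<bottom>\<^bsub>K\<^esub> \<and> (\<forall>v\<in>carrier K. v \<sqsubseteq>\<^bsub>K\<^esub> w \<longrightarrow> \<not> a \<sqsubseteq>\<^bsub>K\<^esub> v \<longrightarrow>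
    (\<exists>u\<in>carrier K. u \<sqsubseteq>\<^bsub>K\<^esub> w \<and> v \<sqsubseteq>\<^bsub>K\<^esub> u \<and> a \<sqsubseteq>\<^bsub>K\<^esub> u \<and> height u = Suc (height v)
      \<and> (\<forall>t\<in>carrier K. v \<sqsubseteq>\<^bsub>K\<^esub> t \<longrightarrow> a \<sqsubseteq>\<^bsub>K\<^esub> t \<longrightarrow> u \<sqsubseteq>\<^bsub>K\<^esub> t)))"
proof -
  obtain T x where w: "V T x" "w = e T x" using assms(1) K_carrier by blast
  have x: "x \<in> carrier L" using V_car(1)[OF w(1)] .
  show ?thesis
  proof (cases "T = {}")
    case True
    have "x \<noteq> \<bottom>" using assms(2) w True bottom_K by auto
    then obtain a where a: "a \<in> atoms L" "a \<sqsubseteq> x" using atom_exists[OF x] by blast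
    have ac: "a \<in> carrier L" using atomD(1)[OF a(1)] .
    have Va: "V {} a" by (rule V_mono[OF w(1)]) (use a ac in auto)
    show ?thesis
    proof (rule bexI[OF _ e_in[OF Va]], intro conjI ballI impI)
      show "e {} a \<sqsubseteq>\<^bsub>K\<^esub> w" using K_le[OF Va w(1)] a w by simp
      show "e {} a \<noteq> \<bottom>\<^bsub>K\<^esub>" using e_inj[OF Va V_bot] atomD(2)[OF a(1)] bottom_K by simp
      fix v assume v: "v \<in> carrier K" "v \<sqsubseteq>\<^bsub>K\<^esub> w" "\<not> e {} a \<sqsubseteq>\<^bsub>K\<^esub> v"
      then obtain S y where y: "V S y" "v = e S y" using K_carrier by blast
      have yc: "y \<in> carrier L" using V_car(1)[OF y(1)] .
      have le: "S \<subseteq> T" "y \<sqsubseteq> x" "\<not> a \<sqsubseteq> y" using v(2,3) K_le[OF y(1) w(1)] K_le[OF Va y(1)] y(2) w(2) by auto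
      have jle: "y \<squnion> a \<sqsubseteq> x" and jc: "y \<squnion> a \<in> carrier L" using join_iff[OF yc ac x] le a(2) lat.join_closed[OF yc ac] by auto
      have Vu: "V S (y \<squnion> a)" by (rule V_mono[OF w(1) le(1) jle jc])
      show "\<exists>u\<in>carrier K. u \<sqsubseteq>\<^bsub>K\<^esub> w \<and> v \<sqsubseteq>\<^bsub>K\<^esub> u \<and> e {} a \<sqsubseteq>\<^bsub>K\<^esub> u \<and> height u = Suc (height v)
        \<and> (\<forall>t\<in>carrier K. v \<sqsubseteq>\<^bsub>K\<^esub> t \<longrightarrow> e {} a \<sqsubseteq>\<^bsub>K\<^esub> t \<longrightarrow> u \<sqsubseteq>\<^bsub>K\<^esub> t)"
      proof (rule bexI[OF _ e_in[OF Vu]], intro conjI ballI impI)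
        show "e S (y \<squnion> a) \<sqsubseteq>\<^bsub>K\<^esub> w" using K_le[OF Vu w(1)] le jle w by simp
        show "v \<sqsubseteq>\<^bsub>K\<^esub> e S (y \<squnion> a)" using K_le[OF y(1) Vu] y lat.join_left[OF yc ac] by simp
        show "e {} a \<sqsubseteq>\<^bsub>K\<^esub> e S (y \<squnion> a)" using K_le[OF Va Vu] lat.join_right[OF yc ac] by simp
        show "height (e S (y \<squnion> a)) = Suc (height v)" using y Vu rk_join_atom[OF yc a(1) le(3)] by (simp add: height_e)
        fix t assume t: "t \<in> carrier K" "v \<sqsubseteq>\<^bsub>K\<^esub> t" "e {} a \<sqsubseteq>\<^bsub>K\<^esub> t"
        then obtain R z where z: "V R z" "t = e R z" using K_carrier by blast
        then show "e S (y \<squnion> a) \<sqsubseteq>\<^bsub>K\<^esub> t"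
          using t K_le[OF y(1) z(1)] K_le[OF Va z(1)] K_le[OF Vu z(1)] y(2) join_iff[OF yc ac V_car(1)[OF z(1)]] by simp
      qed
    qed
  next
    case False
    then obtain a where a: "a \<in> T" by blast
    have Va: "V {a} \<bottom>" by (rule V_mono[OF w(1)]) (use a bottom x in auto)
    show ?thesis
    proof (rule bexI[OF _ e_in[OF Va]], intro conjI ballI impI)
      show "e {a} \<bottom> \<sqsubseteq>\<^bsub>K\<^esub> w" using K_le[OF Va w(1)] a w bottom(2)[OF x] by simp
      show "e {a} \<bottom> \<noteq> \<bottom>\<^bsub>K\<^esub>" using e_inj[OF Va V_bot] bottom_K by simp
      fix v assume v: "v \<in> carrier K" "v \<sqsubseteq>\<^bsub>K\<^esub> w" "\<not> e {a} \<bottom> \<sqsubseteq>\<^bsub>K\<^esub> v"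
      then obtain S y where y: "V S y" "v = e S y" using K_carrier by blast
      have yc: "y \<in> carrier L" using V_car(1)[OF y(1)] .
      have le: "S \<subseteq> T" "y \<sqsubseteq> x" "a \<notin> S"
        using v(2,3) K_le[OF y(1) w(1)] K_le[OF Va y(1)] y(2) w(2) bottom(2)[OF yc] by auto
      have Vu: "V (insert a S) y" by (rule V_mono[OF w(1)]) (use le a yc in auto)
      show "\<exists>u\<in>carrier K. u \<sqsubseteq>\<^bsub>K\<^esub> w \<and> v \<sqsubseteq>\<^bsub>K\<^esub> u \<and> e {a} \<bottom> \<sqsubseteq>\<^bsub>K\<^esub> u \<and> height u = Suc (height v)
        \<and> (\<forall>t\<in>carrier K. v \<sqsubseteq>\<^bsub>K\<^esub> t \<longrightarrow> e {a} \<bottom> \<sqsubseteq>\<^bsub>K\<^esub> t \<longrightarrow> u \<sqsubseteq>\<^bsub>K\<^esub> t)"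
      proof (rule bexI[OF _ e_in[OF Vu]], intro conjI ballI impI)
        show "e (insert a S) y \<sqsubseteq>\<^bsub>K\<^esub> w" using K_le[OF Vu w(1)] le a w by simp
        show "v \<sqsubseteq>\<^bsub>K\<^esub> e (insert a S) y" using K_le[OF y(1) Vu] y L_refl[OF yc] by auto
        show "e {a} \<bottom> \<sqsubseteq>\<^bsub>K\<^esub> e (insert a S) y" using K_le[OF Va Vu] bottom(2)[OF yc] by simp
        show "height (e (insert a S) y) = Suc (height v)" using y Vu le(3) V_car(3)[OF y(1)] by (simp add: height_e)
        fix t assume t: "t \<in> carrier K" "v \<sqsubseteq>\<^bsub>K\<^esub> t" "e {a} \<bottom> \<sqsubseteq>\<^bsub>K\<^esub> t"
        then obtain R z where z: "V R z" "t = e R z" using K_carrier by blast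
        then show "e (insert a S) y \<sqsubseteq>\<^bsub>K\<^esub> t"
          using t K_le[OF y(1) z(1)] K_le[OF Va z(1)] K_le[OF Vu z(1)] y(2) by simp
      qed
    qed
  qed
qed

text \<open>If an antichain in the set had its join \<open>h\<close> in \<open>H\<close>, then
  \<open>h\<close> would be no atom and hence be blown up. The members of the antichain in
  \<open>T\<close> lie strictly below \<open>h\<close>, so they were blown up after it, and the
  others lie below \<open>x\<close>; thus \<open>h\<close> lies below the join that
  \<open>valid_iff\<close> forbids.\<close>

lemma valid_nested:
  assumes "V T x"
  shows "T \<union> {a \<in> atoms L. a \<sqsubseteq> x} \<in> nested_sets L H"
proof -
  let ?S = "T \<union> {a \<in> atoms L. a \<sqsubseteq> x}"
  have aH: "atoms L \<subseteq> H" using pbs by (auto simp: partial_building_set_def)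
  have SH: "?S \<subseteq> H" using assms set_qs aH by (auto simp: V_def)
  have x: "x \<in> carrier L" using V_car(1)[OF assms] .
  have "\<Squnion> B \<notin> H" if B: "B \<subseteq> ?S" "2 \<le> card B" "\<forall>a\<in>B. \<forall>b\<in>B. a \<noteq> b \<longrightarrow> \<not> a \<sqsubseteq> b" for B
  proof
    let ?h = "\<Squnion> B"
    assume h: "?h \<in> H"
    have Bc: "B \<subseteq> carrier L" using B(1) SH H_car by blast
    have Bne: "B \<noteq> {}" using B(2) by auto
    note S = Sup_least[OF Bc Bne, unfolded is_lub_iff]
    have hc: "?h \<in> carrier L" and ub: "\<And>b. b \<in> B \<Longrightarrow> b \<sqsubseteq> ?h" using S Bc by auto
    have other: "\<exists>b'\<in>B. b' \<noteq> b" if "b \<in> B" for b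
    proof (rule ccontr)
      assume "\<not> ?thesis"
      then have "B = {b}" using that by blast
      then show False using B(2) by simp
    qed
    have strict: "b \<noteq> ?h" if b: "b \<in> B" for b
      using other[OF b] ub B(3) b by metis
    have "?h \<notin> atoms L"
    proof
      assume at: "?h \<in> atoms L"
      obtain b where b: "b \<in> B" using Bne by blast
      then have "b = \<bottom> \<or> b = ?h" using atomD(3)[OF at _ ub[OF b]] Bc by blast
      then show False using strict[OF b] H_ne B(1) SH b by blast
    qed
    then have "?h \<in> set qs" using h set_qs by simp
    then obtain us vs where q: "qs = us @ ?h # vs" by (meson split_list)
    have c: "insert x (T \<inter> set us) \<subseteq> carrier L" using x qs_car V_car(2)[OF assms] by auto
    note J = Join_lub[OF c]
    have "b \<sqsubseteq> Join (insert x (T \<inter> set us))" if b: "b \<in> B" for b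
    proof (cases "b \<in> T")
      case True
      then have "b \<in> set us" using V_car(2)[OF assms] q qs_later[OF q] ub[OF b] strict[OF b] by auto
      then show ?thesis using J(2) True by blast
    next
      case False
      then have "b \<sqsubseteq> x" using b B(1) by blast
      then show ?thesis using L_trans[OF _ x J(1) _ J(2)] b Bc by blast
    qed
    then have "?h \<sqsubseteq> Join (insert x (T \<inter> set us))" using S J(1) by blast
    moreover have "valid L qs T x" using assms by (simp add: V_def)
    ultimately show False using q valid_iff[OF x qs_car, of T] by blast
  qed
  then show ?thesis using SH by (simp add: nested_sets_def)
qed

text \<open>If validity failed at \<open>p\<close>, some maximal element \<open>g\<close> of the
  building set below the offending join would lie above \<open>p\<close>, hence in \<open>H\<close>
  by upward closure. By \<open>building_Join\<close>, \<open>g\<close> is a join of members of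
  \<open>S\<close> below it, and the maximal ones among them form an antichain that contradicts
  nestedness.\<close>

lemma nested_valid:
  assumes S: "S \<in> nested_sets L H"
  shows "V (S - atoms L) (Join (S \<inter> atoms L))"
proof -
  obtain G where G: "building_set L G" "H \<subseteq> G" "atoms L \<subseteq> H"
    and up: "\<forall>p\<in>H - atoms L. \<forall>g\<in>G. p \<sqsubseteq> g \<longrightarrow> g \<in> H - atoms L"
    using pbs unfolding partial_building_set_def by blast
  have GL: "G \<subseteq> carrier L" using G(1) by (auto simp: building_set_def)
  have SH: "S \<subseteq> H" using S by (simp add: nested_sets_def)
  have Sc: "S \<subseteq> carrier L" using SH H_car by blast
  let ?T = "S - atoms L" and ?x = "Join (S \<inter> atoms L)"
  have xc: "?x \<in> carrier L" by (rule Join_lub(1)) (use Sc in auto)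
  have "\<not> p \<sqsubseteq> Join (insert ?x (?T \<inter> set us))" if q: "qs = us @ p # vs" for us p vs
  proof
    assume le: "p \<sqsubseteq> Join (insert ?x (?T \<inter> set us))"
    have pq: "p \<in> H - atoms L" using q set_qs by auto
    have pc: "p \<in> carrier L" using pq H_car by blast
    define B where "B = (S \<inter> atoms L) \<union> (?T \<inter> set us)"
    have BS: "B \<subseteq> S" by (auto simp: B_def)
    have Bc: "B \<subseteq> carrier L" using BS Sc by blast
    define y where "y = Join B"
    note JB = Join_lub[OF Bc, folded y_def]
    have "?x \<sqsubseteq> y" by (rule Join_lub(3)) (use Sc JB in \<open>auto simp: B_def\<close>)
    then have "Join (insert ?x (?T \<inter> set us)) \<sqsubseteq> y"
      by (intro Join_lub(3)) (use xc Sc JB in \<open>auto simp: B_def\<close>)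
    then have py: "p \<sqsubseteq> y"
      using L_trans[OF pc _ JB(1) le] Join_lub(1)[of "insert ?x (?T \<inter> set us)"] xc Sc by auto
    have yne: "y \<noteq> \<bottom>" using py le_bottom[OF pc] H_ne pq by auto
    define M where "M = max_below L G y"
    have Mx: "\<exists>h\<in>M. b \<sqsubseteq> h" if b: "b \<in> G" "b \<sqsubseteq> y" for b
    proof -
      have "\<exists>a\<in>{g \<in> G. g \<sqsubseteq> y}. b \<sqsubseteq> a \<and> (\<forall>c\<in>{g \<in> G. g \<sqsubseteq> y}. a \<sqsubseteq> c \<longrightarrow> c = a)"
        by (rule max_above) (use GL b in auto)
      then show ?thesis unfolding M_def max_below_def L_less by blast
    qed
    obtain g where g: "g \<in> M" "p \<sqsubseteq> g" using Mx[OF _ py] pq G(2) by blast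
    have MG: "M \<subseteq> G" by (auto simp: M_def max_below_def)
    have gH: "g \<in> H - atoms L" using up pq g MG by blast
    have gc: "g \<in> carrier L" using gH H_car by blast
    \<comment> \<open>The part of the offending join that each maximal element accounts for. Every
      member of \<open>B\<close> lies below some maximal element, so these parts still join to
      \<open>y\<close>.\<close>
    define f where "f h = Join {b \<in> B. b \<sqsubseteq> h}" for h
    have cc: "{b \<in> B. b \<sqsubseteq> h} \<subseteq> carrier L" for h using Bc by auto
    have fc: "f h \<in> carrier L" for h unfolding f_def by (rule Join_lub(1)[OF cc])
    have fle: "f h \<sqsubseteq> h" if "h \<in> M" for h
      unfolding f_def by (rule Join_lub(3)[OF cc]) (use that MG GL in auto)
    have fM: "f ` M \<subseteq> carrier L" using fc by auto
    have "y \<sqsubseteq> Join (f ` M)"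
      unfolding y_def
    proof (rule Join_lub(3)[OF Bc Join_lub(1)[OF fM]])
      fix b assume b: "b \<in> B"
      have "b \<in> G" using b BS SH G(2) by blast
      then obtain h where h: "h \<in> M" "b \<sqsubseteq> h" using Mx JB(2)[OF b] by blast
      have "b \<sqsubseteq> f h" unfolding f_def by (rule Join_lub(2)[OF cc]) (use b h in auto)
      then show "b \<sqsubseteq> Join (f ` M)"
        using L_trans[OF _ fc Join_lub(1)[OF fM] _ Join_lub(2)[OF fM imageI[OF h(1)]]] b Bc by blast
    qed
    then have fg: "f g = g"
      using building_Join[OF G(1) JB(1) yne, of f g] fc fle g(1) by (simp add: M_def)
    define C where "C = {b \<in> B. b \<sqsubseteq> g}"
    have Cc: "C \<subseteq> carrier L" using Bc by (auto simp: C_def)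
    have JC: "Join C = g" using fg by (simp add: f_def C_def)
    \<comment> \<open>Labels in \<open>B\<close> are listed before \<open>p\<close>, and nothing
      listed before \<open>p\<close> lies above \<open>p\<close>; the atoms in \<open>B\<close> are
      excluded because \<open>g\<close> is no atom. This rules out the trivial way for
      \<open>g\<close> to be the join.\<close>
    have "g \<notin> C"
    proof
      assume "g \<in> C"
      then have "g \<in> set us" using gH by (auto simp: C_def B_def)
      then obtain us1 us2 where "us = us1 @ g # us2" by (meson split_list)
      then have "qs = us1 @ g # (us2 @ p # vs)" using q by simp
      from qs_later[OF this, of p] show False using g(2) by simp
    qed
    define A where "A = {a \<in> C. \<forall>b\<in>C. a \<sqsubseteq> b \<longrightarrow> b = a}"
    have AC: "A \<subseteq> C" by (auto simp: A_def)
    have Ac: "A \<subseteq> carrier L" using AC Cc by blast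
    have above: "\<exists>a\<in>A. c \<sqsubseteq> a" if "c \<in> C" for c
      using max_above[OF Cc that] unfolding A_def by blast
    have JA: "Join A = g"
    proof (rule L_antisym[OF Join_lub(1)[OF Ac] gc])
      show "Join A \<sqsubseteq> g" by (rule Join_lub(3)[OF Ac gc]) (use AC in \<open>auto simp: C_def\<close>)
      have "Join C \<sqsubseteq> Join A"
      proof (rule Join_lub(3)[OF Cc Join_lub(1)[OF Ac]])
        fix c assume c: "c \<in> C"
        obtain a where a: "a \<in> A" "c \<sqsubseteq> a" using above[OF c] by blast
        show "c \<sqsubseteq> Join A" using L_trans[OF _ _ Join_lub(1)[OF Ac] a(2) Join_lub(2)[OF Ac a(1)]] c a(1) Cc Ac by blast
      qed
      then show "g \<sqsubseteq> Join A" using JC by simp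
    qed
    have Ane: "A \<noteq> {}"
    proof
      assume "A = {}"
      then have "g \<sqsubseteq> \<bottom>" using JA Join_lub(3)[of "{}" "\<bottom>"] bottom by auto
      then show False using le_bottom[OF gc] H_ne gH by blast
    qed
    have "card A \<noteq> 1"
    proof
      assume "card A = 1"
      then obtain a where a: "A = {a}" by (auto simp: card_1_singleton_iff)
      then have ac: "a \<in> carrier L" using Ac by blast
      have "g \<sqsubseteq> a" using JA Join_lub(3)[OF Ac ac] a L_refl[OF ac] by auto
      moreover have "a \<sqsubseteq> g" "a \<in> C" using a AC by (auto simp: C_def)
      ultimately have "g = a" using L_antisym[OF gc ac] by blast
      then show False using \<open>a \<in> C\<close> \<open>g \<notin> C\<close> by simp
    qed
    moreover have "card A \<noteq> 0" using Ane finite_subset[OF Ac finL] by simp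
    ultimately have "2 \<le> card A" by linarith
    moreover have "A \<subseteq> S" using AC BS by (auto simp: C_def)
    moreover have "\<forall>a\<in>A. \<forall>b\<in>A. a \<noteq> b \<longrightarrow> \<not> a \<sqsubseteq> b" by (auto simp: A_def)
    ultimately have "\<Squnion> A \<notin> H" using S unfolding nested_sets_def by blast
    then show False using Join_eq_Sup[OF Ac Ane] JA gH by simp
  qed
  then have "valid L qs ?T ?x" unfolding valid_iff[OF xc qs_car] by blast
  then show ?thesis using xc SH set_qs by (auto simp: V_def)
qed

section \<open>Atoms of the blowup and monotonicity of nonfaces\<close>

lemma enc_single: "distinct q \<Longrightarrow> g \<in> set q \<Longrightarrow> enc q {g} x = Exc (Elt g) (Elt x)"
proof (induction q)
  case (Cons p q)
  have "enc q' {} x = Elt x" for q' by (induction q') simp_all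
  moreover have "enc q {g} x = enc q {} x" if "g \<notin> set q" by (rule enc_cong) (use that in auto)
  ultimately show ?case using Cons by auto
qed simp

lemma enc_empty: "enc q {} x = Elt x"
  by (induction q) simp_all

lemma blow_atom_e:
  assumes "g \<in> H"
  shows "blow_atom L g = (if g \<in> atoms L then e {} g else e {g} \<bottom>)"
    and "if g \<in> atoms L then V {} g else V {g} \<bottom>"
proof -
  have gq: "g \<in> set qs" if "g \<notin> atoms L" using that assms set_qs by blast
  show "blow_atom L g = (if g \<in> atoms L then e {} g else e {g} \<bottom>)"
    using enc_single[OF distinct_qs gq] by (simp add: blow_atom_def enc_empty)
  \<comment> \<open>A singleton contains no antichain with two elements, so it is nested, and
    \<open>nested_valid\<close> supplies the valid pair.\<close>
  have n: "{g} \<in> nested_sets L H"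
  proof -
    have "card A \<le> 1" if "A \<subseteq> {g}" for A using card_mono[OF _ that] by simp
    then show ?thesis using assms by (fastforce simp: nested_sets_def)
  qed
  have J: "Join B = m" if "B \<subseteq> {m}" "m \<in> B \<or> m = \<bottom>" "m \<in> carrier L" for B m
  proof -
    have c: "B \<subseteq> carrier L" using that by blast
    show ?thesis
    proof (rule L_antisym[OF Join_lub(1)[OF c] that(3)])
      show "Join B \<sqsubseteq> m" by (rule Join_lub(3)[OF c that(3)]) (use that(1) L_refl[OF that(3)] in auto)
      show "m \<sqsubseteq> Join B" using that(2) Join_lub(2)[OF c] bottom(2)[OF Join_lub(1)[OF c]] by blast
    qed
  qed
  show "if g \<in> atoms L then V {} g else V {g} \<bottom>"
  proof (cases "g \<in> atoms L")
    case True
    then have "{g} - atoms L = {}" "{g} \<inter> atoms L = {g}" by auto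
    then show ?thesis using nested_valid[OF n] J[of "{g}" g] H_car[OF assms] True by simp
  next
    case False
    then have "{g} - atoms L = {g}" "{g} \<inter> atoms L = {}" by auto
    then show ?thesis using nested_valid[OF n] J[of "{}" "\<bottom>"] bottom(1) False by simp
  qed
qed

lemma blow_atom_in: "g \<in> H \<Longrightarrow> blow_atom L g \<in> carrier K"
  using blow_atom_e[of g] e_in by (auto split: if_splits)

text \<open>Together with \<open>valid_nested\<close> this says that the atoms of \<open>K\<close>
  below a given element form a nested set.\<close>

lemma blow_atom_le:
  assumes "g \<in> H" "V T x"
  shows "blow_atom L g \<sqsubseteq>\<^bsub>K\<^esub> e T x \<longleftrightarrow> g \<in> T \<union> {a \<in> atoms L. a \<sqsubseteq> x}"
proof (cases "g \<in> atoms L")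
  case True
  then have "g \<notin> T" using assms(2) set_qs by (auto simp: V_def)
  then show ?thesis using True blow_atom_e[OF assms(1)] K_le[OF _ assms(2), of "{}" g] by simp
next
  case False
  then show ?thesis using blow_atom_e[OF assms(1)] K_le[OF _ assms(2), of "{g}" "\<bottom>"] bottom(2)[OF V_car(1)[OF assms(2)]] by simp
qed

text \<open>Hence the ideals that define the De Concini--Procesi sheaf increase along \<open>K\<close>.\<close>

lemma nonface_mono:
  assumes yz: "y \<in> carrier K" "z \<in> carrier K" "y \<sqsubseteq>\<^bsub>K\<^esub> z"
    and S: "S \<in> nested_sets L H" "is_lub K y (blow_atom L ` S)" and R: "R \<subseteq> H" "S \<union> R \<notin> nested_sets L H"
  shows "\<exists>S'\<in>nested_sets L H. is_lub K z (blow_atom L ` S') \<and> S' \<union> R \<notin> nested_sets L H"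
proof -
  obtain T x where z: "V T x" "z = e T x" using yz(2) K_carrier by blast
  \<comment> \<open>All atoms of \<open>K\<close> below \<open>z\<close>. As \<open>z\<close> is
    their join, this is one of the sets to which the generators of the ideal at \<open>z\<close>
    refer.\<close>
  let ?S = "T \<union> {a \<in> atoms L. a \<sqsubseteq> x}"
  have x: "x \<in> carrier L" using V_car(1)[OF z(1)] .
  have N: "?S \<in> nested_sets L H" by (rule valid_nested[OF z(1)])
  have SH: "?S \<subseteq> H" "S \<subseteq> H" using N S(1) by (auto simp: nested_sets_def)
  have le_of: "z \<sqsubseteq>\<^bsub>K\<^esub> w" if w: "w \<in> carrier K" "\<And>g. g \<in> ?S \<Longrightarrow> blow_atom L g \<sqsubseteq>\<^bsub>K\<^esub> w" for w
  proof -
    obtain U v where u: "V U v" "w = e U v" using w(1) K_carrier by blast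
    have mem: "g \<in> U \<union> {a \<in> atoms L. a \<sqsubseteq> v}" if "g \<in> ?S" for g
      using w(2)[OF that] blow_atom_le[OF _ u(1), of g] u(2) SH(1) that by auto
    have "T \<subseteq> U" using mem set_qs V_car(2)[OF z(1)] by blast
    moreover have "x \<sqsubseteq> v"
    proof (rule atomistic[OF x V_car(1)[OF u(1)]])
      fix a assume "a \<in> atoms L" "a \<sqsubseteq> x"
      then show "a \<sqsubseteq> v" using mem[of a] V_car(2)[OF u(1)] set_qs by blast
    qed
    ultimately show ?thesis using K_le[OF z(1) u(1)] z(2) u(2) by simp
  qed
  have lub: "is_lub K z (blow_atom L ` ?S)"
    unfolding is_lub_iff
  proof (intro conjI ballI impI)
    show "z \<in> carrier K" by fact
    fix w assume "w \<in> blow_atom L ` ?S \<inter> carrier K"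
    then obtain g where g: "g \<in> ?S" "w = blow_atom L g" by blast
    then show "w \<sqsubseteq>\<^bsub>K\<^esub> z" using blow_atom_le[OF _ z(1), of g] z(2) SH(1) by auto
  next
    fix w assume w: "w \<in> carrier K" "\<forall>u\<in>blow_atom L ` ?S \<inter> carrier K. u \<sqsubseteq>\<^bsub>K\<^esub> w"
    show "z \<sqsubseteq>\<^bsub>K\<^esub> w"
    proof (rule le_of[OF w(1)])
      fix g assume g: "g \<in> ?S"
      have "blow_atom L g \<in> carrier K" using blow_atom_in SH(1) g by blast
      then show "blow_atom L g \<sqsubseteq>\<^bsub>K\<^esub> w" using w(2) g by blast
    qed
  qed
  \<comment> \<open>Otherwise the atoms in \<open>?S \<union> R\<close> would have an upper bound
    \<open>?w\<close>. It lies above \<open>z\<close>, hence above \<open>y\<close> and the atoms in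
    \<open>S\<close>, so \<open>S \<union> R\<close> would consist of atoms below \<open>?w\<close>
    and be nested.\<close>
  have "?S \<union> R \<notin> nested_sets L H"
  proof
    assume N2: "?S \<union> R \<in> nested_sets L H"
    let ?U = "(?S \<union> R) - atoms L" and ?v = "Join ((?S \<union> R) \<inter> atoms L)"
    have Vw: "V ?U ?v" by (rule nested_valid[OF N2])
    let ?w = "e ?U ?v"
    have c: "(?S \<union> R) \<inter> atoms L \<subseteq> carrier L" using atomD(1) by blast
    have mem: "g \<in> ?U \<union> {a \<in> atoms L. a \<sqsubseteq> ?v}" if "g \<in> ?S \<union> R" for g
      using that Join_lub(2)[OF c, of g] by blast
    have zw: "z \<sqsubseteq>\<^bsub>K\<^esub> ?w"
    proof (rule le_of[OF e_in[OF Vw]])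
      fix g assume "g \<in> ?S"
      then show "blow_atom L g \<sqsubseteq>\<^bsub>K\<^esub> ?w" using mem[of g] blow_atom_le[OF _ Vw, of g] SH(1) by blast
    qed
    have "S \<union> R \<subseteq> ?U \<union> {a \<in> atoms L. a \<sqsubseteq> ?v}"
    proof
      fix g assume "g \<in> S \<union> R"
      then consider "g \<in> R" | "g \<in> S" by blast
      then show "g \<in> ?U \<union> {a \<in> atoms L. a \<sqsubseteq> ?v}"
      proof cases
        case 1
        then show ?thesis using mem by blast
      next
        case 2
        then have gH: "g \<in> H" using SH(2) by blast
        note gK = blow_atom_in[OF gH]
        have "blow_atom L g \<sqsubseteq>\<^bsub>K\<^esub> y" using S(2) 2 gK by (simp add: is_lub_iff)
        then have "blow_atom L g \<sqsubseteq>\<^bsub>K\<^esub> z" using posetD(3)[OF poset_K gK yz(1,2) _ yz(3)] by blast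
        then have "blow_atom L g \<sqsubseteq>\<^bsub>K\<^esub> ?w" using posetD(3)[OF poset_K gK yz(2) e_in[OF Vw] _ zw] by blast
        then show ?thesis using blow_atom_le[OF gH Vw] by blast
      qed
    qed
    then have "S \<union> R \<in> nested_sets L H" using nested_subset[OF valid_nested[OF Vw]] by blast
    then show False using R(2) by contradiction
  qed
  then show ?thesis using N lub by blast
qed

end

section \<open>The flag complex\<close>

text \<open>Linearity on all finitely supported functions, without carriers. Operators built from
  sums and compositions are then linear outright, and membership in free modules or relation spaces
  is checked on basis elements.\<close>

definition linop :: "(('x \<Rightarrow>\<^sub>0 rat) \<Rightarrow> ('y \<Rightarrow>\<^sub>0 rat)) \<Rightarrow> bool" where
  "linop f \<longleftrightarrow> (\<forall>u v. f (u + v) = f u + f v) \<and> (\<forall>c u. f (scl c u) = scl c (f u))"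

lemma linopD:
  assumes "linop f"
  shows "f (u + v) = f u + f v" "f (scl c u) = scl c (f u)" "f 0 = 0" "f (- u) = - f u" "f (u - v) = f u - f v"
    "f (sum g A) = (\<Sum>x\<in>A. f (g x))"
proof -
  show a: "f (u + v) = f u + f v" for u v using assms by (simp add: linop_def)
  show "f (scl c u) = scl c (f u)" using assms by (simp add: linop_def)
  show z: "f 0 = 0" using a[of 0 0] by simp
  show m: "f (- u) = - f u" for u using a[of u "- u"] z by (simp add: eq_neg_iff_add_eq_0 add.commute)
  show "f (u - v) = f u - f v" using a[of u "- v"] m[of v] by simp
  show "f (sum g A) = (\<Sum>x\<in>A. f (g x))" by (induction A rule: infinite_finite_induct) (simp_all add: a z)
qed

lemma linop_lin_ext: "linop (lin_ext \<phi>)"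
  by (simp add: linop_def lin_ext_add lin_ext_scl)

lemma linop_comp: "linop f \<Longrightarrow> linop g \<Longrightarrow> linop (\<lambda>u. f (g u))"
  by (simp add: linop_def)

lemma linop_add: "linop f \<Longrightarrow> linop g \<Longrightarrow> linop (\<lambda>u. f u + g u)"
  by (simp add: linop_def)

lemma linop_uminus: "linop f \<Longrightarrow> linop (\<lambda>u. - f u)"
  by (auto simp: linop_def intro!: poly_mapping_eqI)

lemma linop_sum: "(\<And>i. i \<in> A \<Longrightarrow> linop (f i)) \<Longrightarrow> linop (\<lambda>u. \<Sum>i\<in>A. f i u)"
  by (simp add: linop_def sum.distrib scl_sum)

lemma linop_scl: "linop (scl c)"
  by (simp add: linop_def mult.commute)

lemma linop_expand:
  assumes "linop f"
  shows "f u = (\<Sum>x\<in>Poly_Mapping.keys u. scl (Poly_Mapping.lookup u x) (f (basis_elt x)))"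
proof -
  have "f u = f (\<Sum>x\<in>Poly_Mapping.keys u. Poly_Mapping.single x (Poly_Mapping.lookup u x))"
    using poly_mapping_expand[of u] by simp
  also have "\<dots> = (\<Sum>x\<in>Poly_Mapping.keys u. f (Poly_Mapping.single x (Poly_Mapping.lookup u x)))"
    by (rule linopD(6)[OF assms])
  also have "\<dots> = (\<Sum>x\<in>Poly_Mapping.keys u. scl (Poly_Mapping.lookup u x) (f (basis_elt x)))"
    using linopD(2)[OF assms, of "Poly_Mapping.lookup u x" "basis_elt x" for x] by simp
  finally show ?thesis .
qed

lemma linop_eq:
  assumes "linop f" "linop g" "\<And>x. x \<in> Poly_Mapping.keys u \<Longrightarrow> f (basis_elt x) = g (basis_elt x)"
  shows "f u = g u"
  using assms(3) by (simp add: linop_expand[OF assms(1), of u] linop_expand[OF assms(2), of u])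

lemma free_submoduleD:
  assumes "submodule R Rat (free_module B)"
  shows "0 \<in> R" "\<And>u v. u \<in> R \<Longrightarrow> v \<in> R \<Longrightarrow> u + v \<in> R" "\<And>c u. u \<in> R \<Longrightarrow> scl c u \<in> R"
    "\<And>u v. u \<in> R \<Longrightarrow> v \<in> R \<Longrightarrow> u - v \<in> R" "\<And>u. u \<in> R \<Longrightarrow> - u \<in> R"
    "\<And>(f :: 'i \<Rightarrow> _) A. (\<And>x. x \<in> A \<Longrightarrow> f x \<in> R) \<Longrightarrow> sum f A \<in> R"
proof -
  note D = submoduleD[OF free_module_module assms, unfolded free_module_simps]
  show z: "0 \<in> R" and a: "\<And>u v. u \<in> R \<Longrightarrow> v \<in> R \<Longrightarrow> u + v \<in> R" and s: "\<And>c u. u \<in> R \<Longrightarrow> scl c u \<in> R"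
    using D by auto
  have n: "- u = scl (- 1) u" for u :: "'a \<Rightarrow>\<^sub>0 rat" by (rule poly_mapping_eqI) simp
  show m: "\<And>u. u \<in> R \<Longrightarrow> - u \<in> R" using s n by metis
  show "\<And>u v. u \<in> R \<Longrightarrow> v \<in> R \<Longrightarrow> u - v \<in> R" using a m by (metis diff_conv_add_uminus)
  show "sum f A \<in> R" if "\<And>x. x \<in> A \<Longrightarrow> f x \<in> R" for f :: "'i \<Rightarrow> _" and A
    using that by (induction A rule: infinite_finite_induct) (auto simp: z a)
qed

lemma linop_in:
  assumes "linop f" "submodule R Rat (free_module B)" "\<And>x. x \<in> Poly_Mapping.keys u \<Longrightarrow> f (basis_elt x) \<in> R"
  shows "f u \<in> R"
  unfolding linop_expand[OF assms(1), of u]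
  by (rule free_submoduleD(6)[OF assms(2)], rule free_submoduleD(3)[OF assms(2)], rule assms(3))

lemma linop_lin_maps:
  assumes "linop f" "\<And>b. b \<in> B \<Longrightarrow> f (basis_elt b) \<in> carrier (free_module B')"
  shows "f \<in> lin_maps (free_module B) (free_module B')"
proof (rule lin_mapsI)
  fix x assume "x \<in> carrier (free_module B)"
  then show "f x \<in> carrier (free_module B')"
    by - (rule linop_in[OF assms(1) carrier_submodule[OF free_module_module]], rule assms(2), auto simp: free_module_simps)
qed (simp_all add: free_module_simps linopD[OF assms(1)])

lemma linop_rel:
  assumes "linop f" "S \<subseteq> carrier (free_module B)" "\<And>b. b \<in> B \<Longrightarrow> f (basis_elt b) \<in> carrier (free_module B')"
    "submodule R Rat (free_module B')" "\<And>s. s \<in> S \<Longrightarrow> f s \<in> R" "u \<in> gen_submodule (free_module B) S"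
  shows "f u \<in> R"
proof -
  have "f \<in> lin_maps (free_module B) (free_module B')" by (rule linop_lin_maps[OF assms(1)]) (rule assms(3))
  then have "f ` gen_submodule (free_module B) S \<subseteq> R"
    by (rule gen_submodule_map[OF free_module_module free_module_module _ assms(4,2)]) (rule assms(5))
  then show ?thesis using assms(6) by (rule subsetD[OF _ imageI])
qed

section \<open>Flag chains and their relations\<close>

context ranked
begin

definition Lev :: "nat \<Rightarrow> 'p set" where
  "Lev n = {y \<in> carrier P. \<rho> y = n}"

definition btw :: "'p \<Rightarrow> 'p \<Rightarrow> 'p set" where
  "btw u v = {y \<in> carrier P. u \<sqsubset> y \<and> y \<sqsubset> v}"

abbreviation fc :: "nat \<Rightarrow> 'p list set" where "fc \<equiv> flag_chains P"

definition gens :: "nat \<Rightarrow> ('p list \<Rightarrow>\<^sub>0 rat) set" where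
  "gens i = {\<Sum>y\<in>btw (ys ! (j - 1)) (ys ! (j + 1)). basis_elt (ys[j := y]) | ys j. ys \<in> fc i \<and> 0 < j \<and> j < i}"

lemma flag_rel_gens: "flag_rel P i = gen_submodule (free_module (fc i)) (gens i)"
  by (simp add: flag_rel_def gens_def btw_def)

lemma finite_Lev: "finite (Lev n)" and finite_btw: "finite (btw u v)"
  using fin by (simp_all add: Lev_def btw_def)

lemma less_rank: "x \<in> carrier P \<Longrightarrow> y \<in> carrier P \<Longrightarrow> x \<sqsubset> y \<Longrightarrow> \<rho> x < \<rho> y"
  using mono posetD(4)[OF poset] by blast

lemma less_trans: "x \<in> carrier P \<Longrightarrow> y \<in> carrier P \<Longrightarrow> z \<in> carrier P \<Longrightarrow> x \<sqsubset> y \<Longrightarrow> y \<sqsubset> z \<Longrightarrow> x \<sqsubset> z"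
  using posetD(3)[OF poset, of x y z] posetD(2)[OF poset, of x y] unfolding posetD(4)[OF poset] by blast

lemma rank_eqI: "x \<in> carrier P \<Longrightarrow> y \<in> carrier P \<Longrightarrow> x \<sqsubseteq> y \<Longrightarrow> \<rho> x = \<rho> y \<Longrightarrow> x = y"
  using mono[of x y] by auto

lemma btw_rank: "u \<in> carrier P \<Longrightarrow> v \<in> carrier P \<Longrightarrow> \<rho> v = Suc (Suc (\<rho> u)) \<Longrightarrow> y \<in> btw u v \<Longrightarrow> \<rho> y = Suc (\<rho> u)"
  using less_rank[of u y] less_rank[of y v] by (auto simp: btw_def)

lemma fc_0: "ys \<in> fc 0 \<longleftrightarrow> (\<exists>b\<in>Lev 0. ys = [b])"
  by (auto simp: flag_chains_def Lev_def rank_eq length_Suc_conv)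

lemma fc_snoc: "ys @ [y] \<in> fc (Suc i) \<longleftrightarrow> ys \<in> fc i \<and> y \<in> Lev (Suc i) \<and> last ys \<sqsubset> y"
proof
  assume *: "ys @ [y] \<in> fc (Suc i)"
  then have l: "length ys = Suc i" by (simp add: flag_chains_def)
  then have ne: "ys \<noteq> []" by auto
  have A: "(ys @ [y]) ! j \<in> carrier P" "rank P ((ys @ [y]) ! j) = j" if "j \<le> Suc i" for j
    using * that unfolding flag_chains_def by blast+
  have B: "(ys @ [y]) ! j \<sqsubset> (ys @ [y]) ! Suc j" if "j < Suc i" for j
    using * that unfolding flag_chains_def by blast
  have "ys ! j \<in> carrier P \<and> rank P (ys ! j) = j" if "j \<le> i" for j
    using A[of j] that l by (simp add: nth_append)
  moreover have "ys ! j \<sqsubset> ys ! Suc j" if "j < i" for j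
    using B[of j] that l by (simp add: nth_append)
  ultimately have "ys \<in> fc i" using l by (simp add: flag_chains_def)
  moreover have "y \<in> Lev (Suc i)" using A[of "Suc i"] l by (simp add: nth_append Lev_def rank_eq)
  moreover have "last ys \<sqsubset> y" using B[of i] l ne by (simp add: nth_append last_conv_nth)
  ultimately show "ys \<in> fc i \<and> y \<in> Lev (Suc i) \<and> last ys \<sqsubset> y" by blast
next
  assume *: "ys \<in> fc i \<and> y \<in> Lev (Suc i) \<and> last ys \<sqsubset> y"
  then have l: "length ys = Suc i" by (simp add: flag_chains_def)
  then have ne: "ys \<noteq> []" by auto
  have "(ys @ [y]) ! j \<in> carrier P \<and> rank P ((ys @ [y]) ! j) = j" if "j \<le> Suc i" for j
  proof (cases "j = Suc i")
    case True
    then show ?thesis using * l by (simp add: nth_append Lev_def rank_eq)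
  next
    case False
    then show ?thesis using * l that by (simp add: nth_append flag_chains_def)
  qed
  moreover have "(ys @ [y]) ! j \<sqsubset> (ys @ [y]) ! Suc j" if "j < Suc i" for j
  proof (cases "j = i")
    case True
    then show ?thesis using * l ne by (simp add: nth_append last_conv_nth)
  next
    case False
    then show ?thesis using * l that by (simp add: nth_append flag_chains_def)
  qed
  ultimately show "ys @ [y] \<in> fc (Suc i)" using l by (simp add: flag_chains_def)
qed

lemma fc_SucE:
  assumes "ys \<in> fc (Suc i)"
  obtains zs y where "ys = zs @ [y]" "zs \<in> fc i" "y \<in> Lev (Suc i)" "last zs \<sqsubset> y"
proof -
  have "ys \<noteq> []" using assms by (auto simp: flag_chains_def)
  then have "ys = butlast ys @ [last ys]" by simp
  then show thesis using that assms fc_snoc by metis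
qed

lemma fc_last: "ys \<in> fc i \<Longrightarrow> last ys \<in> Lev i"
  by (cases i) (auto simp: fc_0 elim: fc_SucE)

lemma fc_length: "ys \<in> fc i \<Longrightarrow> length ys = Suc i"
  by (simp add: flag_chains_def)

lemma fc_ne: "ys \<in> fc i \<Longrightarrow> ys \<noteq> []"
  by (auto simp: flag_chains_def)

lemma Lev_car: "y \<in> Lev n \<Longrightarrow> y \<in> carrier P" and Lev_rank: "y \<in> Lev n \<Longrightarrow> \<rho> y = n"
  by (simp_all add: Lev_def)

definition app :: "'p \<Rightarrow> ('p list \<Rightarrow>\<^sub>0 rat) \<Rightarrow> ('p list \<Rightarrow>\<^sub>0 rat)" where
  "app y = lin_ext (\<lambda>c. if last c \<sqsubset> y then basis_elt (c @ [y]) else 0)"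

lemma linop_app: "linop (app y)"
  unfolding app_def by (rule linop_lin_ext)

lemma app_basis: "app y (basis_elt c) = (if last c \<sqsubset> y then basis_elt (c @ [y]) else 0)"
  by (simp add: app_def)

lemma app_closed: "y \<in> Lev (Suc i) \<Longrightarrow> c \<in> fc i \<Longrightarrow> app y (basis_elt c) \<in> carrier (free_module (fc (Suc i)))"
  by (auto simp: app_basis basis_in_free fc_snoc free_module_simps)

text \<open>The contraction below recurses on the top of a chain. A relation at a lower interior
  position is a relation one degree down with a fixed top appended; one at the highest interior
  position moves the element just below the top and has to be treated on its own.\<close>

lemma gens_cases:
  assumes "g \<in> gens (Suc i)"
  shows "(\<exists>g'\<in>gens i. \<exists>z. \<exists>y\<in>Lev (Suc i). z \<sqsubset> y \<and> (\<forall>c\<in>Poly_Mapping.keys g'. c \<in> fc i \<and> last c = z) \<and> g = app y g')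
    \<or> (\<exists>k us y. i = Suc k \<and> us \<in> fc k \<and> y \<in> Lev (Suc i) \<and> last us \<sqsubset> y
        \<and> g = (\<Sum>w\<in>btw (last us) y. basis_elt (us @ [w, y])))"
proof -
  obtain ys j where ys: "ys \<in> fc (Suc i)" "0 < j" "j < Suc i"
    and g: "g = (\<Sum>y\<in>btw (ys ! (j - 1)) (ys ! (j + 1)). basis_elt (ys[j := y]))"
    using assms unfolding gens_def by blast
  obtain zs y where zs: "ys = zs @ [y]" "zs \<in> fc i" "y \<in> Lev (Suc i)" "last zs \<sqsubset> y"
    by (rule fc_SucE[OF ys(1)])
  note l = fc_length[OF zs(2)]
  show ?thesis
  proof (cases "j < i")
    case True
    let ?B = "btw (zs ! (j - 1)) (zs ! (j + 1))"
    define g' where "g' = (\<Sum>y\<in>?B. basis_elt (zs[j := y]))"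
    have last: "last (zs[j := w]) = last zs" for w using True l by (subst last_list_update) auto
    have e: "g = (\<Sum>w\<in>?B. basis_elt (zs[j := w] @ [y]))"
      unfolding g using True l by (simp add: zs(1) nth_append list_update_append)
    have "g = app y g'"
      unfolding e g'_def linopD(6)[OF linop_app] app_basis last using zs(4) by simp
    moreover have "g' \<in> gens i" unfolding gens_def g'_def using zs(2) ys(2) True by blast
    moreover have "c \<in> fc i \<and> last c = last zs" if c: "c \<in> Poly_Mapping.keys g'" for c
    proof -
      have "Poly_Mapping.keys g' \<subseteq> (\<Union>w\<in>?B. Poly_Mapping.keys (basis_elt (zs[j := w])))"
        unfolding g'_def by (rule Poly_Mapping.keys_sum)
      then obtain w where w: "w \<in> ?B" "c = zs[j := w]" using c by auto
      have A: "zs ! k \<in> carrier P" "rank P (zs ! k) = k" if "k \<le> i" for k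
        using zs(2) that by (auto simp: flag_chains_def)
      have B: "zs ! k \<sqsubset> zs ! Suc k" if "k < i" for k using zs(2) that by (auto simp: flag_chains_def)
      have wc: "w \<in> carrier P" "zs ! (j - 1) \<sqsubset> w" "w \<sqsubset> zs ! (j + 1)" using w(1) by (auto simp: btw_def)
      have "\<rho> w = Suc (\<rho> (zs ! (j - 1)))"
        by (rule btw_rank[OF _ _ _ w(1)]) (use A[of "j - 1"] A[of "j + 1"] ys(2) True rank_eq in auto)
      then have rw: "rank P w = j" using A[of "j - 1"] ys(2) True rank_eq wc(1) by simp
      have "zs[j := w] \<in> fc i"
        unfolding flag_chains_def
      proof (intro CollectI conjI allI impI)
        show "length (zs[j := w]) = Suc i" using l by simp
        fix k
        show "zs[j := w] ! k \<in> carrier P" "rank P (zs[j := w] ! k) = k" if "k \<le> i"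
          using A[OF that] wc(1) rw True l that by (auto simp: nth_list_update)
        show "zs[j := w] ! k \<sqsubset> zs[j := w] ! Suc k" if "k < i"
          using B[OF that] wc True l that by (auto simp: nth_list_update)
      qed
      then show ?thesis using w(2) last by simp
    qed
    ultimately show ?thesis using zs(3,4) by blast
  next
    case False
    then have j: "j = i" using ys(3) by simp
    then obtain k where k: "i = Suc k" using ys(2) by (cases i) auto
    obtain us z where us: "zs = us @ [z]" "us \<in> fc k" "z \<in> Lev (Suc k)" "last us \<sqsubset> z"
      using fc_SucE[of zs k] zs(2) k by auto
    have lu: "length us = Suc k" "us \<noteq> []" using fc_length[OF us(2)] by auto
    have "ys ! (j - 1) = last us" using lu by (simp add: zs(1) us(1) j k nth_append last_conv_nth)
    moreover have "ys ! (j + 1) = y" using lu by (simp add: zs(1) us(1) j k nth_append)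
    moreover have "ys[j := w] = us @ [w, y]" for w using lu by (simp add: zs(1) us(1) j k list_update_append)
    ultimately have "g = (\<Sum>w\<in>btw (last us) y. basis_elt (us @ [w, y]))" using g by simp
    moreover have "last us \<sqsubset> y"
      using less_trans[of "last us" z y] us zs Lev_car fc_last by auto
    ultimately show ?thesis using k us(2) zs(3) by blast
  qed
qed

lemma gens_top:
  assumes "us \<in> fc k" "y \<in> Lev (Suc (Suc k))"
  shows "(\<Sum>w\<in>btw (last us) y. basis_elt (us @ [w, y])) \<in> flag_rel P (Suc (Suc k))
    \<and> (\<forall>w\<in>btw (last us) y. us @ [w, y] \<in> fc (Suc (Suc k)))"
proof -
  have lu: "length us = Suc k" "us \<noteq> []" using fc_length[OF assms(1)] by auto
  have mem: "us @ [w, y] \<in> fc (Suc (Suc k))" if w: "w \<in> btw (last us) y" for w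
  proof -
    have u: "last us \<in> Lev k" using fc_last[OF assms(1)] .
    have "\<rho> w = Suc k" using btw_rank[OF _ _ _ w] u assms(2) Lev_car Lev_rank by metis
    then have "w \<in> Lev (Suc k)" "last us \<sqsubset> w" "w \<sqsubset> y" using w by (auto simp: btw_def Lev_def)
    then have "(us @ [w]) @ [y] \<in> fc (Suc (Suc k))" using assms by (simp only: fc_snoc) simp
    then show ?thesis by simp
  qed
  have "(\<Sum>w\<in>btw (last us) y. basis_elt (us @ [w, y])) \<in> flag_rel P (Suc (Suc k))"
  proof (cases "btw (last us) y = {}")
    \<comment> \<open>Without an element in between there may be no chain to index a generator, but
      then the sum is empty, and zero lies in every subspace.\<close>
    case True
    have "submodule (flag_rel P (Suc (Suc k))) Rat (free_module (fc (Suc (Suc k))))"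
      if "gens (Suc (Suc k)) \<subseteq> carrier (free_module (fc (Suc (Suc k))))"
      unfolding flag_rel_gens by (rule gen_submodule[OF free_module_module that])
    have "0 \<in> flag_rel P (Suc (Suc k))"
      unfolding flag_rel_gens gen_submodule_def hull_def
      using free_submoduleD(1) by blast
    then show ?thesis using True by simp
  next
    case False
    then obtain w where w: "w \<in> btw (last us) y" by blast
    let ?ys = "us @ [w, y]" and ?j = "Suc k"
    have "?ys ! (?j - 1) = last us" using lu by (simp add: nth_append last_conv_nth)
    moreover have "?ys ! (?j + 1) = y" using lu by (simp add: nth_append)
    moreover have "?ys[?j := v] = us @ [v, y]" for v using lu by (simp add: list_update_append)
    ultimately have "(\<Sum>w\<in>btw (last us) y. basis_elt (us @ [w, y])) = (\<Sum>v\<in>btw (?ys ! (?j - 1)) (?ys ! (?j + 1)). basis_elt (?ys[?j := v]))"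
      by simp
    then have "(\<Sum>w\<in>btw (last us) y. basis_elt (us @ [w, y])) \<in> gens (Suc (Suc k))"
      unfolding gens_def using mem[OF w] by (intro CollectI exI[of _ ?ys] exI[of _ ?j]) simp
    then show ?thesis unfolding flag_rel_gens by (rule gen_submodule_incl)
  qed
  then show ?thesis using mem by blast
qed

lemma gens_0: "gens 0 = {}"
  by (simp add: gens_def)

lemma app_closed':
  assumes "y \<in> Lev (Suc i)" "f \<in> carrier (free_module (fc i))"
  shows "app y f \<in> carrier (free_module (fc (Suc i)))"
  by (rule linop_in[OF linop_app carrier_submodule[OF free_module_module]])
    (rule app_closed[OF assms(1)], use assms(2) in \<open>auto simp: free_module_simps\<close>)

lemma gens_closed: "gens i \<subseteq> carrier (free_module (fc i))"
proof (induction i)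
  case 0
  then show ?case by (simp add: gens_0)
next
  case (Suc i)
  show ?case
  proof
    fix g assume "g \<in> gens (Suc i)"
    from gens_cases[OF this] show "g \<in> carrier (free_module (fc (Suc i)))"
    proof (elim disjE exE bexE conjE)
      fix g' z y assume "g' \<in> gens i" "y \<in> Lev (Suc i)" "g = app y g'"
      then show ?thesis using Suc app_closed' by blast
    next
      fix k us y assume *: "i = Suc k" "us \<in> fc k" "y \<in> Lev (Suc i)" "g = (\<Sum>w\<in>btw (last us) y. basis_elt (us @ [w, y]))"
      show ?thesis unfolding *(4)
        by (rule free_sum) (use gens_top[of us k y] * in \<open>auto simp: basis_in_free\<close>)
    qed
  qed
qed

lemma rel_submodule: "submodule (flag_rel P i) Rat (free_module (fc i))"
  unfolding flag_rel_gens by (rule gen_submodule[OF free_module_module gens_closed])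

lemma rel_closed: "u \<in> flag_rel P i \<Longrightarrow> u \<in> carrier (free_module (fc i))"
  using submoduleD(1)[OF free_module_module rel_submodule] by blast

lemma rel_map:
  assumes "linop f" "\<And>b. b \<in> fc i \<Longrightarrow> f (basis_elt b) \<in> carrier (free_module B)"
    "submodule R Rat (free_module B)" "\<And>s. s \<in> gens i \<Longrightarrow> f s \<in> R" "u \<in> flag_rel P i"
  shows "f u \<in> R"
  by (rule linop_rel[OF assms(1) gens_closed assms(2,3,4) assms(5)[unfolded flag_rel_gens]])

lemma app_rel:
  assumes y: "y \<in> Lev (Suc i)" and u: "u \<in> flag_rel P i"
  shows "app y u \<in> flag_rel P (Suc i)"
proof (rule rel_map[OF linop_app app_closed[OF y] rel_submodule _ u])
  fix s assume s: "s \<in> gens i"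
  obtain ys j where ys: "ys \<in> fc i" "0 < j" "j < i"
    and g: "s = (\<Sum>y\<in>btw (ys ! (j - 1)) (ys ! (j + 1)). basis_elt (ys[j := y]))"
    using s unfolding gens_def by blast
  note l = fc_length[OF ys(1)]
  have last: "last (ys[j := w]) = last ys" for w using ys l by (subst last_list_update) auto
  have e: "app y s = (\<Sum>w\<in>btw (ys ! (j - 1)) (ys ! (j + 1)). if last ys \<sqsubset> y then basis_elt (ys[j := w] @ [y]) else 0)"
    unfolding g linopD(6)[OF linop_app] app_basis last ..
  show "app y s \<in> flag_rel P (Suc i)"
  proof (cases "last ys \<sqsubset> y")
    case True
    let ?zs = "ys @ [y]"
    have "?zs \<in> fc (Suc i)" using True ys(1) y by (simp add: fc_snoc)
    moreover have "app y s = (\<Sum>w\<in>btw (?zs ! (j - 1)) (?zs ! (j + 1)). basis_elt (?zs[j := w]))"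
      unfolding e using True ys(3) l by (simp add: nth_append list_update_append)
    ultimately have "app y s \<in> gens (Suc i)" unfolding gens_def using ys(2,3) by (intro CollectI exI[of _ ?zs] exI[of _ j]) simp
    then show ?thesis unfolding flag_rel_gens by (rule gen_submodule_incl)
  next
    case False
    then show ?thesis using e free_submoduleD(1)[OF rel_submodule] by simp
  qed
qed

text \<open>The differential stripped of its sign, which is constant in each degree and can be put
  back by a scalar.\<close>

definition D :: "nat \<Rightarrow> ('p list \<Rightarrow>\<^sub>0 rat) \<Rightarrow> ('p list \<Rightarrow>\<^sub>0 rat)" where
  "D i f = (\<Sum>y\<in>Lev (Suc i). app y f)"

lemma linop_D: "linop (D i)"
  unfolding D_def by (intro linop_sum linop_app)

lemma D_rel: "u \<in> flag_rel P i \<Longrightarrow> D i u \<in> flag_rel P (Suc i)"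
  unfolding D_def by (intro free_submoduleD(6)[OF rel_submodule] app_rel)

lemma D_closed: "u \<in> carrier (free_module (fc i)) \<Longrightarrow> D i u \<in> carrier (free_module (fc (Suc i)))"
  unfolding D_def by (intro free_sum app_closed')

lemma app_sum_basis:
  assumes "finite A"
  shows "(\<Sum>w\<in>A. app w (basis_elt c)) = (\<Sum>w\<in>{w \<in> A. last c \<sqsubset> w}. basis_elt (c @ [w]))"
  unfolding app_basis using assms by (simp add: sum.inter_filter)

lemma flag_diff_op:
  "lin_ext (\<lambda>ys. \<Sum>y\<in>{y \<in> carrier P. rank P y = Suc i \<and> last ys \<sqsubset> y}.
        Poly_Mapping.single (ys @ [y]) ((-1) ^ i)) f = scl ((-1) ^ i) (D i f)"
proof (rule linop_eq[OF linop_lin_ext linop_comp[OF linop_scl linop_D]])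
  fix c
  have "{y \<in> carrier P. rank P y = Suc i \<and> last c \<sqsubset> y} = {y \<in> Lev (Suc i). last c \<sqsubset> y}"
    using rank_eq by (auto simp: Lev_def)
  then show "lin_ext (\<lambda>ys. \<Sum>y\<in>{y \<in> carrier P. rank P y = Suc i \<and> last ys \<sqsubset> y}.
        Poly_Mapping.single (ys @ [y]) ((-1) ^ i)) (basis_elt c) = scl ((-1) ^ i) (D i (basis_elt c))"
    unfolding D_def app_sum_basis[OF finite_Lev] by (simp add: scl_sum)
qed

text \<open>For a fixed final element the two-step extensions of a chain run through a whole
  interval of length two, so their sum is a relation. The square vanishes by the relations and not
  through a cancellation of signs.\<close>

lemma DD_rel:
  assumes "u \<in> carrier (free_module (fc i))"
  shows "D (Suc i) (D i u) \<in> flag_rel P (Suc (Suc i))"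
proof (rule linop_in[OF linop_comp[OF linop_D linop_D] rel_submodule])
  fix c assume "c \<in> Poly_Mapping.keys u"
  then have c: "c \<in> fc i" using assms by (auto simp: free_module_simps)
  have "D (Suc i) (D i (basis_elt c)) = (\<Sum>y\<in>Lev (Suc (Suc i)). \<Sum>w\<in>{w \<in> Lev (Suc i). last c \<sqsubset> w}. app y (basis_elt (c @ [w])))"
    unfolding D_def app_sum_basis[OF finite_Lev] linopD(6)[OF linop_app] ..
  also have "\<dots> = (\<Sum>y\<in>Lev (Suc (Suc i)). \<Sum>w\<in>btw (last c) y. basis_elt (c @ [w, y]))"
  proof (rule sum.cong[OF refl])
    fix y assume y: "y \<in> Lev (Suc (Suc i))"
    have "btw (last c) y = {w \<in> {w \<in> Lev (Suc i). last c \<sqsubset> w}. w \<sqsubset> y}"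
      using btw_rank[of "last c" y] fc_last[OF c] y by (auto simp: btw_def Lev_def)
    then show "(\<Sum>w\<in>{w \<in> Lev (Suc i). last c \<sqsubset> w}. app y (basis_elt (c @ [w]))) = (\<Sum>w\<in>btw (last c) y. basis_elt (c @ [w, y]))"
      using finite_Lev by (simp add: app_basis sum.inter_filter if_conn(1) cong: if_cong)
  qed
  also have "\<dots> \<in> flag_rel P (Suc (Suc i))"
    by (rule free_submoduleD(6)[OF rel_submodule]) (use gens_top[OF c] in blast)
  finally show "D (Suc i) (D i (basis_elt c)) \<in> flag_rel P (Suc (Suc i))" .
qed

end

text \<open>Every chain can be rewritten so that the apex \<open>a\<close> enters in the last step, and removing that last
  step is the contraction. Joining with \<open>a\<close> raises the rank by one, so in each interval of length two
  whose bottom is not above \<open>a\<close> exactly one intermediate element is above \<open>a\<close>; the corresponding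
  relation does the rewriting.\<close>

locale apexed = ranked P \<rho> for P :: "'p gorder" (structure) and \<rho> +
  fixes a :: 'p
  assumes a_car: "a \<in> carrier P" and a_pos: "b \<in> carrier P \<Longrightarrow> \<rho> b = 0 \<Longrightarrow> \<not> a \<sqsubseteq> b"
    and a_join: "v \<in> carrier P \<Longrightarrow> \<not> a \<sqsubseteq> v \<Longrightarrow>
      \<exists>u\<in>carrier P. v \<sqsubseteq> u \<and> a \<sqsubseteq> u \<and> \<rho> u = Suc (\<rho> v) \<and> (\<forall>t\<in>carrier P. v \<sqsubseteq> t \<longrightarrow> a \<sqsubseteq> t \<longrightarrow> u \<sqsubseteq> t)"
begin

lemma a_trans: "v \<in> carrier P \<Longrightarrow> w \<in> carrier P \<Longrightarrow> a \<sqsubseteq> v \<Longrightarrow> v \<sqsubset> w \<Longrightarrow> a \<sqsubseteq> w"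
  using posetD(3)[OF poset a_car, of v w] unfolding posetD(4)[OF poset] by blast

lemma join_unique:
  assumes "v \<in> carrier P" "\<not> a \<sqsubseteq> v"
  shows "\<exists>u. u \<in> carrier P \<and> v \<sqsubset> u \<and> a \<sqsubseteq> u \<and> \<rho> u = Suc (\<rho> v)
    \<and> (\<forall>t\<in>carrier P. v \<sqsubset> t \<longrightarrow> a \<sqsubseteq> t \<longrightarrow> u \<sqsubseteq> t \<and> (\<rho> t = Suc (\<rho> v) \<longrightarrow> t = u))"
proof -
  obtain u where u: "u \<in> carrier P" "v \<sqsubseteq> u" "a \<sqsubseteq> u" "\<rho> u = Suc (\<rho> v)"
    "\<And>t. t \<in> carrier P \<Longrightarrow> v \<sqsubseteq> t \<Longrightarrow> a \<sqsubseteq> t \<Longrightarrow> u \<sqsubseteq> t" using a_join[OF assms] by blast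
  have "t = u" if "t \<in> carrier P" "v \<sqsubset> t" "a \<sqsubseteq> t" "\<rho> t = Suc (\<rho> v)" for t
    using rank_eqI[OF u(1) that(1) u(5)[OF that(1) _ that(3)]] that u(4) posetD(4)[OF poset] by simp
  moreover have "v \<sqsubset> u" using u posetD(4)[OF poset, of v u] by auto
  ultimately show ?thesis using u posetD(4)[OF poset] by blast
qed

definition jn :: "'p \<Rightarrow> 'p" where
  "jn v = (SOME u. u \<in> carrier P \<and> v \<sqsubset> u \<and> a \<sqsubseteq> u \<and> \<rho> u = Suc (\<rho> v)
    \<and> (\<forall>t\<in>carrier P. v \<sqsubset> t \<longrightarrow> a \<sqsubseteq> t \<longrightarrow> u \<sqsubseteq> t \<and> (\<rho> t = Suc (\<rho> v) \<longrightarrow> t = u)))"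

lemma jn:
  assumes "v \<in> carrier P" "\<not> a \<sqsubseteq> v"
  shows "jn v \<in> carrier P" "v \<sqsubset> jn v" "a \<sqsubseteq> jn v" "\<rho> (jn v) = Suc (\<rho> v)"
    "\<And>t. t \<in> carrier P \<Longrightarrow> v \<sqsubset> t \<Longrightarrow> a \<sqsubseteq> t \<Longrightarrow> jn v \<sqsubseteq> t"
    "\<And>t. t \<in> carrier P \<Longrightarrow> v \<sqsubset> t \<Longrightarrow> a \<sqsubseteq> t \<Longrightarrow> \<rho> t = Suc (\<rho> v) \<Longrightarrow> t = jn v"
  using someI_ex[OF join_unique[OF assms], folded jn_def] by simp_all

definition W :: "nat \<Rightarrow> 'p \<Rightarrow> 'p set" where
  "W n y = {w \<in> Lev n. w \<sqsubset> y \<and> \<not> a \<sqsubseteq> w}"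

definition E :: "nat \<Rightarrow> 'p \<Rightarrow> ('p list \<Rightarrow>\<^sub>0 rat) \<Rightarrow> ('p list \<Rightarrow>\<^sub>0 rat)" where
  "E n y f = (\<Sum>w\<in>W n y. app w f)"

lemma finite_W: "finite (W n y)"
  using finite_Lev by (simp add: W_def)

lemma linop_E: "linop (E n y)"
  unfolding E_def by (intro linop_sum linop_app)

lemma E_rel: "u \<in> flag_rel P i \<Longrightarrow> E (Suc i) y u \<in> flag_rel P (Suc i)"
  unfolding E_def by (intro free_submoduleD(6)[OF rel_submodule] app_rel) (auto simp: W_def)

lemma E_basis: "E n y (basis_elt c) = (\<Sum>w\<in>{w \<in> W n y. last c \<sqsubset> w}. basis_elt (c @ [w]))"
  unfolding E_def by (rule app_sum_basis[OF finite_W])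

text \<open>The list is reversed, top first. If \<open>a\<close> lies below \<open>z\<close>
  already, the part up to \<open>z\<close> is rewritten first, as a combination of chains
  \<open>c\<close> with \<open>a\<close> entering at the step to \<open>z\<close>. Between the end
  of \<open>c\<close> and \<open>y\<close> the element \<open>z\<close> is the only one above
  \<open>a\<close>, so the relation replaces it by minus the sum over the others; these are the
  elements that \<open>E\<close> appends, and \<open>y\<close> is then dropped.\<close>

fun psr :: "'p list \<Rightarrow> ('p list \<Rightarrow>\<^sub>0 rat)" where
  "psr [] = 0"
| "psr [b] = 0"
| "psr (y # z # zs) = (if \<not> a \<sqsubseteq> y then 0 else if \<not> a \<sqsubseteq> z then basis_elt (rev (z # zs))
     else - E (\<rho> z) y (psr (z # zs)))"

definition psi :: "'p list \<Rightarrow> ('p list \<Rightarrow>\<^sub>0 rat)" where "psi ys = psr (rev ys)"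

lemma psi_snoc:
  assumes "zs \<in> fc i"
  shows "psi (zs @ [y]) = (if \<not> a \<sqsubseteq> y then 0 else if \<not> a \<sqsubseteq> last zs then basis_elt zs else - E i y (psi zs))"
proof -
  have "zs = butlast zs @ [last zs]" using fc_ne[OF assms] by simp
  then obtain us z where zs: "zs = us @ [z]" by blast
  have "\<rho> z = i" using fc_last[OF assms] zs by (simp add: Lev_def)
  then show ?thesis by (simp add: psi_def zs)
qed

lemma psi_0: "ys \<in> fc 0 \<Longrightarrow> psi ys = 0"
  by (auto simp: fc_0 psi_def)

lemma psi_notabove: "ys \<in> fc i \<Longrightarrow> \<not> a \<sqsubseteq> last ys \<Longrightarrow> psi ys = 0"
  by (cases i) (auto simp: psi_0 psi_snoc elim!: fc_SucE)

text \<open>The chains in \<open>psi ys\<close> avoid \<open>a\<close> to the end, and only the step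
  back to the old top would cross it; this is the situation in which \<open>btw_split\<close>
  applies.\<close>

lemma psi_keys:
  "ys \<in> fc (Suc i) \<Longrightarrow> c \<in> Poly_Mapping.keys (psi ys) \<Longrightarrow>
    c \<in> fc i \<and> \<not> a \<sqsubseteq> last c \<and> last c \<sqsubset> last ys \<and> a \<sqsubseteq> last ys"
proof (induction i arbitrary: ys c)
  case (0 ys c)
  obtain zs y where zs: "ys = zs @ [y]" "zs \<in> fc 0" "y \<in> Lev (Suc 0)" "last zs \<sqsubset> y"
    by (rule fc_SucE[OF 0(1)])
  have "\<not> a \<sqsubseteq> last zs" using fc_last[OF zs(2)] a_pos by (auto simp: Lev_def)
  then show ?case using 0(2) zs by (auto simp: psi_snoc[OF zs(2)] split: if_splits)
next
  case (Suc i ys c)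
  obtain zs y where zs: "ys = zs @ [y]" "zs \<in> fc (Suc i)" "y \<in> Lev (Suc (Suc i))" "last zs \<sqsubset> y"
    by (rule fc_SucE[OF Suc(2)])
  have ay: "a \<sqsubseteq> y" using Suc(3) by (auto simp: zs(1) psi_snoc[OF zs(2)] split: if_splits)
  show ?case
  proof (cases "a \<sqsubseteq> last zs")
    case False
    then show ?thesis using Suc(3) zs ay by (auto simp: psi_snoc[OF zs(2)])
  next
    case True
    have "psi ys = - E (Suc i) y (psi zs)" using True ay by (simp add: zs(1) psi_snoc[OF zs(2)])
    then have "c \<in> Poly_Mapping.keys (E (Suc i) y (psi zs))" using Suc(3) by (simp add: in_keys_iff)
    then have "c \<in> (\<Union>d\<in>Poly_Mapping.keys (psi zs). Poly_Mapping.keys (scl (Poly_Mapping.lookup (psi zs) d) (E (Suc i) y (basis_elt d))))"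
      unfolding linop_expand[OF linop_E, of "Suc i" y "psi zs"] by (rule subsetD[OF Poly_Mapping.keys_sum])
    then obtain d where d: "d \<in> Poly_Mapping.keys (psi zs)"
      and "c \<in> Poly_Mapping.keys (scl (Poly_Mapping.lookup (psi zs) d) (E (Suc i) y (basis_elt d)))"
      by (rule UN_E)
    then have d2: "c \<in> Poly_Mapping.keys (E (Suc i) y (basis_elt d))"
      by (simp add: in_keys_iff lookup_scl)
    note dk = Suc(1)[OF zs(2) d(1)]
    have "c \<in> (\<Union>w\<in>{w \<in> W (Suc i) y. last d \<sqsubset> w}. Poly_Mapping.keys (basis_elt (d @ [w])))"
      using d2 unfolding E_basis by (rule subsetD[OF Poly_Mapping.keys_sum])
    then obtain w where w: "w \<in> W (Suc i) y" "last d \<sqsubset> w" "c = d @ [w]" by auto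
    then show ?thesis using dk ay zs by (auto simp: W_def fc_snoc)
  qed
qed

definition Psi :: "('p list \<Rightarrow>\<^sub>0 rat) \<Rightarrow> ('p list \<Rightarrow>\<^sub>0 rat)" where "Psi = lin_ext psi"

lemma linop_Psi: "linop Psi"
  unfolding Psi_def by (rule linop_lin_ext)

lemma Psi_basis: "Psi (basis_elt c) = psi c"
  by (simp add: Psi_def)

lemma Psi_closed: "c \<in> fc (Suc i) \<Longrightarrow> Psi (basis_elt c) \<in> carrier (free_module (fc i))"
  using psi_keys[of c i] by (auto simp: Psi_basis free_module_simps)

lemma btw_split:
  assumes "u \<in> Lev k" "y \<in> Lev (Suc (Suc k))" "u \<sqsubset> y" "\<not> a \<sqsubseteq> u" "a \<sqsubseteq> y"
  shows "btw u y = insert (jn u) {w \<in> W (Suc k) y. u \<sqsubset> w}" "jn u \<notin> W (Suc k) y"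
proof -
  note u = Lev_car[OF assms(1)] and y = Lev_car[OF assms(2)]
  note j = jn[OF u assms(4)]
  have r: "\<rho> u = k" "\<rho> y = Suc (Suc k)" using assms(1,2) by (simp_all add: Lev_def)
  have 1: "jn u \<sqsubset> y" using j(5)[OF y assms(3,5)] j(4) r posetD(4)[OF poset, of "jn u" y] by auto
  have 2: "w = jn u" if "w \<in> btw u y" "a \<sqsubseteq> w" for w
    using j(6)[of w] btw_rank[OF u y _ that(1)] that r by (auto simp: btw_def)
  have 3: "w \<in> Lev (Suc k)" if "w \<in> btw u y" for w
    using btw_rank[OF u y _ that] that r by (auto simp: btw_def Lev_def)
  show "btw u y = insert (jn u) {w \<in> W (Suc k) y. u \<sqsubset> w}"
  proof (intro subset_antisym subsetI)
    fix w assume w: "w \<in> btw u y"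
    show "w \<in> insert (jn u) {w \<in> W (Suc k) y. u \<sqsubset> w}"
    proof (cases "a \<sqsubseteq> w")
      case True
      then show ?thesis using 2[OF w] by simp
    next
      case False
      then show ?thesis using 3[OF w] w by (simp add: W_def btw_def)
    qed
  next
    fix w assume "w \<in> insert (jn u) {w \<in> W (Suc k) y. u \<sqsubset> w}"
    then show "w \<in> btw u y" using 1 j(1,2) by (auto simp: btw_def W_def Lev_def)
  qed
  show "jn u \<notin> W (Suc k) y" using j(1-4) by (auto simp: W_def)
qed

text \<open>The case of the relation at the last interior position in which the whole interval lies
  above \<open>a\<close>: reindexing along \<open>u \<mapsto> jn u\<close> turns the image into relations again.\<close>

lemma EE_rel:
  assumes c: "c \<in> fc k" "\<not> a \<sqsubseteq> last c" and u: "u \<in> Lev (Suc k)" "last c \<sqsubset> u" "a \<sqsubseteq> u"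
    and y: "y \<in> Lev (Suc (Suc (Suc k)))" "u \<sqsubset> y"
  shows "(\<Sum>w\<in>btw u y. E (Suc (Suc k)) y (E (Suc k) w (basis_elt c))) \<in> flag_rel P (Suc (Suc k))"
proof -
  note cl = fc_last[OF c(1)]
  note vc = Lev_car[OF cl] and uc = Lev_car[OF u(1)] and yc = Lev_car[OF y(1)]
  have rk: "\<rho> (last c) = k" "\<rho> u = Suc k" "\<rho> y = Suc (Suc (Suc k))" using cl u y by (simp_all add: Lev_def)
  have uj: "u = jn (last c)" using jn(6)[OF vc c(2) uc u(2,3)] rk by simp
  have ay: "a \<sqsubseteq> y" using a_trans[OF uc yc u(3) y(2)] .
  let ?U = "{x \<in> W (Suc k) y. last c \<sqsubset> x}"
  \<comment> \<open>Each \<open>x\<close> in \<open>?U\<close> has the single element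
    \<open>jn x\<close> one rank higher above both \<open>x\<close> and \<open>a\<close>, and it
    lies between \<open>u\<close> and \<open>y\<close>. So the double sum meets every
    \<open>x\<close> exactly once.\<close>
  have part: "(\<Sum>w\<in>btw u y. \<Sum>x\<in>{x \<in> W (Suc k) w. last c \<sqsubset> x}. h x) = sum h ?U" for h :: "'p \<Rightarrow> ('p list \<Rightarrow>\<^sub>0 rat)"
  proof -
    have fib: "{x \<in> W (Suc k) w. last c \<sqsubset> x} = {x \<in> ?U. jn x = w}" if w: "w \<in> btw u y" for w
    proof -
      have wc: "w \<in> carrier P" "u \<sqsubset> w" "w \<sqsubset> y" using w by (auto simp: btw_def)
      have rw: "\<rho> w = Suc (Suc k)" using btw_rank[OF uc yc _ w] rk by simp
      have aw: "a \<sqsubseteq> w" using a_trans[OF uc wc(1) u(3) wc(2)] .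
      show ?thesis
      proof (intro equalityI subsetI)
        fix x assume x: "x \<in> {x \<in> W (Suc k) w. last c \<sqsubset> x}"
        then have xc: "x \<in> carrier P" "\<rho> x = Suc k" "x \<sqsubset> w" "\<not> a \<sqsubseteq> x" by (auto simp: W_def Lev_def)
        have "x \<sqsubset> y" using less_trans[OF xc(1) wc(1) yc xc(3) wc(3)] .
        moreover have "w = jn x" using jn(6)[OF xc(1,4) wc(1) xc(3) aw] rw xc(2) by simp
        ultimately show "x \<in> {x \<in> ?U. jn x = w}" using x by (auto simp: W_def)
      next
        fix x assume "x \<in> {x \<in> ?U. jn x = w}"
        then have x: "x \<in> W (Suc k) y" "last c \<sqsubset> x" "jn x = w" by auto
        then have "x \<sqsubset> w" using jn(2)[of x] by (auto simp: W_def Lev_def)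
        then show "x \<in> {x \<in> W (Suc k) w. last c \<sqsubset> x}" using x by (auto simp: W_def)
      qed
    qed
    have im: "jn ` ?U \<subseteq> btw u y"
    proof
      fix w assume "w \<in> jn ` ?U"
      then obtain x where x: "x \<in> W (Suc k) y" "last c \<sqsubset> x" "w = jn x" by auto
      then have xc: "x \<in> carrier P" "\<rho> x = Suc k" "x \<sqsubset> y" "\<not> a \<sqsubseteq> x" by (auto simp: W_def Lev_def)
      note j = jn[OF xc(1,4)]
      have "last c \<sqsubset> jn x" using less_trans[OF vc xc(1) j(1) x(2) j(2)] .
      then have "u \<sqsubseteq> jn x" using jn(5)[OF vc c(2) j(1) _ j(3)] uj by simp
      then have "u \<sqsubset> jn x" using j(4) xc(2) rk(2) posetD(4)[OF poset, of u "jn x"] by auto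
      moreover have "jn x \<sqsubset> y" using j(5)[OF yc xc(3) ay] j(4) xc(2) rk(3) posetD(4)[OF poset, of "jn x" y] by auto
      ultimately show "w \<in> btw u y" using j(1) x(3) by (simp add: btw_def)
    qed
    have "(\<Sum>w\<in>btw u y. \<Sum>x\<in>{x \<in> W (Suc k) w. last c \<sqsubset> x}. h x) = (\<Sum>w\<in>btw u y. \<Sum>x\<in>{x \<in> ?U. jn x = w}. h x)"
      by (rule sum.cong[OF refl]) (simp only: fib)
    also have "\<dots> = sum h ?U" by (rule sum.group[OF _ finite_btw im]) (simp add: finite_W)
    finally show ?thesis .
  qed
  have "(\<Sum>w\<in>btw u y. E (Suc (Suc k)) y (E (Suc k) w (basis_elt c)))
      = (\<Sum>w\<in>btw u y. \<Sum>x\<in>{x \<in> W (Suc k) w. last c \<sqsubset> x}. E (Suc (Suc k)) y (basis_elt (c @ [x])))"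
    unfolding E_basis[of "Suc k"] linopD(6)[OF linop_E] ..
  also have "\<dots> = (\<Sum>x\<in>?U. E (Suc (Suc k)) y (basis_elt (c @ [x])))" by (rule part)
  also have "\<dots> = (\<Sum>w'\<in>W (Suc (Suc k)) y. \<Sum>x\<in>?U. app w' (basis_elt (c @ [x])))"
    unfolding E_def by (rule sum.swap)
  \<comment> \<open>Nothing below \<open>w'\<close> lies above \<open>a\<close>, so for fixed
    \<open>w'\<close> the inner sum runs over a full interval and is a relation.\<close>
  also have "\<dots> = (\<Sum>w'\<in>W (Suc (Suc k)) y. \<Sum>x\<in>btw (last c) w'. basis_elt (c @ [x, w']))"
  proof (rule sum.cong[OF refl])
    fix w' assume w': "w' \<in> W (Suc (Suc k)) y"
    then have wc: "w' \<in> carrier P" "\<rho> w' = Suc (Suc k)" "w' \<sqsubset> y" "\<not> a \<sqsubseteq> w'" by (auto simp: W_def Lev_def)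
    have "btw (last c) w' = {x \<in> ?U. x \<sqsubset> w'}"
    proof (intro equalityI subsetI)
      fix x assume x: "x \<in> btw (last c) w'"
      then have xc: "x \<in> carrier P" "last c \<sqsubset> x" "x \<sqsubset> w'" by (auto simp: btw_def)
      have "\<rho> x = Suc k" using btw_rank[OF vc wc(1) _ x] rk wc(2) by simp
      moreover have "x \<sqsubset> y" using less_trans[OF xc(1) wc(1) yc xc(3) wc(3)] .
      moreover have "\<not> a \<sqsubseteq> x" using a_trans[OF xc(1) wc(1) _ xc(3)] wc(4) by blast
      ultimately show "x \<in> {x \<in> ?U. x \<sqsubset> w'}" using xc by (simp add: W_def Lev_def)
    qed (auto simp: btw_def W_def Lev_def)
    then show "(\<Sum>x\<in>?U. app w' (basis_elt (c @ [x]))) = (\<Sum>x\<in>btw (last c) w'. basis_elt (c @ [x, w']))"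
      by (simp add: app_basis sum.inter_filter[symmetric] finite_W)
  qed
  also have "\<dots> \<in> flag_rel P (Suc (Suc k))"
    by (rule free_submoduleD(6)[OF rel_submodule]) (use gens_top[OF c(1)] in \<open>auto simp: W_def\<close>)
  finally show ?thesis .
qed

text \<open>All chains in \<open>f\<close> end in the same \<open>z\<close>, so the case distinction
  in \<open>psi\<close> comes out the same for every term and passes to the combination. A relation
  with a fixed top appended has this form.\<close>

lemma Psi_app:
  assumes "\<And>c. c \<in> Poly_Mapping.keys f \<Longrightarrow> c \<in> fc i \<and> last c = z" "z \<sqsubset> y"
  shows "Psi (app y f) = (if \<not> a \<sqsubseteq> y then 0 else if \<not> a \<sqsubseteq> z then f else - E i y (Psi f))"
proof -
  have L: "linop (\<lambda>f. if \<not> a \<sqsubseteq> y then 0 else if \<not> a \<sqsubseteq> z then f else - E i y (Psi f))"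
    using linop_uminus[OF linop_comp[OF linop_E linop_Psi]] by (simp add: linop_def)
  show ?thesis
  proof (rule linop_eq[OF linop_comp[OF linop_Psi linop_app] L])
    fix c assume "c \<in> Poly_Mapping.keys f"
    then have c: "c \<in> fc i" "last c = z" using assms(1) by auto
    then show "Psi (app y (basis_elt c)) = (if \<not> a \<sqsubseteq> y then 0 else if \<not> a \<sqsubseteq> z then basis_elt c else - E i y (Psi (basis_elt c)))"
      using assms(2) psi_snoc[OF c(1), of y] by (simp add: app_basis Psi_basis)
  qed
qed

text \<open>With a fixed top appended, the recursion of \<open>psi\<close> reduces to the previous
  degree. For the relation just below the top there are three cases: a top not above
  \<open>a\<close> gives zero; if the top but not the lower end is above \<open>a\<close>, the term
  of \<open>jn ?u\<close> cancels all the others; if the whole interval is above \<open>a\<close>,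
  \<open>EE_rel\<close> applies.\<close>

lemma Psi_gens: "g \<in> gens (Suc i) \<Longrightarrow> Psi g \<in> flag_rel P i"
proof (induction i arbitrary: g)
  case 0
  then show ?case by (simp add: gens_def)
next
  case (Suc i)
  note zero = free_submoduleD(1)[OF rel_submodule]
  from gens_cases[OF Suc(2)] show ?case
  proof (elim disjE exE bexE conjE)
    fix g' z y assume *: "g' \<in> gens (Suc i)" "y \<in> Lev (Suc (Suc i))" "z \<sqsubset> y"
      "\<forall>c\<in>Poly_Mapping.keys g'. c \<in> fc (Suc i) \<and> last c = z" "g = app y g'"
    have "Psi g = (if \<not> a \<sqsubseteq> y then 0 else if \<not> a \<sqsubseteq> z then g' else - E (Suc i) y (Psi g'))"
      unfolding *(5) by (rule Psi_app) (use * in auto)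
    moreover have "g' \<in> flag_rel P (Suc i)" unfolding flag_rel_gens by (rule gen_submodule_incl[OF *(1)])
    moreover have "- E (Suc i) y (Psi g') \<in> flag_rel P (Suc i)"
      by (intro free_submoduleD(5)[OF rel_submodule] E_rel Suc(1) *(1))
    ultimately show ?thesis using zero by simp
  next
    fix k us y assume *: "Suc i = Suc k" "us \<in> fc k" "y \<in> Lev (Suc (Suc i))" "last us \<sqsubset> y"
      "g = (\<Sum>w\<in>btw (last us) y. basis_elt (us @ [w, y]))"
    then have k: "k = i" by simp
    note us = *(2)[unfolded k] and y = *(3)
    let ?u = "last us"
    have ul: "?u \<in> Lev i" using fc_last[OF us] .
    have uc: "?u \<in> carrier P" "\<rho> ?u = i" and yc: "y \<in> carrier P" "\<rho> y = Suc (Suc i)" using ul y by (auto simp: Lev_def)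
    have wfc: "us @ [w] \<in> fc (Suc i)" if "w \<in> btw ?u y" for w
      using btw_rank[OF uc(1) yc(1) _ that] that us uc yc by (auto simp: fc_snoc btw_def Lev_def)
    have Pg: "Psi g = (\<Sum>w\<in>btw ?u y. psi ((us @ [w]) @ [y]))"
      unfolding *(5) linopD(6)[OF linop_Psi] Psi_basis by simp
    show ?thesis
    proof (cases "a \<sqsubseteq> y")
      case False
      have "Psi g = 0" unfolding Pg by (rule sum.neutral) (use False psi_snoc[OF wfc] in simp)
      then show ?thesis using zero by simp
    next
      case ay: True
      show ?thesis
      proof (cases "a \<sqsubseteq> ?u")
        case False
        note sp = btw_split[OF ul y *(4) False ay]
        note j = jn[OF uc(1) False]
        have ju: "jn ?u \<in> btw ?u y" using sp(1) by blast
        have "psi (us @ [jn ?u]) = basis_elt us" using j(3) False by (simp add: psi_snoc[OF us])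
        then have "psi ((us @ [jn ?u]) @ [y]) = - E (Suc i) y (basis_elt us)" using ay j(3) psi_snoc[OF wfc[OF ju], of y] by simp
        also have "\<dots> = - (\<Sum>w\<in>{w \<in> W (Suc i) y. ?u \<sqsubset> w}. basis_elt (us @ [w]))" by (simp only: E_basis)
        finally have t1: "psi ((us @ [jn ?u]) @ [y]) = - (\<Sum>w\<in>{w \<in> W (Suc i) y. ?u \<sqsubset> w}. basis_elt (us @ [w]))" .
        have t2: "psi ((us @ [w]) @ [y]) = basis_elt (us @ [w])" if "w \<in> {w \<in> W (Suc i) y. ?u \<sqsubset> w}" for w
        proof -
          have "w \<in> btw ?u y" using that sp(1) by blast
          then show ?thesis using psi_snoc[OF wfc, of w y] ay that by (simp add: W_def)
        qed
        have "Psi g = psi ((us @ [jn ?u]) @ [y]) + (\<Sum>w\<in>{w \<in> W (Suc i) y. ?u \<sqsubset> w}. psi ((us @ [w]) @ [y]))"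
          unfolding Pg sp(1) by (rule sum.insert) (use sp(2) finite_W in auto)
        also have "\<dots> = 0" unfolding t1 using t2 by simp
        finally show ?thesis using zero by simp
      next
        case au: True
        then obtain k' where k': "i = Suc k'" using uc(2) a_pos[OF uc(1)] by (cases i) auto
        have aw: "a \<sqsubseteq> w" if "w \<in> btw ?u y" for w using that a_trans[OF uc(1) _ au] by (auto simp: btw_def)
        have "psi ((us @ [w]) @ [y]) = E (Suc i) y (E i w (psi us))" if w: "w \<in> btw ?u y" for w
          using psi_snoc[OF wfc[OF w], of y] psi_snoc[OF us, of w] ay aw[OF w] au linopD(4)[OF linop_E] by simp
        then have "Psi g = (\<Sum>w\<in>btw ?u y. E (Suc i) y (E i w (psi us)))" unfolding Pg by simp
        also have "\<dots> \<in> flag_rel P (Suc i)"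
        proof (rule linop_in[OF linop_sum[OF linop_comp[OF linop_E linop_E]] rel_submodule])
          fix c assume "c \<in> Poly_Mapping.keys (psi us)"
          then have c: "c \<in> fc k'" "\<not> a \<sqsubseteq> last c" "last c \<sqsubset> ?u" using psi_keys[of us k' c] us k' by auto
          show "(\<Sum>w\<in>btw ?u y. E (Suc i) y (E i w (basis_elt c))) \<in> flag_rel P (Suc i)"
            unfolding k' by (rule EE_rel[OF c(1,2) _ c(3) au _ *(4)]) (use ul y k' in auto)
        qed
        finally show ?thesis .
      qed
    qed
  qed
qed

lemma Psi_rel: "u \<in> flag_rel P (Suc i) \<Longrightarrow> Psi u \<in> flag_rel P i"
  by (rule rel_map[OF linop_Psi Psi_closed rel_submodule Psi_gens])

text \<open>This justifies the rewriting behind \<open>psi\<close>. For each \<open>c\<close> in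
  \<open>psi zs\<close> the relation over the interval from \<open>last c\<close> to
  \<open>y\<close> exchanges the chain through \<open>last zs\<close> for minus the sum of the
  chains produced by \<open>E\<close>; the induction hypothesis handles \<open>zs\<close>
  itself.\<close>

lemma app_psi_rel:
  "ys \<in> fc (Suc i) \<Longrightarrow> a \<sqsubseteq> last ys \<Longrightarrow> app (last ys) (psi ys) - basis_elt ys \<in> flag_rel P (Suc i)"
proof (induction i arbitrary: ys)
  case (0 ys)
  obtain zs y where zs: "ys = zs @ [y]" "zs \<in> fc 0" "y \<in> Lev (Suc 0)" "last zs \<sqsubset> y"
    by (rule fc_SucE[OF 0(1)])
  have "\<not> a \<sqsubseteq> last zs" using fc_last[OF zs(2)] a_pos by (auto simp: Lev_def)
  then show ?case using 0(2) zs free_submoduleD(1)[OF rel_submodule] by (simp add: psi_snoc[OF zs(2)] app_basis)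
next
  case (Suc i ys)
  obtain zs y where zs: "ys = zs @ [y]" "zs \<in> fc (Suc i)" "y \<in> Lev (Suc (Suc i))" "last zs \<sqsubset> y"
    by (rule fc_SucE[OF Suc(2)])
  have ay: "a \<sqsubseteq> y" using Suc(3) zs(1) by simp
  show ?case
  proof (cases "a \<sqsubseteq> last zs")
    case False
    then show ?thesis using ay zs free_submoduleD(1)[OF rel_submodule] by (simp add: psi_snoc[OF zs(2)] app_basis)
  next
    case True
    let ?z = "last zs"
    have zc: "?z \<in> Lev (Suc i)" using fc_last[OF zs(2)] .
    have "- app y (E (Suc i) y (psi zs)) - app y (app ?z (psi zs)) \<in> flag_rel P (Suc (Suc i))"
    proof (rule linop_in[where f = "\<lambda>f. - app y (E (Suc i) y f) - app y (app ?z f)" and u = "psi zs", OF _ rel_submodule])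
      show "linop (\<lambda>f. - app y (E (Suc i) y f) - app y (app ?z f))"
        using linop_add[OF linop_uminus[OF linop_comp[OF linop_app linop_E]] linop_uminus[OF linop_comp[OF linop_app linop_app]]]
        by simp
      fix c assume "c \<in> Poly_Mapping.keys (psi zs)"
      then have c: "c \<in> fc i" "\<not> a \<sqsubseteq> last c" "last c \<sqsubset> ?z" using psi_keys[OF zs(2)] by auto
      have cl: "last c \<in> Lev i" using fc_last[OF c(1)] .
      have vy: "last c \<sqsubset> y"
        by (rule less_trans[OF Lev_car[OF cl] Lev_car[OF zc] Lev_car[OF zs(3)] c(3) zs(4)])
      note sp = btw_split[OF cl zs(3) vy c(2) ay]
      have z: "?z = jn (last c)" using jn(6)[OF Lev_car[OF cl] c(2) Lev_car[OF zc] c(3) True] cl zc by (simp add: Lev_def)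
      have "(\<Sum>w\<in>btw (last c) y. basis_elt (c @ [w, y])) = basis_elt (c @ [?z, y]) + (\<Sum>w\<in>{w \<in> W (Suc i) y. last c \<sqsubset> w}. basis_elt (c @ [w, y]))"
        unfolding sp(1) z by (rule sum.insert) (use sp(2) finite_W in auto)
      moreover have "app y (E (Suc i) y (basis_elt c)) = (\<Sum>w\<in>{w \<in> W (Suc i) y. last c \<sqsubset> w}. basis_elt (c @ [w, y]))"
        unfolding E_basis linopD(6)[OF linop_app] by (rule sum.cong[OF refl]) (simp add: app_basis W_def)
      moreover have "app y (app ?z (basis_elt c)) = basis_elt (c @ [?z, y])" using c(3) zs(4) by (simp add: app_basis)
      ultimately have "- app y (E (Suc i) y (basis_elt c)) - app y (app ?z (basis_elt c)) = - (\<Sum>w\<in>btw (last c) y. basis_elt (c @ [w, y]))"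
        by simp
      also have "\<dots> \<in> flag_rel P (Suc (Suc i))"
        by (rule free_submoduleD(5)[OF rel_submodule]) (use gens_top[OF c(1) zs(3)] in blast)
      finally show "- app y (E (Suc i) y (basis_elt c)) - app y (app ?z (basis_elt c)) \<in> flag_rel P (Suc (Suc i))" .
    qed
    moreover have "app y (app ?z (psi zs) - basis_elt zs) \<in> flag_rel P (Suc (Suc i))"
      by (rule app_rel[OF zs(3)]) (rule Suc(1)[OF zs(2) True])
    ultimately have "(- app y (E (Suc i) y (psi zs)) - app y (app ?z (psi zs))) + app y (app ?z (psi zs) - basis_elt zs) \<in> flag_rel P (Suc (Suc i))"
      by (rule free_submoduleD(2)[OF rel_submodule])
    moreover have "app y (basis_elt zs) = basis_elt ys" using zs by (simp add: app_basis)
    moreover have "psi ys = - E (Suc i) y (psi zs)" using True ay by (simp add: zs(1) psi_snoc[OF zs(2)])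
    ultimately show ?thesis using zs(1) by (simp add: linopD[OF linop_app])
  qed
qed

text \<open>If the top of the chain is not above \<open>a\<close>, only the extension by its join
  with \<open>a\<close> survives \<open>Psi\<close>, and it returns the chain. Otherwise
  \<open>D\<close> after \<open>Psi\<close> appends every possible element, and all of these except
  the old top cancel against \<open>Psi\<close> after \<open>D\<close> by reindexing along
  \<open>jn\<close>; what remains is \<open>app_psi_rel\<close>.\<close>

lemma contraction:
  assumes f: "f \<in> carrier (free_module (fc i))"
  shows "Psi (D i f) + (if i = 0 then 0 else D (i - 1) (Psi f)) - f \<in> flag_rel P i"
proof (rule linop_in[where f = "\<lambda>f. Psi (D i f) + (if i = 0 then 0 else D (i - 1) (Psi f)) - f" and u = f, OF _ rel_submodule])
  show "linop (\<lambda>f. Psi (D i f) + (if i = 0 then 0 else D (i - 1) (Psi f)) - f)"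
  proof -
    have 1: "linop (\<lambda>f. if i = 0 then 0 else D (i - 1) (Psi f))"
      using linop_comp[OF linop_D linop_Psi, of "i - 1"] by (cases "i = 0") (simp_all add: linop_def)
    have 2: "linop (\<lambda>f :: 'p list \<Rightarrow>\<^sub>0 rat. - f)" using linop_uminus[of "\<lambda>f. f"] by (simp add: linop_def)
    show ?thesis using linop_add[OF linop_add[OF linop_comp[OF linop_Psi linop_D, of i] 1] 2] by simp
  qed
  fix c assume "c \<in> Poly_Mapping.keys f"
  then have c: "c \<in> fc i" using f by (auto simp: free_module_simps)
  have cl: "last c \<in> Lev i" using fc_last[OF c] .
  note cc = Lev_car[OF cl]
  have PD: "Psi (D i (basis_elt c)) = (\<Sum>y\<in>{y \<in> Lev (Suc i). last c \<sqsubset> y}. psi (c @ [y]))"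
    unfolding D_def app_sum_basis[OF finite_Lev] linopD(6)[OF linop_Psi] Psi_basis ..
  show "Psi (D i (basis_elt c)) + (if i = 0 then 0 else D (i - 1) (Psi (basis_elt c))) - basis_elt c \<in> flag_rel P i"
  proof (cases "a \<sqsubseteq> last c")
    case False
    note j = jn[OF cc False]
    have "psi (c @ [y]) = (if y = jn (last c) then basis_elt c else 0)" if "y \<in> {y \<in> Lev (Suc i). last c \<sqsubset> y}" for y
    proof (cases "a \<sqsubseteq> y")
      case True
      have "y = jn (last c)" by (rule j(6)[OF _ _ True]) (use that cl in \<open>auto simp: Lev_def\<close>)
      then show ?thesis using psi_snoc[OF c, of y] False True by simp
    next
      case na: False
      then have "y \<noteq> jn (last c)" using j(3) by metis
      then show ?thesis using psi_snoc[OF c, of y] na by simp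
    qed
    then have "Psi (D i (basis_elt c)) = (\<Sum>y\<in>{y \<in> Lev (Suc i). last c \<sqsubset> y}. if y = jn (last c) then basis_elt c else 0)"
      unfolding PD by simp
    also have "\<dots> = basis_elt c"
    proof -
      have "jn (last c) \<in> {y \<in> Lev (Suc i). last c \<sqsubset> y}" using j(1,2,4) cl by (simp add: Lev_def)
      moreover have "finite {y \<in> Lev (Suc i). last c \<sqsubset> y}" using finite_Lev by simp
      ultimately show ?thesis by (simp only: sum.delta if_True)
    qed
    finally have "Psi (D i (basis_elt c)) = basis_elt c" .
    moreover have "Psi (basis_elt c) = 0" using psi_notabove[OF c False] by (simp add: Psi_basis)
    ultimately show ?thesis using linopD(3)[OF linop_D] free_submoduleD(1)[OF rel_submodule] by simp
  next
    case True
    then obtain k where k: "i = Suc k" using cl a_pos[OF cc] by (cases i) (auto simp: Lev_def)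
    let ?y = "last c"
    have c': "c \<in> fc (Suc k)" using c k by simp
    have "Psi (D i (basis_elt c)) = (\<Sum>y\<in>{y \<in> Lev (Suc i). ?y \<sqsubset> y}. - E i y (psi c))"
      unfolding PD
    proof (rule sum.cong[OF refl])
      fix y assume "y \<in> {y \<in> Lev (Suc i). ?y \<sqsubset> y}"
      then have "a \<sqsubseteq> y" using a_trans[OF cc _ True] by (auto simp: Lev_def)
      then show "psi (c @ [y]) = - E i y (psi c)" using psi_snoc[OF c, of y] True by simp
    qed
    then have 1: "Psi (D i (basis_elt c)) = (\<lambda>f. \<Sum>y\<in>{y \<in> Lev (Suc i). ?y \<sqsubset> y}. - E i y f) (psi c)" .
    have "(\<lambda>f. (\<Sum>y\<in>{y \<in> Lev (Suc i). ?y \<sqsubset> y}. - E i y f) + D k f) (psi c) = app ?y (psi c)"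
    proof (rule linop_eq[OF linop_add[OF linop_sum[OF linop_uminus[OF linop_E]] linop_D] linop_app])
      fix d assume "d \<in> Poly_Mapping.keys (psi c)"
      then have d: "d \<in> fc k" "\<not> a \<sqsubseteq> last d" "last d \<sqsubset> ?y" using psi_keys[OF c'] by auto
      have dl: "last d \<in> Lev k" using fc_last[OF d(1)] .
      note dc = Lev_car[OF dl]
      note jd = jn[OF dc d(2)]
      have yj: "?y = jn (last d)" using jd(6)[OF cc d(3) True] cl dl k by (simp add: Lev_def)
      let ?A = "{w \<in> Lev i. last d \<sqsubset> w}" and ?N = "{w \<in> Lev i. last d \<sqsubset> w \<and> \<not> a \<sqsubseteq> w}"
      let ?Y = "{y \<in> Lev (Suc i). ?y \<sqsubset> y}"
      \<comment> \<open>As in \<open>EE_rel\<close>: an element \<open>w\<close> of rank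
        \<open>i\<close> not above \<open>a\<close> lies below exactly one element of the next rank
        that is above \<open>a\<close>, namely \<open>jn w\<close>.\<close>
      have fib: "{w \<in> W i y. last d \<sqsubset> w} = {w \<in> ?N. jn w = y}" if y: "y \<in> ?Y" for y
      proof -
        have yc: "y \<in> carrier P" "\<rho> y = Suc i" "?y \<sqsubset> y" using y by (auto simp: Lev_def)
        have ay: "a \<sqsubseteq> y" using a_trans[OF cc yc(1) True yc(3)] .
        have "jn w = y" if w: "w \<in> Lev i" "w \<sqsubset> y" "\<not> a \<sqsubseteq> w" for w
          using jn(6)[OF Lev_car[OF w(1)] w(3) yc(1) w(2) ay] yc(2) w(1) by (simp add: Lev_def)
        moreover have "w \<sqsubset> jn w" if "w \<in> Lev i" "\<not> a \<sqsubseteq> w" for w using jn(2)[OF Lev_car[OF that(1)] that(2)] .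
        ultimately show ?thesis by (auto simp: W_def)
      qed
      have im: "jn ` ?N \<subseteq> ?Y"
      proof
        fix y assume "y \<in> jn ` ?N"
        then obtain w where w: "w \<in> Lev i" "last d \<sqsubset> w" "\<not> a \<sqsubseteq> w" "y = jn w" by auto
        note j = jn[OF Lev_car[OF w(1)] w(3)]
        have "last d \<sqsubset> jn w" using less_trans[OF dc Lev_car[OF w(1)] j(1) w(2) j(2)] .
        then have "?y \<sqsubseteq> jn w" using jd(5)[OF j(1) _ j(3)] yj by simp
        then have "?y \<sqsubset> jn w" using j(4) w(1) cl posetD(4)[OF poset, of ?y "jn w"] by (auto simp: Lev_def)
        then show "y \<in> ?Y" using j(1-4) w by (auto simp: Lev_def)
      qed
      have "(\<Sum>y\<in>?Y. E i y (basis_elt d)) = (\<Sum>y\<in>?Y. \<Sum>w\<in>{w \<in> ?N. jn w = y}. basis_elt (d @ [w]))"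
        unfolding E_basis by (rule sum.cong[OF refl]) (simp only: fib)
      also have "\<dots> = (\<Sum>w\<in>?N. basis_elt (d @ [w]))" by (rule sum.group[OF _ _ im]) (simp_all add: finite_Lev)
      finally have s1: "(\<Sum>y\<in>?Y. E i y (basis_elt d)) = (\<Sum>w\<in>?N. basis_elt (d @ [w]))" .
      have "?A = insert ?y ?N"
      proof
        show "?A \<subseteq> insert ?y ?N"
        proof
          fix w assume w: "w \<in> ?A"
          show "w \<in> insert ?y ?N"
          proof (cases "a \<sqsubseteq> w")
            case aw: True
            then have "w = jn (last d)" using jd(6)[of w] w dl k by (auto simp: Lev_def)
            then show ?thesis using yj by simp
          qed (use w in auto)
        qed
      qed (use cl d(3) in auto)
      then have "D k (basis_elt d) = basis_elt (d @ [?y]) + (\<Sum>w\<in>?N. basis_elt (d @ [w]))"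
        unfolding D_def app_sum_basis[OF finite_Lev] using k True finite_Lev[of i] by (simp add: sum.insert)
      then show "(\<Sum>y\<in>?Y. - E i y (basis_elt d)) + D k (basis_elt d) = app ?y (basis_elt d)"
        using s1 d(3) by (simp add: sum_negf app_basis)
    qed
    then have "Psi (D i (basis_elt c)) + D k (Psi (basis_elt c)) - basis_elt c = app ?y (psi c) - basis_elt c"
      using 1 by (simp add: Psi_basis)
    then show ?thesis using app_psi_rel[OF c' True] k by simp
  qed
qed

end

subsection \<open>Restriction and contraction of flag modules\<close>

lemma linop_id: "linop (\<lambda>u. u)"
  by (simp add: linop_def)

lemma induced_free:
  assumes sub: "submodule N Rat (free_module B)" "submodule N' Rat (free_module B')"
    and f: "linop f" "\<And>b. b \<in> B \<Longrightarrow> f (basis_elt b) \<in> carrier (free_module B')" "\<And>u. u \<in> N \<Longrightarrow> f u \<in> N'"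
  shows "induced (free_module B') N' f \<in> lin_maps (quot_module (free_module B) N) (quot_module (free_module B') N')"
    and "\<And>u. u \<in> carrier (free_module B) \<Longrightarrow>
      induced (free_module B') N' f (N +>\<^bsub>free_module B\<^esub> u) = N' +>\<^bsub>free_module B'\<^esub> f u"
proof -
  have l: "f \<in> lin_maps (free_module B) (free_module B')"
    by (rule linop_lin_maps[OF f(1)]) (rule f(2))
  have i: "f ` N \<subseteq> N'" by (rule image_subsetI) (rule f(3))
  show "induced (free_module B') N' f \<in> lin_maps (quot_module (free_module B) N) (quot_module (free_module B') N')"
    by (rule induced_lin[OF free_module_module sub(1) free_module_module sub(2) l i])
  show "induced (free_module B') N' f (N +>\<^bsub>free_module B\<^esub> u) = N' +>\<^bsub>free_module B'\<^esub> f u"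
    if "u \<in> carrier (free_module B)" for u
    by (rule induced_coset[OF free_module_module sub(1) free_module_module sub(2) l i that])
qed

context ranked
begin

abbreviation below_chains :: "'p \<Rightarrow> nat \<Rightarrow> 'p list set" where
  "below_chains x i \<equiv> flag_chains (poset_below P x) i"

abbreviation below_rel :: "'p \<Rightarrow> nat \<Rightarrow> ('p list \<Rightarrow>\<^sub>0 rat) set" where
  "below_rel x i \<equiv> flag_rel (poset_below P x) i"

abbreviation below_free :: "'p \<Rightarrow> nat \<Rightarrow> (rat, 'p list \<Rightarrow>\<^sub>0 rat) module" where
  "below_free x i \<equiv> free_module (below_chains x i)"

abbreviation cls :: "'p \<Rightarrow> nat \<Rightarrow> ('p list \<Rightarrow>\<^sub>0 rat) \<Rightarrow> ('p list \<Rightarrow>\<^sub>0 rat) set" where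
  "cls x i u \<equiv> below_rel x i +>\<^bsub>below_free x i\<^esub> u"

abbreviation Fl :: "'p \<Rightarrow> nat \<Rightarrow> (rat, ('p list \<Rightarrow>\<^sub>0 rat) set) module" where
  "Fl x i \<equiv> flag (poset_below P x) i"

abbreviation fcls :: "nat \<Rightarrow> ('p list \<Rightarrow>\<^sub>0 rat) \<Rightarrow> ('p list \<Rightarrow>\<^sub>0 rat) set" where
  "fcls i u \<equiv> flag_rel P i +>\<^bsub>free_module (fc i)\<^esub> u"

lemma flag_module: "module Rat (flag P i)"
  unfolding flag_def by (rule quot_module_module[OF free_module_module rel_submodule])

lemma flag_cases:
  assumes "m \<in> carrier (flag P i)"
  obtains u where "u \<in> carrier (free_module (fc i))" "m = fcls i u"
  using assms by (auto simp: flag_def quot_module_simps)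

lemma cls_add:
  "u \<in> carrier (free_module (fc i)) \<Longrightarrow> v \<in> carrier (free_module (fc i)) \<Longrightarrow>
    (fcls i u) \<oplus>\<^bsub>flag P i\<^esub> (fcls i v)
      = fcls i (u + v)"
  unfolding flag_def quot_module_simps coset_add[OF free_module_module rel_submodule] free_module_simps(3) ..

lemma cls_eq:
  "u \<in> carrier (free_module (fc i)) \<Longrightarrow> v \<in> carrier (free_module (fc i)) \<Longrightarrow> u - v \<in> flag_rel P i \<Longrightarrow>
    fcls i u = fcls i v"
  by (simp add: coset_eq[OF free_module_module rel_submodule] free_minus)

lemma cls_zero: "fcls i 0 = \<zero>\<^bsub>flag P i\<^esub>"
  using coset_zero[OF free_module_module rel_submodule, of i] by (simp add: flag_def quot_module_simps free_module_simps)

lemma cls_rel: "u \<in> flag_rel P i \<Longrightarrow> fcls i u = \<zero>\<^bsub>flag P i\<^esub>"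
  using cls_eq[of u i 0] cls_zero rel_closed free_submoduleD(1)[OF rel_submodule] by simp

lemma scl_D_closed: "c \<in> fc i \<Longrightarrow> scl k (D i (basis_elt c)) \<in> carrier (free_module (fc (Suc i)))"
  by (intro free_submoduleD(3)[OF carrier_submodule[OF free_module_module]] D_closed) (simp add: basis_in_free)

lemma flag_diff:
  shows "flag_diff P i \<in> lin_maps (flag P i) (flag P (Suc i))"
    and "\<And>u. u \<in> carrier (free_module (fc i)) \<Longrightarrow>
      flag_diff P i (fcls i u)
        = fcls (Suc i) (scl ((-1) ^ i) (D i u))"
proof -
  have e: "flag_diff P i = induced (free_module (fc (Suc i))) (flag_rel P (Suc i)) (\<lambda>u. scl ((-1) ^ i) (D i u))"
    unfolding flag_diff_def by (rule arg_cong[where f = "induced _ _"]) (rule ext, rule flag_diff_op)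
  have r: "scl ((-1) ^ i) (D i u) \<in> flag_rel P (Suc i)" if "u \<in> flag_rel P i" for u
    by (rule free_submoduleD(3)[OF rel_submodule]) (rule D_rel[OF that])
  note ind = induced_free[OF rel_submodule rel_submodule linop_comp[OF linop_scl linop_D] scl_D_closed r]
  show "flag_diff P i \<in> lin_maps (flag P i) (flag P (Suc i))"
    unfolding e flag_def by (rule ind(1))
  show "flag_diff P i (fcls i u)
        = fcls (Suc i) (scl ((-1) ^ i) (D i u))"
    if "u \<in> carrier (free_module (fc i))" for u
    unfolding e by (rule ind(2)[OF _ _ that])
qed

lemma flag_diff_flag_diff:
  assumes "m \<in> carrier (flag P i)"
  shows "flag_diff P (Suc i) (flag_diff P i m) = \<zero>\<^bsub>flag P (Suc (Suc i))\<^esub>"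
proof -
  obtain u where u: "u \<in> carrier (free_module (fc i))" "m = fcls i u"
    by (rule flag_cases[OF assms])
  have c: "scl ((-1) ^ i) (D i u) \<in> carrier (free_module (fc (Suc i)))"
    by (intro free_submoduleD(3)[OF carrier_submodule[OF free_module_module]] D_closed u)
  have "scl ((-1) ^ Suc i) (D (Suc i) (scl ((-1) ^ i) (D i u))) \<in> flag_rel P (Suc (Suc i))"
    unfolding linopD(2)[OF linop_D] by (intro free_submoduleD(3)[OF rel_submodule] DD_rel u)
  then show ?thesis unfolding u(2) flag_diff(2)[OF u(1)] flag_diff(2)[OF c] by (rule cls_rel)
qed

text \<open>Ranks in the ideal below \<open>x\<close> are ranks in the whole poset, and a chain lies
  in the ideal as soon as its top does.\<close>

lemma mem_below_chains:
  assumes x: "x \<in> carrier P"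
  shows "ys \<in> below_chains x i \<longleftrightarrow> ys \<in> fc i \<and> last ys \<sqsubseteq> x"
proof (induction i arbitrary: ys)
  case 0
  interpret Q: ranked "poset_below P x" \<rho> by (rule ranked_below[OF x])
  have L: "b \<in> Q.Lev 0 \<longleftrightarrow> b \<in> Lev 0 \<and> b \<sqsubseteq> x" for b by (auto simp: Q.Lev_def Lev_def below_simps)
  show ?case
  proof (cases "\<exists>b. ys = [b]")
    case True
    then obtain b where "ys = [b]" ..
    then show ?thesis using Q.fc_0[of ys] fc_0[of ys] L[of b] by simp
  next
    case False
    then show ?thesis using Q.fc_0[of ys] fc_0[of ys] by metis
  qed
next
  case (Suc i)
  interpret Q: ranked "poset_below P x" \<rho> by (rule ranked_below[OF x])
  show ?case
  proof (cases ys rule: rev_cases)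
    case Nil
    then show ?thesis using fc_ne[of ys "Suc i"] Q.fc_ne[of ys "Suc i"] by auto
  next
    case (snoc zs y)
    have L: "y \<in> Q.Lev (Suc i) \<longleftrightarrow> y \<in> Lev (Suc i) \<and> y \<sqsubseteq> x" by (auto simp: Q.Lev_def Lev_def below_simps)
    have "last zs \<sqsubseteq> x" if "zs \<in> fc i" "y \<in> Lev (Suc i)" "last zs \<sqsubset> y" "y \<sqsubseteq> x"
      using posetD(3)[OF poset Lev_car[OF fc_last[OF that(1)]] Lev_car[OF that(2)] x _ that(4)] that(3) posetD(4)[OF poset] by blast
    then show ?thesis unfolding snoc fc_snoc Q.fc_snoc Suc L below_simps by auto
  qed
qed

lemma below_gens:
  assumes x: "x \<in> carrier P"
  shows "ranked.gens (poset_below P x) i = {\<Sum>y\<in>btw (ys ! (j - 1)) (ys ! (j + 1)). basis_elt (ys[j := y]) | ys j.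
    ys \<in> fc i \<and> last ys \<sqsubseteq> x \<and> 0 < j \<and> j < i}"
proof -
  interpret Q: ranked "poset_below P x" \<rho> by (rule ranked_below[OF x])
  have B: "Q.btw (ys ! (j - 1)) (ys ! (j + 1)) = btw (ys ! (j - 1)) (ys ! (j + 1))"
    if "ys \<in> below_chains x i" "j < i" for ys j
  proof -
    have "Suc j \<le> i" using that(2) by simp
    then have v: "ys ! Suc j \<in> carrier P" "ys ! Suc j \<sqsubseteq> x"
      using that(1) by (auto simp: flag_chains_def below_simps)
    have "w \<sqsubseteq> x" if "w \<in> carrier P" "w \<sqsubset> ys ! Suc j" for w
      using posetD(3)[OF poset that(1) v(1) x _ v(2)] that(2) posetD(4)[OF poset] by blast
    then show ?thesis by (auto simp: Q.btw_def btw_def below_simps)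
  qed
  show ?thesis
  proof (intro subset_antisym subsetI)
    fix g assume "g \<in> Q.gens i"
    then obtain ys j where ys: "ys \<in> below_chains x i" "0 < j" "j < i"
      and g: "g = (\<Sum>y\<in>Q.btw (ys ! (j - 1)) (ys ! (j + 1)). basis_elt (ys[j := y]))"
      unfolding Q.gens_def by blast
    then show "g \<in> {\<Sum>y\<in>btw (ys ! (j - 1)) (ys ! (j + 1)). basis_elt (ys[j := y]) | ys j.
        ys \<in> fc i \<and> last ys \<sqsubseteq> x \<and> 0 < j \<and> j < i}"
      unfolding B[OF ys(1,3)] mem_below_chains[OF x] by blast
  next
    fix g assume "g \<in> {\<Sum>y\<in>btw (ys ! (j - 1)) (ys ! (j + 1)). basis_elt (ys[j := y]) | ys j.
        ys \<in> fc i \<and> last ys \<sqsubseteq> x \<and> 0 < j \<and> j < i}"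
    then obtain ys j where ys: "ys \<in> below_chains x i" "0 < j" "j < i"
      and g: "g = (\<Sum>y\<in>btw (ys ! (j - 1)) (ys ! (j + 1)). basis_elt (ys[j := y]))"
      unfolding mem_below_chains[OF x] by blast
    show "g \<in> Q.gens i" unfolding g B[OF ys(1,3), symmetric] Q.gens_def using ys by blast
  qed
qed

text \<open>All terms of a relation have the same top, since only interior elements move. So an
  operator that keeps or kills a chain according to its top respects relations. For restriction
  \<open>A\<close> is lying below \<open>x\<close>; for inclusion it is always true.\<close>

lemma below_map_rel:
  assumes x: "x \<in> carrier P" and y: "y \<in> carrier P" and f: "linop f"
    and A: "\<And>ys. ys \<in> fc i \<Longrightarrow> last ys \<sqsubseteq> y \<Longrightarrow> f (basis_elt ys) = (if A (last ys) then basis_elt ys else 0)"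
    and Ax: "\<And>z. z \<in> carrier P \<Longrightarrow> z \<sqsubseteq> y \<Longrightarrow> A z \<Longrightarrow> z \<sqsubseteq> x"
  shows "\<And>c. c \<in> below_chains y i \<Longrightarrow> f (basis_elt c) \<in> carrier (below_free x i)"
    and "\<And>u. u \<in> below_rel y i \<Longrightarrow> f u \<in> below_rel x i"
proof -
  interpret Qx: ranked "poset_below P x" \<rho> by (rule ranked_below[OF x])
  interpret Qy: ranked "poset_below P y" \<rho> by (rule ranked_below[OF y])
  show c: "f (basis_elt c) \<in> carrier (below_free x i)" if "c \<in> below_chains y i" for c
  proof -
    have c: "c \<in> fc i" "last c \<sqsubseteq> y" using that mem_below_chains[OF y] by auto
    then have "c \<in> below_chains x i" if "A (last c)"
      using Ax[OF Lev_car[OF fc_last[OF c(1)]] c(2) that] mem_below_chains[OF x] by simp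
    then show ?thesis unfolding A[OF c] by (cases "A (last c)") (simp_all add: free_module_simps)
  qed
  fix u assume u: "u \<in> below_rel y i"
  show "f u \<in> below_rel x i"
  proof (rule linop_rel[OF f Qy.gens_closed c Qx.rel_submodule _ u[unfolded Qy.flag_rel_gens]])
    fix g assume "g \<in> Qy.gens i"
    then obtain ys j where ys: "ys \<in> fc i" "last ys \<sqsubseteq> y" "0 < j" "j < i"
      and g: "g = (\<Sum>w\<in>btw (ys ! (j - 1)) (ys ! (j + 1)). basis_elt (ys[j := w]))"
      unfolding below_gens[OF y] by blast
    note l = fc_length[OF ys(1)]
    have last: "last (ys[j := w]) = last ys" for w using ys l by (subst last_list_update) auto
    have m: "ys[j := w] \<in> below_chains y i" if "w \<in> btw (ys ! (j - 1)) (ys ! (j + 1))" for w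
    proof -
      have "ys[j := w] \<in> fc i"
      proof -
        have k: "ys ! k \<in> carrier P" "rank P (ys ! k) = k" if "k \<le> i" for k
          using ys(1) that by (simp_all add: flag_chains_def)
        have b: "ys ! k \<sqsubset> ys ! Suc k" if "k < i" for k using ys(1) that by (simp add: flag_chains_def)
        have w: "w \<in> carrier P" "ys ! (j - 1) \<sqsubset> w" "w \<sqsubset> ys ! Suc j" using that by (simp_all add: btw_def)
        have "\<rho> (ys ! (j - 1)) = j - 1" "\<rho> (ys ! Suc j) = Suc j"
          using k[of "j - 1"] k[of "Suc j"] ys(3,4) rank_eq by auto
        then have "\<rho> w = j"
          using btw_rank[of "ys ! (j - 1)" "ys ! (j + 1)" w] that k[of "j - 1"] k[of "Suc j"] ys(3,4) by simp
        then have rw: "rank P w = j" using rank_eq[OF w(1)] by simp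
        show ?thesis unfolding flag_chains_def
        proof (intro CollectI conjI allI impI)
          show "length (ys[j := w]) = Suc i" using l by simp
          show "ys[j := w] ! k \<in> carrier P" "rank P (ys[j := w] ! k) = k" if "k \<le> i" for k
            using k[OF that] w(1) rw l ys(4) that by (auto simp: nth_list_update)
          show "ys[j := w] ! k \<sqsubset> ys[j := w] ! Suc k" if "k < i" for k
            using b[OF that] w(2,3) l ys(3,4) that by (auto simp: nth_list_update)
        qed
      qed
      then show ?thesis using mem_below_chains[OF y] ys(2) last by simp
    qed
    have fg: "f g = (if A (last ys) then g else 0)"
    proof -
      have "f g = (\<Sum>w\<in>btw (ys ! (j - 1)) (ys ! (j + 1)). f (basis_elt (ys[j := w])))"
        unfolding g by (rule linopD(6)[OF f])
      also have "\<dots> = (\<Sum>w\<in>btw (ys ! (j - 1)) (ys ! (j + 1)). if A (last ys) then basis_elt (ys[j := w]) else 0)"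
      proof (rule sum.cong[OF refl])
        fix w assume "w \<in> btw (ys ! (j - 1)) (ys ! (j + 1))"
        then have "ys[j := w] \<in> fc i \<and> last (ys[j := w]) \<sqsubseteq> y" using m mem_below_chains[OF y] by blast
        then show "f (basis_elt (ys[j := w])) = (if A (last ys) then basis_elt (ys[j := w]) else 0)"
          using A[of "ys[j := w]"] last[of w] by simp
      qed
      finally show ?thesis by (simp add: g)
    qed
    show "f g \<in> below_rel x i"
    proof (cases "A (last ys)")
      case True
      then have "last ys \<sqsubseteq> x" by (rule Ax[OF Lev_car[OF fc_last[OF ys(1)]] ys(2)])
      then have "g \<in> Qx.gens i" unfolding below_gens[OF x] g using ys(1,3,4) by blast
      then show ?thesis using fg True gen_submodule_incl[of g "Qx.gens i"] by (simp add: Qx.flag_rel_gens)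
    next
      case False
      then show ?thesis using fg free_submoduleD(1)[OF Qx.rel_submodule] by simp
    qed
  qed
qed

definition cut :: "'p \<Rightarrow> ('p list \<Rightarrow>\<^sub>0 rat) \<Rightarrow> ('p list \<Rightarrow>\<^sub>0 rat)" where
  "cut x = lin_ext (\<lambda>ys. if last ys \<sqsubseteq> x then basis_elt ys else 0)"

lemma linop_cut: "linop (cut x)"
  unfolding cut_def by (rule linop_lin_ext)

lemma cut_basis: "cut x (basis_elt c) = (if last c \<sqsubseteq> x then basis_elt c else 0)"
  by (simp add: cut_def)

lemma cut_free:
  assumes "x \<in> carrier P" "y \<in> carrier P" "u \<in> carrier (below_free y i)"
  shows "cut x u \<in> carrier (below_free x i)"
  by (rule linop_in[OF linop_cut carrier_submodule[OF free_module_module]],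
      rule below_map_rel(1)[OF assms(1,2) linop_cut, where A = "\<lambda>z. z \<sqsubseteq> x"])
    (use assms(3) in \<open>auto simp: cut_basis free_module_simps\<close>)

definition flag_res :: "nat \<Rightarrow> 'p \<Rightarrow> 'p \<Rightarrow> ('p list \<Rightarrow>\<^sub>0 rat) set \<Rightarrow> ('p list \<Rightarrow>\<^sub>0 rat) set" where
  "flag_res i y x = induced (below_free x i) (below_rel x i) (cut x)"

text \<open>The embedding of the flag module of a smaller element. The source is not a parameter
  because \<open>induced\<close> refers to the target only.\<close>

definition flag_inc :: "nat \<Rightarrow> 'p \<Rightarrow> ('p list \<Rightarrow>\<^sub>0 rat) set \<Rightarrow> ('p list \<Rightarrow>\<^sub>0 rat) set" where
  "flag_inc i x = induced (below_free x i) (below_rel x i) (\<lambda>u. u)"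

lemma flag_sheaf_simps: "stalk (flag_sheaf P i) x = Fl x i" "res (flag_sheaf P i) y x = flag_res i y x"
  by (simp_all add: flag_sheaf_def flag_res_def cut_def)

lemma flag_res:
  assumes x: "x \<in> carrier P" and y: "y \<in> carrier P"
  shows "flag_res i y x \<in> lin_maps (Fl y i) (Fl x i)"
    and "\<And>u. u \<in> carrier (below_free y i) \<Longrightarrow> flag_res i y x (cls y i u) = cls x i (cut x u)"
proof -
  interpret Qx: ranked "poset_below P x" \<rho> by (rule ranked_below[OF x])
  interpret Qy: ranked "poset_below P y" \<rho> by (rule ranked_below[OF y])
  have m: "\<And>c. c \<in> below_chains y i \<Longrightarrow> cut x (basis_elt c) \<in> carrier (below_free x i)"
    "\<And>u. u \<in> below_rel y i \<Longrightarrow> cut x u \<in> below_rel x i"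
    using below_map_rel[OF x y linop_cut, where A = "\<lambda>z. z \<sqsubseteq> x" and i = i] by (simp_all add: cut_basis)
  note ind = induced_free[OF Qy.rel_submodule Qx.rel_submodule linop_cut m]
  show "flag_res i y x \<in> lin_maps (Fl y i) (Fl x i)"
    unfolding flag_res_def flag_def by (rule ind(1))
  show "flag_res i y x (cls y i u) = cls x i (cut x u)" if "u \<in> carrier (below_free y i)" for u
    unfolding flag_res_def by (rule ind(2)[OF _ _ that])
qed

lemma flag_inc:
  assumes x: "x \<in> carrier P" and z: "z \<in> carrier P" "z \<sqsubseteq> x"
  shows "flag_inc i x \<in> lin_maps (Fl z i) (Fl x i)"
    and "\<And>u. u \<in> carrier (below_free z i) \<Longrightarrow> flag_inc i x (cls z i u) = cls x i u"
proof -
  interpret Qx: ranked "poset_below P x" \<rho> by (rule ranked_below[OF x])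
  interpret Qz: ranked "poset_below P z" \<rho> by (rule ranked_below[OF z(1)])
  have t: "w \<sqsubseteq> x" if "w \<in> carrier P" "w \<sqsubseteq> z" for w
    by (rule posetD(3)[OF poset that(1) z(1) x that(2) z(2)])
  have m: "\<And>c. c \<in> below_chains z i \<Longrightarrow> basis_elt c \<in> carrier (below_free x i)"
    "\<And>u. u \<in> below_rel z i \<Longrightarrow> u \<in> below_rel x i"
    using below_map_rel[OF x z(1) linop_id, where A = "\<lambda>z. True" and i = i] t by simp_all
  note ind = induced_free[OF Qz.rel_submodule Qx.rel_submodule linop_id m]
  show "flag_inc i x \<in> lin_maps (Fl z i) (Fl x i)"
    unfolding flag_inc_def flag_def by (rule ind(1))
  show "flag_inc i x (cls z i u) = cls x i u" if "u \<in> carrier (below_free z i)" for u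
    unfolding flag_inc_def by (rule ind(2)[OF _ _ that])
qed

lemma Fl_cases:
  assumes "x \<in> carrier P" "m \<in> carrier (Fl x i)"
  obtains u where "u \<in> carrier (below_free x i)" "m = cls x i u"
  by (rule ranked.flag_cases[OF ranked_below[OF assms(1)] assms(2)])

lemma cut_eq:
  assumes y: "y \<in> carrier P" and u: "u \<in> carrier (below_free y i)" and f: "linop f" and g: "linop g"
    and "\<And>c. c \<in> fc i \<Longrightarrow> last c \<sqsubseteq> y \<Longrightarrow> f (basis_elt c) = g (basis_elt c)"
  shows "f u = g u"
  by (rule linop_eq[OF f g]) (use assms(5) u mem_below_chains[OF y] in \<open>auto simp: free_module_simps subset_iff\<close>)

lemma flag_res_id:
  assumes x: "x \<in> carrier P" and m: "m \<in> carrier (Fl x i)"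
  shows "flag_res i x x m = m"
proof -
  obtain u where u: "u \<in> carrier (below_free x i)" "m = cls x i u" by (rule Fl_cases[OF x m])
  have "cut x u = u" by (rule cut_eq[OF x u(1) linop_cut linop_id]) (simp add: cut_basis)
  then show ?thesis unfolding u(2) flag_res(2)[OF x x u(1)] by simp
qed

lemma flag_res_comp:
  assumes x: "x \<in> carrier P" and y: "y \<in> carrier P" and z: "z \<in> carrier P"
    and xy: "x \<sqsubseteq> y" and m: "m \<in> carrier (Fl z i)"
  shows "flag_res i y x (flag_res i z y m) = flag_res i z x m"
proof -
  obtain u where u: "u \<in> carrier (below_free z i)" "m = cls z i u" by (rule Fl_cases[OF z m])
  have "cut x (cut y u) = cut x u"
  proof (rule cut_eq[OF z u(1) linop_comp[OF linop_cut linop_cut] linop_cut])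
    fix c assume c: "c \<in> fc i"
    have "last c \<sqsubseteq> y" if "last c \<sqsubseteq> x" by (rule posetD(3)[OF poset Lev_car[OF fc_last[OF c]] x y that xy])
    then show "cut x (cut y (basis_elt c)) = cut x (basis_elt c)"
      by (simp add: cut_basis linopD(3)[OF linop_cut])
  qed
  then show ?thesis
    unfolding u(2) flag_res(2)[OF y z u(1)] flag_res(2)[OF x z u(1)] flag_res(2)[OF x y cut_free[OF y z u(1)]] by simp
qed

text \<open>A chain killed by the restriction has a top not below \<open>x\<close>, and then none of
  its extensions ends below \<open>x\<close> either; so truncating before or after extending gives
  the same result.\<close>

lemma flag_diff_res:
  assumes x: "x \<in> carrier P" and y: "y \<in> carrier P" and xy: "x \<sqsubseteq> y" and m: "m \<in> carrier (Fl y i)"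
  shows "flag_diff (poset_below P x) i (flag_res i y x m) = flag_res (Suc i) y x (flag_diff (poset_below P y) i m)"
proof -
  interpret Qx: ranked "poset_below P x" \<rho> by (rule ranked_below[OF x])
  interpret Qy: ranked "poset_below P y" \<rho> by (rule ranked_below[OF y])
  obtain u where u: "u \<in> carrier (below_free y i)" "m = cls y i u" by (rule Fl_cases[OF y m])
  have du: "scl ((-1) ^ i) (Qy.D i u) \<in> carrier (below_free y (Suc i))"
    by (intro free_submoduleD(3)[OF carrier_submodule[OF free_module_module]] Qy.D_closed u)
  have "Qx.D i (cut x u) = cut x (Qy.D i u)"
  proof (rule cut_eq[OF y u(1) linop_comp[OF Qx.linop_D linop_cut] linop_comp[OF linop_cut Qy.linop_D]])
    fix c assume c: "c \<in> fc i" "last c \<sqsubseteq> y"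
    let ?A = "{w \<in> Lev (Suc i). w \<sqsubseteq> y \<and> last c \<sqsubset> w}"
    have tr: "last c \<sqsubseteq> x" if "w \<in> Lev (Suc i)" "last c \<sqsubset> w" "w \<sqsubseteq> x" for w
      using posetD(3)[OF poset Lev_car[OF fc_last[OF c(1)]] Lev_car[OF that(1)] x _ that(3)] that(2) posetD(4)[OF poset] by blast
    have ty: "w \<sqsubseteq> y" if "w \<in> Lev (Suc i)" "w \<sqsubseteq> x" for w
      by (rule posetD(3)[OF poset Lev_car[OF that(1)] x y that(2) xy])
    have LQ: "{w \<in> ranked.Lev (poset_below P t) \<rho> (Suc i). last c \<sqsubset> w} = {w \<in> Lev (Suc i). w \<sqsubseteq> t \<and> last c \<sqsubset> w}"
      if "t \<in> carrier P" for t
    proof -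
      interpret Qt: ranked "poset_below P t" \<rho> by (rule ranked_below[OF that])
      show ?thesis by (auto simp: Qt.Lev_def Lev_def below_simps)
    qed
    have Dx: "Qx.D i (basis_elt c) = (\<Sum>w\<in>{w \<in> Lev (Suc i). w \<sqsubseteq> x \<and> last c \<sqsubset> w}. basis_elt (c @ [w]))"
      unfolding Qx.D_def Qx.app_sum_basis[OF Qx.finite_Lev] below_simps LQ[OF x] ..
    have Dy: "Qy.D i (basis_elt c) = (\<Sum>w\<in>?A. basis_elt (c @ [w]))"
      unfolding Qy.D_def Qy.app_sum_basis[OF Qy.finite_Lev] below_simps LQ[OF y] ..
    have "cut x (Qy.D i (basis_elt c)) = (\<Sum>w\<in>?A. if w \<sqsubseteq> x then basis_elt (c @ [w]) else 0)"
      unfolding Dy linopD(6)[OF linop_cut] cut_basis by simp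
    also have "\<dots> = (\<Sum>w\<in>{w \<in> ?A. w \<sqsubseteq> x}. basis_elt (c @ [w]))"
      using finite_Lev by (subst sum.inter_filter[symmetric]) simp_all
    also have "{w \<in> ?A. w \<sqsubseteq> x} = {w \<in> Lev (Suc i). w \<sqsubseteq> x \<and> last c \<sqsubset> w}" using ty by blast
    finally have cy: "cut x (Qy.D i (basis_elt c)) = Qx.D i (basis_elt c)" using Dx by simp
    show "Qx.D i (cut x (basis_elt c)) = cut x (Qy.D i (basis_elt c))"
    proof (cases "last c \<sqsubseteq> x")
      case True
      then show ?thesis using cy by (simp add: cut_basis)
    next
      case False
      then have "{w \<in> Lev (Suc i). w \<sqsubseteq> x \<and> last c \<sqsubset> w} = {}" using tr by blast
      then have "Qx.D i (basis_elt c) = 0" unfolding Dx by (simp only: sum.empty)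
      then show ?thesis using cy False by (simp add: cut_basis linopD(3)[OF Qx.linop_D])
    qed
  qed
  then show ?thesis
    unfolding u(2) flag_res(2)[OF x y u(1)] Qy.flag_diff(2)[OF u(1)] Qx.flag_diff(2)[OF cut_free[OF x y u(1)]]
      flag_res(2)[OF x y du] linopD(2)[OF linop_cut] by simp
qed

lemma flag_zero:
  assumes x: "x \<in> carrier P" and i: "\<rho> x < i"
  shows "carrier (Fl x i) = {\<zero>\<^bsub>Fl x i\<^esub>}"
proof -
  interpret Q: ranked "poset_below P x" \<rho> by (rule ranked_below[OF x])
  have "below_chains x i = {}"
  proof (rule ccontr)
    assume "below_chains x i \<noteq> {}"
    then obtain c where c: "c \<in> fc i" "last c \<sqsubseteq> x" using mem_below_chains[OF x] by blast
    have "\<rho> (last c) \<le> \<rho> x" using mono[OF Lev_car[OF fc_last[OF c(1)]] x c(2)] by (cases "last c = x") auto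
    then show False using i Lev_rank[OF fc_last[OF c(1)]] by simp
  qed
  then have "carrier (below_free x i) = {0}" by (simp add: free_module_simps)
  then have "carrier (Fl x i) = {cls x i 0}" by (simp add: flag_def quot_module_simps)
  then show ?thesis by (simp add: Q.cls_zero)
qed

text \<open>A chain in degree \<open>i\<close> ends in rank \<open>i\<close>, so below an element
  \<open>z\<close> of that rank it ends in \<open>z\<close> itself. Hence different summands do not
  interfere.\<close>

lemma flag_res_inc:
  assumes x: "x \<in> carrier P" and z: "z \<in> carrier P" "z \<sqsubseteq> x" "\<rho> z = i" and z': "z' \<in> carrier P" "\<rho> z' = i"
    and m: "m \<in> carrier (Fl z i)"
  shows "flag_res i x z' (flag_inc i x m) = (if z = z' then m else \<zero>\<^bsub>Fl z' i\<^esub>)"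
proof -
  interpret Qx: ranked "poset_below P x" \<rho> by (rule ranked_below[OF x])
  interpret Q': ranked "poset_below P z'" \<rho> by (rule ranked_below[OF z'(1)])
  obtain u where u: "u \<in> carrier (below_free z i)" "m = cls z i u" by (rule Fl_cases[OF z(1) m])
  have ux: "u \<in> carrier (below_free x i)"
  proof -
    have "below_chains z i \<subseteq> below_chains x i"
      using mem_below_chains[OF x] mem_below_chains[OF z(1)] posetD(3)[OF poset Lev_car[OF fc_last] z(1) x _ z(2)] by blast
    then show ?thesis using u(1) by (auto simp: free_module_simps)
  qed
  have l: "last c = z" if "c \<in> fc i" "last c \<sqsubseteq> z" for c
    using rank_eqI[OF Lev_car[OF fc_last[OF that(1)]] z(1) that(2)] Lev_rank[OF fc_last[OF that(1)]] z(3) by simp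
  have zz: "z \<sqsubseteq> z' \<longleftrightarrow> z = z'"
    using rank_eqI[OF z(1) z'(1)] z(3) z'(2) posetD(1)[OF poset z(1)] by auto
  have "cut z' u = (\<lambda>u. if z = z' then u else 0) u"
  proof (rule cut_eq[OF z(1) u(1) linop_cut])
    show "linop (\<lambda>u. if z = z' then u else 0 :: 'p list \<Rightarrow>\<^sub>0 rat)" by (simp add: linop_def)
    fix c assume "c \<in> fc i" "last c \<sqsubseteq> z"
    then have "last c = z" by (rule l)
    then show "cut z' (basis_elt c) = (if z = z' then basis_elt c else 0)" by (simp add: cut_basis zz)
  qed
  then show ?thesis
    unfolding u(2) flag_inc(2)[OF x z(1,2) u(1)] flag_res(2)[OF z'(1) x ux] by (simp add: Q'.cls_zero)
qed

text \<open>Each chain has exactly one top, so truncating at every \<open>z\<close> of rank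
  \<open>i\<close> and adding up restores it. With \<open>flag_res_inc\<close> this is the direct
  sum decomposition by tops.\<close>

lemma flag_decompose:
  assumes x: "x \<in> carrier P" and m: "m \<in> carrier (Fl x i)"
  shows "(\<Oplus>\<^bsub>Fl x i\<^esub>z\<in>{z \<in> Lev i. z \<sqsubseteq> x}. flag_inc i x (flag_res i x z m)) = m"
proof -
  interpret Q: ranked "poset_below P x" \<rho> by (rule ranked_below[OF x])
  interpret M: module Rat "Fl x i" by (rule Q.flag_module)
  obtain u where u: "u \<in> carrier (below_free x i)" "m = cls x i u" by (rule Fl_cases[OF x m])
  have cz: "cut z u \<in> carrier (below_free x i)" if "z \<in> carrier P" "z \<sqsubseteq> x" for z
  proof -
    have "below_chains z i \<subseteq> below_chains x i"
      using mem_below_chains[OF x] mem_below_chains[OF that(1)] posetD(3)[OF poset Lev_car[OF fc_last] that(1) x _ that(2)] by blast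
    then show ?thesis using cut_free[OF that(1) x u(1)] by (auto simp: free_module_simps)
  qed
  have e: "flag_inc i x (flag_res i x z m) = cls x i (cut z u)" if "z \<in> carrier P" "z \<sqsubseteq> x" for z
    unfolding u(2) flag_res(2)[OF that(1) x u(1)] flag_inc(2)[OF x that cut_free[OF that(1) x u(1)]] ..
  have s: "(\<Oplus>\<^bsub>Fl x i\<^esub>z\<in>Z. flag_inc i x (flag_res i x z m)) = cls x i (\<Sum>z\<in>Z. cut z u)"
    if "finite Z" "Z \<subseteq> {z \<in> carrier P. z \<sqsubseteq> x}" for Z
    using that
  proof (induction Z rule: finite_induct)
    case empty
    then show ?case by (simp add: Q.cls_zero)
  next
    case (insert z Z)
    have cl: "cls x i v \<in> carrier (Fl x i)" if "v \<in> carrier (below_free x i)" for v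
      using that by (auto simp: flag_def quot_module_simps)
    have "(\<Oplus>\<^bsub>Fl x i\<^esub>z\<in>insert z Z. flag_inc i x (flag_res i x z m))
      = flag_inc i x (flag_res i x z m) \<oplus>\<^bsub>Fl x i\<^esub> (\<Oplus>\<^bsub>Fl x i\<^esub>z\<in>Z. flag_inc i x (flag_res i x z m))"
      by (rule M.finsum_insert) (use insert e cl cz in auto)
    also have "\<dots> = cls x i (cut z u) \<oplus>\<^bsub>Fl x i\<^esub> cls x i (\<Sum>z\<in>Z. cut z u)"
      using insert e[of z] by simp
    also have "\<dots> = cls x i (cut z u + (\<Sum>z\<in>Z. cut z u))"
      by (rule Q.cls_add) (use insert cz in \<open>auto intro!: free_sum\<close>)
    finally show ?case using insert by simp
  qed
  let ?Z = "{z \<in> Lev i. z \<sqsubseteq> x}"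
  have "(\<Sum>z\<in>?Z. cut z u) = u"
  proof (rule cut_eq[OF x u(1) linop_sum[OF linop_cut] linop_id])
    fix c assume c: "c \<in> fc i" "last c \<sqsubseteq> x"
    have cl: "last c \<in> Lev i" by (rule fc_last[OF c(1)])
    have "last c \<sqsubseteq> z \<longleftrightarrow> last c = z" if "z \<in> ?Z" for z
      using rank_eqI[OF Lev_car[OF cl], of z] cl that posetD(1)[OF poset Lev_car[OF cl]] by (auto simp: Lev_def)
    then have "(\<Sum>z\<in>?Z. cut z (basis_elt c)) = (\<Sum>z\<in>?Z. if last c = z then basis_elt c else 0)"
      by (simp add: cut_basis)
    also have "\<dots> = basis_elt c"
    proof -
      have "finite ?Z" "last c \<in> ?Z" using finite_Lev cl c(2) by simp_all
      then show ?thesis by (simp only: sum.delta' if_True)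
    qed
    finally show "(\<Sum>z\<in>?Z. cut z (basis_elt c)) = basis_elt c" .
  qed
  moreover have "finite ?Z" "?Z \<subseteq> {z \<in> carrier P. z \<sqsubseteq> x}"
    using finite_Lev[of i] by simp (auto simp: Lev_def)
  ultimately show ?thesis using s[of ?Z] u(2) by simp
qed

end

context apexed
begin

text \<open>\<open>h i\<close> carries the sign of the differential out of degree \<open>i\<close>,
  so in both composites the sign occurs twice and disappears, leaving
  \<open>contraction\<close>.\<close>

lemma flag_contraction:
  shows "\<exists>h. (\<forall>i. h i \<in> lin_maps (flag P (Suc i)) (flag P i))
    \<and> (\<forall>m\<in>carrier (flag P 0). h 0 (flag_diff P 0 m) = m)
    \<and> (\<forall>i. \<forall>m\<in>carrier (flag P (Suc i)). h (Suc i) (flag_diff P (Suc i) m) \<oplus>\<^bsub>flag P (Suc i)\<^esub> flag_diff P i (h i m) = m)"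
proof -
  define h where "h i = induced (free_module (fc i)) (flag_rel P i) (\<lambda>u. scl ((-1) ^ i) (Psi u))" for i
  note fsub = carrier_submodule[OF free_module_module]
  have Pc: "Psi u \<in> carrier (free_module (fc i))" if "u \<in> carrier (free_module (fc (Suc i)))" for u i
    by (rule linop_in[OF linop_Psi fsub], rule Psi_closed) (use that in \<open>auto simp: free_module_simps\<close>)
  have sPc: "scl ((-1) ^ i) (Psi (basis_elt c)) \<in> carrier (free_module (fc i))" if "c \<in> fc (Suc i)" for c i
    by (rule free_submoduleD(3)[OF fsub]) (rule Psi_closed[OF that])
  have sPr: "scl ((-1) ^ i) (Psi u) \<in> flag_rel P i" if "u \<in> flag_rel P (Suc i)" for u i
    by (rule free_submoduleD(3)[OF rel_submodule]) (rule Psi_rel[OF that])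
  note ind = induced_free[OF rel_submodule rel_submodule linop_comp[OF linop_scl linop_Psi] sPc sPr]
  have hl: "h i \<in> lin_maps (flag P (Suc i)) (flag P i)" for i
    unfolding h_def flag_def by (rule ind(1))
  have hc: "h i (fcls (Suc i) u) = fcls i (scl ((-1) ^ i) (Psi u))"
    if "u \<in> carrier (free_module (fc (Suc i)))" for i u
    unfolding h_def by (rule ind(2)[OF _ _ that])
  have sq: "scl ((-1) ^ i) (scl ((-1) ^ i) u) = u" for i and u :: "'p list \<Rightarrow>\<^sub>0 rat"
    by (rule poly_mapping_eqI) (simp add: lookup_scl mult.assoc[symmetric] power_mult_distrib[symmetric])
  have hd: "h i (flag_diff P i (fcls i u)) = fcls i (Psi (D i u))"
    if u: "u \<in> carrier (free_module (fc i))" for i u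
  proof -
    have "scl ((-1) ^ i) (D i u) \<in> carrier (free_module (fc (Suc i)))"
      by (intro free_submoduleD(3)[OF fsub] D_closed u)
    then show ?thesis unfolding flag_diff(2)[OF u] by (simp add: hc linopD(2)[OF linop_Psi] sq)
  qed
  have dh: "flag_diff P i (h i (fcls (Suc i) u)) = fcls (Suc i) (D i (Psi u))"
    if u: "u \<in> carrier (free_module (fc (Suc i)))" for i u
  proof -
    have "scl ((-1) ^ i) (Psi u) \<in> carrier (free_module (fc i))"
      by (intro free_submoduleD(3)[OF fsub] Pc u)
    then show ?thesis unfolding hc[OF u] by (simp add: flag_diff(2) linopD(2)[OF linop_D] sq)
  qed
  have PDc: "Psi (D i u) \<in> carrier (free_module (fc i))" if "u \<in> carrier (free_module (fc i))" for i u
    by (intro Pc D_closed that)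
  have "h 0 (flag_diff P 0 m) = m" if m: "m \<in> carrier (flag P 0)" for m
  proof -
    obtain u where u: "u \<in> carrier (free_module (fc 0))" "m = fcls 0 u"
      by (rule flag_cases[OF m])
    show ?thesis unfolding u(2) hd[OF u(1)]
      by (rule cls_eq[OF PDc[OF u(1)] u(1)]) (use contraction[OF u(1)] in simp)
  qed
  moreover have "h (Suc i) (flag_diff P (Suc i) m) \<oplus>\<^bsub>flag P (Suc i)\<^esub> flag_diff P i (h i m) = m"
    if m: "m \<in> carrier (flag P (Suc i))" for i m
  proof -
    obtain u where u: "u \<in> carrier (free_module (fc (Suc i)))" "m = fcls (Suc i) u"
      by (rule flag_cases[OF m])
    note c = PDc[OF u(1)] D_closed[OF Pc[OF u(1)]]
    show ?thesis unfolding u(2) hd[OF u(1)] dh[OF u(1)] cls_add[OF c]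
      by (rule cls_eq[OF free_submoduleD(2)[OF fsub c] u(1)]) (use contraction[OF u(1)] in simp)
  qed
  ultimately show ?thesis using hl by (intro exI[of _ h]) simp
qed

end

section \<open>The De Concini--Procesi sheaf\<close>

lemma poly_ring_simps:
  "carrier (poly_ring H) = carrier (free_module {m. Poly_Mapping.keys m \<subseteq> H})"
  "add (poly_ring H) = (+)" "x \<otimes>\<^bsub>poly_ring H\<^esub> y = x * y" "\<zero>\<^bsub>poly_ring H\<^esub> = 0" "\<one>\<^bsub>poly_ring H\<^esub> = 1"
  by (auto simp: poly_ring_def ring_of_type_algebra_def free_module_simps)

lemma poly_mult_closed:
  assumes p: "p \<in> carrier (poly_ring H)" and q: "q \<in> carrier (poly_ring H)"
  shows "p * q \<in> carrier (poly_ring H)"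
proof -
  have "Poly_Mapping.keys m \<subseteq> H" if m: "m \<in> Poly_Mapping.keys (p * q)" for m
  proof -
    obtain a b where ab: "m = a + b" "a \<in> Poly_Mapping.keys p" "b \<in> Poly_Mapping.keys q"
      using subsetD[OF keys_mult m] by blast
    have "Poly_Mapping.keys a \<subseteq> H" "Poly_Mapping.keys b \<subseteq> H"
      using p q ab(2,3) by (auto simp: poly_ring_simps free_module_simps)
    then show ?thesis using keys_add[of a b] unfolding ab(1) by blast
  qed
  then show ?thesis by (auto simp: poly_ring_simps free_module_simps)
qed

lemma poly_add_closed:
  "p \<in> carrier (poly_ring H) \<Longrightarrow> q \<in> carrier (poly_ring H) \<Longrightarrow> p + q \<in> carrier (poly_ring H)"
  unfolding poly_ring_simps(1) by (rule free_submoduleD(2)[OF carrier_submodule[OF free_module_module]])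

lemma poly_one_closed: "1 \<in> carrier (poly_ring H)"
  by (simp add: poly_ring_simps free_module_simps flip: single_one)

lemma poly_ring_ring: "ring (poly_ring H)"
proof (rule ringI)
  show "abelian_group (poly_ring H)"
  proof (rule abelian_groupI)
    fix p assume p: "p \<in> carrier (poly_ring H)"
    have "- p \<in> carrier (poly_ring H)"
      using p unfolding poly_ring_simps(1) by (rule free_submoduleD(5)[OF carrier_submodule[OF free_module_module]])
    then show "\<exists>q\<in>carrier (poly_ring H). q \<oplus>\<^bsub>poly_ring H\<^esub> p = \<zero>\<^bsub>poly_ring H\<^esub>"
      by (intro bexI[of _ "- p"]) (simp_all add: poly_ring_simps)
  next
    show "\<zero>\<^bsub>poly_ring H\<^esub> \<in> carrier (poly_ring H)" by (simp add: poly_ring_simps free_module_simps)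
  qed (simp_all add: poly_add_closed poly_ring_simps(2,4) add.assoc add.commute)
  show "Group.monoid (poly_ring H)"
    by (rule monoidI) (simp_all add: poly_mult_closed poly_one_closed poly_ring_simps(3,5) mult.assoc)
qed (simp_all add: poly_ring_simps(2,3) algebra_simps)

lemma poly_prod_closed:
  "(\<And>g. g \<in> T \<Longrightarrow> f g \<in> carrier (poly_ring H)) \<Longrightarrow> prod f T \<in> carrier (poly_ring H)"
  by (induction T rule: infinite_finite_induct) (simp_all add: poly_one_closed poly_mult_closed)

lemma dp_var_closed: "g \<in> H \<Longrightarrow> dp_var g \<in> carrier (poly_ring H)"
  by (simp add: dp_var_def poly_ring_simps free_module_simps)

section \<open>The ideals and the graded pieces of the quotient rings\<close>

context blowup_setting
begin

abbreviation mons :: "('a \<Rightarrow>\<^sub>0 nat) set" where "mons \<equiv> {m. Poly_Mapping.keys m \<subseteq> H}"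

abbreviation J :: "'a blow \<Rightarrow> 'a mpoly set" where "J y \<equiv> DP_ideal L H K y"

abbreviation pcls :: "'a blow \<Rightarrow> 'a mpoly \<Rightarrow> 'a mpoly set" where "pcls y p \<equiv> J y +>\<^bsub>free_module mons\<^esub> p"

abbreviation DP :: "nat \<Rightarrow> 'a blow \<Rightarrow> (rat, 'a mpoly set) module" where "DP i y \<equiv> DP_degree L H K i y"

definition dp_gens :: "'a blow \<Rightarrow> 'a mpoly set" where
  "dp_gens y = {\<Prod>g\<in>T. dp_var g | S T. S \<in> nested_sets L H \<and> is_lub K y (blow_atom L ` S)
         \<and> T \<subseteq> H \<and> S \<union> T \<notin> nested_sets L H}
      \<union> {\<Sum>h\<in>{h \<in> H. g \<sqsubseteq> h}. dp_var h | g. g \<in> atoms L}"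

lemma J_gens: "J y = Idl\<^bsub>poly_ring H\<^esub> dp_gens y"
  by (simp add: DP_ideal_def dp_gens_def)

lemma dp_gens_closed: "dp_gens y \<subseteq> carrier (poly_ring H)"
proof
  fix p assume "p \<in> dp_gens y"
  then consider T where "p = (\<Prod>g\<in>T. dp_var g)" "T \<subseteq> H" | g where "p = (\<Sum>h\<in>{h \<in> H. g \<sqsubseteq> h}. dp_var h)"
    unfolding dp_gens_def by blast
  then show "p \<in> carrier (poly_ring H)"
  proof cases
    case (1 T)
    show ?thesis unfolding 1(1) by (rule poly_prod_closed, rule dp_var_closed) (use 1(2) in blast)
  next
    case (2 g)
    show ?thesis unfolding 2 poly_ring_simps(1)
      by (rule free_sum) (use dp_var_closed[of _ H] in \<open>simp add: poly_ring_simps(1)\<close>)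
  qed
qed

lemma J_ideal: "ideal (J y) (poly_ring H)"
  unfolding J_gens by (rule ring.genideal_ideal[OF poly_ring_ring dp_gens_closed])

text \<open>The linear generators are the same at every element, and the monomial ones persist by
  \<open>nonface_mono\<close>. The restriction maps of the sheaf exist for this reason.\<close>

lemma J_mono:
  assumes "y \<in> carrier K" "z \<in> carrier K" "y \<sqsubseteq>\<^bsub>K\<^esub> z"
  shows "J y \<subseteq> J z"
  unfolding J_gens[of y]
proof (rule ring.genideal_minimal[OF poly_ring_ring J_ideal])
  have z: "dp_gens z \<subseteq> J z" unfolding J_gens by (rule ring.genideal_self[OF poly_ring_ring dp_gens_closed])
  have "dp_gens y \<subseteq> dp_gens z"
  proof
    fix p assume "p \<in> dp_gens y"
    then consider S T where "p = (\<Prod>g\<in>T. dp_var g)" "S \<in> nested_sets L H" "is_lub K y (blow_atom L ` S)" "T \<subseteq> H" "S \<union> T \<notin> nested_sets L H"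
      | g where "p = (\<Sum>h\<in>{h \<in> H. g \<sqsubseteq> h}. dp_var h)" "g \<in> atoms L"
      unfolding dp_gens_def by blast
    then show "p \<in> dp_gens z"
    proof cases
      case (1 S T)
      obtain S' where S': "S' \<in> nested_sets L H" "is_lub K z (blow_atom L ` S')" "S' \<union> T \<notin> nested_sets L H"
        using nonface_mono[OF assms 1(2-5)] by blast
      then show ?thesis unfolding dp_gens_def using 1(1,4) by blast
    next
      case (2 g)
      then show ?thesis unfolding dp_gens_def by blast
    qed
  qed
  then show "dp_gens y \<subseteq> J z" using z by blast
qed

lemma scl_mult: "scl c p = Poly_Mapping.single 0 c * p" for p :: "'a mpoly"
  by (rule mult_map_scale_conv_mult)

lemma const_closed: "Poly_Mapping.single 0 c \<in> carrier (poly_ring H)"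
  by (simp add: poly_ring_simps free_module_simps)

lemma J_submodule: "submodule (J y) Rat (free_module mons)"
proof (rule rat_submoduleI[OF free_module_module])
  interpret ideal "J y" "poly_ring H" by (rule J_ideal)
  show "J y \<subseteq> carrier (free_module mons)" using a_subset by (simp add: poly_ring_simps)
  show "\<zero>\<^bsub>free_module mons\<^esub> \<in> J y"
    using additive_subgroup.zero_closed[OF ideal.axioms(1)[OF J_ideal], of y] by (simp add: poly_ring_simps free_module_simps)
  show "p \<oplus>\<^bsub>free_module mons\<^esub> q \<in> J y" if "p \<in> J y" "q \<in> J y" for p q
    using additive_subgroup.a_closed[OF ideal.axioms(1)[OF J_ideal] that] by (simp add: poly_ring_simps free_module_simps)
  show "c \<odot>\<^bsub>free_module mons\<^esub> p \<in> J y" if "p \<in> J y" for c p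
    using I_l_closed[OF that const_closed, of c] by (simp add: poly_ring_simps free_module_simps scl_mult)
qed

text \<open>Cosets involve addition only, so the quotient ring can be treated as a quotient of
  vector spaces.\<close>

lemma poly_coset: "N +>\<^bsub>poly_ring H\<^esub> p = N +>\<^bsub>free_module mons\<^esub> p"
  by (simp add: a_r_coset_def' poly_ring_simps free_module_simps)

abbreviation hom_polys :: "nat \<Rightarrow> 'a mpoly set" where
  "hom_polys i \<equiv> {p \<in> carrier (free_module mons). homogeneous i p}"

lemma hom_polys_submodule: "submodule (hom_polys i) Rat (free_module mons)"
proof (rule rat_submoduleI[OF free_module_module])
  interpret M: module Rat "free_module mons" by (rule free_module_module)
  show "p \<oplus>\<^bsub>free_module mons\<^esub> q \<in> hom_polys i" if "p \<in> hom_polys i" "q \<in> hom_polys i" for p q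
    using that keys_add[of p q] M.a_closed[of p q] by (auto simp: free_module_simps homogeneous_def)
  show "c \<odot>\<^bsub>free_module mons\<^esub> p \<in> hom_polys i" if "p \<in> hom_polys i" for c p
  proof -
    have "Poly_Mapping.keys (scl c p) \<subseteq> Poly_Mapping.keys p" by (auto simp: in_keys_iff lookup_scl)
    then show ?thesis using that by (auto simp: free_module_simps homogeneous_def)
  qed
qed (auto simp: free_module_simps homogeneous_def)

lemma DP_carrier: "carrier (DP i y) = pcls y ` hom_polys i"
  unfolding DP_degree_def Let_def poly_coset poly_ring_simps(1) by auto

lemma DP_cases:
  assumes "m \<in> carrier (DP i y)"
  obtains p where "p \<in> carrier (free_module mons)" "homogeneous i p" "m = pcls y p"
  using assms unfolding DP_carrier by blast

lemma DP_add: "add (DP i y) = (<+>\<^bsub>free_module mons\<^esub>)" and DP_zero: "\<zero>\<^bsub>DP i y\<^esub> = J y"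
  by (intro ext, simp_all add: DP_degree_def DP_ring_def FactRing_def Let_def set_add_def' poly_ring_simps free_module_simps)

lemma DP_smult:
  assumes "p \<in> carrier (free_module mons)"
  shows "c \<odot>\<^bsub>DP i y\<^esub> (pcls y p) = pcls y (scl c p)"
proof -
  have "c \<odot>\<^bsub>DP i y\<^esub> (pcls y p) = rcoset_mult (poly_ring H) (J y) (J y +>\<^bsub>poly_ring H\<^esub> Poly_Mapping.single 0 c) (J y +>\<^bsub>poly_ring H\<^esub> p)"
    by (simp add: DP_degree_def DP_ring_def FactRing_def Let_def poly_coset)
  also have "\<dots> = J y +>\<^bsub>poly_ring H\<^esub> (Poly_Mapping.single 0 c \<otimes>\<^bsub>poly_ring H\<^esub> p)"
    by (rule ideal.rcoset_mult_add[OF J_ideal const_closed]) (use assms in \<open>simp add: poly_ring_simps\<close>)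
  also have "\<dots> = pcls y (scl c p)" by (simp add: poly_coset poly_ring_simps scl_mult)
  finally show ?thesis .
qed

text \<open>The graded piece is the image of the homogeneous polynomials in the whole quotient, so
  it is a subspace there.\<close>

lemma DP_module: "module Rat (DP i y)"
proof -
  let ?Q = "quot_module (free_module mons) (J y)"
  have sub: "submodule (pcls y ` hom_polys i) Rat ?Q"
    by (rule image_submodule[OF free_module_module quot_module_module[OF free_module_module J_submodule]
          quot_map_lin[OF free_module_module J_submodule] hom_polys_submodule])
  show ?thesis
  proof (rule module_cong[OF submodule_module[OF quot_module_module[OF free_module_module J_submodule] sub]])
    show "carrier (DP i y) = carrier (?Q\<lparr>carrier := pcls y ` hom_polys i\<rparr>)" by (simp add: DP_carrier)
    show "\<zero>\<^bsub>DP i y\<^esub> = \<zero>\<^bsub>?Q\<lparr>carrier := pcls y ` hom_polys i\<rparr>\<^esub>" by (simp add: DP_zero quot_module_simps)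
    show "v \<oplus>\<^bsub>DP i y\<^esub> w = v \<oplus>\<^bsub>?Q\<lparr>carrier := pcls y ` hom_polys i\<rparr>\<^esub> w" for v w by (simp add: DP_add quot_module_simps)
    fix k v assume "v \<in> carrier (?Q\<lparr>carrier := pcls y ` hom_polys i\<rparr>)"
    then obtain p where p: "p \<in> carrier (free_module mons)" "v = pcls y p" by auto
    show "k \<odot>\<^bsub>DP i y\<^esub> v = k \<odot>\<^bsub>?Q\<lparr>carrier := pcls y ` hom_polys i\<rparr>\<^esub> v"
      using coset_smult[OF free_module_module J_submodule p(1), where c = k]
      by (simp add: p(2) DP_smult[OF p(1)] free_module_simps)
  qed
qed

definition dp_res :: "'a blow \<Rightarrow> 'a mpoly set \<Rightarrow> 'a mpoly set" where
  "dp_res z = induced (poly_ring H) (J z) (\<lambda>p. p)"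

lemma DP_sheaf_simps: "stalk (DP_sheaf L H K i) y = DP i y" "res (DP_sheaf L H K i) y z = dp_res z"
  by (simp_all add: DP_sheaf_def dp_res_def)

lemma dp_res_cls:
  assumes "y \<in> carrier K" "z \<in> carrier K" "y \<sqsubseteq>\<^bsub>K\<^esub> z" "p \<in> carrier (free_module mons)"
  shows "dp_res z (pcls y p) = pcls z p"
proof -
  have "dp_res z = induced (free_module mons) (J z) (\<lambda>p. p)"
    unfolding dp_res_def induced_def poly_coset ..
  then show ?thesis
    using induced_coset[OF free_module_module J_submodule free_module_module J_submodule lin_maps_id _ assms(4)]
      J_mono[OF assms(1-3)] by (simp add: image_ident)
qed

lemma dp_res_lin:
  assumes "y \<in> carrier K" "z \<in> carrier K" "y \<sqsubseteq>\<^bsub>K\<^esub> z"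
  shows "dp_res z \<in> lin_maps (DP i y) (DP i z)"
proof (rule lin_mapsI)
  note r = dp_res_cls[OF assms]
  note cadd = coset_add[OF free_module_module J_submodule]
  fix v assume "v \<in> carrier (DP i y)"
  then obtain p where p: "p \<in> carrier (free_module mons)" "homogeneous i p" "v = pcls y p" by (rule DP_cases)
  show "dp_res z v \<in> carrier (DP i z)" unfolding p(3) r[OF p(1)] DP_carrier using p(1,2) by blast
  have sp: "scl c p \<in> carrier (free_module mons)" for c
    by (rule free_submoduleD(3)[OF carrier_submodule[OF free_module_module] p(1)])
  show "dp_res z (c \<odot>\<^bsub>DP i y\<^esub> v) = c \<odot>\<^bsub>DP i z\<^esub> dp_res z v" for c
    unfolding p(3) DP_smult[OF p(1)] r[OF p(1)] r[OF sp] ..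
  fix w assume "w \<in> carrier (DP i y)"
  then obtain q where q: "q \<in> carrier (free_module mons)" "homogeneous i q" "w = pcls y q" by (rule DP_cases)
  have pq: "p \<oplus>\<^bsub>free_module mons\<^esub> q \<in> carrier (free_module mons)"
    using free_submoduleD(2)[OF carrier_submodule[OF free_module_module] p(1) q(1)] by (simp add: free_module_simps(3))
  show "dp_res z (v \<oplus>\<^bsub>DP i y\<^esub> w) = dp_res z v \<oplus>\<^bsub>DP i z\<^esub> dp_res z w"
    unfolding p(3) q(3) DP_add cadd[OF p(1) q(1)] r[OF p(1)] r[OF q(1)] r[OF pq] ..
qed

lemma dp_res_id:
  assumes "y \<in> carrier K" "v \<in> carrier (DP i y)"
  shows "dp_res y v = v"
proof -
  obtain p where p: "p \<in> carrier (free_module mons)" "v = pcls y p" by (rule DP_cases[OF assms(2)])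
  show ?thesis unfolding p(2) by (rule dp_res_cls[OF assms(1,1) posetD(1)[OF poset_K assms(1)] p(1)])
qed

lemma dp_res_comp:
  assumes "w \<in> carrier K" "y \<in> carrier K" "z \<in> carrier K" "w \<sqsubseteq>\<^bsub>K\<^esub> y" "y \<sqsubseteq>\<^bsub>K\<^esub> z" "v \<in> carrier (DP i w)"
  shows "dp_res z (dp_res y v) = dp_res z v"
proof -
  obtain p where p: "p \<in> carrier (free_module mons)" "v = pcls w p" by (rule DP_cases[OF assms(6)])
  have wz: "w \<sqsubseteq>\<^bsub>K\<^esub> z" by (rule posetD(3)[OF poset_K assms(1-5)])
  show ?thesis
    unfolding p(2) dp_res_cls[OF assms(1,2,4) p(1)] dp_res_cls[OF assms(2,3,5) p(1)] dp_res_cls[OF assms(1,3) wz p(1)] ..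
qed

end

section \<open>Functoriality of tensor products\<close>

lemma lin_maps_finsum:
  assumes f: "f \<in> lin_maps M N" and M: "module Rat M" and N: "module Rat N"
    and "finite A" "\<And>a. a \<in> A \<Longrightarrow> g a \<in> carrier M"
  shows "f (\<Oplus>\<^bsub>M\<^esub>a\<in>A. g a) = (\<Oplus>\<^bsub>N\<^esub>a\<in>A. f (g a))"
  using assms(4,5)
proof (induction A rule: finite_induct)
  interpret M: module Rat M by fact
  interpret N: module Rat N by fact
  case empty
  show ?case using lin_maps_zero[OF f M N] by simp
next
  interpret M: module Rat M by fact
  interpret N: module Rat N by fact
  case (insert a A)
  have g: "g \<in> A \<rightarrow> carrier M" "g a \<in> carrier M" using insert.prems by auto
  have fg: "(\<lambda>a. f (g a)) \<in> A \<rightarrow> carrier N" "f (g a) \<in> carrier N" using g lin_mapsD(1)[OF f] by auto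
  show ?case
    using insert.hyps insert.IH insert.prems lin_mapsD(2)[OF f g(2) M.finsum_closed[OF g(1)]]
    by (simp add: M.finsum_insert[OF insert.hyps(1,2) g] N.finsum_insert[OF insert.hyps(1,2) fg])
qed

lemma lin_maps_finsum_maps:
  assumes N: "module Rat N" and "finite A" "\<And>a. a \<in> A \<Longrightarrow> f a \<in> lin_maps M N" and M: "module Rat M"
  shows "(\<lambda>v. \<Oplus>\<^bsub>N\<^esub>a\<in>A. f a v) \<in> lin_maps M N"
  using assms(2,3)
proof (induction A rule: finite_induct)
  interpret N: module Rat N by fact
  case empty
  show ?case using lin_maps_const_zero[OF N] by simp
next
  interpret N: module Rat N by fact
  case (insert a A)
  have i: "(\<lambda>v. \<Oplus>\<^bsub>N\<^esub>a\<in>A. f a v) \<in> lin_maps M N" using insert by simp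
  have fa: "f a \<in> lin_maps M N" using insert.prems by simp
  show ?case
  proof (rule lin_maps_cong[OF lin_maps_add[OF fa i N] M])
    fix v assume v: "v \<in> carrier M"
    show "(\<Oplus>\<^bsub>N\<^esub>a\<in>insert a A. f a v) = f a v \<oplus>\<^bsub>N\<^esub> (\<Oplus>\<^bsub>N\<^esub>a\<in>A. f a v)"
      by (rule N.finsum_insert[OF insert.hyps(1,2)]) (use lin_mapsD(1)[OF insert.prems v] in auto)
  qed
qed

text \<open>The composites are passed as separate maps \<open>k\<close> and \<open>l\<close>,
  because identities such as \<open>flag_res_comp\<close> hold on carriers only, and functions that
  agree there need not be equal.\<close>

lemma tensor_map_comp:
  assumes M: "module Rat M" "module Rat N" "module Rat M'" "module Rat N'" "module Rat M2" "module Rat N2"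
    and f: "f \<in> lin_maps M M'" "g \<in> lin_maps N N'" and f': "f' \<in> lin_maps M' M2" "g' \<in> lin_maps N' N2"
    and k: "k \<in> lin_maps M M2" "l \<in> lin_maps N N2"
    and e: "\<And>m. m \<in> carrier M \<Longrightarrow> f' (f m) = k m" "\<And>n. n \<in> carrier N \<Longrightarrow> g' (g n) = l n"
    and t: "t \<in> carrier (tensor M N)"
  shows "tensor_map M2 N2 f' g' (tensor_map M' N' f g t) = tensor_map M2 N2 k l t"
proof (rule tensor_ext[OF M(1,2) tensor_module[OF M(5,6)] _ _ _ t])
  show "(\<lambda>t. tensor_map M2 N2 f' g' (tensor_map M' N' f g t)) \<in> lin_maps (tensor M N) (tensor M2 N2)"
    by (rule lin_maps_comp[OF tensor_map(1)[OF M(1-4) f] tensor_map(1)[OF M(3-6) f']])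
  show "tensor_map M2 N2 k l \<in> lin_maps (tensor M N) (tensor M2 N2)"
    by (rule tensor_map(1)[OF M(1,2,5,6) k])
  fix m n assume m: "m \<in> carrier M" "n \<in> carrier N"
  show "tensor_map M2 N2 f' g' (tensor_map M' N' f g (pure_tensor M N m n)) = tensor_map M2 N2 k l (pure_tensor M N m n)"
    unfolding tensor_map(2)[OF M(1-4) f m] tensor_map(2)[OF M(1,2,5,6) k m]
      tensor_map(2)[OF M(3-6) f' lin_mapsD(1)[OF f(1) m(1)] lin_mapsD(1)[OF f(2) m(2)]] e(1)[OF m(1)] e(2)[OF m(2)] ..
qed

lemma tensor_map_id:
  assumes M: "module Rat M" "module Rat N" and f: "f \<in> lin_maps M M" "g \<in> lin_maps N N"
    and e: "\<And>m. m \<in> carrier M \<Longrightarrow> f m = m" "\<And>n. n \<in> carrier N \<Longrightarrow> g n = n"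
    and t: "t \<in> carrier (tensor M N)"
  shows "tensor_map M N f g t = t"
proof (rule tensor_ext[OF M tensor_module[OF M] tensor_map(1)[OF M M f] lin_maps_id _ t])
  fix m n assume m: "m \<in> carrier M" "n \<in> carrier N"
  show "tensor_map M N f g (pure_tensor M N m n) = pure_tensor M N m n"
    unfolding tensor_map(2)[OF M M f m] e(1)[OF m(1)] e(2)[OF m(2)] ..
qed

lemma pure_tensor_zero:
  assumes "module Rat M" "module Rat N" "n \<in> carrier N"
  shows "pure_tensor M N \<zero>\<^bsub>M\<^esub> n = \<zero>\<^bsub>tensor M N\<^esub>"
  by (rule lin_maps_zero[OF pure_tensor_lin(1)[OF assms] assms(1) tensor_module[OF assms(1,2)]])

lemma tensor_map_zero:
  assumes M: "module Rat M" "module Rat N" "module Rat M'" "module Rat N'"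
    and f: "f \<in> lin_maps M M'" "g \<in> lin_maps N N'" and e: "\<And>m. m \<in> carrier M \<Longrightarrow> f m = \<zero>\<^bsub>M'\<^esub>"
    and t: "t \<in> carrier (tensor M N)"
  shows "tensor_map M' N' f g t = \<zero>\<^bsub>tensor M' N'\<^esub>"
proof (rule tensor_ext[OF M(1,2) tensor_module[OF M(3,4)] tensor_map(1)[OF M f] lin_maps_const_zero[OF tensor_module[OF M(3,4)]] _ t])
  fix m n assume m: "m \<in> carrier M" "n \<in> carrier N"
  show "tensor_map M' N' f g (pure_tensor M N m n) = \<zero>\<^bsub>tensor M' N'\<^esub>"
    unfolding tensor_map(2)[OF M f m] e[OF m(1)] by (rule pure_tensor_zero[OF M(3,4) lin_mapsD(1)[OF f(2) m(2)]])
qed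

text \<open>The identity of the tensor product is induced by the identity of \<open>M\<close>, which
  vanishes on the carrier, so it is the zero map.\<close>

lemma tensor_zero_module:
  assumes M: "module Rat M" "module Rat N" and z: "carrier M = {\<zero>\<^bsub>M\<^esub>}"
  shows "carrier (tensor M N) = {\<zero>\<^bsub>tensor M N\<^esub>}"
proof -
  interpret T: module Rat "tensor M N" by (rule tensor_module[OF M])
  have "t = \<zero>\<^bsub>tensor M N\<^esub>" if t: "t \<in> carrier (tensor M N)" for t
    using tensor_map_id[OF M lin_maps_id lin_maps_id refl refl t] tensor_map_zero[OF M M lin_maps_id lin_maps_id _ t] z
    by simp
  then show ?thesis using T.zero_closed by blast
qed

text \<open>\<open>M\<close> is a line with basis \<open>b\<close> and coordinate \<open>lk\<close>.
  The inverse of tensoring with \<open>b\<close> multiplies the second factor by the coordinate of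
  the first.\<close>

lemma tensor_line:
  assumes M: "module Rat M" "module Rat N" and b: "b \<in> carrier M"
    and lk: "\<And>m m'. m \<in> carrier M \<Longrightarrow> m' \<in> carrier M \<Longrightarrow> lk (m \<oplus>\<^bsub>M\<^esub> m') = lk m + lk m'"
      "\<And>c m. m \<in> carrier M \<Longrightarrow> lk (c \<odot>\<^bsub>M\<^esub> m) = c * lk m" "lk b = 1"
      "\<And>m. m \<in> carrier M \<Longrightarrow> m = lk m \<odot>\<^bsub>M\<^esub> b"
  shows "inj_on (pure_tensor M N b) (carrier N)" and "pure_tensor M N b ` carrier N = carrier (tensor M N)"
proof -
  interpret M: module Rat M by fact
  interpret N: module Rat N by fact
  interpret T: module Rat "tensor M N" by (rule tensor_module[OF M])
  have N1: "k \<odot>\<^bsub>N\<^esub> n \<in> carrier N" if "n \<in> carrier N" for k n using N.smult_closed[OF _ that] by simp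
  have "\<exists>f\<in>lin_maps (tensor M N) N. \<forall>m\<in>carrier M. \<forall>n\<in>carrier N. f (pure_tensor M N m n) = lk m \<odot>\<^bsub>N\<^esub> n"
  proof (rule tensor_lift[OF M M(2)])
    fix n assume n: "n \<in> carrier N"
    show "(\<lambda>m. lk m \<odot>\<^bsub>N\<^esub> n) \<in> lin_maps M N"
      by (rule lin_mapsI) (simp_all add: n N1 lk(1,2) N.smult_l_distr[simplified] N.smult_assoc1[simplified])
  next
    fix m assume "m \<in> carrier M"
    show "(\<lambda>n. lk m \<odot>\<^bsub>N\<^esub> n) \<in> lin_maps N N" by (rule lin_maps_smult[OF lin_maps_id M(2)])
  qed
  then obtain f where f: "f \<in> lin_maps (tensor M N) N"
    and fp: "\<And>m n. m \<in> carrier M \<Longrightarrow> n \<in> carrier N \<Longrightarrow> f (pure_tensor M N m n) = lk m \<odot>\<^bsub>N\<^esub> n" by auto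
  have fb: "f (pure_tensor M N b n) = n" if "n \<in> carrier N" for n
    using fp[OF b that] lk(3) N.smult_one[OF that] by simp
  show "inj_on (pure_tensor M N b) (carrier N)" by (rule inj_on_inverseI[of _ f]) (rule fb)
  note pl = pure_tensor_lin[OF M]
  have bf: "pure_tensor M N b (f t) = t" if t: "t \<in> carrier (tensor M N)" for t
  proof (rule tensor_ext[OF M tensor_module[OF M] lin_maps_comp[OF f pl(2)[OF b]] lin_maps_id _ t])
    fix m n assume m: "m \<in> carrier M" and n: "n \<in> carrier N"
    have "pure_tensor M N b (f (pure_tensor M N m n)) = lk m \<odot>\<^bsub>tensor M N\<^esub> pure_tensor M N b n"
      unfolding fp[OF m n] by (rule lin_mapsD(3)[OF pl(2)[OF b] n])
    also have "\<dots> = pure_tensor M N (lk m \<odot>\<^bsub>M\<^esub> b) n" by (rule lin_mapsD(3)[OF pl(1)[OF n] b, symmetric])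
    finally show "pure_tensor M N b (f (pure_tensor M N m n)) = pure_tensor M N m n"
      unfolding lk(4)[OF m, symmetric] .
  qed
  show "pure_tensor M N b ` carrier N = carrier (tensor M N)"
  proof (intro subset_antisym subsetI)
    fix t assume "t \<in> pure_tensor M N b ` carrier N"
    then show "t \<in> carrier (tensor M N)" using pure_tensor_closed[OF b, of _ N] by auto
  next
    fix t assume t: "t \<in> carrier (tensor M N)"
    show "t \<in> pure_tensor M N b ` carrier N"
      by (rule image_eqI, rule bf[OF t, symmetric], rule lin_mapsD(1)[OF f t])
  qed
qed

lemma zero_module_module:
  assumes "module Rat M"
  shows "module Rat (zero_module M)"
  unfolding zero_module_def by (rule submodule_module[OF assms zero_submodule[OF assms]])

section \<open>The complex on the poset of intervals\<close>

context blowup_setting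
begin

abbreviation IK :: "('a blow \<times> 'a blow) gorder" where "IK \<equiv> intervals K"

abbreviation CS :: "nat \<Rightarrow> nat \<Rightarrow> ('a blow \<times> 'a blow, 'a cvalue) sheaf" where "CS i j \<equiv> C_sheaf L H K i j"

lemma IK_simps:
  "(x, y) \<in> carrier IK \<longleftrightarrow> x \<in> carrier K \<and> y \<in> carrier K \<and> x \<sqsubseteq>\<^bsub>K\<^esub> y"
  "(x, y) \<sqsubseteq>\<^bsub>IK\<^esub> (x', y') \<longleftrightarrow> x \<sqsubseteq>\<^bsub>K\<^esub> x' \<and> x' \<sqsubseteq>\<^bsub>K\<^esub> y' \<and> y' \<sqsubseteq>\<^bsub>K\<^esub> y"
  by (simp_all add: intervals_def)

lemma IK_cases:
  assumes "p \<in> carrier IK"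
  obtains x y where "p = (x, y)" "x \<in> carrier K" "y \<in> carrier K" "x \<sqsubseteq>\<^bsub>K\<^esub> y"
  using assms by (cases p) (simp add: IK_simps)

lemma IK_le_cases:
  assumes "p \<in> carrier IK" "q \<in> carrier IK" "p \<sqsubseteq>\<^bsub>IK\<^esub> q"
  obtains x y x' y' where "p = (x, y)" "q = (x', y')" "x \<in> carrier K" "y \<in> carrier K" "x' \<in> carrier K" "y' \<in> carrier K"
    "x \<sqsubseteq>\<^bsub>K\<^esub> y" "x' \<sqsubseteq>\<^bsub>K\<^esub> y'" "x \<sqsubseteq>\<^bsub>K\<^esub> x'" "y' \<sqsubseteq>\<^bsub>K\<^esub> y"
  using assms by (cases p; cases q) (simp add: IK_simps)

lemmas K_refl = posetD(1)[OF poset_K] and K_antisym = posetD(2)[OF poset_K] and K_trans = posetD(3)[OF poset_K]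

lemma IK_refl: "p \<in> carrier IK \<Longrightarrow> p \<sqsubseteq>\<^bsub>IK\<^esub> p"
  by (erule IK_cases) (simp add: IK_simps K_refl)

lemma IK_trans:
  assumes "p \<in> carrier IK" "q \<in> carrier IK" "r \<in> carrier IK" "p \<sqsubseteq>\<^bsub>IK\<^esub> q" "q \<sqsubseteq>\<^bsub>IK\<^esub> r"
  shows "p \<sqsubseteq>\<^bsub>IK\<^esub> r"
proof -
  obtain x y x' y' where 1: "p = (x, y)" "q = (x', y')" "x \<in> carrier K" "y \<in> carrier K" "x' \<in> carrier K" "y' \<in> carrier K"
    "x \<sqsubseteq>\<^bsub>K\<^esub> x'" "y' \<sqsubseteq>\<^bsub>K\<^esub> y" by (rule IK_le_cases[OF assms(1,2,4)])
  obtain z w where 2: "r = (z, w)" "z \<in> carrier K" "w \<in> carrier K" "z \<sqsubseteq>\<^bsub>K\<^esub> w" by (rule IK_cases[OF assms(3)])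
  show ?thesis
    using assms(5) K_trans[OF 1(3,5) 2(2) 1(7)] K_trans[OF 2(3) 1(6,4) _ 1(8)] by (simp add: 1(1,2) 2(1,4) IK_simps)
qed

lemma flag_mod: "x \<in> carrier K \<Longrightarrow> module Rat (Fl x j)"
  by (rule ranked.flag_module[OF ranked_below])

lemma CS_simps:
  "stalk (CS i j) (x, y) = tensor (Fl x j) (DP i y)"
  "res (CS i j) (x', y') (x, y) = tensor_map (Fl x j) (DP i y) (flag_res j x' x) (dp_res y)"
  by (simp_all add: C_sheaf_def tensor_sheaf_def pullback_def flag_sheaf_simps DP_sheaf_simps)

abbreviation CT where "CT i j x y \<equiv> tensor (Fl x j) (DP i y)"

lemma CS_sheaf: "is_sheaf IK (CS i j)"
proof (rule is_sheafI)
  fix p assume "p \<in> carrier IK"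
  then obtain x y where p: "p = (x, y)" "x \<in> carrier K" "y \<in> carrier K" by (rule IK_cases)
  show "module Rat (stalk (CS i j) p)"
    unfolding p(1) CS_simps by (rule tensor_module[OF flag_mod[OF p(2)] DP_module])
next
  fix p q assume "p \<in> carrier IK" "q \<in> carrier IK" "p \<sqsubseteq>\<^bsub>IK\<^esub> q"
  then obtain x y x' y' where 1: "p = (x, y)" "q = (x', y')" "x \<in> carrier K" "y \<in> carrier K" "x' \<in> carrier K" "y' \<in> carrier K"
    "x \<sqsubseteq>\<^bsub>K\<^esub> x'" "y' \<sqsubseteq>\<^bsub>K\<^esub> y" by (rule IK_le_cases)
  show "res (CS i j) q p \<in> lin_maps (stalk (CS i j) q) (stalk (CS i j) p)"
    unfolding 1(1,2) CS_simps(1,2)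
    by (rule tensor_map(1)[OF flag_mod[OF 1(5)] DP_module flag_mod[OF 1(3)] DP_module flag_res(1)[OF 1(3,5)] dp_res_lin[OF 1(6,4,8)]])
next
  fix p v assume *: "p \<in> carrier IK" and v: "v \<in> carrier (stalk (CS i j) p)"
  obtain x y where p: "p = (x, y)" "x \<in> carrier K" "y \<in> carrier K" by (rule IK_cases[OF *])
  show "res (CS i j) p p v = v"
    unfolding p(1) CS_simps(1,2)
    by (rule tensor_map_id[OF flag_mod[OF p(2)] DP_module flag_res(1)[OF p(2,2)] dp_res_lin[OF p(3,3) K_refl[OF p(3)]]
          flag_res_id[OF p(2)] dp_res_id[OF p(3)] v[unfolded p(1) CS_simps(1)]])
next
  fix p q r v assume *: "p \<in> carrier IK" "q \<in> carrier IK" "r \<in> carrier IK" "p \<sqsubseteq>\<^bsub>IK\<^esub> q" "q \<sqsubseteq>\<^bsub>IK\<^esub> r"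
    and v: "v \<in> carrier (stalk (CS i j) r)"
  obtain x y x' y' where 1: "p = (x, y)" "q = (x', y')" "x \<in> carrier K" "y \<in> carrier K" "x' \<in> carrier K" "y' \<in> carrier K"
    "x \<sqsubseteq>\<^bsub>K\<^esub> x'" "y' \<sqsubseteq>\<^bsub>K\<^esub> y" by (rule IK_le_cases[OF *(1,2,4)])
  obtain z w where 2: "r = (z, w)" "z \<in> carrier K" "w \<in> carrier K" by (rule IK_cases[OF *(3)])
  have le: "x' \<sqsubseteq>\<^bsub>K\<^esub> z" "w \<sqsubseteq>\<^bsub>K\<^esub> y'" using *(5) by (simp_all add: 1(2) 2(1) IK_simps)
  have wy: "w \<sqsubseteq>\<^bsub>K\<^esub> y" by (rule K_trans[OF 2(3) 1(6,4) le(2) 1(8)])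
  show "res (CS i j) q p (res (CS i j) r q v) = res (CS i j) r p v"
    unfolding 1(1,2) 2(1) CS_simps(2)
    by (rule tensor_map_comp[OF flag_mod[OF 2(2)] DP_module flag_mod[OF 1(5)] DP_module flag_mod[OF 1(3)] DP_module
          flag_res(1)[OF 1(5) 2(2)] dp_res_lin[OF 2(3) 1(6) le(2)] flag_res(1)[OF 1(3,5)] dp_res_lin[OF 1(6,4,8)]
          flag_res(1)[OF 1(3) 2(2)] dp_res_lin[OF 2(3) 1(4) wy]
          flag_res_comp[OF 1(3,5) 2(2) 1(7)] dp_res_comp[OF 2(3) 1(6,4) le(2) 1(8)] v[unfolded 2(1) CS_simps(1)]])
qed

lemma CS_zero_iff: "height x < j \<Longrightarrow> x \<in> carrier K \<Longrightarrow> carrier (CT i j x y) = {\<zero>\<^bsub>CT i j x y\<^esub>}"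
  by (rule tensor_zero_module[OF flag_mod DP_module flag_zero])

section \<open>The differential and its contraction away from the least element\<close>

abbreviation dC :: "nat \<Rightarrow> nat \<Rightarrow> 'a blow \<times> 'a blow \<Rightarrow> 'a cvalue \<Rightarrow> 'a cvalue" where
  "dC \<equiv> C_diff L H K"

lemma C_diff_simps: "dC i j (x, y) = tensor_map (Fl x (Suc j)) (DP i y) (flag_diff (poset_below K x) j) (\<lambda>a. a)"
  by (simp add: C_diff_def)

lemma Fl_diff: "x \<in> carrier K \<Longrightarrow> flag_diff (poset_below K x) j \<in> lin_maps (Fl x j) (Fl x (Suc j))"
  by (rule ranked.flag_diff(1)[OF ranked_below])

lemma C_diff_lin:
  assumes "x \<in> carrier K"
  shows "dC i j (x, y) \<in> lin_maps (CT i j x y) (CT i (Suc j) x y)"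
  unfolding C_diff_simps
  by (rule tensor_map(1)[OF flag_mod[OF assms] DP_module flag_mod[OF assms] DP_module Fl_diff[OF assms] lin_maps_id])

lemma C_diff_hom: "sheaf_hom IK (CS i j) (CS i (Suc j)) (dC i j)"
proof (rule sheaf_homI)
  fix p assume "p \<in> carrier IK"
  then obtain x y where p: "p = (x, y)" "x \<in> carrier K" "y \<in> carrier K" by (rule IK_cases)
  show "dC i j p \<in> lin_maps (stalk (CS i j) p) (stalk (CS i (Suc j)) p)"
    unfolding p(1) CS_simps(1) by (rule C_diff_lin[OF p(2)])
next
  fix p q v assume *: "p \<in> carrier IK" "q \<in> carrier IK" "p \<sqsubseteq>\<^bsub>IK\<^esub> q" and v: "v \<in> carrier (stalk (CS i j) q)"
  obtain x y x' y' where 1: "p = (x, y)" "q = (x', y')" "x \<in> carrier K" "y \<in> carrier K" "x' \<in> carrier K" "y' \<in> carrier K"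
    "x \<sqsubseteq>\<^bsub>K\<^esub> x'" "y' \<sqsubseteq>\<^bsub>K\<^esub> y" by (rule IK_le_cases[OF *])
  note m = flag_mod[OF 1(3)] flag_mod[OF 1(5)]
  note r = flag_res(1)[OF 1(3,5)] and d = dp_res_lin[OF 1(6,4,8)]
  note t = v[unfolded 1(2) CS_simps(1)]
  let ?k = "\<lambda>m. flag_diff (poset_below K x) j (flag_res j x' x m)"
  have k: "?k \<in> lin_maps (Fl x' j) (Fl x (Suc j))" by (rule lin_maps_comp[OF r Fl_diff[OF 1(3)]])
  have "dC i j p (res (CS i j) q p v) = tensor_map (Fl x (Suc j)) (DP i y) ?k (dp_res y) v"
    unfolding 1(1,2) CS_simps(2) C_diff_simps
    by (rule tensor_map_comp[OF m(2) DP_module m(1) DP_module m(1) DP_module r d Fl_diff[OF 1(3)] lin_maps_id k d refl refl t])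
  also have "\<dots> = res (CS i (Suc j)) q p (dC i j q v)"
    unfolding 1(1,2) CS_simps(2) C_diff_simps
    by (rule tensor_map_comp[OF m(2) DP_module m(2) DP_module m(1) DP_module Fl_diff[OF 1(5)] lin_maps_id r d k d
          flag_diff_res[OF 1(3,5,7), symmetric] refl t, symmetric])
  finally show "dC i j p (res (CS i j) q p v) = res (CS i (Suc j)) q p (dC i j q v)" .
qed

lemma C_diff_C_diff:
  assumes x: "x \<in> carrier K" and v: "v \<in> carrier (CT i j x y)"
  shows "dC i (Suc j) (x, y) (dC i j (x, y) v) = \<zero>\<^bsub>CT i (Suc (Suc j)) x y\<^esub>"
proof -
  have k: "(\<lambda>m. flag_diff (poset_below K x) (Suc j) (flag_diff (poset_below K x) j m)) \<in> lin_maps (Fl x j) (Fl x (Suc (Suc j)))"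
    by (rule lin_maps_comp[OF Fl_diff[OF x] Fl_diff[OF x]])
  show ?thesis unfolding C_diff_simps
      tensor_map_comp[OF flag_mod[OF x] DP_module flag_mod[OF x] DP_module flag_mod[OF x] DP_module Fl_diff[OF x] lin_maps_id
        Fl_diff[OF x] lin_maps_id k lin_maps_id refl refl v]
    by (rule tensor_map_zero[OF flag_mod[OF x] DP_module flag_mod[OF x] DP_module k lin_maps_id
          ranked.flag_diff_flag_diff[OF ranked_below[OF x]] v])
qed

lemma below_apexed:
  assumes x: "x \<in> carrier K" "x \<noteq> \<bottom>\<^bsub>K\<^esub>"
  obtains a where "apexed (poset_below K x) height a"
proof -
  obtain a where a: "a \<in> carrier K" "a \<sqsubseteq>\<^bsub>K\<^esub> x" "a \<noteq> \<bottom>\<^bsub>K\<^esub>"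
    and j: "\<forall>v\<in>carrier K. v \<sqsubseteq>\<^bsub>K\<^esub> x \<longrightarrow> \<not> a \<sqsubseteq>\<^bsub>K\<^esub> v \<longrightarrow>
      (\<exists>u\<in>carrier K. u \<sqsubseteq>\<^bsub>K\<^esub> x \<and> v \<sqsubseteq>\<^bsub>K\<^esub> u \<and> a \<sqsubseteq>\<^bsub>K\<^esub> u \<and> height u = Suc (height v)
      \<and> (\<forall>t\<in>carrier K. v \<sqsubseteq>\<^bsub>K\<^esub> t \<longrightarrow> a \<sqsubseteq>\<^bsub>K\<^esub> t \<longrightarrow> u \<sqsubseteq>\<^bsub>K\<^esub> t))"
    using apex_exists[OF x] by (elim bexE conjE)
  \<comment> \<open>The apex has positive rank, so no element of rank zero lies above it; chains
    therefore start outside its up-set, as the locale demands.\<close>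
  have ha: "0 < height a"
    using mono[OF bottom_K_least(1) a(1) bottom_K_least(2)[OF a(1)]] a(3) height_bottom by auto
  have "apexed (poset_below K x) height a"
  proof (intro apexed.intro ranked_below[OF x(1)] apexed_axioms.intro)
    show "a \<in> carrier (poset_below K x)" using a by (simp add: below_simps)
    show "\<not> a \<sqsubseteq>\<^bsub>poset_below K x\<^esub> b" if b: "b \<in> carrier (poset_below K x)" "height b = 0" for b
      using mono[OF a(1), of b] b ha by (cases "a = b") (auto simp: below_simps)
    show "\<exists>u\<in>carrier (poset_below K x). v \<sqsubseteq>\<^bsub>poset_below K x\<^esub> u \<and> a \<sqsubseteq>\<^bsub>poset_below K x\<^esub> u \<and> height u = Suc (height v)
        \<and> (\<forall>t\<in>carrier (poset_below K x). v \<sqsubseteq>\<^bsub>poset_below K x\<^esub> t \<longrightarrow> a \<sqsubseteq>\<^bsub>poset_below K x\<^esub> t \<longrightarrow> u \<sqsubseteq>\<^bsub>poset_below K x\<^esub> t)"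
      if v: "v \<in> carrier (poset_below K x)" "\<not> a \<sqsubseteq>\<^bsub>poset_below K x\<^esub> v" for v
    proof -
      have v': "v \<in> carrier K" "v \<sqsubseteq>\<^bsub>K\<^esub> x" "\<not> a \<sqsubseteq>\<^bsub>K\<^esub> v" using v by (simp_all add: below_simps)
      obtain u where "u \<in> carrier K" "u \<sqsubseteq>\<^bsub>K\<^esub> x" "v \<sqsubseteq>\<^bsub>K\<^esub> u" "a \<sqsubseteq>\<^bsub>K\<^esub> u" "height u = Suc (height v)"
        "\<forall>t\<in>carrier K. v \<sqsubseteq>\<^bsub>K\<^esub> t \<longrightarrow> a \<sqsubseteq>\<^bsub>K\<^esub> t \<longrightarrow> u \<sqsubseteq>\<^bsub>K\<^esub> t"
        using j[rule_format, OF v'] by (elim bexE conjE)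
      then show ?thesis unfolding below_simps by blast
    qed
  qed
  then show ?thesis by (rule that)
qed

text \<open>The contraction of the flag complex is linear, so it survives tensoring with the
  identity of the second factor. The clause on zero is what turns the homotopy identity into
  exactness on cocycles.\<close>

lemma C_contraction:
  assumes x: "x \<in> carrier K" "x \<noteq> \<bottom>\<^bsub>K\<^esub>"
  shows "\<exists>h. (\<forall>j. \<forall>v\<in>carrier (CT i (Suc j) x y). h j v \<in> carrier (CT i j x y))
    \<and> (\<forall>j. h j \<zero>\<^bsub>CT i (Suc j) x y\<^esub> = \<zero>\<^bsub>CT i j x y\<^esub>)
    \<and> (\<forall>v\<in>carrier (CT i 0 x y). h 0 (dC i 0 (x, y) v) = v)
    \<and> (\<forall>j. \<forall>v\<in>carrier (CT i (Suc j) x y).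
        h (Suc j) (dC i (Suc j) (x, y) v) \<oplus>\<^bsub>CT i (Suc j) x y\<^esub> dC i j (x, y) (h j v) = v)"
proof -
  obtain a where a: "apexed (poset_below K x) height a" by (rule below_apexed[OF x])
  obtain h where h: "\<forall>j. h j \<in> lin_maps (Fl x (Suc j)) (Fl x j)"
    "\<forall>m\<in>carrier (Fl x 0). h 0 (flag_diff (poset_below K x) 0 m) = m"
    "\<forall>j. \<forall>m\<in>carrier (Fl x (Suc j)). h (Suc j) (flag_diff (poset_below K x) (Suc j) m)
      \<oplus>\<^bsub>Fl x (Suc j)\<^esub> flag_diff (poset_below K x) j (h j m) = m"
    using apexed.flag_contraction[OF a] by (elim exE conjE)
  note hl = h(1)[rule_format]
  note F = flag_mod[OF x(1)] and d = Fl_diff[OF x(1)]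
  define g where "g j = tensor_map (Fl x j) (DP i y) (h j) (\<lambda>a. a)" for j
  have gl: "g j \<in> lin_maps (CT i (Suc j) x y) (CT i j x y)" for j
    unfolding g_def by (rule tensor_map(1)[OF F DP_module F DP_module hl lin_maps_id])
  have T: "module Rat (CT i j x y)" for j
    by (rule tensor_module[OF F DP_module])
  have g0: "g 0 (dC i 0 (x, y) v) = v" if v: "v \<in> carrier (CT i 0 x y)" for v
  proof -
      have "g 0 (dC i 0 (x, y) v) = tensor_map (Fl x 0) (DP i y) (\<lambda>m. m) (\<lambda>a. a) v"
      unfolding g_def C_diff_simps
      by (rule tensor_map_comp[OF F DP_module F DP_module F DP_module d lin_maps_id hl lin_maps_id lin_maps_id lin_maps_id
            h(2)[rule_format] refl v])
    also have "\<dots> = v" by (rule tensor_map_id[OF F DP_module lin_maps_id lin_maps_id refl refl v])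
    finally show ?thesis .
  qed
  have gS: "g (Suc j) (dC i (Suc j) (x, y) v) \<oplus>\<^bsub>CT i (Suc j) x y\<^esub> dC i j (x, y) (g j v) = v"
    if v: "v \<in> carrier (CT i (Suc j) x y)" for j v
  proof (rule tensor_ext[OF F DP_module T, where t = v and g = "\<lambda>v. v"
        and f = "\<lambda>v. g (Suc j) (dC i (Suc j) (x, y) v) \<oplus>\<^bsub>CT i (Suc j) x y\<^esub> dC i j (x, y) (g j v)"])
    show "v \<in> carrier (CT i (Suc j) x y)" by (rule v)
    show "(\<lambda>v. g (Suc j) (dC i (Suc j) (x, y) v) \<oplus>\<^bsub>CT i (Suc j) x y\<^esub> dC i j (x, y) (g j v))
        \<in> lin_maps (CT i (Suc j) x y) (CT i (Suc j) x y)"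
      by (rule lin_maps_add[OF lin_maps_comp[OF C_diff_lin[OF x(1)] gl] lin_maps_comp[OF gl C_diff_lin[OF x(1)]] T])
    show "(\<lambda>x. x) \<in> lin_maps (CT i (Suc j) x y) (CT i (Suc j) x y)"
      by (rule lin_maps_id)
    fix m n assume m: "m \<in> carrier (Fl x (Suc j))" and n: "n \<in> carrier (DP i y)"
    let ?p = "pure_tensor (Fl x (Suc j)) (DP i y)"
    have 1: "g (Suc j) (dC i (Suc j) (x, y) (?p m n)) = ?p (h (Suc j) (flag_diff (poset_below K x) (Suc j) m)) n"
      unfolding g_def C_diff_simps tensor_map(2)[OF F DP_module F DP_module d lin_maps_id m n]
      by (rule tensor_map(2)[OF F DP_module F DP_module hl lin_maps_id lin_mapsD(1)[OF d m] n])
    have 2: "dC i j (x, y) (g j (?p m n)) = ?p (flag_diff (poset_below K x) j (h j m)) n"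
      unfolding g_def C_diff_simps tensor_map(2)[OF F DP_module F DP_module hl lin_maps_id m n]
      by (rule tensor_map(2)[OF F DP_module F DP_module d lin_maps_id lin_mapsD(1)[OF hl m] n])
    have "?p (h (Suc j) (flag_diff (poset_below K x) (Suc j) m)) n \<oplus>\<^bsub>CT i (Suc j) x y\<^esub> ?p (flag_diff (poset_below K x) j (h j m)) n
      = ?p (h (Suc j) (flag_diff (poset_below K x) (Suc j) m) \<oplus>\<^bsub>Fl x (Suc j)\<^esub> flag_diff (poset_below K x) j (h j m)) n"
      by (rule lin_mapsD(2)[OF pure_tensor_lin(1)[OF F DP_module n] lin_mapsD(1)[OF hl lin_mapsD(1)[OF d m]] lin_mapsD(1)[OF d lin_mapsD(1)[OF hl m]], symmetric])
    then show "g (Suc j) (dC i (Suc j) (x, y) (?p m n)) \<oplus>\<^bsub>CT i (Suc j) x y\<^esub> dC i j (x, y) (g j (?p m n)) = ?p m n"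
      unfolding 1 2 h(3)[rule_format, OF m] .
  qed
  show ?thesis
    using lin_mapsD(1)[OF gl] lin_maps_zero[OF gl T T] g0 gS by (intro exI[of _ g]) simp
qed

end

section \<open>Acyclicity of the sheaves of the complex\<close>

context blowup_setting
begin

text \<open>Tensored with the identity, \<open>flag_decompose\<close> recovers an element over
  \<open>(x, y)\<close> from its restrictions to the pairs \<open>(z, y)\<close>. Separation
  follows, and glued sections are built from the same kind of sum.\<close>

lemma C_decompose:
  assumes x: "x \<in> carrier K" and y: "y \<in> carrier K" and v: "v \<in> carrier (CT i j x y)"
  shows "(\<Oplus>\<^bsub>CT i j x y\<^esub>z\<in>{z \<in> Lev j. z \<sqsubseteq>\<^bsub>K\<^esub> x}.
    tensor_map (Fl x j) (DP i y) (flag_inc j x) (\<lambda>a. a) (res (CS i j) (x, y) (z, y) v)) = v"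
proof -
  let ?Z = "{z \<in> Lev j. z \<sqsubseteq>\<^bsub>K\<^esub> x}"
  let ?e = "\<lambda>z. tensor_map (Fl x j) (DP i y) (flag_inc j x) (\<lambda>a. a)"
  note F = flag_mod[OF x] and yy = K_refl[OF y]
  have T: "module Rat (CT i j x y)" by (rule tensor_module[OF F DP_module])
  have fin: "finite ?Z" using finite_Lev[of j] by simp
  have z: "z \<in> carrier K" "z \<sqsubseteq>\<^bsub>K\<^esub> x" if "z \<in> ?Z" for z using that by (simp_all add: Lev_def)
  have rl: "res (CS i j) (x, y) (z, y) \<in> lin_maps (CT i j x y) (CT i j z y)" if "z \<in> ?Z" for z
    unfolding CS_simps(2) by (rule tensor_map(1)[OF F DP_module flag_mod[OF z(1)[OF that]] DP_module flag_res(1)[OF z(1)[OF that] x] dp_res_lin[OF y y yy]])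
  have el: "?e z \<in> lin_maps (CT i j z y) (CT i j x y)" if "z \<in> ?Z" for z
    by (rule tensor_map(1)[OF flag_mod[OF z(1)[OF that]] DP_module F DP_module flag_inc(1)[OF x z[OF that]] lin_maps_id])
  have erl: "(\<lambda>v. ?e z (res (CS i j) (x, y) (z, y) v)) \<in> lin_maps (CT i j x y) (CT i j x y)" if "z \<in> ?Z" for z
    by (rule lin_maps_comp[OF rl[OF that] el[OF that]])
  show ?thesis
  proof (rule tensor_ext[OF F DP_module T, where t = v and g = "\<lambda>v. v"
        and f = "\<lambda>v. \<Oplus>\<^bsub>CT i j x y\<^esub>z\<in>?Z. ?e z (res (CS i j) (x, y) (z, y) v)"])
    show "v \<in> carrier (CT i j x y)" by (rule v)
    show "(\<lambda>v. v) \<in> lin_maps (CT i j x y) (CT i j x y)" by (rule lin_maps_id)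
    show "(\<lambda>v. \<Oplus>\<^bsub>CT i j x y\<^esub>z\<in>?Z. ?e z (res (CS i j) (x, y) (z, y) v))
      \<in> lin_maps (CT i j x y) (CT i j x y)"
      by (rule lin_maps_finsum_maps[OF T fin erl T])
    fix m n assume m: "m \<in> carrier (Fl x j)" and n: "n \<in> carrier (DP i y)"
    let ?p = "pure_tensor (Fl x j) (DP i y)"
    interpret T: module Rat "CT i j x y" by (rule T)
    have c: "flag_inc j x (flag_res j x z m) \<in> carrier (Fl x j)" if "z \<in> ?Z" for z
      by (rule lin_mapsD(1)[OF flag_inc(1)[OF x z[OF that]] lin_mapsD(1)[OF flag_res(1)[OF z(1)[OF that] x] m]])
    have e: "?e z (res (CS i j) (x, y) (z, y) (?p m n)) = ?p (flag_inc j x (flag_res j x z m)) n" if "z \<in> ?Z" for z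
      unfolding CS_simps(2) tensor_map(2)[OF F DP_module flag_mod[OF z(1)[OF that]] DP_module flag_res(1)[OF z(1)[OF that] x] dp_res_lin[OF y y yy] m n]
        dp_res_id[OF y n]
      by (rule tensor_map(2)[OF flag_mod[OF z(1)[OF that]] DP_module F DP_module flag_inc(1)[OF x z[OF that]] lin_maps_id
            lin_mapsD(1)[OF flag_res(1)[OF z(1)[OF that] x] m] n])
    have "(\<Oplus>\<^bsub>CT i j x y\<^esub>z\<in>?Z. ?e z (res (CS i j) (x, y) (z, y) (?p m n)))
      = (\<Oplus>\<^bsub>CT i j x y\<^esub>z\<in>?Z. ?p (flag_inc j x (flag_res j x z m)) n)"
      by (rule T.finsum_cong'[OF refl Pi_I[OF pure_tensor_closed[OF c n]] e])
    also have "\<dots> = ?p (\<Oplus>\<^bsub>Fl x j\<^esub>z\<in>?Z. flag_inc j x (flag_res j x z m)) n"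
      by (rule lin_maps_finsum[OF pure_tensor_lin(1)[OF F DP_module n] F T fin c, symmetric])
    also have "\<dots> = ?p m n" unfolding flag_decompose[OF x m] ..
    finally show "(\<Oplus>\<^bsub>CT i j x y\<^esub>z\<in>?Z. ?e z (res (CS i j) (x, y) (z, y) (?p m n))) = ?p m n" .
  qed
qed

lemma C_res_inc:
  assumes x: "x \<in> carrier K" and z: "z \<in> carrier K" "z \<sqsubseteq>\<^bsub>K\<^esub> x" "height z = j" and z': "z' \<in> carrier K" "height z' = j"
    and y: "y \<in> carrier K" "y' \<in> carrier K" "y \<sqsubseteq>\<^bsub>K\<^esub> y'" and v: "v \<in> carrier (CT i j z y)"
  shows "res (CS i j) (x, y) (z', y') (tensor_map (Fl x j) (DP i y) (flag_inc j x) (\<lambda>a. a) v)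
    = (if z = z' then res (CS i j) (z, y) (z', y') v else \<zero>\<^bsub>CT i j z' y'\<^esub>)"
proof -
  note F = flag_mod[OF z(1)] flag_mod[OF x] flag_mod[OF z'(1)]
  note d = dp_res_lin[OF y] and inc = flag_inc(1)[OF x z(1,2)] and r = flag_res(1)[OF z'(1) x]
  note t = v
  let ?k = "\<lambda>m. flag_res j x z' (flag_inc j x m)"
  have k: "?k \<in> lin_maps (Fl z j) (Fl z' j)" by (rule lin_maps_comp[OF inc r])
  have km: "?k m = (if z = z' then m else \<zero>\<^bsub>Fl z' j\<^esub>)" if "m \<in> carrier (Fl z j)" for m
    by (rule flag_res_inc[OF x z z' that])
  have e: "res (CS i j) (x, y) (z', y') (tensor_map (Fl x j) (DP i y) (flag_inc j x) (\<lambda>a. a) v)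
      = tensor_map (Fl z' j) (DP i y') ?k (dp_res y') v"
    unfolding CS_simps(2)
    by (rule tensor_map_comp[OF F(1) DP_module F(2) DP_module F(3) DP_module inc lin_maps_id r d k d refl refl t])
  show ?thesis
  proof (cases "z = z'")
    case True
    have "tensor_map (Fl z' j) (DP i y') ?k (dp_res y') v
      = tensor_map (Fl z' j) (DP i y') (flag_res j z z') (dp_res y') v"
    proof (rule tensor_ext[OF F(1) DP_module tensor_module[OF F(3) DP_module] tensor_map(1)[OF F(1) DP_module F(3) DP_module k d]
          tensor_map(1)[OF F(1) DP_module F(3) DP_module flag_res(1)[OF z'(1) z(1)] d] _ t])
      fix m n assume m: "m \<in> carrier (Fl z j)" and n: "n \<in> carrier (DP i y)"
      show "tensor_map (Fl z' j) (DP i y') ?k (dp_res y') (pure_tensor (Fl z j) (DP i y) m n)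
        = tensor_map (Fl z' j) (DP i y') (flag_res j z z') (dp_res y') (pure_tensor (Fl z j) (DP i y) m n)"
        unfolding tensor_map(2)[OF F(1) DP_module F(3) DP_module k d m n] km[OF m]
          tensor_map(2)[OF F(1) DP_module F(3) DP_module flag_res(1)[OF z'(1) z(1)] d m n]
        using True flag_res_id[OF z(1) m] by simp
    qed
    then show ?thesis using True e by (simp add: CS_simps(2))
  next
    case False
    have "tensor_map (Fl z' j) (DP i y') ?k (dp_res y') v = \<zero>\<^bsub>CT i j z' y'\<^esub>"
      by (rule tensor_map_zero[OF F(1) DP_module F(3) DP_module k d _ t]) (use km False in simp)
    then show ?thesis using False e by (simp add: CS_simps(1))
  qed
qed

text \<open>On pairs with first entry of rank \<open>j\<close> the relation used is the order of the
  intervals: such pairs are comparable only if their first entries, being of equal rank, coincide.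
  The components are therefore indexed by the first entry.\<close>

theorem C_acyclic: "gamma_acyclic IK (CS i j)"
proof (rule component_cover.acyclic[of IK "CS i j" "{(z, y). z \<in> carrier K \<and> y \<in> carrier K \<and> height z = j \<and> z \<sqsubseteq>\<^bsub>K\<^esub> y}"
      "\<lambda>t t'. fst t = fst t' \<and> snd t' \<sqsubseteq>\<^bsub>K\<^esub> snd t" "\<lambda>p t. (fst t, snd p)" "\<lambda>t. (fst t, fst t)"], rule component_cover.intro)
  let ?T = "{(z, y). z \<in> carrier K \<and> y \<in> carrier K \<and> height z = j \<and> z \<sqsubseteq>\<^bsub>K\<^esub> y}"
  let ?rel = "\<lambda>t t' :: 'a blow \<times> 'a blow. fst t = fst t' \<and> snd t' \<sqsubseteq>\<^bsub>K\<^esub> snd t"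
  show "is_sheaf IK (CS i j)" by (rule CS_sheaf)
  show "p \<sqsubseteq>\<^bsub>IK\<^esub> p" if "p \<in> carrier IK" for p by (rule IK_refl[OF that])
  show "p \<sqsubseteq>\<^bsub>IK\<^esub> r" if "p \<in> carrier IK" "q \<in> carrier IK" "r \<in> carrier IK" "p \<sqsubseteq>\<^bsub>IK\<^esub> q" "q \<sqsubseteq>\<^bsub>IK\<^esub> r" for p q r
    by (rule IK_trans[OF that])
  show "?T \<subseteq> carrier IK" by (auto simp: IK_simps)
  show "t \<sqsubseteq>\<^bsub>IK\<^esub> t'" if "t \<in> ?T" "t' \<in> ?T" "?rel t t'" for t t'
    using that by (cases t; cases t') (simp add: IK_simps K_refl)
  show "?rel t t" if "t \<in> ?T" for t using that K_refl by auto
  show "?rel t t''" if "t \<in> ?T" "t' \<in> ?T" "t'' \<in> ?T" "?rel t t'" "?rel t' t''" for t t' t''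
  proof -
    have s: "snd u \<in> carrier K" if "u \<in> ?T" for u using that by auto
    show ?thesis
      by (rule conjI[OF trans[OF conjunct1[OF that(4)] conjunct1[OF that(5)]]
            K_trans[OF s[OF that(3)] s[OF that(2)] s[OF that(1)] conjunct2[OF that(5)] conjunct2[OF that(4)]]])
  qed
  show "(fst t, snd p) \<in> ?T \<and> (fst t, snd p) \<sqsubseteq>\<^bsub>IK\<^esub> p \<and> ?rel t (fst t, snd p)"
    if p: "p \<in> carrier IK" and t: "t \<in> ?T" and le: "t \<sqsubseteq>\<^bsub>IK\<^esub> p" for p t
  proof -
    obtain x y where xy: "p = (x, y)" "x \<in> carrier K" "y \<in> carrier K" "x \<sqsubseteq>\<^bsub>K\<^esub> y" by (rule IK_cases[OF p])
    obtain z w where zw: "t = (z, w)" "z \<in> carrier K" "w \<in> carrier K" "height z = j" using t by auto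
    have "z \<sqsubseteq>\<^bsub>K\<^esub> x" "y \<sqsubseteq>\<^bsub>K\<^esub> w" using le by (simp_all add: xy(1) zw(1) IK_simps)
    then show ?thesis using xy zw K_refl K_trans[OF zw(2) xy(2,3) _ xy(4)] by (simp add: IK_simps)
  qed
  show "(fst t, snd p) = (fst t', snd p)" if "?rel t t'" for p t t' :: "'a blow \<times> 'a blow" using that by simp
  show "(fst t, fst t) \<in> ?T \<and> ?rel t (fst t, fst t)" if "t \<in> ?T" for t using that K_refl by auto
  show "(fst t, fst t) = (fst t', fst t')" if "?rel t t'" for t t' :: "'a blow \<times> 'a blow" using that by simp
  have inT: "(z, y) \<in> ?T \<and> (z, y) \<sqsubseteq>\<^bsub>IK\<^esub> (x, y)"
    if "x \<in> carrier K" "y \<in> carrier K" "x \<sqsubseteq>\<^bsub>K\<^esub> y" "z \<in> {z \<in> Lev j. z \<sqsubseteq>\<^bsub>K\<^esub> x}" for x y z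
    using that K_trans[of z x y] K_refl[of y] by (simp add: IK_simps Lev_def)
  fix p assume "p \<in> carrier IK"
  then obtain x y where p: "p = (x, y)" "x \<in> carrier K" "y \<in> carrier K" "x \<sqsubseteq>\<^bsub>K\<^esub> y" by (rule IK_cases)
  let ?Z = "{z \<in> Lev j. z \<sqsubseteq>\<^bsub>K\<^esub> x}"
  let ?e = "tensor_map (Fl x j) (DP i y) (flag_inc j x) (\<lambda>a. a)"
  have T: "module Rat (CT i j z w)" if "z \<in> carrier K" for z w
    by (rule tensor_module[OF flag_mod[OF that] DP_module])
  interpret T: module Rat "CT i j x y" by (rule T[OF p(2)])
  have fin: "finite ?Z" using finite_Lev[of j] by simp
  have z: "z \<in> carrier K" "z \<sqsubseteq>\<^bsub>K\<^esub> x" "height z = j" if "z \<in> ?Z" for z using that by (simp_all add: Lev_def)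
  have el: "?e \<in> lin_maps (CT i j z y) (CT i j x y)" if "z \<in> ?Z" for z
    by (rule tensor_map(1)[OF flag_mod[OF z(1)[OF that]] DP_module flag_mod[OF p(2)] DP_module flag_inc(1)[OF p(2) z(1,2)[OF that]] lin_maps_id])
  show "v = \<zero>\<^bsub>stalk (CS i j) p\<^esub>" if v: "v \<in> carrier (stalk (CS i j) p)"
    and 0: "\<And>t. t \<in> ?T \<Longrightarrow> t \<sqsubseteq>\<^bsub>IK\<^esub> p \<Longrightarrow> res (CS i j) p t v = \<zero>\<^bsub>stalk (CS i j) t\<^esub>" for v
  proof -
    have "?e (res (CS i j) (x, y) (z, y) v) = \<zero>\<^bsub>CT i j x y\<^esub>" if "z \<in> ?Z" for z
    proof -
      have "res (CS i j) (x, y) (z, y) v = \<zero>\<^bsub>CT i j z y\<^esub>"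
        using 0[of "(z, y)"] inT[OF p(2-4) that] unfolding p(1) CS_simps(1) by blast
      then show ?thesis using lin_maps_zero[OF el[OF that] T[OF z(1)[OF that]] T[OF p(2)]] by simp
    qed
    then have "(\<Oplus>\<^bsub>CT i j x y\<^esub>z\<in>?Z. ?e (res (CS i j) (x, y) (z, y) v)) = \<zero>\<^bsub>CT i j x y\<^esub>"
      by (rule T.add.finprod_one_eqI)
    then show ?thesis using C_decompose[OF p(2,3)] v unfolding p(1) by (simp add: CS_simps(1))
  qed
  show "\<exists>v\<in>carrier (stalk (CS i j) p). \<forall>t\<in>?T. t \<sqsubseteq>\<^bsub>IK\<^esub> p \<longrightarrow> res (CS i j) p t v = s t"
    if s: "\<And>t. t \<in> ?T \<Longrightarrow> t \<sqsubseteq>\<^bsub>IK\<^esub> p \<Longrightarrow> s t \<in> carrier (stalk (CS i j) t)"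
      and c: "\<And>t t'. t \<in> ?T \<Longrightarrow> t' \<in> ?T \<Longrightarrow> ?rel t t' \<Longrightarrow> t' \<sqsubseteq>\<^bsub>IK\<^esub> p \<Longrightarrow> res (CS i j) t' t (s t') = s t" for s
  proof -
    have sz: "s (z, y) \<in> carrier (CT i j z y)" if "z \<in> ?Z" for z
      using s[of "(z, y)"] inT[OF p(2-4) that] unfolding p(1) CS_simps(1) by blast
    have ez: "?e (s (z, y)) \<in> carrier (CT i j x y)" if "z \<in> ?Z" for z
      by (rule lin_mapsD(1)[OF el[OF that] sz[OF that]])
    \<comment> \<open>The values at the peaks \<open>(z, y)\<close> are pushed into the stalk over
      \<open>(x, y)\<close> and added. The values at other members of a component are restrictions
      of the value at its peak, so matching the peaks is enough.\<close>
    define v where "v = (\<Oplus>\<^bsub>CT i j x y\<^esub>z\<in>?Z. ?e (s (z, y)))"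
    have v: "v \<in> carrier (stalk (CS i j) p)" unfolding v_def p(1) CS_simps(1) by (rule T.finsum_closed) (use ez in blast)
    have "res (CS i j) p t v = s t" if t: "t \<in> ?T" and le: "t \<sqsubseteq>\<^bsub>IK\<^esub> p" for t
    proof -
      obtain z' y' where t': "t = (z', y')" "z' \<in> carrier K" "y' \<in> carrier K" "height z' = j" "z' \<sqsubseteq>\<^bsub>K\<^esub> y'" using t by auto
      have le': "z' \<sqsubseteq>\<^bsub>K\<^esub> x" "y \<sqsubseteq>\<^bsub>K\<^esub> y'" using le by (simp_all add: p(1) t'(1) IK_simps)
      have z'Z: "z' \<in> ?Z" using t' le' by (simp add: Lev_def)
      have tc: "t \<in> carrier IK" unfolding t'(1) IK_simps using t' by simp
      have pc: "p \<in> carrier IK" unfolding p(1) IK_simps using p by simp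
      have st: "s t \<in> carrier (CT i j z' y')" using s[OF t le] by (simp only: t'(1) CS_simps(1))
      interpret T': module Rat "CT i j z' y'" by (rule T[OF t'(2)])
      have "res (CS i j) (x, y) (z', y') v = (\<Oplus>\<^bsub>CT i j z' y'\<^esub>z\<in>?Z. res (CS i j) (x, y) (z', y') (?e (s (z, y))))"
        unfolding v_def
        by (rule lin_maps_finsum[OF is_sheafD(2)[OF CS_sheaf tc[unfolded t'(1)] pc[unfolded p(1)] le[unfolded t'(1) p(1)], unfolded CS_simps(1)] T[OF p(2)] T[OF t'(2)] fin ez])
      also have "\<dots> = (\<Oplus>\<^bsub>CT i j z' y'\<^esub>z\<in>?Z. if z = z' then s t else \<zero>\<^bsub>CT i j z' y'\<^esub>)"
      proof (rule T'.finsum_cong'[OF refl])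
        show "(\<lambda>z. if z = z' then s t else \<zero>\<^bsub>CT i j z' y'\<^esub>) \<in> ?Z \<rightarrow> carrier (CT i j z' y')"
          using st by simp
        fix z assume zZ: "z \<in> ?Z"
        have cc: "res (CS i j) (z', y) (z', y') (s (z', y)) = s t"
          using c[OF t, of "(z', y)"] inT[OF p(2-4) z'Z] le'(2) unfolding t'(1) p(1) by simp
        show "res (CS i j) (x, y) (z', y') (?e (s (z, y))) = (if z = z' then s t else \<zero>\<^bsub>CT i j z' y'\<^esub>)"
          using C_res_inc[OF p(2) z[OF zZ] t'(2,4) p(3) t'(3) le'(2) sz[OF zZ]] cc by simp
      qed
      also have "\<dots> = s t" by (rule T'.add.finprod_singleton_swap[OF z'Z fin]) (use st in simp)
      finally show ?thesis by (simp only: p(1) t'(1))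
    qed
    then show ?thesis using v by blast
  qed
qed

section \<open>The augmentation and exactness\<close>

abbreviation IS :: "nat \<Rightarrow> ('a blow \<times> 'a blow, 'a mpoly set) sheaf" where "IS i \<equiv> iota_shriek K (DP_sheaf L H K i)"

lemma IS_simps:
  "stalk (IS i) (x, y) = (if x = \<bottom>\<^bsub>K\<^esub> then DP i y else zero_module (DP i y))"
  "res (IS i) (x', y') (x, y) v = (if x' = \<bottom>\<^bsub>K\<^esub> then dp_res y v else \<zero>\<^bsub>DP i y\<^esub>)"
  by (simp_all add: iota_shriek_def DP_sheaf_simps)

lemma zero_module_simps:
  "carrier (zero_module M) = {\<zero>\<^bsub>M\<^esub>}" "\<zero>\<^bsub>zero_module M\<^esub> = \<zero>\<^bsub>M\<^esub>"
  by (simp_all add: zero_module_def)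

lemma le_bottom: "x \<in> carrier K \<Longrightarrow> x \<sqsubseteq>\<^bsub>K\<^esub> \<bottom>\<^bsub>K\<^esub> \<Longrightarrow> x = \<bottom>\<^bsub>K\<^esub>"
  by (rule K_antisym[OF _ bottom_K_least(1) _ bottom_K_least(2)])

lemma IS_module: "module Rat (stalk (IS i) (x, y))" and IS_zero: "\<zero>\<^bsub>stalk (IS i) (x, y)\<^esub> = \<zero>\<^bsub>DP i y\<^esub>"
  unfolding IS_simps using DP_module zero_module_module[OF DP_module] by (simp_all add: zero_module_simps)

lemma dp_res_zero: "y \<in> carrier K \<Longrightarrow> z \<in> carrier K \<Longrightarrow> y \<sqsubseteq>\<^bsub>K\<^esub> z \<Longrightarrow> dp_res z \<zero>\<^bsub>DP i y\<^esub> = \<zero>\<^bsub>DP i z\<^esub>"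
  by (rule lin_maps_zero[OF dp_res_lin DP_module DP_module])

lemma IS_sheaf: "is_sheaf IK (IS i)"
proof (rule is_sheafI)
  fix p assume "p \<in> carrier IK"
  then show "module Rat (stalk (IS i) p)" using IS_module by (cases p) simp
next
  fix p q assume *: "p \<in> carrier IK" "q \<in> carrier IK" "p \<sqsubseteq>\<^bsub>IK\<^esub> q"
  obtain x y x' y' where 1: "p = (x, y)" "q = (x', y')" "x \<in> carrier K" "y \<in> carrier K" "x' \<in> carrier K" "y' \<in> carrier K"
    "x \<sqsubseteq>\<^bsub>K\<^esub> x'" "y' \<sqsubseteq>\<^bsub>K\<^esub> y" by (rule IK_le_cases[OF *])
  show "res (IS i) q p \<in> lin_maps (stalk (IS i) q) (stalk (IS i) p)"
  proof (cases "x' = \<bottom>\<^bsub>K\<^esub>")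
    case True
    then have x: "x = \<bottom>\<^bsub>K\<^esub>" using le_bottom[OF 1(3)] 1(7) by simp
    have "res (IS i) q p = dp_res y" by (rule ext) (simp add: 1(1,2) IS_simps True)
    then show ?thesis using dp_res_lin[OF 1(6,4,8)] by (simp add: 1(1,2) IS_simps True x)
  next
    case False
    have "res (IS i) q p = (\<lambda>v. \<zero>\<^bsub>stalk (IS i) (x, y)\<^esub>)" by (rule ext) (simp add: 1(1,2) IS_simps(2) IS_zero False)
    then show ?thesis using lin_maps_const_zero[OF IS_module] by (simp add: 1(1))
  qed
next
  fix p v assume *: "p \<in> carrier IK" and v: "v \<in> carrier (stalk (IS i) p)"
  obtain x y where p: "p = (x, y)" "x \<in> carrier K" "y \<in> carrier K" by (rule IK_cases[OF *])
  show "res (IS i) p p v = v"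
    using v dp_res_id[OF p(3), of v i] by (cases "x = \<bottom>\<^bsub>K\<^esub>") (simp_all add: p(1) IS_simps zero_module_simps)
next
  fix p q r v assume *: "p \<in> carrier IK" "q \<in> carrier IK" "r \<in> carrier IK" "p \<sqsubseteq>\<^bsub>IK\<^esub> q" "q \<sqsubseteq>\<^bsub>IK\<^esub> r"
    and v: "v \<in> carrier (stalk (IS i) r)"
  obtain x y x' y' where 1: "p = (x, y)" "q = (x', y')" "x \<in> carrier K" "y \<in> carrier K" "x' \<in> carrier K" "y' \<in> carrier K"
    "x \<sqsubseteq>\<^bsub>K\<^esub> x'" "y' \<sqsubseteq>\<^bsub>K\<^esub> y" by (rule IK_le_cases[OF *(1,2,4)])
  obtain z w where 2: "r = (z, w)" "z \<in> carrier K" "w \<in> carrier K" by (rule IK_cases[OF *(3)])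
  have le: "x' \<sqsubseteq>\<^bsub>K\<^esub> z" "w \<sqsubseteq>\<^bsub>K\<^esub> y'" using *(5) by (simp_all add: 1(2) 2(1) IK_simps)
  show "res (IS i) q p (res (IS i) r q v) = res (IS i) r p v"
  proof (cases "z = \<bottom>\<^bsub>K\<^esub>")
    case True
    then have "x' = \<bottom>\<^bsub>K\<^esub>" using le_bottom[OF 1(5)] le(1) by simp
    moreover have "v \<in> carrier (DP i w)" using v True by (simp add: 2(1) IS_simps)
    ultimately show ?thesis using dp_res_comp[OF 2(3) 1(6,4) le(2) 1(8)] True by (simp add: 1(1,2) 2(1) IS_simps)
  next
    case False
    then show ?thesis using dp_res_zero[OF 1(6,4,8)] by (simp add: 1(1,2) 2(1) IS_simps)
  qed
qed

abbreviation bot_cls :: "('a blow list \<Rightarrow>\<^sub>0 rat) set" where "bot_cls \<equiv> cls \<bottom>\<^bsub>K\<^esub> 0 (basis_elt [\<bottom>\<^bsub>K\<^esub>])"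

lemma C_aug_simps:
  "C_aug L H K i (x, y) a = (if x = \<bottom>\<^bsub>K\<^esub> then pure_tensor (Fl x 0) (DP i y) bot_cls a else \<zero>\<^bsub>CT i 0 x y\<^esub>)"
  by (simp add: C_aug_def Let_def CS_simps(1))

lemma bottom_chains: "below_chains \<bottom>\<^bsub>K\<^esub> 0 = {[\<bottom>\<^bsub>K\<^esub>]}"
proof (intro subset_antisym subsetI)
  fix ys assume "ys \<in> below_chains \<bottom>\<^bsub>K\<^esub> 0"
  then have ys: "ys \<in> fc 0" "last ys \<sqsubseteq>\<^bsub>K\<^esub> \<bottom>\<^bsub>K\<^esub>" using mem_below_chains[OF bottom_K_least(1)] by auto
  obtain b where b: "b \<in> Lev 0" "ys = [b]" using ys(1) fc_0 by blast
  then show "ys \<in> {[\<bottom>\<^bsub>K\<^esub>]}" using le_bottom[of b] ys(2) by (simp add: Lev_def)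
next
  fix ys assume "ys \<in> {[\<bottom>\<^bsub>K\<^esub>]}"
  then show "ys \<in> below_chains \<bottom>\<^bsub>K\<^esub> 0"
    using mem_below_chains[OF bottom_K_least(1), of ys 0] fc_0[of ys] bottom_K_least(1) height_bottom K_refl by (simp add: Lev_def)
qed

lemma bot_cls_in: "bot_cls \<in> carrier (Fl \<bottom>\<^bsub>K\<^esub> 0)"
  by (auto simp: flag_def quot_module_simps bottom_chains basis_in_free)

lemma aug_bijective:
  "inj_on (pure_tensor (Fl \<bottom>\<^bsub>K\<^esub> 0) (DP i y) bot_cls) (carrier (DP i y))"
  "pure_tensor (Fl \<bottom>\<^bsub>K\<^esub> 0) (DP i y) bot_cls ` carrier (DP i y) = carrier (tensor (Fl \<bottom>\<^bsub>K\<^esub> 0) (DP i y))"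
proof -
  interpret Q: ranked "poset_below K \<bottom>\<^bsub>K\<^esub>" height by (rule ranked_below[OF bottom_K_least(1)])
  have "below_rel \<bottom>\<^bsub>K\<^esub> 0 \<subseteq> {\<zero>\<^bsub>below_free \<bottom>\<^bsub>K\<^esub> 0\<^esub>}"
    unfolding Q.flag_rel_gens Q.gens_0 by (rule gen_submodule_minimal[OF empty_subsetI zero_submodule[OF free_module_module]])
  then have rel: "below_rel \<bottom>\<^bsub>K\<^esub> 0 = {0}" using free_submoduleD(1)[OF Q.rel_submodule, of 0] by (auto simp: free_module_simps)
  have cls: "cls \<bottom>\<^bsub>K\<^esub> 0 u = {u}" for u by (simp add: a_r_coset_def' rel free_module_simps)
  \<comment> \<open>In degree zero there are no relations, so classes are singletons, and the
    coefficient of the chain consisting of the least element is a coordinate on the flag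
    module.\<close>
  define lk where "lk m = Poly_Mapping.lookup (the_elem m) [\<bottom>\<^bsub>K\<^esub>]" for m :: "('a blow list \<Rightarrow>\<^sub>0 rat) set"
  have lk: "lk (cls \<bottom>\<^bsub>K\<^esub> 0 u) = Poly_Mapping.lookup u [\<bottom>\<^bsub>K\<^esub>]" for u by (simp add: lk_def cls)
  have sm: "c \<odot>\<^bsub>Fl \<bottom>\<^bsub>K\<^esub> 0\<^esub> cls \<bottom>\<^bsub>K\<^esub> 0 u = cls \<bottom>\<^bsub>K\<^esub> 0 (scl c u)" if "u \<in> carrier (below_free \<bottom>\<^bsub>K\<^esub> 0)" for c u
    using coset_smult[OF free_module_module Q.rel_submodule that, of c] by (simp add: flag_def free_module_simps)
  have 1: "lk (m \<oplus>\<^bsub>Fl \<bottom>\<^bsub>K\<^esub> 0\<^esub> m') = lk m + lk m'"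
    if m: "m \<in> carrier (Fl \<bottom>\<^bsub>K\<^esub> 0)" "m' \<in> carrier (Fl \<bottom>\<^bsub>K\<^esub> 0)" for m m'
  proof -
    obtain u where u: "u \<in> carrier (below_free \<bottom>\<^bsub>K\<^esub> 0)" "m = cls \<bottom>\<^bsub>K\<^esub> 0 u" by (rule Fl_cases[OF bottom_K_least(1) m(1)])
    obtain u' where u': "u' \<in> carrier (below_free \<bottom>\<^bsub>K\<^esub> 0)" "m' = cls \<bottom>\<^bsub>K\<^esub> 0 u'" by (rule Fl_cases[OF bottom_K_least(1) m(2)])
    show ?thesis unfolding u(2) u'(2) Q.cls_add[OF u(1) u'(1)] lk by (rule lookup_add)
  qed
  have 2: "lk (c \<odot>\<^bsub>Fl \<bottom>\<^bsub>K\<^esub> 0\<^esub> m) = c * lk m" if m: "m \<in> carrier (Fl \<bottom>\<^bsub>K\<^esub> 0)" for c m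
  proof -
    obtain u where u: "u \<in> carrier (below_free \<bottom>\<^bsub>K\<^esub> 0)" "m = cls \<bottom>\<^bsub>K\<^esub> 0 u" by (rule Fl_cases[OF bottom_K_least(1) m])
    show ?thesis unfolding u(2) sm[OF u(1)] lk by (rule lookup_scl)
  qed
  have 3: "lk bot_cls = 1" unfolding lk by simp
  have 4: "m = lk m \<odot>\<^bsub>Fl \<bottom>\<^bsub>K\<^esub> 0\<^esub> bot_cls" if m: "m \<in> carrier (Fl \<bottom>\<^bsub>K\<^esub> 0)" for m
  proof -
    obtain u where u: "u \<in> carrier (below_free \<bottom>\<^bsub>K\<^esub> 0)" "m = cls \<bottom>\<^bsub>K\<^esub> 0 u" by (rule Fl_cases[OF bottom_K_least(1) m])
    have "Poly_Mapping.lookup u k = 0" if "k \<noteq> [\<bottom>\<^bsub>K\<^esub>]" for k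
      using u(1) that by (auto simp: free_module_simps bottom_chains in_keys_iff)
    then have "scl (Poly_Mapping.lookup u [\<bottom>\<^bsub>K\<^esub>]) (basis_elt [\<bottom>\<^bsub>K\<^esub>]) = u"
      by (intro poly_mapping_eqI) (simp add: lookup_single when_def)
    moreover have "basis_elt [\<bottom>\<^bsub>K\<^esub>] \<in> carrier (below_free \<bottom>\<^bsub>K\<^esub> 0)" by (simp add: basis_in_free bottom_chains)
    ultimately show ?thesis unfolding u(2) lk by (simp add: sm)
  qed
  note tl = tensor_line[OF flag_mod[OF bottom_K_least(1)] DP_module bot_cls_in, of lk, OF 1 2 3 4]
  show "inj_on (pure_tensor (Fl \<bottom>\<^bsub>K\<^esub> 0) (DP i y) bot_cls) (carrier (DP i y))" by (rule tl(1))
  show "pure_tensor (Fl \<bottom>\<^bsub>K\<^esub> 0) (DP i y) bot_cls ` carrier (DP i y) = carrier (tensor (Fl \<bottom>\<^bsub>K\<^esub> 0) (DP i y))"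
    by (rule tl(2))
qed

lemma CS_module: "x \<in> carrier K \<Longrightarrow> module Rat (CT i j x y)"
  by (rule tensor_module[OF flag_mod DP_module])

text \<open>Restriction goes from \<open>x'\<close> to a smaller \<open>x\<close>. From the least
  element it stays there; over any other element the source has the value zero, so both ways around
  the square give zero.\<close>

lemma C_aug_hom: "sheaf_hom IK (IS i) (CS i 0) (C_aug L H K i)"
proof -
  have lin: "C_aug L H K i (x, y) \<in> lin_maps (stalk (IS i) (x, y)) (CT i 0 x y)" if "x \<in> carrier K" for x y
  proof (cases "x = \<bottom>\<^bsub>K\<^esub>")
    case True
    have "C_aug L H K i (x, y) = (\<lambda>a. pure_tensor (Fl \<bottom>\<^bsub>K\<^esub> 0) (DP i y) bot_cls a)"
      by (rule ext) (simp add: C_aug_simps True)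
    then show ?thesis
      using pure_tensor_lin(2)[OF flag_mod[OF bottom_K_least(1)] DP_module bot_cls_in] by (simp add: IS_simps CS_simps(1) True)
  next
    case False
    have "C_aug L H K i (x, y) = (\<lambda>a. \<zero>\<^bsub>CT i 0 x y\<^esub>)" by (rule ext) (simp add: C_aug_simps False)
    then show ?thesis using lin_maps_const_zero[OF CS_module[OF that]] by simp
  qed
  show ?thesis
  proof (rule sheaf_homI)
    fix p assume *: "p \<in> carrier IK"
    obtain x y where p: "p = (x, y)" "x \<in> carrier K" "y \<in> carrier K" by (rule IK_cases[OF *])
    show "C_aug L H K i p \<in> lin_maps (stalk (IS i) p) (stalk (CS i 0) p)" unfolding p(1) CS_simps(1) by (rule lin[OF p(2)])
  next
    fix p q v assume *: "p \<in> carrier IK" "q \<in> carrier IK" "p \<sqsubseteq>\<^bsub>IK\<^esub> q" and v: "v \<in> carrier (stalk (IS i) q)"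
    obtain x y x' y' where 1: "p = (x, y)" "q = (x', y')" "x \<in> carrier K" "y \<in> carrier K" "x' \<in> carrier K" "y' \<in> carrier K"
      "x \<sqsubseteq>\<^bsub>K\<^esub> x'" "y' \<sqsubseteq>\<^bsub>K\<^esub> y" by (rule IK_le_cases[OF *])
    show "C_aug L H K i p (res (IS i) q p v) = res (CS i 0) q p (C_aug L H K i q v)"
    proof (cases "x' = \<bottom>\<^bsub>K\<^esub>")
      case True
      then have x: "x = \<bottom>\<^bsub>K\<^esub>" using le_bottom[OF 1(3)] 1(7) by simp
      have v': "v \<in> carrier (DP i y')" using v True by (simp add: 1(2) IS_simps)
      note B = bottom_K_least(1)
      have "tensor_map (Fl \<bottom>\<^bsub>K\<^esub> 0) (DP i y) (flag_res 0 \<bottom>\<^bsub>K\<^esub> \<bottom>\<^bsub>K\<^esub>) (dp_res y) (pure_tensor (Fl \<bottom>\<^bsub>K\<^esub> 0) (DP i y') bot_cls v)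
        = pure_tensor (Fl \<bottom>\<^bsub>K\<^esub> 0) (DP i y) (flag_res 0 \<bottom>\<^bsub>K\<^esub> \<bottom>\<^bsub>K\<^esub> bot_cls) (dp_res y v)"
        by (rule tensor_map(2)[OF flag_mod[OF B] DP_module flag_mod[OF B] DP_module flag_res(1)[OF B B] dp_res_lin[OF 1(6,4,8)] bot_cls_in v'])
      then show ?thesis
        unfolding 1(1,2) x True CS_simps(2) by (simp add: C_aug_simps IS_simps flag_res_id[OF B bot_cls_in])
    next
      case False
      have "res (IS i) q p v = \<zero>\<^bsub>stalk (IS i) (x, y)\<^esub>" by (simp add: 1(1,2) IS_simps(2) IS_zero False)
      then have l: "C_aug L H K i p (res (IS i) q p v) = \<zero>\<^bsub>stalk (CS i 0) p\<^esub>"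
        using lin_maps_zero[OF lin[OF 1(3)] IS_module CS_module[OF 1(3)]] by (simp add: 1(1) CS_simps(1))
      have "res (CS i 0) q p \<zero>\<^bsub>stalk (CS i 0) q\<^esub> = \<zero>\<^bsub>stalk (CS i 0) p\<^esub>"
        by (rule lin_maps_zero[OF is_sheafD(2)[OF CS_sheaf *] is_sheafD(1)[OF CS_sheaf *(2)] is_sheafD(1)[OF CS_sheaf *(1)]])
      then show ?thesis unfolding l by (simp add: 1(2) C_aug_simps False CS_simps(1))
    qed
  qed
qed

text \<open>Over the least element the complex is concentrated in degree zero, where the
  augmentation is a bijection; elsewhere the contraction applies and the source of the augmentation
  is zero. All degrees are covered, as the cut at the largest rank is made only afterwards.\<close>

lemma C_exact:
  assumes x: "x \<in> carrier K"
  shows "inj_on (C_aug L H K i (x, y)) (carrier (stalk (IS i) (x, y)))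
    \<and> C_aug L H K i (x, y) ` carrier (stalk (IS i) (x, y))
      = {v \<in> carrier (CT i 0 x y). dC i 0 (x, y) v = \<zero>\<^bsub>CT i (Suc 0) x y\<^esub>}
    \<and> dC i j (x, y) ` carrier (CT i j x y)
      = {v \<in> carrier (CT i (Suc j) x y). dC i (Suc j) (x, y) v = \<zero>\<^bsub>CT i (Suc (Suc j)) x y\<^esub>}"
proof -
  note dl = lin_mapsD(1)[OF C_diff_lin[OF x, where i = i and y = y]]
  have T0: "\<zero>\<^bsub>CT i j x y\<^esub> \<in> carrier (CT i j x y)" for j
  proof -
    interpret T: module Rat "CT i j x y" by (rule CS_module[OF x])
    show ?thesis by (rule T.zero_closed)
  qed
  have d0: "dC i j (x, y) \<zero>\<^bsub>CT i j x y\<^esub> = \<zero>\<^bsub>CT i (Suc j) x y\<^esub>" for j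
    by (rule lin_maps_zero[OF C_diff_lin[OF x] CS_module[OF x] CS_module[OF x]])
  show ?thesis
  proof (cases "x = \<bottom>\<^bsub>K\<^esub>")
    case True
    have Z: "carrier (CT i (Suc k) x y) = {\<zero>\<^bsub>CT i (Suc k) x y\<^esub>}" for k
      by (rule CS_zero_iff[OF _ x]) (simp add: True height_bottom)
    have dz: "dC i k (x, y) v = \<zero>\<^bsub>CT i (Suc k) x y\<^esub>" if "v \<in> carrier (CT i k x y)" for k v
      using dl[OF that] Z by blast
    have aug: "C_aug L H K i (x, y) = pure_tensor (Fl \<bottom>\<^bsub>K\<^esub> 0) (DP i y) bot_cls"
      by (rule ext) (simp add: C_aug_simps True)
    have S: "stalk (IS i) (x, y) = DP i y" "CT i 0 x y = tensor (Fl \<bottom>\<^bsub>K\<^esub> 0) (DP i y)"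
      by (simp_all add: IS_simps CS_simps(1) True)
    have "{v \<in> carrier (CT i 0 x y). dC i 0 (x, y) v = \<zero>\<^bsub>CT i (Suc 0) x y\<^esub>} = carrier (CT i 0 x y)"
      using dz by blast
    moreover have "dC i j (x, y) ` carrier (CT i j x y) = {\<zero>\<^bsub>CT i (Suc j) x y\<^esub>}"
      using dz T0[of j] by (auto simp: image_iff)
    moreover have "{v \<in> carrier (CT i (Suc j) x y). dC i (Suc j) (x, y) v = \<zero>\<^bsub>CT i (Suc (Suc j)) x y\<^esub>}
      = {\<zero>\<^bsub>CT i (Suc j) x y\<^esub>}"
      using Z[of j] d0[of "Suc j"] by auto
    ultimately show ?thesis using aug_bijective[of i y] unfolding aug S by simp
  next
    case False
    obtain h where h: "\<forall>j. \<forall>v\<in>carrier (CT i (Suc j) x y). h j v \<in> carrier (CT i j x y)"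
      "\<forall>j. h j \<zero>\<^bsub>CT i (Suc j) x y\<^esub> = \<zero>\<^bsub>CT i j x y\<^esub>"
      "\<forall>v\<in>carrier (CT i 0 x y). h 0 (dC i 0 (x, y) v) = v"
      "\<forall>j. \<forall>v\<in>carrier (CT i (Suc j) x y).
        h (Suc j) (dC i (Suc j) (x, y) v) \<oplus>\<^bsub>CT i (Suc j) x y\<^esub> dC i j (x, y) (h j v) = v"
      using C_contraction[OF x False, of i y] by (elim exE conjE)
    have aug: "C_aug L H K i (x, y) a = \<zero>\<^bsub>CT i 0 x y\<^esub>" for a by (simp add: C_aug_simps False)
    have IS: "carrier (stalk (IS i) (x, y)) = {\<zero>\<^bsub>DP i y\<^esub>}" by (simp add: IS_simps False zero_module_simps)
    have k0: "v = \<zero>\<^bsub>CT i 0 x y\<^esub>"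
      if "v \<in> carrier (CT i 0 x y)" "dC i 0 (x, y) v = \<zero>\<^bsub>CT i (Suc 0) x y\<^esub>" for v
      using h(3)[rule_format, OF that(1)] h(2)[rule_format, of 0] unfolding that(2) by simp
    have ker: "dC i j (x, y) (h j v) = v"
      if v: "v \<in> carrier (CT i (Suc j) x y)" "dC i (Suc j) (x, y) v = \<zero>\<^bsub>CT i (Suc (Suc j)) x y\<^esub>" for v
    proof -
      interpret T: module Rat "CT i (Suc j) x y" by (rule CS_module[OF x])
      have "dC i j (x, y) (h j v) \<in> carrier (CT i (Suc j) x y)"
        by (rule dl[OF h(1)[rule_format, OF v(1)]])
      then show ?thesis using h(4)[rule_format, OF v(1)] h(2)[rule_format, of "Suc j"] unfolding v(2) by simp
    qed
    have "dC i j (x, y) ` carrier (CT i j x y)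
      = {v \<in> carrier (CT i (Suc j) x y). dC i (Suc j) (x, y) v = \<zero>\<^bsub>CT i (Suc (Suc j)) x y\<^esub>}"
    proof (intro subset_antisym subsetI)
      fix w assume "w \<in> dC i j (x, y) ` carrier (CT i j x y)"
      then obtain v where v: "v \<in> carrier (CT i j x y)" "w = dC i j (x, y) v" by (rule imageE)
      show "w \<in> {v \<in> carrier (CT i (Suc j) x y). dC i (Suc j) (x, y) v = \<zero>\<^bsub>CT i (Suc (Suc j)) x y\<^esub>}"
        unfolding v(2) using dl[OF v(1)] C_diff_C_diff[OF x v(1)] by simp
    next
      fix w assume "w \<in> {v \<in> carrier (CT i (Suc j) x y). dC i (Suc j) (x, y) v = \<zero>\<^bsub>CT i (Suc (Suc j)) x y\<^esub>}"
      then have w: "w \<in> carrier (CT i (Suc j) x y)" "dC i (Suc j) (x, y) w = \<zero>\<^bsub>CT i (Suc (Suc j)) x y\<^esub>" by simp_all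
      show "w \<in> dC i j (x, y) ` carrier (CT i j x y)"
        by (rule image_eqI, rule ker[OF w, symmetric], rule h(1)[rule_format, OF w(1)])
    qed
    moreover have "{v \<in> carrier (CT i 0 x y). dC i 0 (x, y) v = \<zero>\<^bsub>CT i (Suc 0) x y\<^esub>}
      = {\<zero>\<^bsub>CT i 0 x y\<^esub>}"
    proof (intro subset_antisym subsetI)
      fix v assume "v \<in> {v \<in> carrier (CT i 0 x y). dC i 0 (x, y) v = \<zero>\<^bsub>CT i (Suc 0) x y\<^esub>}"
      then show "v \<in> {\<zero>\<^bsub>CT i 0 x y\<^esub>}" using k0[of v] by simp
    qed (use T0[of 0] d0[of 0] in simp)
    ultimately show ?thesis by (simp add: IS aug)
  qed
qed

lemma height_max: "x \<in> carrier K \<Longrightarrow> height x \<le> max_rank K"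
  unfolding max_rank_def using fin rank_eq[of x] by (intro Max_ge) (auto intro!: image_eqI[of _ _ x])

theorem C_resolution: "resolution IK (IS i) (C_aug L H K i) (CS i) (dC i) (enat (max_rank K))"
proof -
  let ?ker = "\<lambda>p j. if enat j < enat (max_rank K)
    then {v \<in> carrier (stalk (CS i j) p). dC i j p v = \<zero>\<^bsub>stalk (CS i (Suc j)) p\<^esub>} else carrier (stalk (CS i j) p)"
  \<comment> \<open>At the cut the kernel is by definition the whole stalk. This agrees with the
    complex before the cut, since stalks in degrees beyond the largest rank vanish.\<close>
  have ker: "?ker (x, y) j = {v \<in> carrier (CT i j x y). dC i j (x, y) v = \<zero>\<^bsub>CT i (Suc j) x y\<^esub>}"
    if x: "x \<in> carrier K" for x y j
  proof (cases "j < max_rank K")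
    case False
    have "carrier (CT i (Suc j) x y) = {\<zero>\<^bsub>CT i (Suc j) x y\<^esub>}"
      by (rule CS_zero_iff[OF _ x]) (use False height_max[OF x] in simp)
    then have "dC i j (x, y) v = \<zero>\<^bsub>CT i (Suc j) x y\<^esub>" if "v \<in> carrier (CT i j x y)" for v
      using lin_mapsD(1)[OF C_diff_lin[OF x] that] by blast
    then show ?thesis using False by (auto simp: CS_simps(1))
  qed (simp add: CS_simps(1))
  show ?thesis unfolding resolution_def Let_def
  proof (intro conjI allI impI ballI)
    fix p assume *: "p \<in> carrier IK"
    obtain x y where p: "p = (x, y)" "x \<in> carrier K" by (rule IK_cases[OF *])
    show "inj_on (C_aug L H K i p) (carrier (stalk (IS i) p))" unfolding p(1) CS_simps(1) by (rule C_exact[OF p(2), THEN conjunct1])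
    show "C_aug L H K i p ` carrier (stalk (IS i) p) = ?ker p 0" unfolding p(1) ker[OF p(2)] unfolding CS_simps(1) by (rule C_exact[OF p(2), THEN conjunct2, THEN conjunct1])
    show "dC i j p ` carrier (stalk (CS i j) p) = ?ker p (Suc j)" for j
      unfolding p(1) ker[OF p(2)] unfolding CS_simps(1) by (rule C_exact[OF p(2), THEN conjunct2, THEN conjunct2])
  qed (rule IS_sheaf CS_sheaf C_aug_hom C_diff_hom)+
qed

end

theorem theorem6p1p5:
  fixes L :: "'a gorder" and H :: "'a set" and ps :: "'a list" and K :: "'a blow gorder"
  assumes "geometric_lattice L"
    and "partial_building_set L H"
    and "blowup_order L H ps"
    and "K = iterated_blowup L ps"
  shows "(\<forall>i. resolution (intervals K) (iota_shriek K (DP_sheaf L H K i)) (C_aug L H K i)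
             (C_sheaf L H K i) (C_diff L H K i) (enat (max_rank K)))
       \<and> (\<forall>i j. gamma_acyclic (intervals K) (C_sheaf L H K i j))"
proof -
  interpret blowup_setting L H ps K
    by (intro blowup_setting.intro geom_lattice.intro blowup_setting_axioms.intro assms)
  show ?thesis using C_resolution C_acyclic by blast
qed

end
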